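(* Let $\Lambda$ be a cyclic Nakayama algebra of finite global dimension. Then there is an integer $m\ge 1$ such that $\varepsilon^{m-1}(\Lambda)$ is a cyclic Nakayama algebra, $\varepsilon^m(\Lambda)$ is not cyclic (all its connected components are linear Nakayama algebras, possibly semisimple), and $$\mathrm{gl.dim}\,\Lambda\le 2m+r_{m-1}-C,$$ where $r_{m-1}$ is the minimal number of relations which define the cyclic Nakayama algebra $\varepsilon^{m-1}(\Lambda)$ and $C$ is the number of connected components of $\varepsilon^m(\Lambda)$.
   Context: $\mathbb{K}$ is an algebraically closed field; modules are finitely generated right modules. A Nakayama algebra is a bound quiver algebra all of whose indecomposable modules are uniserial; a connected one is linear or cyclic according to whether its quiver is a linearly oriented $\mathbb{A}_n$ or an oriented cycle. Cyclic Nakayama algebra: $\Lambda=\mathbb{K}Q/I$, where $Q$ is the cyclic quiver with vertices $1,\dots,N$ ($N\ge 2$) and arrows $\alpha_i:i\to i+1$ (with $\alpha_N:N\to 1$; indices modulo $N$), and $I$ is generated by an irredundant system of $r\ge1$ relations, each a path of length at least two. (The same definitions are used when a rank one algebra, whose quiver is one loop, arises as a syzygy filtered algebra.) $S_i$ is the simple module at vertex $i$, and $P(S_i)$ its projective cover, which is uniserial with composition factors $S_i,S_{i+1},\dots$ from the top. For simple modules write $\tau S_i:=S_{i+1}$. For a cyclic Nakayama algebra $A$, $\mathcal S(A)$ is the set of isomorphism classes of socles of indecomposable projective $A$-modules and $\mathcal S'(A)=\{\tau S: S\in\mathcal S(A)\}$. The syzygy filtered algebra is $\varepsilon(A):=\mathrm{End}_A\big(\bigoplus_{S\in\mathcal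 S'(A)}P(S)\big)$. Higher syzygy filtered algebras: $\varepsilon^0(\Lambda)=\Lambda$ and $\varepsilon^{n}(\Lambda)=\varepsilon(\varepsilon^{n-1}(\Lambda))$, provided that $\varepsilon^{n-1}(\Lambda)$ is a cyclic Nakayama algebra. *)

theory Defs
  imports
    "HOL-Algebra.Module"
    "HOL-Algebra.QuotRing"
    "HOL-Computational_Algebra.Polynomial"
    "HOL-Library.Extended_Nat"
    "Graph_Theory.Arc_Walk"
begin

section \<open>Algebras over a field\<close>

text \<open>
  The ground field is a type \<open>'k\<close> of class \<open>field\<close>. An algebra is a \<^typ>\<open>('k, 'a) module\<close> record,
  i.e. a ring record together with a scalar multiplication by \<open>'k\<close>.
\<close>

locale k_algebra = ring A for A :: "('k::field, 'a) module" (structure) +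
  assumes smult_closed: "x \<in> carrier A \<Longrightarrow> c \<odot> x \<in> carrier A"
    and smult_l_distr: "x \<in> carrier A \<Longrightarrow> (c + d) \<odot> x = c \<odot> x \<oplus> d \<odot> x"
    and smult_r_distr: "\<lbrakk>x \<in> carrier A; y \<in> carrier A\<rbrakk> \<Longrightarrow> c \<odot> (x \<oplus> y) = c \<odot> x \<oplus> c \<odot> y"
    and smult_smult: "x \<in> carrier A \<Longrightarrow> (c * d) \<odot> x = c \<odot> (d \<odot> x)"
    and smult_one: "x \<in> carrier A \<Longrightarrow> 1 \<odot> x = x"
    and smult_mult_l: "\<lbrakk>x \<in> carrier A; y \<in> carrier A\<rbrakk> \<Longrightarrow> (c \<odot> x) \<otimes> y = c \<odot> (x \<otimes> y)"
    and smult_mult_r: "\<lbrakk>x \<in> carrier A; y \<in> carrier A\<rbrakk> \<Longrightarrow> x \<otimes> (c \<odot> y) = c \<odot> (x \<otimes> y)"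

definition alg_isos :: "('k::field, 'a) module \<Rightarrow> ('k, 'b) module \<Rightarrow> ('a \<Rightarrow> 'b) set" where
  "alg_isos A B = {h. k_algebra A \<and> k_algebra B \<and> h \<in> ring_iso A B \<and>
     (\<forall>c. \<forall>x\<in>carrier A. h (c \<odot>\<^bsub>A\<^esub> x) = c \<odot>\<^bsub>B\<^esub> h x)}"

definition alg_isomorphic :: "('k::field, 'a) module \<Rightarrow> ('k, 'b) module \<Rightarrow> bool" where
  "alg_isomorphic A B \<longleftrightarrow> alg_isos A B \<noteq> {}"

definition quotient_algebra :: "('k::field, 'a) module \<Rightarrow> 'a set \<Rightarrow> ('k, 'a set) module" where
  "quotient_algebra A I =
     ring.extend (A Quot I) (module.fields (\<lambda>c X. (\<Union>x\<in>X. I +>\<^bsub>A\<^esub> (c \<odot>\<^bsub>A\<^esub> x))))"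

text \<open>
  Decompositions of \<open>A\<close> as a direct product of algebras correspond to decompositions of \<open>\<one>\<close> into
  orthogonal central idempotents; the connected components (blocks) are the algebras \<open>e A\<close> for
  the primitive central idempotents \<open>e\<close>.
\<close>

definition central_idempotent :: "('k, 'a) module \<Rightarrow> 'a \<Rightarrow> bool" where
  "central_idempotent A e \<longleftrightarrow> e \<in> carrier A \<and> e \<otimes>\<^bsub>A\<^esub> e = e \<and>
     (\<forall>x\<in>carrier A. e \<otimes>\<^bsub>A\<^esub> x = x \<otimes>\<^bsub>A\<^esub> e)"

definition primitive_central_idempotent :: "('k, 'a) module \<Rightarrow> 'a \<Rightarrow> bool" where
  "primitive_central_idempotent A e \<longleftrightarrow> central_idempotent A e \<and> e \<noteq> \<zero>\<^bsub>A\<^esub> \<and>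
     (\<forall>f. central_idempotent A f \<and> e \<otimes>\<^bsub>A\<^esub> f = f \<longrightarrow> f = \<zero>\<^bsub>A\<^esub> \<or> f = e)"

definition connected_components :: "('k, 'a) module \<Rightarrow> ('k, 'a) module set" where
  "connected_components A =
     {A\<lparr>carrier := {e \<otimes>\<^bsub>A\<^esub> x | x. x \<in> carrier A}, one := e\<rparr> | e. primitive_central_idempotent A e}"


section \<open>Right modules\<close>

text \<open>
  A right \<open>A\<close>-module \<open>M\<close> is a \<^typ>\<open>('a, 'm) module\<close> record in which \<open>a \<odot>\<^bsub>M\<^esub> x\<close> stands for \<open>x \<cdot> a\<close>;
  hence the order of the factors in \<open>smult_mult\<close>. The fields \<open>mult\<close> and \<open>one\<close> of \<open>M\<close> are ignored.
\<close>

locale right_module = A?: ring A + M?: abelian_group M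
  for A :: "('a, 'r) ring_scheme" (structure) and M :: "('a, 'm) module" (structure) +
  assumes smult_closed: "\<lbrakk>a \<in> carrier A; x \<in> carrier M\<rbrakk> \<Longrightarrow> a \<odot>\<^bsub>M\<^esub> x \<in> carrier M"
    and smult_l_distr: "\<lbrakk>a \<in> carrier A; b \<in> carrier A; x \<in> carrier M\<rbrakk> \<Longrightarrow>
      (a \<oplus>\<^bsub>A\<^esub> b) \<odot>\<^bsub>M\<^esub> x = a \<odot>\<^bsub>M\<^esub> x \<oplus>\<^bsub>M\<^esub> b \<odot>\<^bsub>M\<^esub> x"
    and smult_r_distr: "\<lbrakk>a \<in> carrier A; x \<in> carrier M; y \<in> carrier M\<rbrakk> \<Longrightarrow>
      a \<odot>\<^bsub>M\<^esub> (x \<oplus>\<^bsub>M\<^esub> y) = a \<odot>\<^bsub>M\<^esub> x \<oplus>\<^bsub>M\<^esub> a \<odot>\<^bsub>M\<^esub> y"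
    and smult_mult: "\<lbrakk>a \<in> carrier A; b \<in> carrier A; x \<in> carrier M\<rbrakk> \<Longrightarrow>
      (a \<otimes>\<^bsub>A\<^esub> b) \<odot>\<^bsub>M\<^esub> x = b \<odot>\<^bsub>M\<^esub> (a \<odot>\<^bsub>M\<^esub> x)"
    and smult_one: "x \<in> carrier M \<Longrightarrow> \<one>\<^bsub>A\<^esub> \<odot>\<^bsub>M\<^esub> x = x"

text \<open>
  Module homomorphisms are extensional functions, so that homomorphisms are equal iff they agree
  on the carrier.
\<close>

definition mod_hom ::
  "('a, 'r) ring_scheme \<Rightarrow> ('a, 'm) module \<Rightarrow> ('a, 'n) module \<Rightarrow> ('m \<Rightarrow> 'n) set" where
  "mod_hom A M N = {h \<in> carrier M \<rightarrow>\<^sub>E carrier N.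
     (\<forall>x\<in>carrier M. \<forall>y\<in>carrier M. h (x \<oplus>\<^bsub>M\<^esub> y) = h x \<oplus>\<^bsub>N\<^esub> h y) \<and>
     (\<forall>a\<in>carrier A. \<forall>x\<in>carrier M. h (a \<odot>\<^bsub>M\<^esub> x) = a \<odot>\<^bsub>N\<^esub> h x)}"

definition hom_kernel :: "('a, 'm) module \<Rightarrow> ('a, 'n) module \<Rightarrow> ('m \<Rightarrow> 'n) \<Rightarrow> 'm set" where
  "hom_kernel M N h = {x \<in> carrier M. h x = \<zero>\<^bsub>N\<^esub>}"

definition endomorphism_algebra ::
  "('k::field, 'a) module \<Rightarrow> ('a, 'm) module \<Rightarrow> ('k, 'm \<Rightarrow> 'm) module" where
  "endomorphism_algebra A M =
     \<lparr>carrier = mod_hom A M M,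
      monoid.mult = compose (carrier M),
      one = (\<lambda>x\<in>carrier M. x),
      zero = (\<lambda>x\<in>carrier M. \<zero>\<^bsub>M\<^esub>),
      add = (\<lambda>f g. \<lambda>x\<in>carrier M. f x \<oplus>\<^bsub>M\<^esub> g x),
      module.smult = (\<lambda>c f. \<lambda>x\<in>carrier M. (c \<odot>\<^bsub>A\<^esub> \<one>\<^bsub>A\<^esub>) \<odot>\<^bsub>M\<^esub> f x)\<rparr>"

text \<open>Direct sum of a family over a finite index set \<open>V\<close>.\<close>

definition direct_sum :: "'i set \<Rightarrow> ('i \<Rightarrow> ('a, 'm) module) \<Rightarrow> ('a, 'i \<Rightarrow> 'm) module" where
  "direct_sum V M =
     \<lparr>carrier = (\<Pi>\<^sub>E i\<in>V. carrier (M i)),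
      monoid.mult = undefined,
      one = undefined,
      zero = (\<lambda>i\<in>V. \<zero>\<^bsub>M i\<^esub>),
      add = (\<lambda>x y. \<lambda>i\<in>V. x i \<oplus>\<^bsub>M i\<^esub> y i),
      module.smult = (\<lambda>a x. \<lambda>i\<in>V. a \<odot>\<^bsub>M i\<^esub> x i)\<rparr>"

definition fg_module :: "('a, 'r) ring_scheme \<Rightarrow> ('a, 'm) module \<Rightarrow> bool" where
  "fg_module A M \<longleftrightarrow> right_module A M \<and>
     (\<exists>X. finite X \<and> X \<subseteq> carrier M \<and> (\<forall>H. submodule H A M \<and> X \<subseteq> H \<longrightarrow> H = carrier M))"

definition simple_module :: "('a, 'r) ring_scheme \<Rightarrow> ('a, 'm) module \<Rightarrow> bool" where
  "simple_module A M \<longleftrightarrow> right_module A M \<and> carrier M \<noteq> {\<zero>\<^bsub>M\<^esub>} \<and>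
     (\<forall>H. submodule H A M \<longrightarrow> H = {\<zero>\<^bsub>M\<^esub>} \<or> H = carrier M)"

definition uniserial_module :: "('a, 'r) ring_scheme \<Rightarrow> ('a, 'm) module \<Rightarrow> bool" where
  "uniserial_module A M \<longleftrightarrow> right_module A M \<and>
     (\<forall>H L. submodule H A M \<and> submodule L A M \<longrightarrow> H \<subseteq> L \<or> L \<subseteq> H)"

definition indecomposable_module :: "('a, 'r) ring_scheme \<Rightarrow> ('a, 'm) module \<Rightarrow> bool" where
  "indecomposable_module A M \<longleftrightarrow> right_module A M \<and> carrier M \<noteq> {\<zero>\<^bsub>M\<^esub>} \<and>
     (\<forall>H L. submodule H A M \<and> submodule L A M \<and> H \<inter> L = {\<zero>\<^bsub>M\<^esub>} \<and> H <+>\<^bsub>M\<^esub> L = carrier M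
        \<longrightarrow> H = {\<zero>\<^bsub>M\<^esub>} \<or> L = {\<zero>\<^bsub>M\<^esub>})"

text \<open>The sum of all simple submodules, i.e. the least submodule containing them.\<close>

definition socle :: "('a, 'r) ring_scheme \<Rightarrow> ('a, 'm) module \<Rightarrow> ('a, 'm) module" where
  "socle A M = M\<lparr>carrier := \<Inter>{H. submodule H A M \<and>
     (\<forall>L. submodule L A M \<and> simple_module A (M\<lparr>carrier := L\<rparr>) \<longrightarrow> L \<subseteq> H)}\<rparr>"


section \<open>Homological dimension\<close>

text \<open>
  A fixed universe that contains every finitely generated right \<open>A\<close>-module up to isomorphism:
  such a module is a quotient \<open>A\<^sup>n/U\<close>, whose elements are cosets, i.e. sets of functions
  \<open>nat \<Rightarrow> 'a\<close>.
\<close>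

type_synonym 'a rmod = "('a, (nat \<Rightarrow> 'a) set) module"

definition projective_module :: "('a, 'r) ring_scheme \<Rightarrow> 'a rmod \<Rightarrow> bool" where
  "projective_module A P \<longleftrightarrow> fg_module A P \<and>
     (\<forall>(M :: 'a rmod) (N :: 'a rmod) g f.
        fg_module A M \<and> fg_module A N \<and> g \<in> mod_hom A M N \<and> g ` carrier M = carrier N \<and>
        f \<in> mod_hom A P N
        \<longrightarrow> (\<exists>h\<in>mod_hom A P M. \<forall>x\<in>carrier P. g (h x) = f x))"

definition projective_cover :: "('a, 'r) ring_scheme \<Rightarrow> 'a rmod \<Rightarrow> 'a rmod \<Rightarrow> bool" where
  "projective_cover A P M \<longleftrightarrow> projective_module A P \<and> fg_module A M \<and>
     (\<exists>p\<in>mod_hom A P M. p ` carrier P = carrier M \<and>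
        (\<forall>H. submodule H A P \<and> H <+>\<^bsub>P\<^esub> hom_kernel P M p = carrier P \<longrightarrow> H = carrier P))"

text \<open>\<open>\<dots> \<rightarrow> P 1 \<rightarrow> P 0 \<rightarrow> M \<rightarrow> 0\<close> is a projective resolution with \<open>P i = 0\<close> for \<open>i > n\<close>.\<close>

definition projective_resolution ::
  "('a, 'r) ring_scheme \<Rightarrow> 'a rmod \<Rightarrow> nat \<Rightarrow> (nat \<Rightarrow> 'a rmod)
     \<Rightarrow> (nat \<Rightarrow> (nat \<Rightarrow> 'a) set \<Rightarrow> (nat \<Rightarrow> 'a) set) \<Rightarrow> ((nat \<Rightarrow> 'a) set \<Rightarrow> (nat \<Rightarrow> 'a) set) \<Rightarrow> bool"
where
  "projective_resolution A M n P d p \<longleftrightarrow>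
     (\<forall>i. projective_module A (P i)) \<and>
     (\<forall>i>n. carrier (P i) = {\<zero>\<^bsub>P i\<^esub>}) \<and>
     p \<in> mod_hom A (P 0) M \<and> p ` carrier (P 0) = carrier M \<and>
     (\<forall>i. d i \<in> mod_hom A (P (Suc i)) (P i)) \<and>
     d 0 ` carrier (P 1) = hom_kernel (P 0) M p \<and>
     (\<forall>i. d (Suc i) ` carrier (P (Suc (Suc i))) = hom_kernel (P (Suc i)) (P i) (d i))"

definition proj_dim :: "('a, 'r) ring_scheme \<Rightarrow> 'a rmod \<Rightarrow> enat" where
  "proj_dim A M = Inf {enat n | n. \<exists>P d p. projective_resolution A M n P d p}"

definition gl_dim :: "('a, 'r) ring_scheme \<Rightarrow> enat" where
  "gl_dim A = (SUP M \<in> {M :: 'a rmod. fg_module A M}. proj_dim A M)"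


section \<open>Bound quiver algebras\<close>

text \<open>
  A quiver is a \<^typ>\<open>('v, 'e) pre_digraph\<close>. A path is a pair of its source and its list of arrows,
  in the order in which they are traversed. Paths are composed from left to right, so that the
  indecomposable projective right module \<open>e\<^sub>i A\<close> is spanned by the paths starting at \<open>i\<close>.
\<close>

type_synonym ('v, 'e) path = "'v \<times> 'e list"

definition paths :: "('v, 'e) pre_digraph \<Rightarrow> ('v, 'e) path set" where
  "paths Q = {(u, p). \<exists>v. pre_digraph.awalk Q u p v}"

definition path_elem :: "('v, 'e) path \<Rightarrow> ('v, 'e) path \<Rightarrow> 'k::field" where
  "path_elem w = (\<lambda>w'. if w' = w then 1 else 0)"

text \<open>Elements are finitely supported families of coefficients, multiplied by convolution.\<close>

definition path_algebra :: "('v, 'e) pre_digraph \<Rightarrow> ('k::field, ('v, 'e) path \<Rightarrow> 'k) module" where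
  "path_algebra Q =
     \<lparr>carrier = {f. finite {w. f w \<noteq> 0} \<and> {w. f w \<noteq> 0} \<subseteq> paths Q},
      monoid.mult = (\<lambda>f g (u, p). \<Sum>k\<le>length p.
        f (u, take k p) * g (last (pre_digraph.awalk_verts Q u (take k p)), drop k p)),
      one = (\<lambda>(u, p). if u \<in> verts Q \<and> p = [] then 1 else 0),
      zero = (\<lambda>w. 0),
      add = (\<lambda>f g w. f w + g w),
      module.smult = (\<lambda>c f w. c * f w)\<rparr>"

definition admissible_ideal ::
  "('v, 'e) pre_digraph \<Rightarrow> (('v, 'e) path \<Rightarrow> 'k::field) set \<Rightarrow> bool" where
  "admissible_ideal Q I \<longleftrightarrow> ideal I (path_algebra Q) \<and>
     (\<forall>f\<in>I. \<forall>w. f w \<noteq> 0 \<longrightarrow> 2 \<le> length (snd w)) \<and>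
     (\<exists>m. \<forall>w\<in>paths Q. m \<le> length (snd w) \<longrightarrow> path_elem w \<in> I)"


section \<open>Nakayama algebras\<close>

text \<open>The vertices \<open>1, \<dots>, N\<close> are represented by \<open>0, \<dots>, N - 1\<close>.\<close>

definition cyclic_quiver :: "nat \<Rightarrow> (nat, nat) pre_digraph" where
  "cyclic_quiver N = \<lparr>verts = {0..<N}, arcs = {0..<N}, tail = id, head = (\<lambda>i. Suc i mod N)\<rparr>"

definition linear_quiver :: "nat \<Rightarrow> (nat, nat) pre_digraph" where
  "linear_quiver n = \<lparr>verts = {0..<n}, arcs = {i. Suc i < n}, tail = id, head = Suc\<rparr>"

definition cyclic_relations :: "nat \<Rightarrow> ((nat, nat) path \<Rightarrow> 'k::field) set \<Rightarrow> bool" where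
  "cyclic_relations N R \<longleftrightarrow> finite R \<and> R \<noteq> {} \<and>
     R \<subseteq> {path_elem w | w. w \<in> paths (cyclic_quiver N) \<and> 2 \<le> length (snd w)} \<and>
     (\<forall>R'. R' \<subset> R \<longrightarrow>
        genideal (path_algebra (cyclic_quiver N)) R' \<noteq> genideal (path_algebra (cyclic_quiver N)) R)"

definition cyclic_algebra ::
  "nat \<Rightarrow> ((nat, nat) path \<Rightarrow> 'k::field) set \<Rightarrow> ('k, ((nat, nat) path \<Rightarrow> 'k) set) module" where
  "cyclic_algebra N R =
     quotient_algebra (path_algebra (cyclic_quiver N)) (genideal (path_algebra (cyclic_quiver N)) R)"

text \<open>The rank \<open>N = 1\<close>, where the quiver is a loop, is included.\<close>

definition cyclic_presentation ::
  "('k::field, 'a) module \<Rightarrow> nat \<Rightarrow> ((nat, nat) path \<Rightarrow> 'k) set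
     \<Rightarrow> (((nat, nat) path \<Rightarrow> 'k) set \<Rightarrow> 'a) \<Rightarrow> bool" where
  "cyclic_presentation A N R \<phi> \<longleftrightarrow>
     1 \<le> N \<and> cyclic_relations N R \<and> \<phi> \<in> alg_isos (cyclic_algebra N R) A"

definition cyclic_nakayama :: "('k::field, 'a) module \<Rightarrow> bool" where
  "cyclic_nakayama A \<longleftrightarrow> (\<exists>N R \<phi>. cyclic_presentation A N R \<phi>)"

definition min_relations :: "('k::field, 'a) module \<Rightarrow> nat" where
  "min_relations A = (LEAST r. \<exists>N R \<phi>. cyclic_presentation A N R \<phi> \<and> card R = r)"

definition linear_nakayama :: "('k::field, 'a) module \<Rightarrow> bool" where
  "linear_nakayama A \<longleftrightarrow>
     (\<exists>n I. 1 \<le> n \<and> admissible_ideal (linear_quiver n) I \<and>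
        alg_isomorphic (quotient_algebra (path_algebra (linear_quiver n)) I) A) \<and>
     (\<forall>M :: 'a rmod. fg_module A M \<and> indecomposable_module A M \<longrightarrow> uniserial_module A M)"


section \<open>Syzygy filtered algebras\<close>

definition vertex_idempotent ::
  "nat \<Rightarrow> ((nat, nat) path \<Rightarrow> 'k::field) set \<Rightarrow> (((nat, nat) path \<Rightarrow> 'k) set \<Rightarrow> 'a) \<Rightarrow> nat \<Rightarrow> 'a"
where
  "vertex_idempotent N R \<phi> i =
     (let KQ = path_algebra (cyclic_quiver N) in \<phi> (genideal KQ R +>\<^bsub>KQ\<^esub> path_elem (i, [])))"

text \<open>
  The simple module at a vertex is the one on which the idempotent \<open>e\<close> of that vertex acts
  non-trivially.
\<close>

definition simple_at :: "('a, 'r) ring_scheme \<Rightarrow> 'a \<Rightarrow> ('a, 'm) module \<Rightarrow> bool" where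
  "simple_at A e S \<longleftrightarrow> simple_module A S \<and> (\<exists>x\<in>carrier S. e \<odot>\<^bsub>S\<^esub> x \<noteq> \<zero>\<^bsub>S\<^esub>)"

text \<open>
  Isomorphism classes of simple modules are encoded by the vertices of the quiver; the map
  \<open>\<tau> S\<^sub>i = S\<^bsub>i+1\<^esub>\<close> becomes \<open>i \<mapsto> Suc i mod N\<close>.
\<close>

definition socle_vertices :: "('a, 'r) ring_scheme \<Rightarrow> nat \<Rightarrow> (nat \<Rightarrow> 'a) \<Rightarrow> nat set" where
  "socle_vertices A N e = {i. i < N \<and> (\<exists>P :: 'a rmod.
     projective_module A P \<and> indecomposable_module A P \<and> simple_at A (e i) (socle A P))}"

definition shifted_socle_vertices :: "('a, 'r) ring_scheme \<Rightarrow> nat \<Rightarrow> (nat \<Rightarrow> 'a) \<Rightarrow> nat set" where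
  "shifted_socle_vertices A N e = (\<lambda>i. Suc i mod N) ` socle_vertices A N e"

text \<open>
  \<open>syzygy_filtered A B\<close>: the algebra \<open>A\<close> is cyclic Nakayama and \<open>B\<close> is an isomorphic copy of the
  endomorphism algebra \<open>\<epsilon>(A)\<close>, which is determined by \<open>A\<close> up to isomorphism. A relation is used
  because the endomorphism algebra lives on another type, which would obstruct iteration.
\<close>

definition syzygy_filtered :: "('k::field, 'a) module \<Rightarrow> ('k, 'b) module \<Rightarrow> bool" where
  "syzygy_filtered A B \<longleftrightarrow>
     (\<exists>N R \<phi> P. cyclic_presentation A N R \<phi> \<and>
        (let e = vertex_idempotent N R \<phi>; V = shifted_socle_vertices A N e in
           (\<forall>i\<in>V. \<exists>S :: 'a rmod. simple_at A (e i) S \<and> projective_cover A (P i) S) \<and>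
           alg_isomorphic (endomorphism_algebra A (direct_sum V P)) B))"

end

theory Submission
  imports Defs "HOL-Library.Function_Algebras"
begin

text \<open>
  A cyclic Nakayama algebra is governed by one function on the integers. Unroll the cycle with
  \<open>N\<close> vertices to the integers and let \<open>f i\<close> be the first point at which
  the path starting at \<open>i\<close> has become zero. Then \<open>f\<close> is monotone,
  satisfies \<open>f (i + N) = f i + N\<close> and \<open>i < f i\<close>, and the algebra is
  isomorphic to the algebra \<open>PM N f\<close> of \<open>N\<close>-periodic matrices, indexed by
  the integers, with support in \<open>i \<le> j < f i\<close> (\<open>cyclic_algebra_iso\<close>).
  All algebras that occur are handled as copies of some \<open>PM N f\<close> (locale
  \<open>nak\<close>).

  The uniserial module with composition factors at \<open>a, \<dots>, b - 1\<close> is zero if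
  \<open>a = b\<close>, projective if \<open>b = f a\<close>, and its syzygy belongs to \<open>b,
  \<dots>, f a - 1\<close>. So projective dimensions are computed by iterating \<open>(a, b)
  \<mapsto> (b, f a)\<close>, which is the predicate \<open>stop\<close>. If all pairs stop after
  \<open>d\<close> steps, with \<open>d\<close> positive, then the global dimension is at most
  \<open>d\<close> (\<open>gl_dim_bound\<close>); instead of decomposing modules into uniserial
  ones, the proof takes a submodule of a direct sum of indecomposable projectives and follows the
  leading terms of its elements through one syzygy (\<open>relations_leads\<close>).

  The socle of the projective at \<open>i\<close> sits at \<open>f i - 1\<close>, so the
  projectives that define the syzygy filtered algebra are those at the points of \<open>range
  f\<close>, and their endomorphism algebra is the corner of \<open>PM N f\<close> at these points
  (\<open>left_mult_iso\<close>). Enumerating \<open>range f\<close> increasingly by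
  \<open>w\<close> turns this corner into \<open>PM n f'\<close>, where \<open>f \<circ> w = w
  \<circ> f'\<close> and \<open>n\<close> is the number of residues of \<open>range f\<close>. The
  second syzygy of any pair has both ends in \<open>range f\<close>; hence a bound \<open>D\<close>
  for \<open>f'\<close> gives the bound \<open>D + 2\<close> for \<open>f\<close>
  (\<open>stop_reduces\<close>).

  The corner stops being cyclic when \<open>f'\<close> has a break \<open>f' z = z + 1\<close>.
  Then its components are linear Nakayama algebras, at most one for each break, and if there are
  \<open>C\<close> breaks in a period then all pairs stop after \<open>n - C\<close> steps
  (\<open>linear_stop\<close>). Moreover \<open>n\<close> is at most the number of relations, in
  every presentation of the algebra, because the elements that the radical annihilates on both
  sides form a space of dimension \<open>n\<close> (\<open>range_card_le\<close>). Adding the two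
  steps for each of the \<open>m\<close> reductions gives the bound of the theorem.

  A break must appear. As long as there is none, \<open>n \<le> N\<close>, and equality forces
  \<open>f\<close> to be a shift \<open>i \<mapsto> i + c\<close> with \<open>c \<ge> 2\<close>.
  The composite \<open>p\<close> of the projections from the first algebra, whose function is
  \<open>f\<^sub>0\<close>, then satisfies \<open>p (f\<^sub>0 i) = p i + c\<close>. In this
  situation two elements \<open>t, t'\<close> of the first algebra have the property that, on the
  part of a module on which a certain idempotent acts as the identity, the kernel of each is the
  image of the other whenever the module has finite projective dimension; but this fails for a
  simple module (\<open>gl_dim_infinite\<close>). So finite global dimension makes the number of
  vertices drop until a break occurs.
\<close>

section \<open>Length functions and their syzygies\<close>

text \<open>
  The functions \<open>f\<close> that occur as \<open>f i\<close> = first point beyond the longest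
  nonzero path from \<open>i\<close>, on the universal cover of a cycle with \<open>N\<close>
  vertices.
\<close>

definition adm :: "int \<Rightarrow> (int \<Rightarrow> int) \<Rightarrow> bool" where
  "adm N f \<longleftrightarrow> 1 \<le> N \<and> mono f \<and> (\<forall>i. f (i + N) = f i + N) \<and> (\<forall>i. i < f i)"

lemma periodic_shift:
  fixes f :: "int \<Rightarrow> int"
  assumes "\<And>i. f (i + N) = f i + M"
  shows "f (i + t * N) = f i + t * M"
proof (induction t rule: int_induct[where k = 0])
  case base show ?case by simp
next
  case (step1 t)
  have "f (i + (t + 1) * N) = f ((i + t * N) + N)" by (simp add: algebra_simps)
  also have "\<dots> = f (i + t * N) + M" by (rule assms)
  finally show ?case using step1 by (simp add: algebra_simps)
next
  case (step2 t)
  have "f (i + t * N) = f ((i + (t - 1) * N) + N)" by (simp add: algebra_simps)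
  also have "\<dots> = f (i + (t - 1) * N) + M" by (rule assms)
  finally show ?case using step2 by (simp add: algebra_simps)
qed

lemma admD:
  assumes "adm N f"
  shows "1 \<le> N" "i \<le> j \<Longrightarrow> f i \<le> f j" "f (i + N) = f i + N" "i < f i" "i + 1 \<le> f i"
    "f (i + t * N) = f i + t * N"
proof -
  show *: "1 \<le> N" "i \<le> j \<Longrightarrow> f i \<le> f j" "f (i + N) = f i + N" "i < f i"
    using assms by (auto simp: adm_def mono_def)
  show "i + 1 \<le> f i" using *(4) by linarith
  show "f (i + t * N) = f i + t * N"
    by (rule periodic_shift) (use assms in \<open>auto simp: adm_def\<close>)
qed

lemma adm_mod: "adm N f \<Longrightarrow> f i = f (i mod N) + N * (i div N)"
  using admD(6)[of N f "i mod N" "i div N"] by (simp add: algebra_simps)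

lemma adm_length_bound:
  assumes "adm N f" shows "f i - i \<le> f 0 + N"
proof -
  have "f i - i = f (i mod N) - i mod N"
    using adm_mod[OF assms, of i] by (simp add: minus_mult_div_eq_mod [symmetric])
  moreover have "f (i mod N) \<le> f (0 + N)"
    using admD(1)[OF assms] by (intro admD(2)[OF assms]) (simp add: less_imp_le)
  moreover have "0 \<le> i mod N" using admD(1)[OF assms] by simp
  ultimately show ?thesis using admD(3)[OF assms, of 0] by simp
qed
text \<open>
  A pair \<open>(a, b)\<close> stands for the uniserial module with composition factors at
  \<open>a, \<dots>, b - 1\<close>, whose projective cover has composition factors at \<open>a,
  \<dots>, f a - 1\<close>. It is projective or zero in case \<open>stop f 0 a b\<close>, and its
  syzygy is the pair \<open>(b, f a)\<close>; so \<open>stop f D a b\<close> says that its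
  projective dimension is at most \<open>D\<close>.
\<close>

primrec stop :: "(int \<Rightarrow> int) \<Rightarrow> nat \<Rightarrow> int \<Rightarrow> int \<Rightarrow> bool" where
  "stop f 0 a b = (a = b \<or> b = f a)"
| "stop f (Suc D) a b = stop f D b (f a)"

lemma stop_Suc: "stop f D a b \<Longrightarrow> stop f (Suc D) a b"
  by (induction D arbitrary: a b) auto

lemma stop_mono: "D \<le> D' \<Longrightarrow> stop f D a b \<Longrightarrow> stop f D' a b"
  by (induction D' rule: dec_induct) (auto simp del: stop.simps intro: stop_Suc)

lemma stop_conj:
  assumes "inj w" "\<And>j. f (w j) = w (f' j)"
  shows "stop f D (w a) (w b) \<longleftrightarrow> stop f' D a b"
  by (induction D arbitrary: a b) (auto simp: assms(2) dest: injD[OF assms(1)])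

text \<open>
  A break \<open>z\<close> is never crossed: all syzygies of a pair that starts at \<open>a \<le>
  z\<close> end at \<open>z + 1\<close> or before, while the starting point moves to the right with
  each nontrivial step.
\<close>

lemma stop_before_breakpoint:
  assumes "adm N f" "f z = z + 1"
  shows "a \<le> b \<Longrightarrow> b \<le> f a \<Longrightarrow> f a \<le> z + 1 \<Longrightarrow> z - a \<le> int D \<Longrightarrow> stop f D a b"
proof (induction D arbitrary: a b)
  case 0
  have "a < f a" using admD(4)[OF assms(1)] .
  with 0 have "a = z" by linarith
  with 0 assms(2) show ?case by auto
next
  case (Suc D)
  consider "a = b" | "b = z + 1" | "a < b" "b \<le> z" using Suc.prems by linarith
  then show ?case
  proof cases
    case 1 show ?thesis by (rule stop_mono[of 0]) (use 1 in auto)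
  next
    case 2 show ?thesis by (rule stop_mono[of 0]) (use 2 Suc.prems in auto)
  next
    case 3
    have "f a \<le> f b" "f b \<le> f z" using 3 by (auto intro!: admD(2)[OF assms(1)])
    then show ?thesis using Suc.IH[of b "f a"] Suc.prems 3 assms(2) by simp
  qed
qed

lemma window_card:
  fixes Z :: "int set"
  assumes n: "1 \<le> n" and per: "\<And>i. i + n \<in> Z \<longleftrightarrow> i \<in> Z"
  shows "card (Z \<inter> {a..<a + n}) = card (Z \<inter> {0..<n})"
proof (rule bij_betw_same_card[of "\<lambda>i. i mod n"])
  have per': "i + t * n \<in> Z \<longleftrightarrow> i \<in> Z" for i t
  proof (induction t rule: int_induct[where k = 0])
    case base show ?case by simp
  next
    case (step1 t) with per[of "i + t * n"] show ?case by (simp add: algebra_simps)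
  next
    case (step2 t) with per[of "i + (t - 1) * n"] show ?case by (simp add: algebra_simps)
  qed
  have mem: "i mod n \<in> Z \<longleftrightarrow> i \<in> Z" for i
    using per'[of "i mod n" "i div n"] by (simp add: mult.commute)
  have inj: "inj_on (\<lambda>i. i mod n) {a..<a + n}"
  proof (rule inj_onI)
    fix x y assume xy: "x \<in> {a..<a + n}" "y \<in> {a..<a + n}" "x mod n = y mod n"
    then have "n dvd x - y" by (simp add: mod_eq_dvd_iff)
    then obtain k where k: "x - y = n * k" by auto
    have "\<bar>n * k\<bar> < n" using xy k by auto
    then have "\<bar>k\<bar> * n < 1 * n" using n by (simp add: abs_mult mult.commute)
    then have "\<bar>k\<bar> < 1" using n by (subst (asm) mult_less_cancel_right) auto
    then have "k = 0" by simp
    then show "x = y" using k by simp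
  qed
  have "(\<lambda>i. i mod n) ` (Z \<inter> {a..<a + n}) = Z \<inter> {0..<n}"
  proof
    show "(\<lambda>i. i mod n) ` (Z \<inter> {a..<a + n}) \<subseteq> Z \<inter> {0..<n}" using mem n by auto
    show "Z \<inter> {0..<n} \<subseteq> (\<lambda>i. i mod n) ` (Z \<inter> {a..<a + n})"
    proof
      fix j assume j: "j \<in> Z \<inter> {0..<n}"
      let ?i = "a + (j - a) mod n"
      have "?i mod n = j" using j by (simp add: mod_add_right_eq)
      moreover have "?i \<in> {a..<a + n}" using n by simp
      moreover from calculation(1) have "?i \<in> Z" using mem[of ?i] j by simp
      ultimately show "j \<in> (\<lambda>i. i mod n) ` (Z \<inter> {a..<a + n})" by (intro image_eqI[of _ _ ?i]) auto
    qed
  qed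
  with inj show "bij_betw (\<lambda>i. i mod n) (Z \<inter> {a..<a + n}) (Z \<inter> {0..<n})"
    by (auto simp: bij_betw_def intro: inj_on_subset)
qed

lemma least_int_ge:
  fixes P :: "int \<Rightarrow> bool"
  assumes "P k" "a \<le> k"
  obtains m where "P m" "a \<le> m" "\<And>i. a \<le> i \<Longrightarrow> P i \<Longrightarrow> m \<le> i"
proof -
  define l where "l = (LEAST d :: nat. P (a + int d))"
  have ex: "P (a + int (nat (k - a)))" using assms by simp
  have "P (a + int l)" unfolding l_def by (rule LeastI[of "\<lambda>d. P (a + int d)", OF ex])
  moreover have "a + int l \<le> i" if "a \<le> i" "P i" for i
  proof -
    have "P (a + int (nat (i - a)))" using that by simp
    then have "l \<le> nat (i - a)" unfolding l_def by (rule Least_le)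
    then show ?thesis using that by linarith
  qed
  ultimately show ?thesis by (intro that[of "a + int l"]) auto
qed

lemma greatest_int_le:
  fixes P :: "int \<Rightarrow> bool"
  assumes "P k" "k \<le> a"
  obtains m where "P m" "m \<le> a" "\<And>i. i \<le> a \<Longrightarrow> P i \<Longrightarrow> i \<le> m"
proof -
  obtain m where "P (- m)" "- a \<le> m" "\<And>i. - a \<le> i \<Longrightarrow> P (- i) \<Longrightarrow> m \<le> i"
    using least_int_ge[of "\<lambda>i. P (- i)" "- k" "- a"] assms by auto
  then show ?thesis by (intro that[of "- m"]) (auto, metis minus_le_iff neg_le_iff_le minus_minus)
qed

text \<open>
  Let \<open>y\<close> be the first break at or after \<open>a\<close>. The breaks in the window
  \<open>{a..<a + N}\<close> all lie at or after \<open>y\<close>, so \<open>y - a\<close> is at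
  most \<open>N\<close> minus their number, and \<open>y - a\<close> steps suffice.
\<close>

lemma linear_stop:
  assumes f: "adm N f" and z: "f z = z + 1" and ab: "a \<le> b" "b \<le> f a"
  shows "stop f (nat N - card {j \<in> {0..<N}. f j = j + 1}) a b"
proof -
  define Z where "Z = {j. f j = j + 1}"
  have N: "1 \<le> N" using admD(1)[OF f] .
  have per: "i + N \<in> Z \<longleftrightarrow> i \<in> Z" for i using admD(3)[OF f, of i] by (auto simp: Z_def)
  have zZ: "z + t * N \<in> Z" for t using admD(6)[OF f, of z t] z by (simp add: Z_def)
  have "a \<le> z + \<bar>a - z\<bar> * N"
  proof -
    define d where "d = \<bar>a - z\<bar>"
    have "d * 1 \<le> d * N" by (intro mult_left_mono) (use N in \<open>auto simp: d_def\<close>)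
    moreover have "a \<le> z + d" by (simp add: d_def)
    ultimately show ?thesis unfolding d_def[symmetric] by linarith
  qed
  \<comment> \<open>the first break at or after the starting point\<close>
  from least_int_ge[of "\<lambda>i. i \<in> Z", OF zZ this] obtain y
    where y: "y \<in> Z" "a \<le> y" "\<And>i. a \<le> i \<Longrightarrow> i \<in> Z \<Longrightarrow> y \<le> i" by metis
  have yf: "f y = y + 1" using y by (simp add: Z_def)
  have "f a \<le> y + 1" using admD(2)[OF f y(2)] yf by simp
  have "Z \<inter> {a..<a + N} \<subseteq> {y..<a + N}" using y by auto
  then have "card (Z \<inter> {a..<a + N}) \<le> nat (a + N - y)"
    by (metis card_atLeastLessThan_int card_mono finite_atLeastLessThan_int)
  moreover have "Z \<inter> {0..<N} = {j \<in> {0..<N}. f j = j + 1}" by (auto simp: Z_def)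
  ultimately have C: "card {j \<in> {0..<N}. f j = j + 1} \<le> nat (a + N - y)"
    using window_card[OF N per, of a] by simp
  have "card {j \<in> {0..<N}. f j = j + 1} \<le> card {0..<N}" by (rule card_mono) auto
  then have C2: "card {j \<in> {0..<N}. f j = j + 1} \<le> nat N" by simp
  have "0 < card (Z \<inter> {a..<a + N})"
  proof -
    have "(z - a) mod N + a \<in> Z" using zZ[of "- ((z - a) div N)"]
      by (simp add: minus_mult_div_eq_mod[symmetric] algebra_simps)
    then have "(z - a) mod N + a \<in> Z \<inter> {a..<a + N}" using N by simp
    then show ?thesis by (auto simp: card_gt_0_iff)
  qed
  then have "y < a + N" using \<open>card (Z \<inter> {a..<a + N}) \<le> nat (a + N - y)\<close> by linarith
  have "y - a \<le> int (nat N - card {j \<in> {0..<N}. f j = j + 1})" using C C2 N \<open>y < a + N\<close> by linarith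
  then show ?thesis using stop_before_breakpoint[OF f yf ab \<open>f a \<le> y + 1\<close>] by simp
qed
lemma strict_mono_int_step:
  fixes w :: "int \<Rightarrow> int"
  assumes "\<And>j. w j < w (j + 1)"
  shows "strict_mono w"
proof (rule strict_monoI)
  fix x y :: int assume "x < y"
  then show "w x < w y"
  proof (induction y rule: int_gr_induct)
    case base show ?case using assms[of x] by (simp add: add.commute)
  next
    case (step i) then show ?case using assms[of i] by simp
  qed
qed

text \<open>
  The elements of \<open>W\<close> in \<open>{0..<N}\<close> are listed increasingly and the list
  is continued periodically.
\<close>

lemma periodic_enumeration:
  fixes W :: "int set"
  assumes N: "1 \<le> N" and per: "\<And>i. i + N \<in> W \<longleftrightarrow> i \<in> W" and ne: "W \<noteq> {}"
  obtains w :: "int \<Rightarrow> int" and n where "strict_mono w" "range w = W" "1 \<le> n" "\<And>j. w (j + n) = w j + N"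
proof -
  have per': "i + t * N \<in> W \<longleftrightarrow> i \<in> W" for i t
  proof (induction t rule: int_induct[where k = 0])
    case base show ?case by simp
  next
    case (step1 t) with per[of "i + t * N"] show ?case by (simp add: algebra_simps)
  next
    case (step2 t) with per[of "i + (t - 1) * N"] show ?case by (simp add: algebra_simps)
  qed
  have mem: "i mod N \<in> W \<longleftrightarrow> i \<in> W" for i
    using per'[of "i mod N" "i div N"] by (simp add: mult.commute)
  define X where "X = W \<inter> {0..<N}"
  define xs where "xs = sorted_list_of_set X"
  define n where "n = int (length xs)"
  have fin: "finite X" by (simp add: X_def)
  have "X \<noteq> {}"
  proof -
    from ne obtain i where "i \<in> W" by auto
    then have "i mod N \<in> X" using mem N by (auto simp: X_def)
    then show ?thesis by auto
  qed
  then have n: "1 \<le> n" using fin by (simp add: n_def xs_def Suc_le_eq card_gt_0_iff)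
  have set_xs: "set xs = X" using fin by (simp add: xs_def)
  have srt: "sorted_wrt (<) xs" by (simp add: xs_def)
  define w where "w j = xs ! nat (j mod n) + N * (j div n)" for j
  have in_X: "xs ! nat (j mod n) \<in> X" for j
  proof -
    have "0 \<le> j mod n" "j mod n < n" using n by auto
    then have "nat (j mod n) < length xs" by (simp add: n_def nat_less_iff)
    then show ?thesis using set_xs nth_mem by blast
  qed
  have wper: "w (j + n) = w j + N" for j
    using n by (simp add: w_def algebra_simps)
  have step: "w j < w (j + 1)" for j
  proof (cases "j mod n + 1 < n")
    case True
    have *: "(j + 1) mod n = j mod n + 1" "(j + 1) div n = j div n"
    proof -
      have j: "j = n * (j div n) + j mod n" by simp
      have "j + 1 = n * (j div n) + (j mod n + 1)" by simp
      moreover have "0 \<le> j mod n + 1" using n by (simp add: add_nonneg_nonneg)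
      ultimately show "(j + 1) div n = j div n" "(j + 1) mod n = j mod n + 1"
        using True n by (metis div_pos_pos_trivial div_mult_self4 add_0_right mult.commute
          not_one_le_zero add.commute, metis mod_mult_self4 mod_pos_pos_trivial mult.commute)
    qed
    have "xs ! nat (j mod n) < xs ! nat (j mod n + 1)"
    proof (rule sorted_wrt_nth_less[OF srt])
      have "0 \<le> j mod n" using n by simp
      then show "nat (j mod n) < nat (j mod n + 1)" by linarith
      show "nat (j mod n + 1) < length xs" using True n \<open>0 \<le> j mod n\<close> by (simp add: n_def nat_less_iff)
    qed
    then show ?thesis by (simp add: w_def *)
  next
    case False
    have "j mod n < n" using n by simp
    with False have e: "j mod n = n - 1" by simp
    have "j = n * (j div n) + (n - 1)" using mult_div_mod_eq[of n j] e by linarith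
    then have j: "j + 1 = n * (j div n + 1)" by (simp add: algebra_simps)
    have *: "(j + 1) mod n = 0" by (subst j) simp
    have **: "(j + 1) div n = j div n + 1" by (subst j) (use n in simp)
    have "xs ! nat (j mod n) < N" "0 \<le> xs ! nat ((j + 1) mod n)"
      using in_X[of j] in_X[of "j + 1"] by (auto simp: X_def)
    then show ?thesis unfolding w_def * ** by (simp add: algebra_simps)
  qed
  have "range w = W"
  proof
    show "range w \<subseteq> W"
    proof
      fix i assume "i \<in> range w"
      then obtain j where j: "i = w j" by auto
      have "xs ! nat (j mod n) \<in> W" using in_X[of j] by (auto simp: X_def)
      then show "i \<in> W" unfolding j w_def using per'[of "xs ! nat (j mod n)" "j div n"]
        by (simp add: mult.commute)
    qed
    show "W \<subseteq> range w"
    proof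
      fix i assume "i \<in> W"
      then have "i mod N \<in> set xs" using mem N by (auto simp: set_xs X_def)
      then obtain k where k: "k < length xs" "xs ! k = i mod N" by (auto simp: in_set_conv_nth)
      have "w (int k + n * (i div N)) = i"
      proof -
        have "int k < n" using k by (simp add: n_def)
        then have "(int k + n * (i div N)) mod n = int k" "(int k + n * (i div N)) div n = i div N"
          using n by auto
        then show ?thesis using k by (simp add: w_def)
      qed
      then show "i \<in> range w" by (metis rangeI)
    qed
  qed
  moreover have "strict_mono w" by (rule strict_mono_int_step) (rule step)
  ultimately show ?thesis using wper n that by blast
qed
text \<open>
  Passage from \<open>f\<close> to the function \<open>f'\<close> of the syzygy filtered algebra:
  \<open>w\<close> enumerates \<open>range f\<close>, the vertices that survive, and
  \<open>f'\<close> is the restriction of \<open>f\<close> to \<open>range f\<close> in this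
  numbering.
\<close>

definition reduces :: "int \<Rightarrow> (int \<Rightarrow> int) \<Rightarrow> (int \<Rightarrow> int) \<Rightarrow> int \<Rightarrow> (int \<Rightarrow> int) \<Rightarrow> bool" where
  "reduces N f w n f' \<longleftrightarrow> adm N f \<and> strict_mono w \<and> range w = range f \<and> 1 \<le> n \<and>
     (\<forall>j. w (j + n) = w j + N) \<and> (\<forall>j. f (w j) = w (f' j))"

lemma reduces_exists:
  assumes "adm N f" obtains w n f' where "reduces N f w n f'"
proof -
  have per: "i + N \<in> range f \<longleftrightarrow> i \<in> range f" for i
  proof
    assume "i + N \<in> range f"
    then obtain k where "i + N = f k" by auto
    then have "i = f (k - N)" using admD(3)[OF assms, of "k - N"] by simp
    then show "i \<in> range f" by auto
  next
    assume "i \<in> range f"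
    then obtain k where "i = f k" by auto
    then have "i + N = f (k + N)" using admD(3)[OF assms, of k] by simp
    then show "i + N \<in> range f" by auto
  qed
  obtain w n where w: "strict_mono w" "range w = range f" "1 \<le> n" "\<And>j :: int. w (j + n) = w j + N"
    by (rule periodic_enumeration[OF admD(1)[OF assms] per]) (blast, rule that)
  have "f (w j) = w (inv_into UNIV w (f (w j)))" for j
    by (rule f_inv_into_f[symmetric]) (simp add: w(2))
  then show ?thesis using w assms by (intro that[of w n "\<lambda>j. inv_into UNIV w (f (w j))"]) (auto simp: reduces_def)
qed

lemma reducesD:
  assumes "reduces N f w n f'"
  shows "adm N f" "strict_mono w" "inj w" "range w = range f" "1 \<le> n" "w (j + n) = w j + N"
    "f (w j) = w (f' j)" "w i < w j \<longleftrightarrow> i < j" "w i \<le> w j \<longleftrightarrow> i \<le> j" "w i = w j \<longleftrightarrow> i = j"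
    "w (j + t * n) = w j + t * N"
proof -
  show *: "adm N f" "strict_mono w" "range w = range f" "1 \<le> n" "w (j + n) = w j + N"
    "f (w j) = w (f' j)" using assms by (auto simp: reduces_def)
  show "inj w" using strict_mono_imp_inj_on[OF *(2)] .
  show "w i < w j \<longleftrightarrow> i < j" "w i \<le> w j \<longleftrightarrow> i \<le> j" "w i = w j \<longleftrightarrow> i = j"
    using strict_mono_less[OF *(2)] strict_mono_less_eq[OF *(2)] strict_mono_eq[OF *(2)] by auto
  show "w (j + t * n) = w j + t * N"
    by (rule periodic_shift) (use assms in \<open>auto simp: reduces_def\<close>)
qed

lemma reduces_adm:
  assumes "reduces N f w n f'" shows "adm n f'"
  unfolding adm_def
proof (intro conjI allI)
  note r = reducesD[OF assms]
  show "1 \<le> n" by (rule r)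
  show "mono f'"
  proof (rule monoI)
    fix i j :: int assume "i \<le> j"
    then have "f (w i) \<le> f (w j)" using r by (intro admD(2)[OF r(1)]) simp
    then show "f' i \<le> f' j" using r by simp
  qed
  show "f' (i + n) = f' i + n" for i
  proof -
    have "w (f' (i + n)) = f (w i + N)" using r by metis
    also have "\<dots> = w (f' i + n)" using r admD(3)[OF r(1)] by metis
    finally show ?thesis using r(10) by blast
  qed
  show "i < f' i" for i
    using admD(4)[OF r(1), of "w i"] r by simp
qed

text \<open>
  The choice of the origin of the enumeration is free; it will be used to move a break of
  \<open>f'\<close> to \<open>-1\<close>, so that no component wraps around the cycle.
\<close>

lemma reduces_shift:
  assumes "reduces N f w n f'"
  shows "reduces N f (\<lambda>j. w (j + s)) n (\<lambda>j. f' (j + s) - s)"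
proof -
  note r = reducesD[OF assms]
  have "range (\<lambda>j. w (j + s)) = range w"
  proof
    show "range w \<subseteq> range (\<lambda>j. w (j + s))"
    proof
      fix x assume "x \<in> range w"
      then obtain j where "x = w ((j - s) + s)" by auto
      then show "x \<in> range (\<lambda>j. w (j + s))" by blast
    qed
  qed auto
  moreover have "strict_mono (\<lambda>j. w (j + s))" using r(8) by (auto simp: strict_mono_def)
  moreover have "w (j + n + s) = w (j + s) + N" for j using r(6)[of "j + s"] by (simp add: algebra_simps)
  ultimately show ?thesis using r unfolding reduces_def by auto
qed

lemma reduces_card:
  assumes "reduces N f w n f'"
  shows "nat n = card (range f \<inter> {0..<N})"
proof -
  note r = reducesD[OF assms]
  have N: "1 \<le> N" by (rule admD(1)[OF r(1)])
  have per: "i + N \<in> range f \<longleftrightarrow> i \<in> range f" for i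
  proof
    assume "i + N \<in> range f"
    then obtain k where "i + N = f k" by auto
    then have "i = f (k - N)" using admD(3)[OF r(1), of "k - N"] by simp
    then show "i \<in> range f" by auto
  next
    assume "i \<in> range f"
    then obtain k where "i = f k" by auto
    then have "i + N = f (k + N)" using admD(3)[OF r(1), of k] by simp
    then show "i + N \<in> range f" by auto
  qed
  have "card (range f \<inter> {0..<N}) = card (range f \<inter> {w 0..<w 0 + N})"
    using window_card[OF N per, of "w 0"] by simp
  also have "range f \<inter> {w 0..<w 0 + N} = w ` {0..<n}"
  proof -
    have e: "w 0 + N = w n" using r(6)[of 0] by simp
    show ?thesis unfolding e r(4)[symmetric] using r(8,9) by auto
  qed
  also have "card (w ` {0..<n}) = nat n"
    by (subst card_image) (auto intro: inj_on_subset[OF r(3)])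
  finally show ?thesis by simp
qed

lemma reduces_le:
  assumes "reduces N f w n f'" shows "n \<le> N"
proof -
  have "card (range f \<inter> {0..<N}) \<le> card {0..<N}" by (rule card_mono) auto
  then show ?thesis using reduces_card[OF assms] reducesD(5)[OF assms] by simp
qed

text \<open>
  The map \<open>p\<close> sends a vertex \<open>i\<close> to the number of \<open>f i\<close> in
  the enumeration of \<open>range f\<close>. It intertwines \<open>f\<close> with
  \<open>f'\<close>, and these projections can be composed along a tower of reductions.
\<close>

lemma reduces_projection:
  assumes "reduces N f w n f'"
  obtains p where "mono p" "surj p" "\<And>i. p (i + N) = p i + n" "\<And>i. p (f i) = f' (p i)"
    "\<And>i. f i = w (p i)"
proof -
  note r = reducesD[OF assms]
  define p where "p i = inv_into UNIV w (f i)" for i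
  have fp: "f i = w (p i)" for i
    unfolding p_def by (rule f_inv_into_f[symmetric]) (simp add: r(4))
  have "mono p"
    by (rule monoI) (use fp r(9) admD(2)[OF r(1)] in metis)
  moreover have "surj p"
    unfolding surj_def
  proof
    fix j
    have "w j \<in> range f" using r(4) by auto
    then obtain i where "f i = w j" by auto
    then show "\<exists>i. j = p i" using fp r(10) by metis
  qed
  moreover have "p (i + N) = p i + n" for i
    using fp[of "i + N"] admD(3)[OF r(1), of i] fp[of i] r(6)[of "p i"] r(10) by metis
  moreover have "p (f i) = f' (p i)" for i
    using fp[of "f i"] fp[of i] r(7)[of "p i"] r(10) by metis
  ultimately show ?thesis using fp that by blast
qed

text \<open>
  Two steps lead from \<open>(a, b)\<close> to \<open>(f a, f b)\<close>, and both entries are in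
  \<open>range f\<close>, where \<open>f\<close> acts like \<open>f'\<close>.
\<close>

lemma stop_reduces:
  assumes "reduces N f w n f'" and "\<And>a b. a \<le> b \<Longrightarrow> b \<le> f' a \<Longrightarrow> stop f' D a b"
    and "a \<le> b" "b \<le> f a"
  shows "stop f (D + 2) a b"
proof -
  note r = reducesD[OF assms(1)]
  obtain p where p: "\<And>i. f i = w (p i)" using reduces_projection[OF assms(1)] by metis
  have "p a \<le> p b" using admD(2)[OF r(1) assms(3)] p r(9) by metis
  moreover have "p b \<le> f' (p a)" using admD(2)[OF r(1) assms(4)] p r(7) r(9) by metis
  ultimately have "stop f D (w (p a)) (w (p b))" using stop_conj[of w f f', OF r(3,7)] assms(2) by blast
  then show ?thesis using p by (simp add: numeral_2_eq_2)
qed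

text \<open>
  If no vertex is lost then \<open>f\<close> is a monotone bijection of the integers, hence a
  shift.
\<close>

lemma reduces_bijective:
  assumes "reduces N f w N f'" obtains c where "\<And>i. f i = i + c"
proof -
  note r = reducesD[OF assms]
  have N: "1 \<le> N" by (rule admD(1)[OF r(1)])
  have "card (range f \<inter> {0..<N}) = card {0..<N}" using reduces_card[OF assms] N by simp
  then have "range f \<inter> {0..<N} = {0..<N}" by (intro card_subset_eq) auto
  then have sub: "{0..<N} \<subseteq> range f" by auto
  have surj: "j \<in> range f" for j
  proof -
    have "j mod N \<in> range f" using sub N by (auto intro!: subsetD[OF sub])
    then obtain i where "f i = j mod N" by auto
    then have "f (i + (j div N) * N) = j" using admD(6)[OF r(1), of i "j div N"] by simp
    then show ?thesis by (metis rangeI)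
  qed
  have step: "f (i + 1) \<le> f i + 1" for i
  proof (rule ccontr)
    assume "\<not> ?thesis"
    then have gap: "f i + 1 < f (i + 1)" by simp
    obtain k where k: "f k = f i + 1" using surj[of "f i + 1"] by auto
    show False
    proof (cases "k \<le> i")
      case True then show False using admD(2)[OF r(1) True] k by simp
    next
      case False
      then have "i + 1 \<le> k" by simp
      from admD(2)[OF r(1) this] show False using k gap by simp
    qed
  qed
  have anti: "f (i + int k) \<le> f i + int k" for i k
  proof (induction k)
    case (Suc k) then show ?case using step[of "i + int k"] by (simp add: algebra_simps)
  qed simp
  have one: "f (i + 1) = f i + 1" for i
  proof -
    have "f ((i + 1) + int (nat (N - 1))) \<le> f (i + 1) + int (nat (N - 1))" by (rule anti)
    moreover have "(i + 1) + int (nat (N - 1)) = i + N" using N by simp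
    ultimately have "f i + 1 \<le> f (i + 1)" using admD(3)[OF r(1), of i] N by simp
    with step[of i] show ?thesis by simp
  qed
  have "f i = i + f 0" for i
    using periodic_shift[of f 1 1 0 i] one by simp
  then show ?thesis by (rule that)
qed

section \<open>Isomorphisms of algebras\<close>

lemma k_algebraI:
  assumes "ring A"
    and "\<And>c x. x \<in> carrier A \<Longrightarrow> c \<odot>\<^bsub>A\<^esub> x \<in> carrier A"
    and "\<And>c d x. x \<in> carrier A \<Longrightarrow> (c + d) \<odot>\<^bsub>A\<^esub> x = c \<odot>\<^bsub>A\<^esub> x \<oplus>\<^bsub>A\<^esub> d \<odot>\<^bsub>A\<^esub> x"
    and "\<And>c x y. x \<in> carrier A \<Longrightarrow> y \<in> carrier A \<Longrightarrow> c \<odot>\<^bsub>A\<^esub> (x \<oplus>\<^bsub>A\<^esub> y) = c \<odot>\<^bsub>A\<^esub> x \<oplus>\<^bsub>A\<^esub> c \<odot>\<^bsub>A\<^esub> y"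
    and "\<And>c d x. x \<in> carrier A \<Longrightarrow> (c * d) \<odot>\<^bsub>A\<^esub> x = c \<odot>\<^bsub>A\<^esub> (d \<odot>\<^bsub>A\<^esub> x)"
    and "\<And>x. x \<in> carrier A \<Longrightarrow> 1 \<odot>\<^bsub>A\<^esub> x = x"
    and "\<And>c x y. x \<in> carrier A \<Longrightarrow> y \<in> carrier A \<Longrightarrow> (c \<odot>\<^bsub>A\<^esub> x) \<otimes>\<^bsub>A\<^esub> y = c \<odot>\<^bsub>A\<^esub> (x \<otimes>\<^bsub>A\<^esub> y)"
    and "\<And>c x y. x \<in> carrier A \<Longrightarrow> y \<in> carrier A \<Longrightarrow> x \<otimes>\<^bsub>A\<^esub> (c \<odot>\<^bsub>A\<^esub> y) = c \<odot>\<^bsub>A\<^esub> (x \<otimes>\<^bsub>A\<^esub> y)"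
  shows "k_algebra (A :: ('k::field, 'a) module)"
  by (intro k_algebra.intro k_algebra_axioms.intro assms)

text \<open>
  Transport of structure: nothing about \<open>X\<close> but its operations is known beforehand,
  and the algebra axioms for \<open>X\<close> are part of the conclusion. In this way quotient
  algebras, endomorphism algebras and blocks are recognised as algebras and identified at the same
  time.
\<close>

lemma alg_transport:
  fixes B :: "('k::field, 'b) module" and X :: "('k, 'x) module"
  assumes B: "k_algebra B" and im: "T ` carrier B = carrier X" and inj: "inj_on T (carrier B)"
    and add: "\<And>x y. x \<in> carrier B \<Longrightarrow> y \<in> carrier B \<Longrightarrow> T (x \<oplus>\<^bsub>B\<^esub> y) = T x \<oplus>\<^bsub>X\<^esub> T y"
    and mult: "\<And>x y. x \<in> carrier B \<Longrightarrow> y \<in> carrier B \<Longrightarrow> T (x \<otimes>\<^bsub>B\<^esub> y) = T x \<otimes>\<^bsub>X\<^esub> T y"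
    and one: "T \<one>\<^bsub>B\<^esub> = \<one>\<^bsub>X\<^esub>" and zero: "T \<zero>\<^bsub>B\<^esub> = \<zero>\<^bsub>X\<^esub>"
    and smult: "\<And>c x. x \<in> carrier B \<Longrightarrow> T (c \<odot>\<^bsub>B\<^esub> x) = c \<odot>\<^bsub>X\<^esub> T x"
  shows "T \<in> alg_isos B X"
proof -
  interpret B: k_algebra B by (rule B)
  note rep = im[symmetric]
  have ab: "abelian_group X"
    apply (rule abelian_groupI)
         apply (auto simp: rep add[symmetric] zero[symmetric] B.add.m_ac)[5]
    apply (auto simp: rep)
    subgoal for x
      apply (rule bexI[of _ "\<ominus>\<^bsub>B\<^esub> x"])
       apply (auto simp: add[symmetric] zero[symmetric] B.l_neg)
      done
    done
  have mon: "Group.monoid X"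
    by (rule Group.monoidI) (auto simp: rep mult[symmetric] one[symmetric] B.m_assoc)
  have ring: "ring X"
    by (rule ringI[OF ab mon]) (auto simp: rep mult[symmetric] add[symmetric] B.l_distr B.r_distr)
  have X: "k_algebra X"
    by (rule k_algebraI[OF ring])
      (auto simp: rep mult[symmetric] add[symmetric] smult[symmetric] B.smult_closed B.smult_l_distr
        B.smult_r_distr B.smult_smult B.smult_one B.smult_mult_l B.smult_mult_r)
  have "T \<in> ring_iso B X"
    by (rule ring_iso_memI) (use im inj add mult one in \<open>auto simp: bij_betw_def\<close>)
  then show ?thesis using B X smult by (simp add: alg_isos_def)
qed

lemma alg_isosD:
  assumes "h \<in> alg_isos A B"
  shows "k_algebra A" "k_algebra B" "bij_betw h (carrier A) (carrier B)"
    "x \<in> carrier A \<Longrightarrow> h x \<in> carrier B"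
    "x \<in> carrier A \<Longrightarrow> y \<in> carrier A \<Longrightarrow> h (x \<otimes>\<^bsub>A\<^esub> y) = h x \<otimes>\<^bsub>B\<^esub> h y"
    "x \<in> carrier A \<Longrightarrow> y \<in> carrier A \<Longrightarrow> h (x \<oplus>\<^bsub>A\<^esub> y) = h x \<oplus>\<^bsub>B\<^esub> h y"
    "h \<one>\<^bsub>A\<^esub> = \<one>\<^bsub>B\<^esub>" "h \<zero>\<^bsub>A\<^esub> = \<zero>\<^bsub>B\<^esub>"
    "x \<in> carrier A \<Longrightarrow> h (c \<odot>\<^bsub>A\<^esub> x) = c \<odot>\<^bsub>B\<^esub> h x"
proof -
  from assms have h: "k_algebra A" "k_algebra B" "h \<in> ring_iso A B"
    "\<And>c x. x \<in> carrier A \<Longrightarrow> h (c \<odot>\<^bsub>A\<^esub> x) = c \<odot>\<^bsub>B\<^esub> h x" by (auto simp: alg_isos_def)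
  interpret A: k_algebra A by (rule h(1))
  interpret B: k_algebra B by (rule h(2))
  show "k_algebra A" "k_algebra B" by (rule h)+
  show "bij_betw h (carrier A) (carrier B)"
    "x \<in> carrier A \<Longrightarrow> h x \<in> carrier B"
    "x \<in> carrier A \<Longrightarrow> y \<in> carrier A \<Longrightarrow> h (x \<otimes>\<^bsub>A\<^esub> y) = h x \<otimes>\<^bsub>B\<^esub> h y"
    "x \<in> carrier A \<Longrightarrow> y \<in> carrier A \<Longrightarrow> h (x \<oplus>\<^bsub>A\<^esub> y) = h x \<oplus>\<^bsub>B\<^esub> h y"
    "h \<one>\<^bsub>A\<^esub> = \<one>\<^bsub>B\<^esub>"
    using ring_iso_memE[OF h(3)] by auto
  have "h \<in> ring_hom A B" using h(3) by (simp add: ring_iso_def)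
  then show "h \<zero>\<^bsub>A\<^esub> = \<zero>\<^bsub>B\<^esub>" using ring_hom_zero[OF _ A.ring_axioms B.ring_axioms] by blast
  show "x \<in> carrier A \<Longrightarrow> h (c \<odot>\<^bsub>A\<^esub> x) = c \<odot>\<^bsub>B\<^esub> h x" by (rule h)
qed

lemma alg_isos_sym:
  assumes "h \<in> alg_isos A B" shows "inv_into (carrier A) h \<in> alg_isos B A"
proof -
  note h = alg_isosD[OF assms]
  interpret A: k_algebra A by (rule h(1))
  interpret B: k_algebra B by (rule h(2))
  let ?g = "inv_into (carrier A) h"
  have inj: "inj_on h (carrier A)" and im: "h ` carrier A = carrier B"
    using h(3) by (auto simp: bij_betw_def)
  have g: "?g (h x) = x" if "x \<in> carrier A" for x using inj that by simp
  show ?thesis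
  proof (rule alg_transport[OF h(2)])
    show "?g ` carrier B = carrier A" using inv_into_image_cancel[OF inj, of "carrier A"] im by simp
    show "inj_on ?g (carrier B)" using im inj_on_inv_into[of "carrier B" h "carrier A"] by simp
    show "?g (x \<oplus>\<^bsub>B\<^esub> y) = ?g x \<oplus>\<^bsub>A\<^esub> ?g y" "?g (x \<otimes>\<^bsub>B\<^esub> y) = ?g x \<otimes>\<^bsub>A\<^esub> ?g y"
      if "x \<in> carrier B" "y \<in> carrier B" for x y
      using that unfolding im[symmetric] by (auto simp: g h(5,6)[symmetric])
    show "?g (c \<odot>\<^bsub>B\<^esub> x) = c \<odot>\<^bsub>A\<^esub> ?g x" if "x \<in> carrier B" for c x
      using that unfolding im[symmetric] by (auto simp: g h(9)[symmetric] A.smult_closed)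
    show "?g \<one>\<^bsub>B\<^esub> = \<one>\<^bsub>A\<^esub>" "?g \<zero>\<^bsub>B\<^esub> = \<zero>\<^bsub>A\<^esub>"
      by (simp_all add: g h(7,8)[symmetric])
  qed
qed

lemma alg_isos_trans:
  assumes "h \<in> alg_isos A B" "g \<in> alg_isos B C" shows "(\<lambda>x. g (h x)) \<in> alg_isos A C"
proof (rule alg_transport)
  note h = alg_isosD[OF assms(1)] and g = alg_isosD[OF assms(2)]
  interpret A: k_algebra A by (rule h(1))
  show "k_algebra A" by (rule h)
  have im: "h ` carrier A = carrier B" "g ` carrier B = carrier C"
    using h(3) g(3) by (auto simp: bij_betw_def)
  then show "(\<lambda>x. g (h x)) ` carrier A = carrier C" by (metis image_image)
  show "inj_on (\<lambda>x. g (h x)) (carrier A)"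
    using comp_inj_on[of h "carrier A" g] h(3) g(3) im by (auto simp: bij_betw_def comp_def)
  fix x y c assume x: "x \<in> carrier A"
  show "g (h (c \<odot>\<^bsub>A\<^esub> x)) = c \<odot>\<^bsub>C\<^esub> g (h x)" by (simp only: h(4,9)[OF x] g(9))
  assume y: "y \<in> carrier A"
  show "g (h (x \<oplus>\<^bsub>A\<^esub> y)) = g (h x) \<oplus>\<^bsub>C\<^esub> g (h y)" 
    by (simp only: h(6)[OF x y] g(6)[OF h(4)[OF x] h(4)[OF y]])
  show "g (h (x \<otimes>\<^bsub>A\<^esub> y)) = g (h x) \<otimes>\<^bsub>C\<^esub> g (h y)" 
    by (simp only: h(5)[OF x y] g(5)[OF h(4)[OF x] h(4)[OF y]])
next
  show "g (h \<one>\<^bsub>A\<^esub>) = \<one>\<^bsub>C\<^esub>" "g (h \<zero>\<^bsub>A\<^esub>) = \<zero>\<^bsub>C\<^esub>"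
    by (simp_all only: alg_isosD(7,8)[OF assms(1)] alg_isosD(7,8)[OF assms(2)])
qed

lemma alg_isos_id: "k_algebra A \<Longrightarrow> (\<lambda>x. x) \<in> alg_isos A A"
  by (rule alg_transport[where T = "\<lambda>x. x"]) (simp_all add: image_def inj_on_def)

text \<open>
  The isomorphism theorem, in the direction from the image to the quotient: an element of the image
  goes to its fibre, which is a coset of the kernel.
\<close>

lemma quotient_by_kernel:
  fixes K :: "('k::field, 'a) module" and T :: "('k, 'b) module"
  assumes K: "k_algebra K" and T: "k_algebra T" and im: "h ` carrier K = carrier T"
    and add: "\<And>x y. x \<in> carrier K \<Longrightarrow> y \<in> carrier K \<Longrightarrow> h (x \<oplus>\<^bsub>K\<^esub> y) = h x \<oplus>\<^bsub>T\<^esub> h y"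
    and mult: "\<And>x y. x \<in> carrier K \<Longrightarrow> y \<in> carrier K \<Longrightarrow> h (x \<otimes>\<^bsub>K\<^esub> y) = h x \<otimes>\<^bsub>T\<^esub> h y"
    and one: "h \<one>\<^bsub>K\<^esub> = \<one>\<^bsub>T\<^esub>"
    and smult: "\<And>c x. x \<in> carrier K \<Longrightarrow> h (c \<odot>\<^bsub>K\<^esub> x) = c \<odot>\<^bsub>T\<^esub> h x"
  defines "I \<equiv> {x \<in> carrier K. h x = \<zero>\<^bsub>T\<^esub>}"
  shows "ideal I K" "(\<lambda>t. {x \<in> carrier K. h x = t}) \<in> alg_isos T (quotient_algebra K I)"
    "\<And>x. x \<in> carrier K \<Longrightarrow> I +>\<^bsub>K\<^esub> x = {y \<in> carrier K. h y = h x}"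
proof -
  interpret K: k_algebra K by (rule K)
  interpret T: k_algebra T by (rule T)
  have hom: "h \<in> ring_hom K T" 
    by (rule ring_hom_memI) (simp_all only: im[symmetric] add mult one imageI)
  note H = ring_hom_ringI2[OF K.ring_axioms T.ring_axioms hom]
  have h0: "h \<zero>\<^bsub>K\<^esub> = \<zero>\<^bsub>T\<^esub>" by (rule ring_hom_zero[OF hom K.ring_axioms T.ring_axioms])
  have hc: "h x \<in> carrier T" if "x \<in> carrier K" for x using that im by blast
  have I: "I = a_kernel K T h" by (simp add: I_def a_kernel_def')
  show ideal: "ideal I K" unfolding I by (rule ring_hom_ring.kernel_is_ideal[OF H])
  note rsum = abelian_subgroup.a_rcos_sum[OF abelian_subgroupI3[OF ideal.axioms(1)[OF ideal] K.abelian_group_axioms]]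
  show coset: "I +>\<^bsub>K\<^esub> x = {y \<in> carrier K. h y = h x}" if "x \<in> carrier K" for x
  proof
    show "I +>\<^bsub>K\<^esub> x \<subseteq> {y \<in> carrier K. h y = h x}"
    proof
      fix y assume "y \<in> I +>\<^bsub>K\<^esub> x"
      then obtain i where i: "i \<in> carrier K" "h i = \<zero>\<^bsub>T\<^esub>" "y = i \<oplus>\<^bsub>K\<^esub> x"
        unfolding a_r_coset_def' I_def by blast
      show "y \<in> {y \<in> carrier K. h y = h x}"
        unfolding i(3) using i(1) that hc[OF that] add[OF i(1) that] i(2) by simp
    qed
    show "{y \<in> carrier K. h y = h x} \<subseteq> I +>\<^bsub>K\<^esub> x"
    proof
      fix y assume y: "y \<in> {y \<in> carrier K. h y = h x}"
      then have "y = (y \<ominus>\<^bsub>K\<^esub> x) \<oplus>\<^bsub>K\<^esub> x" using that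
        by (simp add: K.minus_eq K.add.m_assoc K.l_neg)
      moreover have "y \<ominus>\<^bsub>K\<^esub> x \<in> I"
      proof -
        have m: "y \<ominus>\<^bsub>K\<^esub> x \<in> carrier K" using y that by simp
        have "h x = h (y \<ominus>\<^bsub>K\<^esub> x) \<oplus>\<^bsub>T\<^esub> h x" using calculation add[OF m that] y by simp
        then have "h (y \<ominus>\<^bsub>K\<^esub> x) = \<zero>\<^bsub>T\<^esub>" using T.add.r_cancel_one'[of "h x" "h (y \<ominus>\<^bsub>K\<^esub> x)"] hc that m by simp
        then show ?thesis using m by (simp add: I_def)
      qed
      ultimately show "y \<in> I +>\<^bsub>K\<^esub> x" unfolding a_r_coset_def' by blast
    qed
  qed
  let ?T = "\<lambda>t. {x \<in> carrier K. h x = t}"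
  have rep: "\<exists>x\<in>carrier K. h x = t" if "t \<in> carrier T" for t
    using that unfolding im[symmetric] by blast
  have TK: "?T (h x) = I +>\<^bsub>K\<^esub> x" if "x \<in> carrier K" for x by (rule coset[OF that, symmetric])
  have flds: "carrier (quotient_algebra K I) = a_rcosets\<^bsub>K\<^esub> I"
    "monoid.mult (quotient_algebra K I) = rcoset_mult K I" "one (quotient_algebra K I) = I +>\<^bsub>K\<^esub> \<one>\<^bsub>K\<^esub>"
    "zero (quotient_algebra K I) = I" "add (quotient_algebra K I) = set_add K"
    "module.smult (quotient_algebra K I) = (\<lambda>c X. (\<Union>x\<in>X. I +>\<^bsub>K\<^esub> (c \<odot>\<^bsub>K\<^esub> x)))"
    by (simp_all add: quotient_algebra_def FactRing_def ring.defs module.defs monoid.defs)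
  show "?T \<in> alg_isos T (quotient_algebra K I)"
  proof (rule alg_transport[OF T], unfold flds)
    show "?T ` carrier T = a_rcosets\<^bsub>K\<^esub> I"
    proof -
      have "?T ` carrier T = (\<lambda>x. I +>\<^bsub>K\<^esub> x) ` carrier K"
        unfolding im[symmetric] image_image by (rule image_cong) (simp_all add: TK)
      also have "\<dots> = a_rcosets\<^bsub>K\<^esub> I" by (auto simp: A_RCOSETS_def')
      finally show ?thesis .
    qed
    show "inj_on ?T (carrier T)"
    proof (rule inj_onI)
      fix s t assume "s \<in> carrier T" "t \<in> carrier T" and e: "?T s = ?T t"
      then obtain x where "x \<in> carrier K" "h x = s" using rep by blast
      then have "x \<in> ?T s" by simp
      then show "s = t" unfolding e using \<open>h x = s\<close> by simp
    qed
    fix s t assume "s \<in> carrier T" "t \<in> carrier T"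
    then obtain x y where xy: "x \<in> carrier K" "s = h x" "y \<in> carrier K" "t = h y"
      using rep by metis
    have "?T (s \<oplus>\<^bsub>T\<^esub> t) = I +>\<^bsub>K\<^esub> (x \<oplus>\<^bsub>K\<^esub> y)"
      unfolding xy(2,4) add[OF xy(1,3), symmetric] by (rule TK) (simp add: xy)
    also have "\<dots> = ?T s <+>\<^bsub>K\<^esub> ?T t"
      unfolding xy(2,4) TK[OF xy(1)] TK[OF xy(3)] using rsum[OF xy(1,3)] by simp
    finally show "?T (s \<oplus>\<^bsub>T\<^esub> t) = ?T s <+>\<^bsub>K\<^esub> ?T t" .
    have "?T (s \<otimes>\<^bsub>T\<^esub> t) = I +>\<^bsub>K\<^esub> (x \<otimes>\<^bsub>K\<^esub> y)"
      unfolding xy(2,4) mult[OF xy(1,3), symmetric] by (rule TK) (simp add: xy)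
    also have "\<dots> = [mod I:] ?T s \<Otimes>\<^bsub>K\<^esub> ?T t"
      unfolding xy(2,4) TK[OF xy(1)] TK[OF xy(3)] using ideal.rcoset_mult_add[OF ideal xy(1,3)] by simp
    finally show "?T (s \<otimes>\<^bsub>T\<^esub> t) = [mod I:] ?T s \<Otimes>\<^bsub>K\<^esub> ?T t" .
  next
    show "?T \<one>\<^bsub>T\<^esub> = I +>\<^bsub>K\<^esub> \<one>\<^bsub>K\<^esub>" unfolding one[symmetric] by (rule TK) simp
    show "?T \<zero>\<^bsub>T\<^esub> = I" by (simp only: I_def)
    fix c s assume "s \<in> carrier T"
    then obtain x where x: "x \<in> carrier K" "s = h x" using rep by metis
    have "I +>\<^bsub>K\<^esub> (c \<odot>\<^bsub>K\<^esub> y) = ?T (c \<odot>\<^bsub>T\<^esub> s)" if "y \<in> carrier K" "h y = h x" for y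
      unfolding coset[OF K.smult_closed[OF that(1)]] x(2) smult[OF that(1)] that(2) ..
    then have "(\<Union>x\<in>?T s. I +>\<^bsub>K\<^esub> (c \<odot>\<^bsub>K\<^esub> x)) = (\<Union>x\<in>?T s. ?T (c \<odot>\<^bsub>T\<^esub> s))"
      by (intro SUP_cong refl) (simp add: x(2))
    also have "\<dots> = ?T (c \<odot>\<^bsub>T\<^esub> s)"
    proof -
      have "x \<in> ?T s" using x by simp
      then show ?thesis by blast
    qed
    finally show "?T (c \<odot>\<^bsub>T\<^esub> s) = (\<Union>x\<in>?T s. I +>\<^bsub>K\<^esub> (c \<odot>\<^bsub>K\<^esub> x))" by (rule sym)
  qed
qed

section \<open>Path algebras\<close>

abbreviation ptgt :: "('v, 'e) pre_digraph \<Rightarrow> 'v \<Rightarrow> 'e list \<Rightarrow> 'v" where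
  "ptgt Q u p \<equiv> last (pre_digraph.awalk_verts Q u p)"

lemma ptgt_conv: "ptgt Q u p = (if p = [] then u else head Q (last p))"
  by (simp add: pre_digraph.awalk_verts_conv)

lemma ptgt_append: "ptgt Q (ptgt Q u p) q = ptgt Q u (p @ q)"
  by (simp add: ptgt_conv)

lemma ptgt_take_drop: "ptgt Q (ptgt Q u (take j p)) (take i (drop j p)) = ptgt Q u (take (j + i) p)"
  by (simp only: ptgt_append take_add)

text \<open>
  Both sides sum over the ways to cut a path of length \<open>n\<close> into three pieces; this is
  the associativity of the convolution product.
\<close>

lemma triangle_swap:
  fixes F :: "nat \<Rightarrow> nat \<Rightarrow> 'b::comm_monoid_add"
  shows "(\<Sum>k\<le>n. \<Sum>j\<le>k. F j (k - j)) = (\<Sum>j\<le>n. \<Sum>i\<le>n - j. F j i)"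
  unfolding sum.Sigma[OF finite_atMost ballI[OF finite_atMost]]
  by (rule sum.reindex_bij_witness[of _ "\<lambda>(j, i). (i + j, j)" "\<lambda>(k, j). (j, k - j)"]) auto

locale finite_quiver = wf_digraph Q for Q :: "('v, 'e) pre_digraph" +
  assumes fin_verts: "finite (verts Q)"
begin

lemma in_pathsD:
  assumes "(u, p) \<in> paths Q" shows "u \<in> verts Q" "ptgt Q u p \<in> verts Q" "awalk u p (ptgt Q u p)"
  using assms by (auto simp: paths_def) (auto simp: awalk_def)?

lemma paths_append:
  assumes "(u, p) \<in> paths Q" "(ptgt Q u p, q) \<in> paths Q" shows "(u, p @ q) \<in> paths Q"
  using assms in_pathsD(3)[OF assms(1)] in_pathsD(3)[OF assms(2)] awalk_appendI
  unfolding paths_def by blast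

lemma path_algebra_simps:
  "carrier (path_algebra Q) = {f. finite {w. f w \<noteq> 0} \<and> {w. f w \<noteq> 0} \<subseteq> paths Q}"
  "zero (path_algebra Q) = (\<lambda>w. 0)"
  "add (path_algebra Q) = (\<lambda>f g w. f w + g w)"
  "module.smult (path_algebra Q) = (\<lambda>c f w. c * f w)"
  "one (path_algebra Q) (u, p) = (if u \<in> verts Q \<and> p = [] then 1 else 0)"
  "monoid.mult (path_algebra Q) f g (u, p) = (\<Sum>k\<le>length p. f (u, take k p) * g (ptgt Q u (take k p), drop k p))"
  by (auto simp: path_algebra_def)

lemma path_algebra_closed:
  fixes f g :: "('v, 'e) path \<Rightarrow> 'k::field"
  shows "\<one>\<^bsub>path_algebra Q\<^esub> \<in> carrier (path_algebra Q :: ('k, _) module)"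
    "f \<in> carrier (path_algebra Q) \<Longrightarrow> g \<in> carrier (path_algebra Q) \<Longrightarrow> f \<otimes>\<^bsub>path_algebra Q\<^esub> g \<in> carrier (path_algebra Q)"
    "f \<in> carrier (path_algebra Q) \<Longrightarrow> g \<in> carrier (path_algebra Q) \<Longrightarrow> f \<oplus>\<^bsub>path_algebra Q\<^esub> g \<in> carrier (path_algebra Q)"
    "f \<in> carrier (path_algebra Q) \<Longrightarrow> c \<odot>\<^bsub>path_algebra Q\<^esub> f \<in> carrier (path_algebra Q)"
proof -
  have "{w. \<one>\<^bsub>(path_algebra Q :: ('k, _) module)\<^esub> w \<noteq> 0} = verts Q \<times> {[]}"
    by (auto simp: path_algebra_def split: if_splits)
  moreover have "verts Q \<times> {[]} \<subseteq> paths Q" by (auto simp: paths_def awalk_def)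
  ultimately show "\<one>\<^bsub>path_algebra Q\<^esub> \<in> carrier (path_algebra Q :: ('k, _) module)"
    using fin_verts by (simp add: path_algebra_simps)
  show "f \<oplus>\<^bsub>path_algebra Q\<^esub> g \<in> carrier (path_algebra Q)"
    if "f \<in> carrier (path_algebra Q)" "g \<in> carrier (path_algebra Q)"
  proof -
    have "{w. f w + g w \<noteq> 0} \<subseteq> {w. f w \<noteq> 0} \<union> {w. g w \<noteq> 0}" by auto
    then show ?thesis using that unfolding path_algebra_simps
      by (auto intro: finite_subset)
  qed
  show "c \<odot>\<^bsub>path_algebra Q\<^esub> f \<in> carrier (path_algebra Q)" if "f \<in> carrier (path_algebra Q)"
  proof -
    have "{w. c * f w \<noteq> 0} \<subseteq> {w. f w \<noteq> 0}" by auto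
    then show ?thesis using that unfolding path_algebra_simps
      by (auto intro: finite_subset)
  qed
  show "f \<otimes>\<^bsub>path_algebra Q\<^esub> g \<in> carrier (path_algebra Q)"
    if fg: "f \<in> carrier (path_algebra Q)" "g \<in> carrier (path_algebra Q)"
  proof -
    have *: "\<exists>k\<le>length p. f (u, take k p) \<noteq> 0 \<and> g (ptgt Q u (take k p), drop k p) \<noteq> 0"
      if "(f \<otimes>\<^bsub>path_algebra Q\<^esub> g) (u, p) \<noteq> 0" for u p
    proof (rule ccontr)
      assume "\<not> ?thesis"
      then have "\<forall>k\<in>{..length p}. f (u, take k p) * g (ptgt Q u (take k p), drop k p) = 0" by auto
      from sum.neutral[OF this] that show False by (simp add: path_algebra_simps)
    qed
    have "{w. (f \<otimes>\<^bsub>path_algebra Q\<^esub> g) w \<noteq> 0} \<subseteq>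
      (\<lambda>((u, p), (v, q)). (u, p @ q)) ` ({w. f w \<noteq> 0} \<times> {w. g w \<noteq> 0})"
    proof (intro subsetI, clarify)
      fix u p assume "(f \<otimes>\<^bsub>path_algebra Q\<^esub> g) (u, p) \<noteq> 0"
      from *[OF this] obtain k where "f (u, take k p) \<noteq> 0" "g (ptgt Q u (take k p), drop k p) \<noteq> 0"
        by blast
      then show "(u, p) \<in> (\<lambda>((u, p), (v, q)). (u, p @ q)) ` ({w. f w \<noteq> 0} \<times> {w. g w \<noteq> 0})"
        by (intro image_eqI[of _ _ "((u, take k p), (ptgt Q u (take k p), drop k p))"]) auto
    qed
    then have "finite {w. (f \<otimes>\<^bsub>path_algebra Q\<^esub> g) w \<noteq> 0}"
      by (rule finite_subset) (use fg in \<open>simp add: path_algebra_simps\<close>)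
    moreover have "{w. (f \<otimes>\<^bsub>path_algebra Q\<^esub> g) w \<noteq> 0} \<subseteq> paths Q"
    proof (intro subsetI, clarify)
      fix u p assume "(f \<otimes>\<^bsub>path_algebra Q\<^esub> g) (u, p) \<noteq> 0"
      from *[OF this] obtain k where "f (u, take k p) \<noteq> 0" "g (ptgt Q u (take k p), drop k p) \<noteq> 0"
        by blast
      then have "(u, take k p @ drop k p) \<in> paths Q"
        using fg by (intro paths_append) (auto simp: path_algebra_simps)
      then show "(u, p) \<in> paths Q" by simp
    qed
    ultimately show ?thesis by (simp add: path_algebra_simps(1))
  qed
qed

lemma path_algebra_assoc:
  fixes f g h :: "('v, 'e) path \<Rightarrow> 'k::field"
  shows "(f \<otimes>\<^bsub>path_algebra Q\<^esub> g) \<otimes>\<^bsub>path_algebra Q\<^esub> h = f \<otimes>\<^bsub>path_algebra Q\<^esub> (g \<otimes>\<^bsub>path_algebra Q\<^esub> h)"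
proof (rule ext, clarify)
  fix u p
  define F where "F j i = f (u, take j p) * g (ptgt Q u (take j p), take i (drop j p)) *
     h (ptgt Q u (take (j + i) p), drop (j + i) p)" for j i
  have "((f \<otimes>\<^bsub>path_algebra Q\<^esub> g) \<otimes>\<^bsub>path_algebra Q\<^esub> h) (u, p) = (\<Sum>k\<le>length p. \<Sum>j\<le>k. F j (k - j))"
    by (auto simp: path_algebra_simps F_def sum_distrib_right min_def drop_take intro!: sum.cong)
  also have "\<dots> = (\<Sum>j\<le>length p. \<Sum>i\<le>length p - j. F j i)" by (rule triangle_swap)
  also have "\<dots> = (f \<otimes>\<^bsub>path_algebra Q\<^esub> (g \<otimes>\<^bsub>path_algebra Q\<^esub> h)) (u, p)"
    by (auto simp: path_algebra_simps F_def sum_distrib_left ptgt_take_drop mult.assoc add.commute intro!: sum.cong)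
  finally show "((f \<otimes>\<^bsub>path_algebra Q\<^esub> g) \<otimes>\<^bsub>path_algebra Q\<^esub> h) (u, p) =
    (f \<otimes>\<^bsub>path_algebra Q\<^esub> (g \<otimes>\<^bsub>path_algebra Q\<^esub> h)) (u, p)" .
qed

lemma path_algebra_one:
  fixes f :: "('v, 'e) path \<Rightarrow> 'k::field"
  assumes f: "f \<in> carrier (path_algebra Q)"
  shows "\<one>\<^bsub>path_algebra Q\<^esub> \<otimes>\<^bsub>path_algebra Q\<^esub> f = f" "f \<otimes>\<^bsub>path_algebra Q\<^esub> \<one>\<^bsub>path_algebra Q\<^esub> = f"
proof -
  have nz: "u \<in> verts Q \<and> ptgt Q u p \<in> verts Q" if "f (u, p) \<noteq> 0" for u p
    using in_pathsD(1,2)[of u p] f that by (auto simp: path_algebra_simps)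
  show "\<one>\<^bsub>path_algebra Q\<^esub> \<otimes>\<^bsub>path_algebra Q\<^esub> f = f"
  proof (rule ext, clarify)
    fix u p
    have "(\<one>\<^bsub>path_algebra Q\<^esub> \<otimes>\<^bsub>path_algebra Q\<^esub> f) (u, p) =
      (\<Sum>k\<in>{..length p}. if k = 0 then (if u \<in> verts Q then f (u, p) else 0) else 0)"
      unfolding path_algebra_simps by (rule sum.cong) (auto simp: ptgt_conv)
    also have "\<dots> = f (u, p)" using nz by auto
    finally show "(\<one>\<^bsub>path_algebra Q\<^esub> \<otimes>\<^bsub>path_algebra Q\<^esub> f) (u, p) = f (u, p)" .
  qed
  show "f \<otimes>\<^bsub>path_algebra Q\<^esub> \<one>\<^bsub>path_algebra Q\<^esub> = f"
  proof (rule ext, clarify)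
    fix u p
    have "(f \<otimes>\<^bsub>path_algebra Q\<^esub> \<one>\<^bsub>path_algebra Q\<^esub>) (u, p) =
      (\<Sum>k\<in>{..length p}. if k = length p then (if ptgt Q u p \<in> verts Q then f (u, p) else 0) else 0)"
      unfolding path_algebra_simps by (rule sum.cong) auto
    also have "\<dots> = f (u, p)" using nz by auto
    finally show "(f \<otimes>\<^bsub>path_algebra Q\<^esub> \<one>\<^bsub>path_algebra Q\<^esub>) (u, p) = f (u, p)" .
  qed
qed

lemma path_algebra_k_algebra: "k_algebra (path_algebra Q :: ('k::field, _) module)"
proof (rule k_algebraI)
  let ?K = "path_algebra Q :: ('k::field, _) module"
  show "ring ?K"
  proof (rule ringI)
    show "abelian_group ?K"
    proof (rule abelian_groupI)
      fix x assume "x \<in> carrier ?K"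
      then show "\<exists>y\<in>carrier ?K. y \<oplus>\<^bsub>?K\<^esub> x = \<zero>\<^bsub>?K\<^esub>"
        using path_algebra_closed(4)[of x "-1"]
        by (intro bexI[of _ "(-1) \<odot>\<^bsub>?K\<^esub> x"]) (auto simp: path_algebra_simps)
    qed (use path_algebra_closed(3) in \<open>auto simp: path_algebra_simps add_ac\<close>)
    show "Group.monoid ?K"
      by (rule Group.monoidI) (simp_all add: path_algebra_closed path_algebra_assoc path_algebra_one)
  qed (auto simp: path_algebra_simps distrib_left distrib_right sum.distrib)
qed (use path_algebra_closed(4) in \<open>auto simp: path_algebra_simps algebra_simps sum_distrib_left\<close>)

end

section \<open>Algebras of periodic matrices\<close>

text \<open>
  Upper triangular matrices indexed by the integers, invariant under the diagonal shift by
  \<open>N\<close>, and truncated to the positions \<open>(i, j)\<close> with \<open>j < f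
  i\<close>. The entry at \<open>(i, j)\<close> is the coefficient of the path from
  \<open>i\<close> to \<open>j\<close> on the universal cover; periodicity makes it depend only on
  the path in the cycle.
\<close>

definition PM :: "int \<Rightarrow> (int \<Rightarrow> int) \<Rightarrow> ('k::field, int \<Rightarrow> int \<Rightarrow> 'k) module" where
  "PM N f = \<lparr>carrier = {g. (\<forall>i j. g (i + N) (j + N) = g i j) \<and> (\<forall>i j. g i j \<noteq> 0 \<longrightarrow> i \<le> j \<and> j < f i)},
     monoid.mult = (\<lambda>g h i j. if j < f i then (\<Sum>k\<in>{i..j}. g i k * h k j) else 0),
     one = (\<lambda>i j. if i = j then 1 else 0),
     zero = (\<lambda>i j. 0),
     add = (\<lambda>g h i j. g i j + h i j),
     module.smult = (\<lambda>c g i j. c * g i j)\<rparr>"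

lemma PM_simps:
  "carrier (PM N f) = {g. (\<forall>i j. g (i + N) (j + N) = g i j) \<and> (\<forall>i j. g i j \<noteq> 0 \<longrightarrow> i \<le> j \<and> j < f i)}"
  "monoid.mult (PM N f) = (\<lambda>g h i j. if j < f i then (\<Sum>k\<in>{i..j}. g i k * h k j) else 0)"
  "one (PM N f) = (\<lambda>i j. if i = j then 1 else 0)"
  "zero (PM N f) = (\<lambda>i j. 0)"
  "add (PM N f) = (\<lambda>g h i j. g i j + h i j)"
  "module.smult (PM N f) = (\<lambda>c g i j. c * g i j)"
  by (simp_all add: PM_def)

lemma PM_D:
  assumes "g \<in> carrier (PM N f)"
  shows "g (i + N) (j + N) = g i j" "g i j \<noteq> 0 \<Longrightarrow> i \<le> j" "g i j \<noteq> 0 \<Longrightarrow> j < f i"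
    "g (i + t * N) (j + t * N) = g i j"
proof -
  show *: "g (i + N) (j + N) = g i j" for i j using assms by (auto simp: PM_simps)
  show "g i j \<noteq> 0 \<Longrightarrow> i \<le> j" "g i j \<noteq> 0 \<Longrightarrow> j < f i" using assms by (auto simp: PM_simps)
  show "g (i + t * N) (j + t * N) = g i j"
  proof (induction t rule: int_induct[where k = 0])
    case base show ?case by simp
  next
    case (step1 t) with *[of "i + t * N" "j + t * N"] show ?case by (simp add: algebra_simps)
  next
    case (step2 t) with *[of "i + (t - 1) * N" "j + (t - 1) * N"] show ?case by (simp add: algebra_simps)
  qed
qed

lemma interval_swap:
  fixes F :: "int \<Rightarrow> int \<Rightarrow> 'b::comm_monoid_add"
  shows "(\<Sum>k\<in>{i..j}. \<Sum>m\<in>{i..k}. F m k) = (\<Sum>m\<in>{i..j}. \<Sum>k\<in>{m..j}. F m k)"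
  unfolding sum.Sigma[OF finite_atLeastAtMost_int ballI[OF finite_atLeastAtMost_int]]
  by (rule sum.reindex_bij_witness[of _ prod.swap prod.swap]) auto

text \<open>
  Truncation is compatible with the product because \<open>f\<close> is monotone: if \<open>j \<ge>
  f k\<close> for some \<open>k \<ge> i\<close> then \<open>j \<ge> f i\<close>, so the discarded
  positions form an ideal.
\<close>

lemma PM_k_algebra:
  assumes f: "adm N f" shows "k_algebra (PM N f :: ('k::field, _) module)"
proof (rule k_algebraI)
  let ?K = "PM N f :: ('k::field, _) module"
  have cl_mult: "x \<otimes>\<^bsub>?K\<^esub> y \<in> carrier ?K" if x: "x \<in> carrier ?K" and y: "y \<in> carrier ?K" for x y
  proof -
    have shift: "(x \<otimes>\<^bsub>?K\<^esub> y) (i + N) (j + N) = (x \<otimes>\<^bsub>?K\<^esub> y) i j" for i j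
    proof -
      have "(\<Sum>k\<in>{i + N..j + N}. x (i + N) k * y k (j + N)) = (\<Sum>k\<in>{i..j}. x (i + N) (k + N) * y (k + N) (j + N))"
        by (rule sum.reindex_bij_witness[of _ "\<lambda>k. k + N" "\<lambda>k. k - N"]) auto
      then show ?thesis
        by (simp only: PM_simps(2) admD(3)[OF f] PM_D(1)[OF x] PM_D(1)[OF y] add_less_cancel_right)
    qed
    have "i \<le> j \<and> j < f i" if "(x \<otimes>\<^bsub>?K\<^esub> y) i j \<noteq> 0" for i j
      using that by (cases "i \<le> j"; cases "j < f i") (simp_all add: PM_simps(2))
    with shift show ?thesis unfolding PM_simps(1) by blast
  qed
  have cl_add: "x \<oplus>\<^bsub>?K\<^esub> y \<in> carrier ?K" if x: "x \<in> carrier ?K" and y: "y \<in> carrier ?K" for x y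
  proof -
    have "x i j \<noteq> 0 \<or> y i j \<noteq> 0" if "x i j + y i j \<noteq> 0" for i j using that by auto
    then have "i \<le> j \<and> j < f i" if "x i j + y i j \<noteq> 0" for i j
      using that PM_D(2,3)[OF x] PM_D(2,3)[OF y] by blast
    then show ?thesis using PM_D(1)[OF x] PM_D(1)[OF y] by (auto simp: PM_simps)
  qed
  have mult_eq: "(x \<otimes>\<^bsub>?K\<^esub> y) i j = (if j < f i then \<Sum>k\<in>{i..j}. x i k * y k j else 0)" for x y i j
    by (simp only: PM_simps(2))
  have assoc: "(x \<otimes>\<^bsub>?K\<^esub> y) \<otimes>\<^bsub>?K\<^esub> z = x \<otimes>\<^bsub>?K\<^esub> (y \<otimes>\<^bsub>?K\<^esub> z)" for x y z
  proof (intro ext)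
    fix i j
    have "(\<Sum>k = i..j. (x \<otimes>\<^bsub>?K\<^esub> y) i k * z k j) = (\<Sum>m = i..j. x i m * (y \<otimes>\<^bsub>?K\<^esub> z) m j)" if "j < f i"
    proof -
      have "(\<Sum>k = i..j. (x \<otimes>\<^bsub>?K\<^esub> y) i k * z k j) = (\<Sum>k\<in>{i..j}. \<Sum>m\<in>{i..k}. x i m * y m k * z k j)"
        using that by (intro sum.cong) (auto simp: PM_simps sum_distrib_right)
      also have "\<dots> = (\<Sum>m\<in>{i..j}. \<Sum>k\<in>{m..j}. x i m * y m k * z k j)" by (rule interval_swap)
      also have "\<dots> = (\<Sum>m = i..j. x i m * (y \<otimes>\<^bsub>?K\<^esub> z) m j)"
      proof (intro sum.cong refl)
        fix m assume "m \<in> {i..j}"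
        then have "f i \<le> f m" by (intro admD(2)[OF f]) simp
        then have "j < f m" using that by simp
        then show "(\<Sum>k\<in>{m..j}. x i m * y m k * z k j) = x i m * (y \<otimes>\<^bsub>?K\<^esub> z) m j"
          by (simp add: PM_simps sum_distrib_left mult.assoc)
      qed
      finally show ?thesis .
    qed
    then show "((x \<otimes>\<^bsub>?K\<^esub> y) \<otimes>\<^bsub>?K\<^esub> z) i j = (x \<otimes>\<^bsub>?K\<^esub> (y \<otimes>\<^bsub>?K\<^esub> z)) i j"
      unfolding mult_eq[of "x \<otimes>\<^bsub>?K\<^esub> y" z] mult_eq[of x "y \<otimes>\<^bsub>?K\<^esub> z"] by (rule if_cong[OF refl _ refl])
  qed
  show "ring ?K"
  proof (rule ringI)
    show "abelian_group ?K"
    proof (rule abelian_groupI)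
      fix x assume x: "x \<in> carrier ?K"
      have "(\<lambda>i j. - x i j) \<in> carrier ?K" using x unfolding PM_simps(1) by simp
      moreover have "(\<lambda>i j. - x i j) \<oplus>\<^bsub>?K\<^esub> x = \<zero>\<^bsub>?K\<^esub>" unfolding PM_simps(4,5) by simp
      ultimately show "\<exists>y\<in>carrier ?K. y \<oplus>\<^bsub>?K\<^esub> x = \<zero>\<^bsub>?K\<^esub>" by blast
      show "\<zero>\<^bsub>?K\<^esub> \<oplus>\<^bsub>?K\<^esub> x = x" unfolding PM_simps(4,5) by simp
    next
      show "\<zero>\<^bsub>?K\<^esub> \<in> carrier ?K" unfolding PM_simps(1,4) by simp
    qed (use cl_add in blast, unfold PM_simps(5), simp_all add: add_ac)
    show "Group.monoid ?K"
    proof (rule Group.monoidI)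
      show "\<one>\<^bsub>?K\<^esub> \<in> carrier ?K" using admD(4)[OF f] by (auto simp: PM_simps)
      fix x assume x: "x \<in> carrier ?K"
      show "\<one>\<^bsub>?K\<^esub> \<otimes>\<^bsub>?K\<^esub> x = x"
      proof (intro ext)
        fix i j
        have "(\<Sum>k = i..j. (if i = k then 1 else 0) * x k j) = (\<Sum>k = i..j. if k = i then x i j else 0)"
          by (rule sum.cong) auto
        then show "(\<one>\<^bsub>?K\<^esub> \<otimes>\<^bsub>?K\<^esub> x) i j = x i j" using PM_D(2,3)[OF x, of i j] by (auto simp: PM_simps)
      qed
      show "x \<otimes>\<^bsub>?K\<^esub> \<one>\<^bsub>?K\<^esub> = x"
      proof (intro ext)
        fix i j
        have "(\<Sum>k = i..j. x i k * (if k = j then 1 else 0)) = (\<Sum>k = i..j. if k = j then x i j else 0)"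
          by (rule sum.cong) auto
        then show "(x \<otimes>\<^bsub>?K\<^esub> \<one>\<^bsub>?K\<^esub>) i j = x i j" using PM_D(2,3)[OF x, of i j] by (auto simp: PM_simps)
      qed
    qed (use cl_mult assoc in auto)
  qed (auto simp: PM_simps distrib_left distrib_right sum.distrib intro!: ext)
qed (auto simp: PM_simps algebra_simps sum_distrib_left intro!: ext)

section \<open>Truncated path algebras as periodic matrices\<close>

text \<open>
  The path of length \<open>l\<close> in the cycle with \<open>n\<close> vertices that lifts to the
  path from \<open>i\<close> to \<open>i + l\<close> on the universal cover.
\<close>

definition cpath :: "nat \<Rightarrow> int \<Rightarrow> nat \<Rightarrow> (nat, nat) path" where
  "cpath n i l = (nat (i mod int n), map (\<lambda>k. nat ((i + int k) mod int n)) [0..<l])"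

lemma cpath_simps [simp]:
  "fst (cpath n i l) = nat (i mod int n)" "length (snd (cpath n i l)) = l"
  "snd (cpath n i 0) = []"
  by (simp_all add: cpath_def)

lemma cpath_take: "k \<le> l \<Longrightarrow> take k (snd (cpath n i l)) = snd (cpath n i k)"
  by (simp add: cpath_def take_map)

lemma cpath_drop: "k \<le> l \<Longrightarrow> drop k (snd (cpath n i l)) = snd (cpath n (i + int k) (l - k))"
  by (rule nth_equalityI) (simp_all add: cpath_def drop_map add.assoc)

lemma cpath_mod_eq: "i mod int n = j mod int n \<Longrightarrow> cpath n i l = cpath n j l"
  unfolding cpath_def by (simp add: mod_add_cong[of i "int n" j "int k" "int k" for k])

lemma cpath_shift: "cpath n (i + t * int n) l = cpath n i l"
  by (rule cpath_mod_eq) simp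

lemma cpath_eqD:
  assumes "1 \<le> n" "cpath n i k = cpath n j l" shows "k = l" "i mod int n = j mod int n"
proof -
  show "k = l" using arg_cong[OF assms(2), of "\<lambda>w. length (snd w)"] by simp
  have "nat (i mod int n) = nat (j mod int n)" using arg_cong[OF assms(2), of fst] by simp
  moreover have "0 \<le> i mod int n" "0 \<le> j mod int n" using assms(1) by simp_all
  ultimately show "i mod int n = j mod int n" by simp
qed
text \<open>
  The common part of the cycle and of the linearly oriented quiver: both embed into the cycle on
  \<open>{0..<n}\<close>, and it is only required that the paths which \<open>f\<close> declares
  nonzero exist in \<open>Q\<close>.
\<close>

locale quiver_model = finite_quiver Q for Q :: "(nat, nat) pre_digraph" +
  fixes n :: nat and f :: "int \<Rightarrow> int"
  assumes n: "1 \<le> n" and verts_Q: "verts Q = {0..<n}"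
    and head_Q: "\<And>e. e \<in> arcs Q \<Longrightarrow> head Q e = Suc e mod n"
    and f: "adm (int n) f"
    and cpath_paths: "\<And>i j. i \<le> j \<Longrightarrow> j < f i \<Longrightarrow> cpath n i (nat (j - i)) \<in> paths Q"
begin

definition mat :: "((nat, nat) path \<Rightarrow> 'k::field) \<Rightarrow> int \<Rightarrow> int \<Rightarrow> 'k" where
  "mat g i j = (if i \<le> j \<and> j < f i then g (cpath n i (nat (j - i))) else 0)"

lemma ptgt_cpath:
  assumes "cpath n i l \<in> paths Q"
  shows "ptgt Q (nat (i mod int n)) (snd (cpath n i l)) = nat ((i + int l) mod int n)"
proof (cases l)
  case 0 then show ?thesis by (simp add: ptgt_conv)
next
  case (Suc m)
  have last: "last (snd (cpath n i l)) = nat ((i + int m) mod int n)" by (simp add: cpath_def Suc)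
  have ne: "snd (cpath n i l) \<noteq> []" by (simp add: cpath_def Suc)
  have "set (snd (cpath n i l)) \<subseteq> arcs Q" using assms by (auto simp: paths_def awalk_def cpath_def)
  then have "nat ((i + int m) mod int n) \<in> arcs Q" using last last_in_set[OF ne] by auto
  then have "head Q (nat ((i + int m) mod int n)) = Suc (nat ((i + int m) mod int n)) mod n"
    by (rule head_Q)
  also have "\<dots> = nat ((i + int l) mod int n)"
  proof -
    have "int (Suc (nat ((i + int m) mod int n)) mod n) = ((i + int m) mod int n + 1) mod int n"
      using n by (simp add: zmod_int add.commute)
    also have "\<dots> = (i + int l) mod int n" by (subst mod_add_left_eq) (simp add: Suc algebra_simps)
    finally show ?thesis using nat_int by metis
  qed
  finally show ?thesis using ne by (simp add: ptgt_conv last)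
qed

lemma mat_in: "mat g \<in> carrier (PM (int n) f)"
proof -
  have "mat g (i + int n) (j + int n) = mat g i j" for i j
    using cpath_shift[of n i 1 "nat (j - i)"] by (simp add: mat_def admD(3)[OF f])
  then show ?thesis unfolding PM_simps(1) by (auto simp: mat_def)
qed

lemma mat_mult: "mat (g \<otimes>\<^bsub>path_algebra Q\<^esub> h) = mat g \<otimes>\<^bsub>PM (int n) f\<^esub> mat h"
proof (intro ext)
  fix i j
  show "mat (g \<otimes>\<^bsub>path_algebra Q\<^esub> h) i j = (mat g \<otimes>\<^bsub>PM (int n) f\<^esub> mat h) i j"
  proof (cases "i \<le> j \<and> j < f i")
    case False
    then show ?thesis by (cases "j < f i") (simp_all add: mat_def PM_simps(2))
  next
    case True
    define l where "l = nat (j - i)"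
    have jl: "j = i + int l" using True by (simp add: l_def)
    define u where "u = nat (i mod int n)"
    define p where "p = snd (cpath n i l)"
    have up: "cpath n i l = (u, p)" by (simp add: u_def p_def prod_eq_iff)
    have "(g \<otimes>\<^bsub>path_algebra Q\<^esub> h) (u, p) =
        (\<Sum>k\<le>l. g (u, take k p) * h (ptgt Q u (take k p), drop k p))"
      unfolding path_algebra_simps(6) by (simp add: p_def)
    also have "\<dots> = (\<Sum>k\<le>l. mat g i (i + int k) * mat h (i + int k) j)"
    proof (rule sum.cong[OF refl])
      fix k assume "k \<in> {..l}"
      then have k: "k \<le> l" by simp
      have lt: "i + int k < f i" "i + int k \<le> j" using True k jl by auto
      have "f i \<le> f (i + int k)" by (rule admD(2)[OF f]) simp
      then have lt2: "j < f (i + int k)" using True by simp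
      have pk: "cpath n i k \<in> paths Q" using cpath_paths[of i "i + int k"] lt(1) by simp
      have 1: "(u, take k p) = cpath n i k" using k by (simp add: p_def u_def cpath_take prod_eq_iff)
      have "ptgt Q u (take k p) = nat ((i + int k) mod int n)"
        using ptgt_cpath[OF pk] k by (simp add: u_def p_def cpath_take)
      then have 2: "(ptgt Q u (take k p), drop k p) = cpath n (i + int k) (l - k)"
        using k by (simp add: p_def cpath_drop prod_eq_iff)
      have "nat (j - (i + int k)) = l - k" using jl k by simp
      then show "g (u, take k p) * h (ptgt Q u (take k p), drop k p) = mat g i (i + int k) * mat h (i + int k) j"
        unfolding 1 2 by (simp add: mat_def lt lt2)
    qed
    also have "\<dots> = (\<Sum>k\<in>{i..j}. mat g i k * mat h k j)"
      by (rule sum.reindex_bij_witness[of _ "\<lambda>k. nat (k - i)" "\<lambda>k. i + int k"]) (auto simp: jl)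
    finally have "(g \<otimes>\<^bsub>path_algebra Q\<^esub> h) (u, p) = (\<Sum>k\<in>{i..j}. mat g i k * mat h k j)" .
    moreover have "mat (g \<otimes>\<^bsub>path_algebra Q\<^esub> h) i j = (g \<otimes>\<^bsub>path_algebra Q\<^esub> h) (u, p)"
      unfolding mat_def l_def[symmetric] up using True by simp
    ultimately show ?thesis unfolding PM_simps(2) using True by simp
  qed
qed

text \<open>
  A matrix is determined by its finitely many entries in the rows \<open>0, \<dots>, n - 1\<close>,
  which serve as coefficients of paths.
\<close>

lemma mat_surj: "mat ` carrier (path_algebra Q) = carrier (PM (int n) f :: ('k::field, _) module)"
proof
  show "mat ` carrier (path_algebra Q) \<subseteq> carrier (PM (int n) f :: ('k::field, _) module)"
    by (rule image_subsetI) (rule mat_in)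
  show "carrier (PM (int n) f :: ('k::field, _) module) \<subseteq> mat ` carrier (path_algebra Q)"
  proof
    fix m :: "int \<Rightarrow> int \<Rightarrow> 'k" assume m: "m \<in> carrier (PM (int n) f)"
    define S where "S = {cpath n i l | i l. i + int l < f i}"
    define g where "g w = (if w \<in> S then m (int (fst w)) (int (fst w) + int (length (snd w))) else 0)" for w
    have "cpath n i l \<in> paths Q" if "i + int l < f i" for i l
      using cpath_paths[of i "i + int l"] that by simp
    then have "S \<subseteq> paths Q" unfolding S_def by blast
    have "S \<subseteq> (\<lambda>(i, l). cpath n i l) ` ({0..<int n} \<times> {..nat (f 0 + int n)})"
    proof
      fix w assume "w \<in> S"
      then obtain i l where w: "w = cpath n i l" "i + int l < f i" by (auto simp: S_def)
      have "f i - i \<le> f 0 + int n" by (rule adm_length_bound[OF f])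
      then have "l \<le> nat (f 0 + int n)" using w(2) by linarith
      moreover have "w = cpath n (i mod int n) l" unfolding w(1) by (rule cpath_mod_eq) simp
      ultimately show "w \<in> (\<lambda>(i, l). cpath n i l) ` ({0..<int n} \<times> {..nat (f 0 + int n)})"
        using n by (intro image_eqI[of _ _ "(i mod int n, l)"]) auto
    qed
    then have "finite S" by (rule finite_subset) simp
    have "{w. g w \<noteq> 0} \<subseteq> S" by (auto simp: g_def)
    then have "g \<in> carrier (path_algebra Q)"
      using finite_subset[OF _ \<open>finite S\<close>] subset_trans[OF _ \<open>S \<subseteq> paths Q\<close>]
      unfolding path_algebra_simps(1) by simp
    moreover have "mat g = m"
    proof (intro ext)
      fix i j
      show "mat g i j = m i j"
      proof (cases "i \<le> j \<and> j < f i")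
        case False
        then show ?thesis using PM_D(2,3)[OF m, of i j] by (auto simp: mat_def)
      next
        case True
        define l where "l = nat (j - i)"
        have jl: "j = i + int l" using True by (simp add: l_def)
        have inS: "cpath n i l \<in> S" using True jl by (auto simp: S_def)
        have ii: "i mod int n = i + (- (i div int n)) * int n"
          by (simp add: minus_mult_div_eq_mod[symmetric] mult.commute)
        have "m (i mod int n) (i mod int n + int l) = m i j"
          unfolding ii jl using PM_D(4)[OF m, of i "- (i div int n)" "i + int l"] by (simp add: algebra_simps)
        moreover have "0 \<le> i mod int n" using n by simp
        ultimately show ?thesis using True inS by (simp add: mat_def g_def l_def[symmetric])
      qed
    qed
    ultimately show "m \<in> mat ` carrier (path_algebra Q)" by blast
  qed
qed

definition vanishing :: "((nat, nat) path \<Rightarrow> 'k::field) set" where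
  "vanishing = {g \<in> carrier (path_algebra Q). \<forall>i l. i + int l < f i \<longrightarrow> g (cpath n i l) = 0}"

lemma vanishing_kernel:
  "(vanishing :: (_ \<Rightarrow> 'k::field) set) = {g \<in> carrier (path_algebra Q). mat g = \<zero>\<^bsub>PM (int n) f\<^esub>}"
proof -
  have "(\<forall>i l. i + int l < f i \<longrightarrow> g (cpath n i l) = 0) \<longleftrightarrow> mat g = (\<lambda>i j. 0)" for g :: "(nat, nat) path \<Rightarrow> 'k::field"
  proof
    assume *: "\<forall>i l. i + int l < f i \<longrightarrow> g (cpath n i l) = 0"
    show "mat g = (\<lambda>i j. 0)" using * by (intro ext) (simp add: mat_def)
  next
    assume *: "mat g = (\<lambda>i j. 0)"
    show "\<forall>i l. i + int l < f i \<longrightarrow> g (cpath n i l) = 0"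
    proof (intro allI impI)
      fix i l assume "i + int l < f i"
      then show "g (cpath n i l) = 0" using fun_cong[OF fun_cong[OF *, of i], of "i + int l"] by (simp add: mat_def)
    qed
  qed
  then show ?thesis by (simp add: vanishing_def PM_simps(4))
qed

lemma mat_one: "mat \<one>\<^bsub>path_algebra Q\<^esub> = \<one>\<^bsub>(PM (int n) f :: ('k::field, _) module)\<^esub>"
proof (intro ext)
  fix i j
  have v: "nat (i mod int n) \<in> verts Q" using n by (simp add: verts_Q nat_less_iff)
  have "i < f i" by (rule admD(4)[OF f])
  moreover have "\<one>\<^bsub>(path_algebra Q :: ('k, _) module)\<^esub> (cpath n i l) = (if l = 0 then 1 else 0)" for l
    using v unfolding cpath_def path_algebra_simps(5) by simp
  ultimately show "mat \<one>\<^bsub>path_algebra Q\<^esub> i j = \<one>\<^bsub>(PM (int n) f :: ('k::field, _) module)\<^esub> i j"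
    unfolding mat_def PM_simps(3) by (cases "i = j") simp_all
qed

lemma vanishing_quotient:
  shows "ideal (vanishing :: (_ \<Rightarrow> 'k::field) set) (path_algebra Q)"
    "(\<lambda>t. {x \<in> carrier (path_algebra Q). mat x = t}) \<in>
       alg_isos (PM (int n) f) (quotient_algebra (path_algebra Q :: ('k, _) module) vanishing)"
    "x \<in> carrier (path_algebra Q :: ('k, _) module) \<Longrightarrow>
       vanishing +>\<^bsub>path_algebra Q\<^esub> x = {y \<in> carrier (path_algebra Q). mat y = mat x}"
proof -
  have a: "mat (x \<oplus>\<^bsub>path_algebra Q\<^esub> y) = mat x \<oplus>\<^bsub>PM (int n) f\<^esub> mat y" for x y :: "_ \<Rightarrow> 'k"
    by (intro ext) (simp add: mat_def path_algebra_simps PM_simps)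
  have s: "mat (c \<odot>\<^bsub>path_algebra Q\<^esub> x) = c \<odot>\<^bsub>PM (int n) f\<^esub> mat x" for c and x :: "_ \<Rightarrow> 'k"
    by (intro ext) (simp add: mat_def path_algebra_simps PM_simps)
  note q = quotient_by_kernel[where h = mat and 'a = "(nat, nat) path \<Rightarrow> 'k", OF path_algebra_k_algebra PM_k_algebra[OF f] mat_surj]
  show "ideal (vanishing :: (_ \<Rightarrow> 'k::field) set) (path_algebra Q)"
    unfolding vanishing_kernel by (rule q(1)) (rule a mat_mult mat_one s)+
  show "(\<lambda>t. {x \<in> carrier (path_algebra Q). mat x = t}) \<in>
       alg_isos (PM (int n) f) (quotient_algebra (path_algebra Q :: ('k, _) module) vanishing)"
    unfolding vanishing_kernel by (rule q(2)) (rule a mat_mult mat_one s)+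
  show "vanishing +>\<^bsub>path_algebra Q\<^esub> x = {y \<in> carrier (path_algebra Q). mat y = mat x}"
    if "x \<in> carrier (path_algebra Q :: ('k, _) module)"
    unfolding vanishing_kernel by (rule q(3)[OF _ _ _ _ that]) (rule a mat_mult mat_one s)+
qed

end
lemma cyclic_finite_quiver:
  assumes "1 \<le> N" shows "finite_quiver (cyclic_quiver N)"
  by unfold_locales (use assms in \<open>auto simp: cyclic_quiver_def\<close>)

lemma cpath_cas:
  "1 \<le> N \<Longrightarrow> pre_digraph.cas (cyclic_quiver N) (nat (i mod int N)) (snd (cpath N i l)) (nat ((i + int l) mod int N))"
proof (induction l arbitrary: i)
  case 0 then show ?case by (simp add: pre_digraph.cas.simps)
next
  case (Suc l)
  have "Suc (nat (i mod int N)) mod N = nat ((i + 1) mod int N)"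
  proof -
    have "int (Suc (nat (i mod int N)) mod N) = (i mod int N + 1) mod int N"
      using Suc.prems by (simp add: zmod_int add.commute)
    also have "\<dots> = (i + 1) mod int N" by (simp add: mod_add_left_eq)
    finally show ?thesis using nat_int by metis
  qed
  moreover have "snd (cpath N i (Suc l)) = nat (i mod int N) # snd (cpath N (i + 1) l)"
    unfolding cpath_def snd_conv by (subst map_upt_Suc) (simp add: algebra_simps)
  ultimately show ?case using Suc.IH[of "i + 1"] Suc.prems
    by (simp add: pre_digraph.cas.simps cyclic_quiver_def algebra_simps)
qed

lemma cpath_in_cyclic:
  assumes "1 \<le> N" shows "cpath N i l \<in> paths (cyclic_quiver N)"
proof -
  have "set (snd (cpath N i l)) \<subseteq> arcs (cyclic_quiver N)"
    using assms by (auto simp: cpath_def cyclic_quiver_def nat_less_iff)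
  moreover have "nat (i mod int N) \<in> verts (cyclic_quiver N)"
    using assms by (simp add: cyclic_quiver_def nat_less_iff)
  ultimately have "pre_digraph.awalk (cyclic_quiver N) (nat (i mod int N)) (snd (cpath N i l)) (nat ((i + int l) mod int N))"
    using cpath_cas[OF assms] by (simp add: pre_digraph.awalk_def)
  then have "(nat (i mod int N), snd (cpath N i l)) \<in> paths (cyclic_quiver N)" by (auto simp: paths_def)
  then show ?thesis by (simp add: cpath_def)
qed

lemma cyclic_paths_cpath:
  assumes N: "1 \<le> N" and w: "w \<in> paths (cyclic_quiver N)"
  shows "w = cpath N (int (fst w)) (length (snd w))"
proof -
  have *: "p = snd (cpath N (int u) (length p))"
    if "u < N" "pre_digraph.cas (cyclic_quiver N) u p v" for u p v
    using that
  proof (induction p arbitrary: u)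
    case Nil then show ?case by simp
  next
    case (Cons e p)
    have e: "e = u" "pre_digraph.cas (cyclic_quiver N) (Suc u mod N) p v"
      using Cons.prems by (auto simp: pre_digraph.cas.simps cyclic_quiver_def)
    have "p = snd (cpath N (int (Suc u mod N)) (length p))"
      using Cons.IH[OF _ e(2)] N by simp
    also have "\<dots> = snd (cpath N (int u + 1) (length p))"
    proof -
      have "int (Suc u mod N) mod int N = (int u + 1) mod int N" by (simp add: zmod_int add.commute)
      then show ?thesis by (simp only: cpath_mod_eq[of "int (Suc u mod N)" N "int u + 1"])
    qed
    finally have p: "p = snd (cpath N (int u + 1) (length p))" .
    have "snd (cpath N (int u) (Suc (length p))) = nat (int u mod int N) # snd (cpath N (int u + 1) (length p))"
      unfolding cpath_def snd_conv by (subst map_upt_Suc) (simp add: algebra_simps)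
    also have "nat (int u mod int N) = u" using Cons.prems(1) by simp
    finally show ?case using p e(1) by simp
  qed
  obtain u p where up: "w = (u, p)" by (cases w)
  then obtain v where "pre_digraph.awalk (cyclic_quiver N) u p v" using w by (auto simp: paths_def)
  then have u: "u < N" "pre_digraph.cas (cyclic_quiver N) u p v"
    by (auto simp: pre_digraph.awalk_def cyclic_quiver_def)
  then show ?thesis using *[OF u] by (simp add: up prod_eq_iff)
qed

lemma cyclic_model:
  assumes "1 \<le> N" "adm (int N) f" shows "quiver_model (cyclic_quiver N) N f"
  by (rule quiver_model.intro[OF cyclic_finite_quiver[OF assms(1)]], rule quiver_model_axioms.intro)
    (use assms cpath_in_cyclic[OF assms(1)] in \<open>simp_all add: cyclic_quiver_def\<close>)

section \<open>Ideals generated by paths of a cycle\<close>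

text \<open>
  The path from \<open>i\<close> to \<open>j\<close> contains a relation. Here \<open>i \<le>
  j\<close> is implied, since the relation itself has a nonnegative length.
\<close>

definition covered :: "nat \<Rightarrow> ((nat, nat) path \<Rightarrow> 'k::field) set \<Rightarrow> int \<Rightarrow> int \<Rightarrow> bool" where
  "covered N R i j \<longleftrightarrow> (\<exists>s l. i \<le> s \<and> s + int l \<le> j \<and> path_elem (cpath N s l) \<in> R)"

lemma path_elem_inj: "path_elem w = (path_elem w' :: _ \<Rightarrow> 'k::field) \<longleftrightarrow> w = w'"
proof
  assume "path_elem w = (path_elem w' :: _ \<Rightarrow> 'k::field)"
  then have "path_elem w w = (path_elem w' w :: 'k)" by (rule fun_cong)
  then show "w = w'" by (simp add: path_elem_def split: if_splits)
qed simp

lemma covered_mono: "covered N R i j \<Longrightarrow> i' \<le> i \<Longrightarrow> j \<le> j' \<Longrightarrow> covered N R i' j'"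
  unfolding covered_def by (meson order_trans)

lemma covered_shift: "covered N R i j \<Longrightarrow> covered N R (i + t * int N) (j + t * int N)"
  unfolding covered_def
proof (elim exE conjE)
  fix s l assume *: "i \<le> s" "s + int l \<le> j" "path_elem (cpath N s l) \<in> R"
  show "\<exists>s l. i + t * int N \<le> s \<and> s + int l \<le> j + t * int N \<and> path_elem (cpath N s l) \<in> R"
    by (rule exI[of _ "s + t * int N"], rule exI[of _ l]) (use * in \<open>simp add: cpath_shift\<close>)
qed

text \<open>
  Paths of length at least \<open>d\<close>. Relations have \<open>d = 2\<close>; a syzygy filtered
  algebra that is no longer cyclic is presented on the cycle by zero paths of length
  \<open>1\<close> as well.
\<close>

definition path_elems :: "nat \<Rightarrow> nat \<Rightarrow> ((nat, nat) path \<Rightarrow> 'k::field) set" where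
  "path_elems N d = {path_elem w | w. w \<in> paths (cyclic_quiver N) \<and> d \<le> length (snd w)}"

locale cyclic_paths = finite_quiver "cyclic_quiver N" for N :: nat + assumes N: "1 \<le> N"
begin

abbreviation "KQ \<equiv> path_algebra (cyclic_quiver N)"

lemma in_path_algebra:
  "finite {w. f w \<noteq> 0} \<Longrightarrow> {w. f w \<noteq> 0} \<subseteq> paths (cyclic_quiver N) \<Longrightarrow> f \<in> carrier KQ"
  unfolding path_algebra_simps(1) by simp

lemma path_elem_in: "w \<in> paths (cyclic_quiver N) \<Longrightarrow> (path_elem w :: _ \<Rightarrow> 'k::field) \<in> carrier KQ"
  by (rule in_path_algebra) (simp_all add: path_elem_def)

lemma cyc_ptgt: "ptgt (cyclic_quiver N) (fst (cpath N i k)) (snd (cpath N i k)) = fst (cpath N (i + int k) l)"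
proof -
  have "adm (int N) (\<lambda>i. i + 1)" using N by (simp add: adm_def mono_def)
  then interpret quiver_model "cyclic_quiver N" N "\<lambda>i. i + 1" by (rule cyclic_model[OF N])
  show ?thesis using ptgt_cpath[OF cpath_in_cyclic[OF N], of i k] by simp
qed

lemma mult_cpath:
  "(g \<otimes>\<^bsub>KQ\<^esub> h) (cpath N i l) = (\<Sum>k\<le>l. g (cpath N i k) * h (cpath N (i + int k) (l - k)))"
proof -
  have "(g \<otimes>\<^bsub>KQ\<^esub> h) (fst (cpath N i l), snd (cpath N i l)) =
    (\<Sum>k\<le>l. g (cpath N i k) * h (cpath N (i + int k) (l - k)))"
    unfolding path_algebra_simps(6)
  proof (rule sum.cong)
    fix k assume "k \<in> {..l}"
    then have k: "k \<le> l" by simp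
    have 1: "(fst (cpath N i l), snd (cpath N i k)) = cpath N i k" by (simp add: prod_eq_iff)
    have "ptgt (cyclic_quiver N) (fst (cpath N i l)) (snd (cpath N i k)) = fst (cpath N (i + int k) (l - k))"
      using cyc_ptgt[of i k "l - k"] by simp
    then have 2: "(ptgt (cyclic_quiver N) (fst (cpath N i l)) (snd (cpath N i k)), snd (cpath N (i + int k) (l - k)))
      = cpath N (i + int k) (l - k)" by (simp add: prod_eq_iff)
    show "g (fst (cpath N i l), take k (snd (cpath N i l))) *
         h (ptgt (cyclic_quiver N) (fst (cpath N i l)) (take k (snd (cpath N i l))), drop k (snd (cpath N i l))) =
         g (cpath N i k) * h (cpath N (i + int k) (l - k))"
      unfolding cpath_take[OF k] cpath_drop[OF k] 1 2 ..
  qed simp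
  then show ?thesis unfolding prod.collapse .
qed

lemma path_elem_mult:
  "path_elem (cpath N i k) \<otimes>\<^bsub>KQ\<^esub> path_elem (cpath N (i + int k) m) = (path_elem (cpath N i (k + m)) :: _ \<Rightarrow> 'k::field)"
  (is "?a \<otimes>\<^bsub>KQ\<^esub> ?b = ?c")
proof
  interpret K: k_algebra "KQ :: ('k, _) module" by (rule path_algebra_k_algebra)
  fix w
  have ab: "?a \<in> carrier KQ" "?b \<in> carrier KQ" "?c \<in> carrier KQ"
    by (rule path_elem_in, rule cpath_in_cyclic[OF N])+
  show "(?a \<otimes>\<^bsub>KQ\<^esub> ?b) w = ?c w"
  proof (cases "w \<in> paths (cyclic_quiver N)")
    case False
    then have "\<not> (?a \<otimes>\<^bsub>KQ\<^esub> ?b) w \<noteq> 0" "\<not> ?c w \<noteq> 0"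
      using ab(3) K.m_closed[OF ab(1,2)] unfolding path_algebra_simps(1) by blast+
    then show ?thesis by simp
  next
    case True
    define j where "j = int (fst w)"
    define l where "l = length (snd w)"
    have w: "w = cpath N j l" unfolding j_def l_def by (rule cyclic_paths_cpath[OF N True])
    have c: "cpath N s p = cpath N t q \<longleftrightarrow> p = q \<and> s mod int N = t mod int N" for s t p q
      using cpath_eqD[OF N, of s p t q] cpath_mod_eq[of s N t q] by blast
    define B where "B \<longleftrightarrow> j mod int N = i mod int N"
    have e1: "?a (cpath N j q) = (if q = k \<and> B then 1 else 0)" for q
      unfolding path_elem_def c B_def by (rule refl)
    have e2: "?b (cpath N (j + int k) (l - k)) = (if l - k = m then 1 else 0)" if B
    proof -
      have "(j + int k) mod int N = (i + int k) mod int N"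
        using that unfolding B_def by (rule mod_add_cong) (rule refl)
      then show ?thesis unfolding path_elem_def c by simp
    qed
    have e3: "?c w = (if l = k + m \<and> B then 1 else 0)"
      unfolding w path_elem_def c B_def by (rule refl)
    have "(?a \<otimes>\<^bsub>KQ\<^esub> ?b) w = (\<Sum>q\<le>l. ?a (cpath N j q) * ?b (cpath N (j + int q) (l - q)))"
      unfolding w by (rule mult_cpath)
    also have "\<dots> = (\<Sum>q\<le>l. if q = k then (if B \<and> l - k = m then 1 else 0) else 0)"
    proof (rule sum.cong[OF refl])
      fix q
      show "?a (cpath N j q) * ?b (cpath N (j + int q) (l - q)) = (if q = k then (if B \<and> l - k = m then 1 else 0) else 0)"
      proof (cases "q = k \<and> B")
        case True
        then have B: B and q: "q = k" by simp_all
        show ?thesis unfolding q e1 e2[OF B] using B by simp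
      qed (auto simp: e1)
    qed
    also have "\<dots> = ?c w" unfolding e3 by auto
    finally show ?thesis .
  qed
qed

text \<open>
  The candidate for the ideal generated by \<open>R\<close>: combinations of paths that contain a
  relation.
\<close>

definition killed :: "((nat, nat) path \<Rightarrow> 'k::field) set \<Rightarrow> ((nat, nat) path \<Rightarrow> 'k) set" where
  "killed R = {g \<in> carrier KQ. \<forall>i l. g (cpath N i l) \<noteq> 0 \<longrightarrow> covered N R i (i + int l)}"

lemma killed_ideal: "ideal (killed R :: (_ \<Rightarrow> 'k::field) set) KQ"
proof -
  interpret K: k_algebra "KQ :: ('k, _) module" by (rule path_algebra_k_algebra)
  have nz: "\<exists>k\<le>l. g (cpath N i k) \<noteq> 0 \<and> h (cpath N (i + int k) (l - k)) \<noteq> 0"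
    if "(g \<otimes>\<^bsub>KQ\<^esub> h) (cpath N i l) \<noteq> 0" for g h :: "_ \<Rightarrow> 'k" and i l
  proof (rule ccontr)
    assume "\<not> ?thesis"
    then have "\<forall>k\<in>{..l}. g (cpath N i k) * h (cpath N (i + int k) (l - k)) = 0" by auto
    from sum.neutral[OF this] show False using that unfolding mult_cpath by simp
  qed
  show ?thesis
  proof (rule idealI)
    show "ring (KQ :: ('k, _) module)" by (rule K.ring_axioms)
    show "subgroup (killed R) (add_monoid (KQ :: ('k, _) module))"
    proof (rule K.add.subgroupI)
      show "killed R \<subseteq> carrier (KQ :: ('k, _) module)" by (auto simp: killed_def)
      have "\<zero>\<^bsub>KQ\<^esub> \<in> (killed R :: (_ \<Rightarrow> 'k) set)"
        unfolding killed_def using K.zero_closed by (simp add: path_algebra_simps(2))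
      then show "killed R \<noteq> ({} :: (_ \<Rightarrow> 'k) set)" by blast
    next
      fix a assume a: "a \<in> (killed R :: (_ \<Rightarrow> 'k) set)"
      then have ac: "a \<in> carrier KQ" by (simp add: killed_def)
      have "(\<ominus>\<^bsub>KQ\<^esub> a) \<oplus>\<^bsub>KQ\<^esub> a = \<zero>\<^bsub>KQ\<^esub>" by (rule K.l_neg[OF ac])
      then have "(\<ominus>\<^bsub>KQ\<^esub> a) w + a w = 0" for w unfolding path_algebra_simps(2,3) by (rule fun_cong)
      then have "(\<ominus>\<^bsub>KQ\<^esub> a) w \<noteq> 0 \<Longrightarrow> a w \<noteq> 0" for w by (metis add.right_neutral)
      then show "\<ominus>\<^bsub>KQ\<^esub> a \<in> (killed R :: (_ \<Rightarrow> 'k) set)"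
        using a K.a_inv_closed[OF ac] unfolding killed_def by blast
    next
      fix a b assume a: "a \<in> (killed R :: (_ \<Rightarrow> 'k) set)" and b: "b \<in> (killed R :: (_ \<Rightarrow> 'k) set)"
      have "a w + b w \<noteq> 0 \<Longrightarrow> a w \<noteq> 0 \<or> b w \<noteq> 0" for w by auto
      moreover have "a \<oplus>\<^bsub>KQ\<^esub> b \<in> carrier KQ" using a b by (simp add: killed_def)
      ultimately show "a \<oplus>\<^bsub>KQ\<^esub> b \<in> (killed R :: (_ \<Rightarrow> 'k) set)"
        using a b unfolding killed_def by (simp add: path_algebra_simps(3)) blast
    qed
    fix a x assume a: "a \<in> (killed R :: (_ \<Rightarrow> 'k) set)" and x: "x \<in> carrier (KQ :: ('k, _) module)"
    have ac: "a \<in> carrier KQ" and ak: "\<And>i l. a (cpath N i l) \<noteq> 0 \<Longrightarrow> covered N R i (i + int l)"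
      using a by (simp_all add: killed_def)
    have "covered N R i (i + int l)" if nz': "(x \<otimes>\<^bsub>KQ\<^esub> a) (cpath N i l) \<noteq> 0" for i l
    proof -
      from nz[OF nz'] obtain k where k: "k \<le> l" "a (cpath N (i + int k) (l - k)) \<noteq> 0" by blast
      from covered_mono[OF ak[OF k(2)], of i "i + int l"] k(1) show ?thesis by simp
    qed
    then show "x \<otimes>\<^bsub>KQ\<^esub> a \<in> (killed R :: (_ \<Rightarrow> 'k) set)"
      using K.m_closed[OF x ac] unfolding killed_def by blast
    have "covered N R i (i + int l)" if nz': "(a \<otimes>\<^bsub>KQ\<^esub> x) (cpath N i l) \<noteq> 0" for i l
    proof -
      from nz[OF nz'] obtain k where k: "k \<le> l" "a (cpath N i k) \<noteq> 0" by blast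
      from covered_mono[OF ak[OF k(2)], of i "i + int l"] k(1) show ?thesis by simp
    qed
    then show "a \<otimes>\<^bsub>KQ\<^esub> x \<in> (killed R :: (_ \<Rightarrow> 'k) set)"
      using K.m_closed[OF ac x] unfolding killed_def by blast
  qed
qed

text \<open>
  A path that contains a relation is a product of the relation with paths on both sides, hence is
  in the ideal; a combination of such paths is built up along its finite support.
\<close>

lemma genideal_killed:
  fixes R :: "((nat, nat) path \<Rightarrow> 'k::field) set"
  assumes R: "R \<subseteq> path_elems N 0"
  shows "genideal KQ R = killed R"
proof
  interpret K: k_algebra "KQ :: ('k, _) module" by (rule path_algebra_k_algebra)
  have rep: "\<exists>w. r = path_elem w \<and> w \<in> paths (cyclic_quiver N)" if "r \<in> R" for r
    using subsetD[OF R that] unfolding path_elems_def by blast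
  have RK: "R \<subseteq> carrier KQ"
  proof
    fix r assume "r \<in> R"
    from rep[OF this] obtain w where "r = path_elem w" "w \<in> paths (cyclic_quiver N)" by blast
    then show "r \<in> carrier KQ" using path_elem_in by simp
  qed
  have "R \<subseteq> killed R"
  proof
    fix r assume r: "r \<in> R"
    from rep[OF this] obtain w where w: "r = path_elem w" "w \<in> paths (cyclic_quiver N)" by blast
    have "covered N R i (i + int l)" if "r (cpath N i l) \<noteq> 0" for i l
    proof -
      have "cpath N i l = w" using that unfolding w path_elem_def by (simp split: if_splits)
      then have "path_elem (cpath N i l) \<in> R" using r w by simp
      then show ?thesis unfolding covered_def by blast
    qed
    then show "r \<in> killed R" using subsetD[OF RK r] unfolding killed_def by simp
  qed
  then show "genideal KQ R \<subseteq> killed R" by (rule K.genideal_minimal[OF killed_ideal])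
  interpret I: ideal "genideal KQ R" "KQ :: ('k, _) module" by (rule K.genideal_ideal[OF RK])
  have mem: "path_elem (cpath N i l) \<in> genideal KQ R" if cov: "covered N R i (i + int l)" for i l
  proof -
    from cov obtain s m where s: "i \<le> s" "s + int m \<le> i + int l" "path_elem (cpath N s m) \<in> R"
      unfolding covered_def by blast
    define k where "k = nat (s - i)"
    define q where "q = l - (k + m)"
    have sk: "s = i + int k" and l: "l = k + m + q" using s unfolding k_def q_def by auto
    have c: "(path_elem (cpath N a b) :: _ \<Rightarrow> 'k) \<in> carrier KQ" for a b
      by (rule path_elem_in, rule cpath_in_cyclic[OF N])
    have "path_elem (cpath N s m) \<in> genideal KQ R" using s(3) K.genideal_self[OF RK] by blast
    then have "path_elem (cpath N i k) \<otimes>\<^bsub>KQ\<^esub> path_elem (cpath N (i + int k) m) \<in> genideal KQ R"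
      unfolding sk by (rule I.I_l_closed[OF _ c])
    then have "path_elem (cpath N i (k + m)) \<in> genideal KQ R" unfolding path_elem_mult .
    then have "path_elem (cpath N i (k + m)) \<otimes>\<^bsub>KQ\<^esub> path_elem (cpath N (i + int (k + m)) q) \<in> genideal KQ R"
      by (rule I.I_r_closed[OF _ c])
    then show ?thesis unfolding path_elem_mult l .
  qed
  have sub: "g \<in> genideal KQ R"
    if "finite S" "S \<subseteq> {cpath N i l | i l. covered N R i (i + int l)}" "{w. g w \<noteq> 0} \<subseteq> S" for S and g :: "_ \<Rightarrow> 'k"
    using that
  proof (induction S arbitrary: g)
    case empty
    then have "g = \<zero>\<^bsub>KQ\<^esub>" unfolding path_algebra_simps(2) by auto
    then show ?case by (simp add: I.zero_closed)
  next
    case (insert w S)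
    define g' where "g' = (\<lambda>v. if v = w then 0 else g v)"
    have 1: "g' \<in> genideal KQ R" by (rule insert.IH) (use insert.prems in \<open>auto simp: g'_def\<close>)
    obtain i l where "w = cpath N i l" "covered N R i (i + int l)" using insert.prems(1) by blast
    then have pI: "(path_elem w :: _ \<Rightarrow> 'k) \<in> genideal KQ R" using mem by simp
    then have "(g w \<odot>\<^bsub>KQ\<^esub> \<one>\<^bsub>KQ\<^esub>) \<otimes>\<^bsub>KQ\<^esub> path_elem w \<in> genideal KQ R"
      by (rule I.I_l_closed) (rule K.smult_closed[OF K.one_closed])
    moreover have pc: "(path_elem w :: _ \<Rightarrow> 'k) \<in> carrier KQ" by (rule I.a_Hcarr[OF pI])
    have "(g w \<odot>\<^bsub>KQ\<^esub> \<one>\<^bsub>KQ\<^esub>) \<otimes>\<^bsub>KQ\<^esub> path_elem w = g w \<odot>\<^bsub>KQ\<^esub> path_elem w"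
      by (rule trans[OF K.smult_mult_l[OF K.one_closed pc]]) (simp only: K.l_one[OF pc])
    ultimately have "g w \<odot>\<^bsub>KQ\<^esub> path_elem w \<in> genideal KQ R" by simp
    with 1 have "g' \<oplus>\<^bsub>KQ\<^esub> (g w \<odot>\<^bsub>KQ\<^esub> path_elem w) \<in> genideal KQ R" by (rule I.a_closed)
    moreover have "g' \<oplus>\<^bsub>KQ\<^esub> (g w \<odot>\<^bsub>KQ\<^esub> path_elem w) = g"
      unfolding path_algebra_simps(3,4) by (rule ext) (simp add: g'_def path_elem_def)
    ultimately show ?case by simp
  qed
  show "killed R \<subseteq> genideal KQ R"
  proof
    fix g assume g: "g \<in> killed R"
    then have gc: "finite {w. g w \<noteq> 0}" "{w. g w \<noteq> 0} \<subseteq> paths (cyclic_quiver N)"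
      unfolding killed_def path_algebra_simps(1) by blast+
    show "g \<in> genideal KQ R"
    proof (rule sub[OF gc(1) _ subset_refl])
      show "{w. g w \<noteq> 0} \<subseteq> {cpath N i l | i l. covered N R i (i + int l)}"
      proof
        fix w assume w: "w \<in> {w. g w \<noteq> 0}"
        then have "w \<in> paths (cyclic_quiver N)" using gc(2) by blast
        then obtain j l where wjl: "w = cpath N j l" using cyclic_paths_cpath[OF N] by blast
        have "g (cpath N j l) \<noteq> 0" using w unfolding wjl by simp
        then have "covered N R j (j + int l)" using g unfolding killed_def by blast
        then show "w \<in> {cpath N i l | i l. covered N R i (i + int l)}" unfolding wjl by blast
      qed
    qed
  qed
qed

end

lemma cyclic_paths_intro: "1 \<le> N \<Longrightarrow> cyclic_paths N"
  by (rule cyclic_paths.intro[OF cyclic_finite_quiver]) (simp_all add: cyclic_paths_axioms_def)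

section \<open>Cyclic algebras as periodic matrices\<close>

text \<open>
  \<open>f i\<close> is the least endpoint of a path from \<open>i\<close> that vanishes modulo
  \<open>R\<close>.
\<close>

definition cutoff :: "nat \<Rightarrow> ((nat, nat) path \<Rightarrow> 'k::field) set \<Rightarrow> (int \<Rightarrow> int) \<Rightarrow> bool" where
  "cutoff N R f \<longleftrightarrow> adm (int N) f \<and> (\<forall>i j. covered N R i j \<longleftrightarrow> f i \<le> j)"

text \<open>
  Periodicity lets every path be prolonged until it contains a given relation, so a least endpoint
  exists. All relations have length at least \<open>Suc d\<close>, hence so has every vanishing
  path.
\<close>

lemma cutoff_exists:
  fixes R :: "((nat, nat) path \<Rightarrow> 'k::field) set"
  assumes N: "1 \<le> N" and R: "R \<subseteq> path_elems N (Suc d)" "R \<noteq> {}"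
  obtains f where "cutoff N R f" "\<And>i. i + int (Suc d) \<le> f i"
proof -
  have len: "Suc d \<le> l" if mem: "path_elem (cpath N s l) \<in> R" for s l
  proof -
    from subsetD[OF R(1) mem] obtain w where
      w: "path_elem (cpath N s l) = (path_elem w :: _ \<Rightarrow> 'k)" "Suc d \<le> length (snd w)"
      unfolding path_elems_def by blast
    from w(1) have "cpath N s l = w" unfolding path_elem_inj .
    then show ?thesis using w(2) by auto
  qed
  have low: "i + int (Suc d) \<le> j" if "covered N R i j" for i j
  proof -
    from that obtain s l where "i \<le> s" "s + int l \<le> j" "path_elem (cpath N s l) \<in> R"
      unfolding covered_def by blast
    then show ?thesis using len[of s l] by linarith
  qed
  obtain r where r: "r \<in> R" using R(2) by blast
  obtain w where w: "r = path_elem w" "w \<in> paths (cyclic_quiver N)"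
    using subsetD[OF R(1) r] unfolding path_elems_def by blast
  define s0 where "s0 = int (fst w)"
  define l0 where "l0 = length (snd w)"
  have "w = cpath N s0 l0" unfolding s0_def l0_def by (rule cyclic_paths_cpath[OF N w(2)])
  then have "path_elem (cpath N s0 l0) \<in> R" using r w(1) by simp
  then have cov0: "covered N R s0 (s0 + int l0)" unfolding covered_def by blast
  have "\<exists>m. covered N R i m \<and> (\<forall>j. covered N R i j \<longrightarrow> m \<le> j)" for i
  proof -
    define t where "t = \<bar>i - s0\<bar>"
    have "t * 1 \<le> t * int N" by (rule mult_left_mono) (use N in \<open>auto simp: t_def\<close>)
    moreover have "i \<le> s0 + t" by (simp add: t_def)
    ultimately have le: "i \<le> s0 + t * int N" by linarith
    have cov: "covered N R i (s0 + int l0 + t * int N)"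
      by (rule covered_mono[OF covered_shift[OF cov0, of t] le]) simp
    have "i \<le> s0 + int l0 + t * int N" using low[OF cov] by simp
    from least_int_ge[of "covered N R i", OF cov this] obtain m
      where m: "covered N R i m" "\<And>j. i \<le> j \<Longrightarrow> covered N R i j \<Longrightarrow> m \<le> j" by metis
    have "m \<le> j" if "covered N R i j" for j using m(2)[OF _ that] low[OF that] by simp
    with m(1) show ?thesis by blast
  qed
  then obtain f where f: "\<And>i. covered N R i (f i)" "\<And>i j. covered N R i j \<Longrightarrow> f i \<le> j" by metis
  have iff: "covered N R i j \<longleftrightarrow> f i \<le> j" for i j
    using f(2)[of i j] covered_mono[OF f(1)[of i], of i j] by auto
  have "adm (int N) f"
    unfolding adm_def
  proof (intro conjI allI)
    show "1 \<le> int N" using N by simp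
    show "mono f"
    proof (rule monoI)
      fix i j :: int assume "i \<le> j"
      then show "f i \<le> f j" by (rule f(2)[OF covered_mono[OF f(1)[of j] _ order_refl]])
    qed
    show "i < f i" for i using low[OF f(1)[of i]] by simp
    show "f (i + int N) = f i + int N" for i
    proof (rule antisym)
      show "f (i + int N) \<le> f i + int N" using f(2) covered_shift[OF f(1)[of i], of 1] by simp
      have "covered N R i (f (i + int N) - int N)" using covered_shift[OF f(1)[of "i + int N"], of "-1"] by simp
      then show "f i + int N \<le> f (i + int N)" using f(2) by fastforce
    qed
  qed
  then show ?thesis using iff low[OF f(1)] by (intro that[of f]) (auto simp: cutoff_def)
qed

text \<open>
  A value \<open>f i\<close> is attained because some relation ends at this point of the cycle; so
  residues of values inject into relations.
\<close>

lemma cutoff_card: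
  fixes R :: "((nat, nat) path \<Rightarrow> 'k::field) set"
  assumes N: "1 \<le> N" and R: "finite R" and f: "cutoff N R f"
  shows "card (range f \<inter> {0..<int N}) \<le> card R"
proof -
  define W where "W = {w. (path_elem w :: _ \<Rightarrow> 'k) \<in> R}"
  have inj: "inj_on (path_elem :: _ \<Rightarrow> _ \<Rightarrow> 'k) W" by (rule inj_onI) (simp add: path_elem_inj)
  have sub: "path_elem ` W \<subseteq> R" unfolding W_def by blast
  then have W: "finite W" "card W \<le> card R"
    using inj_on_finite[OF inj sub R] card_inj_on_le[OF inj sub R] by blast+
  have "range f \<inter> {0..<int N} \<subseteq> (\<lambda>w. (int (fst w) + int (length (snd w))) mod int N) ` W"
  proof
    fix t assume t: "t \<in> range f \<inter> {0..<int N}"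
    then obtain i where i: "t = f i" by blast
    \<comment> \<open>the path from i to t contains a relation but its initial part does not, so a
      relation ends at t\<close>
    have "covered N R i t" "\<not> covered N R i (t - 1)" using f by (simp_all add: cutoff_def i)
    then obtain s l where s: "i \<le> s" "s + int l \<le> t" "path_elem (cpath N s l) \<in> R" "\<not> s + int l \<le> t - 1"
      unfolding covered_def by blast
    then have e: "s + int l = t" by simp
    have "(int (fst (cpath N s l)) + int (length (snd (cpath N s l)))) mod int N = (s mod int N + int l) mod int N"
      using N by simp
    also have "\<dots> = t" using t e by (simp add: mod_add_left_eq)
    finally show "t \<in> (\<lambda>w. (int (fst w) + int (length (snd w))) mod int N) ` W"
      using s(3) unfolding W_def by (intro image_eqI[of _ _ "cpath N s l"]) simp_all
  qed
  then have "card (range f \<inter> {0..<int N}) \<le> card W" by (rule surj_card_le[OF W(1)])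
  then show ?thesis using W(2) by simp
qed

definition vertex_unit :: "nat \<Rightarrow> int \<Rightarrow> int \<Rightarrow> int \<Rightarrow> 'k::field" where
  "vertex_unit N i = (\<lambda>a b. if a = b \<and> a mod int N = i mod int N then 1 else 0)"

text \<open>
  The ideal generated by \<open>R\<close> is the kernel of the map that sends an element of the
  path algebra to its truncated matrix. The vertex idempotents are tracked because the definition
  of the syzygy filtered algebra refers to them.
\<close>

lemma cyclic_algebra_iso:
  fixes R :: "((nat, nat) path \<Rightarrow> 'k::field) set"
  assumes N: "1 \<le> N" and R: "R \<subseteq> path_elems N 0" and rf: "cutoff N R f"
  obtains T where "T \<in> alg_isos (PM (int N) f) (cyclic_algebra N R)"
    "\<And>i. i < N \<Longrightarrow> vertex_idempotent N R (\<lambda>x. x) i = T (vertex_unit N (int i))"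
proof -
  have f: "adm (int N) f" using rf by (simp add: cutoff_def)
  interpret C: cyclic_paths N by (rule cyclic_paths_intro[OF N])
  interpret quiver_model "cyclic_quiver N" N f by (rule cyclic_model[OF N f])
  have "(vanishing :: (_ \<Rightarrow> 'k) set) = C.killed R"
  proof -
    have *: "i + int l < f i \<longleftrightarrow> \<not> covered N R i (i + int l)" for i l
      using rf unfolding cutoff_def by (simp add: not_le)
    have "(\<forall>i l. i + int l < f i \<longrightarrow> g (cpath N i l) = 0) \<longleftrightarrow>
        (\<forall>i l. g (cpath N i l) \<noteq> 0 \<longrightarrow> covered N R i (i + int l))" for g :: "_ \<Rightarrow> 'k"
      unfolding * by blast
    then show ?thesis unfolding vanishing_def C.killed_def by simp
  qed
  then have I: "genideal (path_algebra (cyclic_quiver N)) R = vanishing"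
    using C.genideal_killed[OF R] by simp
  define T where "T t = {x \<in> carrier (path_algebra (cyclic_quiver N) :: ('k, _) module). mat x = t}" for t
  have "T \<in> alg_isos (PM (int N) f) (cyclic_algebra N R)"
    unfolding cyclic_algebra_def I T_def by (rule vanishing_quotient(2))
  moreover have "vertex_idempotent N R (\<lambda>x. x) i = T (vertex_unit N (int i))" if i: "i < N" for i
  proof -
    have ip: "(i, []) = cpath N (int i) 0" using i by (simp add: cpath_def)
    have "mat (path_elem (i, []) :: _ \<Rightarrow> 'k) = vertex_unit N (int i)"
    proof (intro ext)
      fix a b
      have "(path_elem (i, []) :: _ \<Rightarrow> 'k) (cpath N a l) = (if l = 0 \<and> a mod int N = int i mod int N then 1 else 0)" for l
        unfolding path_elem_def ip using cpath_eqD[OF N, of a l "int i" 0] cpath_mod_eq[of a N "int i" 0] by auto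
      then show "mat (path_elem (i, [])) a b = (vertex_unit N (int i) a b :: 'k)"
        unfolding mat_def vertex_unit_def using admD(4)[OF f, of a] by auto
    qed
    moreover have "(path_elem (i, []) :: _ \<Rightarrow> 'k) \<in> carrier (path_algebra (cyclic_quiver N))"
      unfolding ip by (rule C.path_elem_in, rule cpath_in_cyclic[OF N])
    ultimately show ?thesis
      unfolding vertex_idempotent_def Let_def I T_def
      using vanishing_quotient(3)[of "path_elem (i, []) :: _ \<Rightarrow> 'k"] by simp
  qed
  ultimately show ?thesis by (rule that)
qed

text \<open>
  The minimal zero paths: the path from \<open>i\<close> to \<open>f i\<close> is minimal iff the
  path from \<open>i + 1\<close> to \<open>f i\<close> is still nonzero.
\<close>

definition min_zero_paths :: "nat \<Rightarrow> (int \<Rightarrow> int) \<Rightarrow> ((nat, nat) path \<Rightarrow> 'k::field) set" where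
  "min_zero_paths N f = {path_elem (cpath N i (nat (f i - i))) | i. f i < f (i + 1)}"

lemma min_zero_paths_cutoff:
  assumes N: "1 \<le> N" and f: "adm (int N) f"
  shows "cutoff N (min_zero_paths N f :: (_ \<Rightarrow> 'k::field) set) f"
proof -
  have "covered N (min_zero_paths N f :: (_ \<Rightarrow> 'k) set) i j \<longleftrightarrow> f i \<le> j" for i j
  proof
    assume "covered N (min_zero_paths N f :: (_ \<Rightarrow> 'k) set) i j"
    then obtain s l where s: "i \<le> s" "s + int l \<le> j" "(path_elem (cpath N s l) :: _ \<Rightarrow> 'k) \<in> min_zero_paths N f"
      unfolding covered_def by blast
    then obtain k where "(path_elem (cpath N s l) :: _ \<Rightarrow> 'k) = path_elem (cpath N k (nat (f k - k)))"
      unfolding min_zero_paths_def by blast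
    then have "cpath N s l = cpath N k (nat (f k - k))" unfolding path_elem_inj .
    from cpath_eqD[OF N this] have l: "l = nat (f k - k)" "s mod int N = k mod int N" .
    have "f (s mod int N) = f (k mod int N)" using l(2) by simp
    then have "f s - s = f k - k" using adm_mod[OF f, of s] adm_mod[OF f, of k] l(2)
      minus_mult_div_eq_mod[of s "int N"] minus_mult_div_eq_mod[of k "int N"] by linarith
    then have "s + int l = f s" using l(1) admD(4)[OF f, of k] by simp
    moreover have "f i \<le> f s" by (rule admD(2)[OF f s(1)])
    ultimately show "f i \<le> j" using s(2) by simp
  next
    assume "f i \<le> j"
    obtain s where s: "f s = f i" "s \<le> f i" "\<And>k. k \<le> f i \<Longrightarrow> f k = f i \<Longrightarrow> k \<le> s"
      by (rule greatest_int_le[of "\<lambda>k. f k = f i" i "f i", OF refl less_imp_le[OF admD(4)[OF f]]]) blast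
    have i_s: "i \<le> s" using s(3)[of i] admD(4)[OF f, of i] by simp
    have "f s < f (s + 1)"
    proof (rule ccontr)
      assume "\<not> ?thesis"
      then have "f (s + 1) = f s" using admD(2)[OF f, of s "s + 1"] by simp
      then have "s + 1 \<le> s" using s(1) admD(5)[OF f, of s] by (intro s(3)) simp_all
      then show False by simp
    qed
    then have "(path_elem (cpath N s (nat (f s - s))) :: _ \<Rightarrow> 'k) \<in> min_zero_paths N f"
      unfolding min_zero_paths_def by blast
    moreover have "s + int (nat (f s - s)) \<le> j" using admD(4)[OF f, of s] s(1) \<open>f i \<le> j\<close> by simp
    ultimately show "covered N (min_zero_paths N f :: (_ \<Rightarrow> 'k) set) i j"
      using i_s unfolding covered_def by blast
  qed
  then show ?thesis using f by (simp add: cutoff_def)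
qed

lemma min_zero_paths_sub:
  assumes N: "1 \<le> N" and d: "\<And>i. i + int d \<le> f i"
  shows "(min_zero_paths N f :: (_ \<Rightarrow> 'k::field) set) \<subseteq> path_elems N d"
proof
  fix r :: "_ \<Rightarrow> 'k" assume "r \<in> min_zero_paths N f"
  then obtain i where i: "r = path_elem (cpath N i (nat (f i - i)))" unfolding min_zero_paths_def by blast
  show "r \<in> path_elems N d"
    unfolding path_elems_def i using cpath_in_cyclic[OF N, of i "nat (f i - i)"] d[of i]
    by (intro CollectI exI[of _ "cpath N i (nat (f i - i))"]) simp
qed

text \<open>
  Irredundancy: a minimal zero path contains no other zero path, so it is not in the ideal
  generated by the remaining ones.
\<close>

lemma min_zero_paths_relations:
  assumes N: "1 \<le> N" and f: "adm (int N) f" and two: "\<And>i. i + 2 \<le> f i"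
  shows "cyclic_relations N (min_zero_paths N f :: (_ \<Rightarrow> 'k::field) set)"
  unfolding cyclic_relations_def
proof (intro conjI allI impI)
  let ?R = "min_zero_paths N f :: (_ \<Rightarrow> 'k) set"
  interpret C: cyclic_paths N by (rule cyclic_paths_intro[OF N])
  have rf: "cutoff N ?R f" by (rule min_zero_paths_cutoff[OF N f])
  have "?R \<subseteq> (\<lambda>i. path_elem (cpath N i (nat (f i - i)))) ` {0..<int N}"
  proof
    fix r assume "r \<in> ?R"
    then obtain i where r: "r = path_elem (cpath N i (nat (f i - i)))" unfolding min_zero_paths_def by blast
    have "f (i mod int N) - i mod int N = f i - i" using adm_mod[OF f, of i]
      minus_mult_div_eq_mod[of i "int N"] by linarith
    then have "r = path_elem (cpath N (i mod int N) (nat (f (i mod int N) - i mod int N)))"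
      unfolding r using cpath_mod_eq[of "i mod int N" N i] by simp
    then show "r \<in> (\<lambda>i. path_elem (cpath N i (nat (f i - i)))) ` {0..<int N}"
      using N by (intro image_eqI[of _ _ "i mod int N"]) simp_all
  qed
  then show "finite ?R" by (rule finite_subset) simp
  have "covered N ?R 0 (f 0)" using rf by (simp add: cutoff_def)
  then show "?R \<noteq> {}" unfolding covered_def by blast
  have "?R \<subseteq> path_elems N 2" by (rule min_zero_paths_sub[OF N]) (use two in simp)
  then show "?R \<subseteq> {path_elem w |w. w \<in> paths (cyclic_quiver N) \<and> 2 \<le> length (snd w)}"
    by (simp only: path_elems_def)
  have sub0: "?R \<subseteq> path_elems N 0" by (rule min_zero_paths_sub[OF N]) (use admD(4)[OF f] in \<open>simp add: less_imp_le\<close>)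
  fix R' assume R': "R' \<subset> ?R"
  then obtain r where r: "r \<in> ?R" "r \<notin> R'" by blast
  then obtain i where i: "r = path_elem (cpath N i (nat (f i - i)))" "f i < f (i + 1)"
    unfolding min_zero_paths_def by blast
  let ?l = "nat (f i - i)"
  have il: "i + int ?l = f i" using admD(4)[OF f, of i] by simp
  show "genideal C.KQ R' \<noteq> genideal C.KQ ?R"
  proof
    assume e: "genideal C.KQ R' = genideal C.KQ ?R"
    have sub': "R' \<subseteq> path_elems N 0" using R' sub0 by blast
    interpret K: k_algebra "C.KQ :: ('k, _) module" by (rule C.path_algebra_k_algebra)
    have "?R \<subseteq> carrier C.KQ"
    proof
      fix q assume "q \<in> ?R"
      from subsetD[OF sub0 this] show "q \<in> carrier C.KQ" using C.path_elem_in unfolding path_elems_def by auto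
    qed
    then have "r \<in> genideal C.KQ ?R" using K.genideal_self r(1) by blast
    then have "r \<in> C.killed R'" using e C.genideal_killed[OF sub'] by simp
    moreover have "r (cpath N i ?l) \<noteq> 0" unfolding i path_elem_def by simp
    ultimately have "covered N R' i (f i)" unfolding C.killed_def using il by fastforce
    then obtain s m where s: "i \<le> s" "s + int m \<le> f i" "path_elem (cpath N s m) \<in> R'"
      unfolding covered_def by blast
    then have "(path_elem (cpath N s m) :: _ \<Rightarrow> 'k) \<in> ?R" using R' by blast
    then have "covered N ?R s (s + int m)" unfolding covered_def by blast
    then have fs: "f s \<le> s + int m" using rf by (simp add: cutoff_def)
    have "s = i"
    proof (rule ccontr)
      assume "s \<noteq> i"
      then have "f (i + 1) \<le> f s" using s(1) by (intro admD(2)[OF f]) simp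
      then show False using fs s(2) i(2) by simp
    qed
    then have "m = ?l" using fs s(2) by simp
    then show False using s(3) r(2) i(1) \<open>s = i\<close> by simp
  qed
qed

section \<open>Matrix units and right ideals\<close>

text \<open>
  An algebra together with an isomorphism from an algebra of periodic matrices. The algebra lives
  on an arbitrary type, which covers quotients of path algebras and their blocks alike.
\<close>

locale nak = k_algebra A for A :: "('k::field, 'a) module" (structure) +
  fixes N :: int and f :: "int \<Rightarrow> int" and Phi :: "(int \<Rightarrow> int \<Rightarrow> 'k) \<Rightarrow> 'a"
  assumes adm: "adm N f" and Phi: "Phi \<in> alg_isos (PM N f) A"

lemma nakI: "adm N f \<Longrightarrow> Phi \<in> alg_isos (PM N f) A \<Longrightarrow> nak A N f Phi"
  using alg_isosD(2) by (auto simp: nak_def nak_axioms_def)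

context nak
begin

lemmas a = admD[OF adm]
lemmas P = alg_isosD[OF Phi]

text \<open>
  The matrix entries of an element of the algebra.
\<close>

definition co :: "'a \<Rightarrow> int \<Rightarrow> int \<Rightarrow> 'k" where "co = inv_into (carrier (PM N f)) Phi"

lemma co_in: "x \<in> carrier A \<Longrightarrow> co x \<in> carrier (PM N f)"
  using P(3) unfolding co_def bij_betw_def by (metis inv_into_into)

lemma Phi_co: "x \<in> carrier A \<Longrightarrow> Phi (co x) = x"
  using P(3) unfolding co_def bij_betw_def by (metis f_inv_into_f)

lemma co_Phi: "g \<in> carrier (PM N f) \<Longrightarrow> co (Phi g) = g"
  using P(3) unfolding co_def bij_betw_def by (simp add: inv_into_f_f)

lemma co_out: "x \<in> carrier A \<Longrightarrow> \<not> (i \<le> j \<and> j < f i) \<Longrightarrow> co x i j = 0"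
  using PM_D(2,3)[OF co_in, of x i j] by auto

lemma co_shift: "x \<in> carrier A \<Longrightarrow> co x (i + t * N) (j + t * N) = co x i j"
  by (rule PM_D(4)[OF co_in])

lemma co_eqI:
  assumes "x \<in> carrier A" "y \<in> carrier A" and "\<And>i j. i \<le> j \<Longrightarrow> j < f i \<Longrightarrow> co x i j = co y i j"
  shows "x = y"
proof -
  have "co x i j = co y i j" for i j
    using assms co_out by (cases "i \<le> j \<and> j < f i") auto
  then have "co x = co y" by (intro ext)
  then show ?thesis using Phi_co assms(1,2) by metis
qed

lemma co_add: "x \<in> carrier A \<Longrightarrow> y \<in> carrier A \<Longrightarrow> co (x \<oplus> y) i j = co x i j + co y i j"
proof -
  assume x: "x \<in> carrier A" and y: "y \<in> carrier A"
  interpret K: k_algebra "PM N f :: ('k, _) module" by (rule P(1))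
  have "x \<oplus> y = Phi (co x \<oplus>\<^bsub>PM N f\<^esub> co y)" using P(6)[OF co_in[OF x] co_in[OF y]] by (simp add: Phi_co x y)
  then show ?thesis using co_Phi[OF K.add.m_closed[OF co_in[OF x] co_in[OF y]]] by (simp add: PM_simps(5))
qed

lemma co_mult: "x \<in> carrier A \<Longrightarrow> y \<in> carrier A \<Longrightarrow>
  co (x \<otimes> y) i j = (if j < f i then \<Sum>k\<in>{i..j}. co x i k * co y k j else 0)"
proof -
  assume x: "x \<in> carrier A" and y: "y \<in> carrier A"
  interpret K: k_algebra "PM N f :: ('k, _) module" by (rule P(1))
  have "x \<otimes> y = Phi (co x \<otimes>\<^bsub>PM N f\<^esub> co y)" using P(5)[OF co_in[OF x] co_in[OF y]] by (simp add: Phi_co x y)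
  then have "co (x \<otimes> y) = co x \<otimes>\<^bsub>PM N f\<^esub> co y" using co_Phi[OF K.m_closed[OF co_in[OF x] co_in[OF y]]] by simp
  then show ?thesis by (simp only: PM_simps(2))
qed

lemma co_one: "co \<one> i j = (if i = j then 1 else 0)"
proof -
  interpret K: k_algebra "PM N f :: ('k, _) module" by (rule P(1))
  have "co \<one> = \<one>\<^bsub>PM N f\<^esub>" using P(7) co_Phi[OF K.one_closed] by simp
  then show ?thesis by (simp only: PM_simps(3))
qed

lemma co_zero: "co \<zero> i j = 0"
proof -
  interpret K: k_algebra "PM N f :: ('k, _) module" by (rule P(1))
  have "co \<zero> = \<zero>\<^bsub>PM N f\<^esub>" using P(8) co_Phi[OF K.zero_closed] by simp
  then show ?thesis by (simp only: PM_simps(4))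
qed

lemma co_smult: "x \<in> carrier A \<Longrightarrow> co (c \<odot> x) i j = c * co x i j"
proof -
  assume x: "x \<in> carrier A"
  interpret K: k_algebra "PM N f :: ('k, _) module" by (rule P(1))
  have "c \<odot> x = Phi (c \<odot>\<^bsub>PM N f\<^esub> co x)" using P(9)[OF co_in[OF x]] by (simp add: Phi_co x)
  then show ?thesis using co_Phi[OF K.smult_closed[OF co_in[OF x]]] by (simp add: PM_simps(6))
qed

lemma co_neg: "x \<in> carrier A \<Longrightarrow> co (\<ominus> x) i j = - co x i j"
  using co_add[of "\<ominus> x" x i j] by (simp add: l_neg co_zero eq_neg_iff_add_eq_0)

lemma co_minus: "x \<in> carrier A \<Longrightarrow> y \<in> carrier A \<Longrightarrow> co (x \<ominus> y) i j = co x i j - co y i j"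
  by (simp add: minus_eq co_add co_neg)
text \<open>
  The periodic matrix unit at \<open>(i, j)\<close>, i.e. the path from \<open>i\<close> to
  \<open>j\<close>; it is zero if \<open>j \<ge> f i\<close>.
\<close>

definition E :: "int \<Rightarrow> int \<Rightarrow> 'a" where
  "E i j = Phi (\<lambda>a b. if i \<le> j \<and> j < f i \<and> b - a = j - i \<and> N dvd a - i then 1 else 0)"

lemma dvd_shift: "N dvd i + N - k \<longleftrightarrow> N dvd i - k" for i k :: int
  using dvd_add_triv_right_iff[of N "i - k"] by (simp add: algebra_simps)

lemma f_dvd: "N dvd x - i \<Longrightarrow> f x = f i + (x - i)"
proof -
  assume "N dvd x - i"
  then obtain t where "x - i = N * t" by auto
  then have "x = i + t * N" by (simp add: mult.commute)
  then show ?thesis using a(6)[of i t] by simp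
qed

lemma E_PM: "(\<lambda>a b. if i \<le> j \<and> j < f i \<and> b - a = j - i \<and> N dvd a - i then 1 else 0 :: 'k) \<in> carrier (PM N f)"
  unfolding PM_simps(1)
proof (intro CollectI conjI allI impI)
  fix x y
  show "(if i \<le> j \<and> j < f i \<and> (y + N) - (x + N) = j - i \<and> N dvd x + N - i then 1 else 0 :: 'k) =
     (if i \<le> j \<and> j < f i \<and> y - x = j - i \<and> N dvd x - i then 1 else 0)" by (simp add: dvd_shift)
  assume nz: "(if i \<le> j \<and> j < f i \<and> y - x = j - i \<and> N dvd x - i then 1 else 0 :: 'k) \<noteq> 0"
  show "x \<le> y" using nz by (simp split: if_splits)
  show "y < f x" using nz f_dvd[of x i] by (simp split: if_splits)
qed

lemma E_closed [simp]: "E i j \<in> carrier A"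
  unfolding E_def by (rule P(4)[OF E_PM])

lemma co_E: "co (E i j) x y = (if i \<le> j \<and> j < f i \<and> y - x = j - i \<and> N dvd x - i then 1 else 0)"
  unfolding E_def co_Phi[OF E_PM] ..

lemma co_mult_E:
  assumes x: "x \<in> carrier A" and jk: "j \<le> k" "k < f j"
  shows "co (x \<otimes> E j k) i l = (if l < f i \<and> N dvd l - k then co x i (l - (k - j)) else 0)"
proof (cases "l < f i \<and> N dvd l - k")
  case False
  have "co (E j k) c l = 0" if "\<not> N dvd l - k" for c
  proof -
    have "\<not> N dvd c - j" if "l - c = k - j"
    proof -
      have "c - j = l - k" using that by linarith
      then show ?thesis using \<open>\<not> N dvd l - k\<close> by simp
    qed
    then show ?thesis unfolding co_E by simp
  qed
  then show ?thesis using False by (auto simp: co_mult x)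
next
  case True
  have e: "co (E j k) c l = (if c = l - (k - j) then 1 else 0)" for c
  proof (cases "c = l - (k - j)")
    case c: True
    have "c - j = l - k" using c by linarith
    then show ?thesis using True jk c by (simp add: co_E)
  next
    case False
    then have "l - c \<noteq> k - j" by linarith
    then show ?thesis using False by (simp add: co_E)
  qed
  have "(\<Sum>c\<in>{i..l}. co x i c * co (E j k) c l) = (\<Sum>c\<in>{i..l}. if c = l - (k - j) then co x i (l - (k - j)) else 0)"
    by (rule sum.cong) (auto simp: e)
  also have "\<dots> = co x i (l - (k - j))"
    using jk co_out[OF x, of i "l - (k - j)"] by auto
  finally show ?thesis using True by (simp add: co_mult x)
qed

lemma co_E_mult:
  assumes x: "x \<in> carrier A" and jk: "j \<le> k" "k < f j"
  shows "co (E j k \<otimes> x) i l = (if l < f i \<and> N dvd i - j then co x (i + (k - j)) l else 0)"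
proof (cases "l < f i \<and> N dvd i - j")
  case False then show ?thesis by (auto simp: co_mult x co_E)
next
  case True
  have e: "co (E j k) i c = (if c = i + (k - j) then 1 else 0)" for c
    using True jk by (auto simp: co_E)
  have "(\<Sum>c\<in>{i..l}. co (E j k) i c * co x c l) = (\<Sum>c\<in>{i..l}. if c = i + (k - j) then co x (i + (k - j)) l else 0)"
    by (rule sum.cong) (auto simp: e)
  also have "\<dots> = co x (i + (k - j)) l"
    using jk co_out[OF x, of "i + (k - j)" l] by auto
  finally show ?thesis using True by (simp add: co_mult x)
qed

abbreviation e :: "int \<Rightarrow> 'a" where "e i \<equiv> E i i"

lemma co_e: "co (e i) x y = (if x = y \<and> N dvd x - i then 1 else 0)"
  using a(4)[of i] by (auto simp: co_E)

lemma co_mult_e: "x \<in> carrier A \<Longrightarrow> co (x \<otimes> e k) i l = (if N dvd l - k then co x i l else 0)"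
  using co_mult_E[of x k k i l] a(4)[of k] co_out[of x i l] by auto

lemma co_e_mult: "x \<in> carrier A \<Longrightarrow> co (e k \<otimes> x) i l = (if N dvd i - k then co x i l else 0)"
  using co_E_mult[of x k k i l] a(4)[of k] co_out[of x i l] by auto

lemma E_shift: "E (i + t * N) (j + t * N) = E i j"
proof (rule co_eqI)
  fix x y :: int
  have "N dvd x - (i + t * N) \<longleftrightarrow> N dvd x - i"
    by (metis diff_diff_eq dvd_diff_commute dvd_diff_right_iff dvd_triv_right)
  moreover have "j + t * N < f (i + t * N) \<longleftrightarrow> j < f i" using a(6)[of i t] by simp
  ultimately show "co (E (i + t * N) (j + t * N)) x y = co (E i j) x y" by (simp add: co_E)
qed simp_all

lemma e_cong: "N dvd i - j \<Longrightarrow> e i = e j"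
proof -
  assume "N dvd i - j"
  then obtain t where "i - j = N * t" by auto
  then have "i = j + t * N" by (simp add: mult.commute)
  then show ?thesis using E_shift[of j t j] by simp
qed

lemma E_mult_E:
  assumes "i \<le> j" "j \<le> k" shows "E i j \<otimes> E j k = E i k"
proof (cases "j < f i \<and> k < f j")
  case True
  show ?thesis
  proof (rule co_eqI)
    fix x y assume xy: "x \<le> y" "y < f x"
    have "f x = f i + (x - i)" if "N dvd x - i" using f_dvd that by simp
    moreover have "y - (k - j) - x = j - i \<longleftrightarrow> y - x = k - i" by linarith
    moreover have "N dvd y - k \<longleftrightarrow> N dvd x - i" if "y - x = k - i"
    proof -
      have "y - k = x - i" using that by linarith
      then show ?thesis by simp
    qed
    ultimately show "co (E i j \<otimes> E j k) x y = co (E i k) x y"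
      using xy True assms by (auto simp: co_mult_E co_E)
  qed simp_all
next
  case False
  have ik: "\<not> k < f i" using False a(2)[OF assms(1)] assms by auto
  have "E i k = \<zero>"
    by (rule co_eqI) (use ik in \<open>simp_all add: co_E co_zero\<close>)
  moreover have "E i j \<otimes> E j k = \<zero>"
  proof (cases "j < f i")
    case False
    then have "E i j = \<zero>" by (intro co_eqI) (simp_all add: co_E co_zero)
    then show ?thesis by simp
  next
    case True
    then have "E j k = \<zero>" using False by (intro co_eqI) (simp_all add: co_E co_zero)
    then show ?thesis by simp
  qed
  ultimately show ?thesis by simp
qed

lemma E_zero_iff: "E i j = \<zero> \<longleftrightarrow> \<not> (i \<le> j \<and> j < f i)"
proof
  assume "E i j = \<zero>"
  then have "co (E i j) i j = 0" by (simp add: co_zero)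
  then show "\<not> (i \<le> j \<and> j < f i)" by (simp add: co_E split: if_splits)
next
  assume "\<not> (i \<le> j \<and> j < f i)"
  then show "E i j = \<zero>" by (intro co_eqI) (auto simp: co_E co_zero)
qed

lemma e_idem: "e i \<otimes> e i = e i" by (rule E_mult_E) simp_all

lemma e_E: "i \<le> j \<Longrightarrow> e i \<otimes> E i j = E i j" "i \<le> j \<Longrightarrow> E i j \<otimes> e j = E i j"
  by (rule E_mult_E; simp)+
text \<open>
  The right ideal \<open>e i A\<close>, which is the projective module at \<open>i\<close>. By
  periodicity its elements are determined by the entries in row \<open>i\<close>.
\<close>

definition row :: "int \<Rightarrow> 'a set" where "row i = {s \<in> carrier A. e i \<otimes> s = s}"

lemma row_closed: "s \<in> row i \<Longrightarrow> s \<in> carrier A" by (simp add: row_def)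

lemma row_mult: "s \<in> row i \<Longrightarrow> x \<in> carrier A \<Longrightarrow> s \<otimes> x \<in> row i"
  by (simp add: row_def m_assoc[symmetric])

lemma row_add: "s \<in> row i \<Longrightarrow> t \<in> row i \<Longrightarrow> s \<oplus> t \<in> row i"
  by (simp add: row_def r_distr)

lemma row_neg: "s \<in> row i \<Longrightarrow> \<ominus> s \<in> row i"
  by (simp add: row_def r_minus)

lemma row_minus: "s \<in> row i \<Longrightarrow> t \<in> row i \<Longrightarrow> s \<ominus> t \<in> row i"
  by (simp add: minus_eq row_add row_neg)

lemma row_zero: "\<zero> \<in> row i" by (simp add: row_def)

lemma row_smult: "s \<in> row i \<Longrightarrow> c \<odot> s \<in> row i"
  by (simp add: row_def smult_closed smult_mult_r)

lemma row_E: "i \<le> j \<Longrightarrow> E i j \<in> row i" by (simp add: row_def e_E)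

lemma row_e_mult: "x \<in> carrier A \<Longrightarrow> e i \<otimes> x \<in> row i"
  by (simp add: row_def m_assoc[symmetric] e_idem)

lemma row_co: "s \<in> row i \<Longrightarrow> \<not> N dvd x - i \<Longrightarrow> co s x y = 0"
  using co_e_mult[of s i x y] by (simp add: row_def)

lemma row_eqI:
  assumes "s \<in> row i" "t \<in> row i" and "\<And>j. i \<le> j \<Longrightarrow> j < f i \<Longrightarrow> co s i j = co t i j"
  shows "s = t"
proof (rule co_eqI[OF row_closed[OF assms(1)] row_closed[OF assms(2)]])
  fix x y assume xy: "x \<le> y" "y < f x"
  show "co s x y = co t x y"
  proof (cases "N dvd x - i")
    case False then show ?thesis using row_co assms by simp
  next
    case True
    then obtain q where "x - i = N * q" by auto
    then have x: "x = i + q * N" by (simp add: mult.commute)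
    have "y - q * N < f i" using xy(2) a(6)[of i q] unfolding x by simp
    then have "co s i (y - q * N) = co t i (y - q * N)" using xy(1) x by (intro assms(3)) simp_all
    then show ?thesis
      using co_shift[OF row_closed[OF assms(1)], of i q "y - q * N"]
        co_shift[OF row_closed[OF assms(2)], of i q "y - q * N"] x by simp
  qed
qed

text \<open>
  The element of \<open>row i\<close> with prescribed entries \<open>r\<close> in row
  \<open>i\<close>.
\<close>

definition rowv :: "int \<Rightarrow> (int \<Rightarrow> 'k) \<Rightarrow> 'a" where
  "rowv i r = Phi (\<lambda>a b. if a \<le> b \<and> b < f a \<and> N dvd a - i then r (b - (a - i)) else 0)"

lemma rowv_PM: "(\<lambda>a b. if a \<le> b \<and> b < f a \<and> N dvd a - i then r (b - (a - i)) else 0) \<in> carrier (PM N f)"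
  unfolding PM_simps(1)
proof (intro CollectI conjI allI impI)
  fix x y
  have "r (y + (i - x)) = r (y - (x - i))" by (rule arg_cong[where f = r]) simp
  then show "(if x + N \<le> y + N \<and> y + N < f (x + N) \<and> N dvd x + N - i then r ((y + N) - (x + N - i)) else 0) =
     (if x \<le> y \<and> y < f x \<and> N dvd x - i then r (y - (x - i)) else 0)" by (simp add: dvd_shift a(3))
  assume nz: "(if x \<le> y \<and> y < f x \<and> N dvd x - i then r (y - (x - i)) else 0) \<noteq> 0"
  show "x \<le> y" "y < f x" using nz by (simp_all split: if_splits)
qed

lemma rowv_closed: "rowv i r \<in> carrier A" unfolding rowv_def by (rule P(4)[OF rowv_PM])

lemma co_rowv: "co (rowv i r) i j = (if i \<le> j \<and> j < f i then r j else 0)"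
  unfolding rowv_def co_Phi[OF rowv_PM] by simp

lemma rowv_row: "rowv i r \<in> row i"
  unfolding row_def
proof (intro CollectI conjI rowv_closed)
  show "e i \<otimes> rowv i r = rowv i r"
  proof (rule co_eqI)
    fix x y
    have "co (rowv i r) x y = (if x \<le> y \<and> y < f x \<and> N dvd x - i then r (y - (x - i)) else 0)"
      unfolding rowv_def co_Phi[OF rowv_PM] by simp
    then show "co (e i \<otimes> rowv i r) x y = co (rowv i r) x y" by (simp add: co_e_mult rowv_closed)
  qed (simp_all add: rowv_closed)
qed

definition tail_row :: "int \<Rightarrow> int \<Rightarrow> 'a set" where
  "tail_row i b = {x \<in> row i. \<forall>j<b. co x i j = 0}"

text \<open>
  Uniseriality of \<open>row i\<close>. Let \<open>b\<close> be the first column in which an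
  element of \<open>H\<close> has a nonzero entry. Multiplying that element by matrix units gives
  elements of \<open>H\<close> with any later leading column, and these eliminate the entries of an
  arbitrary element of \<open>tail_row i b\<close>, starting from the last column.
\<close>

lemma right_ideal_char:
  assumes H: "H \<subseteq> row i" "\<zero> \<in> H" "\<And>x y. x \<in> H \<Longrightarrow> y \<in> H \<Longrightarrow> x \<oplus> y \<in> H"
    "\<And>x c. x \<in> H \<Longrightarrow> c \<in> carrier A \<Longrightarrow> x \<otimes> c \<in> H"
  obtains b where "i \<le> b" "b \<le> f i" "H = tail_row i b"
proof -
  let ?P = "\<lambda>j. (\<exists>g\<in>H. co g i j \<noteq> 0) \<or> j = f i"
  obtain b where b: "?P b" "i \<le> b" "\<And>j. i \<le> j \<Longrightarrow> ?P j \<Longrightarrow> b \<le> j"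
    by (rule least_int_ge[of ?P "f i" i]) (use a(4)[of i] in \<open>auto intro: less_imp_le\<close>)
  have bf: "b \<le> f i" using b(3)[of "f i"] a(4)[of i] by simp
  have Hc: "x \<in> carrier A" if "x \<in> H" for x using that H(1) row_closed by blast
  have below: "co x i j = 0" if "x \<in> H" "j < b" for x j
  proof (cases "i \<le> j")
    case True then show ?thesis using b(3)[OF True] that by (meson not_le)
  qed (use co_out[OF Hc[OF that(1)], of i j] in simp)
  have "tail_row i (f i - int n) \<subseteq> H" if "b \<le> f i - int n" for n
    using that
  proof (induction n)
    case 0
    show ?case
    proof
      fix x assume x: "x \<in> tail_row i (f i - int 0)"
      then have "x = \<zero>" by (intro row_eqI[of x i \<zero>]) (auto simp: tail_row_def row_zero co_zero)
      then show "x \<in> H" using H(2) by simp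
    qed
  next
    case (Suc n)
    define j0 where "j0 = f i - int (Suc n)"
    have bj: "b \<le> j0" "j0 < f i" using Suc.prems by (simp_all add: j0_def)
    then obtain g where g: "g \<in> H" "co g i b \<noteq> 0" using b(1) by auto
    show ?case
    proof
      fix x assume x: "x \<in> tail_row i (f i - int (Suc n))"
      then have xr: "x \<in> row i" and x0: "\<And>j. j < j0 \<Longrightarrow> co x i j = 0" by (auto simp: tail_row_def j0_def)
      define y where "y = g \<otimes> ((co x i j0 / co g i b) \<odot> E b j0)"
      have "f i \<le> f b" by (rule a(2)[OF b(2)])
      then have jb: "j0 < f b" using bj by simp
      have yH: "y \<in> H" unfolding y_def by (rule H(4)[OF g(1)]) (simp add: smult_closed)
      have "co y i j = (co x i j0 / co g i b) * co (g \<otimes> E b j0) i j" for j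
        unfolding y_def by (simp add: smult_mult_r Hc[OF g(1)] co_smult)
      then have coy: "co y i j = (if j < f i \<and> N dvd j - j0 then (co x i j0 / co g i b) * co g i (j - (j0 - b)) else 0)" for j
        by (simp add: co_mult_E[OF Hc[OF g(1)] bj(1) jb])
      have "co (x \<ominus> y) i j = 0" if "j < j0 + 1" for j
      proof (cases "j = j0")
        case True
        then show ?thesis using coy[of j0] bj g(2) by (simp add: co_minus row_closed[OF xr] Hc[OF yH])
      next
        case False
        then have "j < j0" using that by simp
        moreover from this have "co y i j = 0" using below[OF g(1), of "j - (j0 - b)"] coy[of j] by simp
        ultimately show ?thesis using x0 by (simp add: co_minus row_closed[OF xr] Hc[OF yH])
      qed
      moreover have "x \<ominus> y \<in> row i" using xr yH H(1) by (intro row_minus) auto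
      ultimately have "x \<ominus> y \<in> tail_row i (f i - int n)" by (auto simp: tail_row_def j0_def)
      then have "x \<ominus> y \<in> H" using Suc.IH Suc.prems by auto
      then have "(x \<ominus> y) \<oplus> y \<in> H" by (rule H(3)[OF _ yH])
      moreover have "(x \<ominus> y) \<oplus> y = x"
        using row_closed[OF xr] Hc[OF yH] by (simp add: minus_eq a_assoc l_neg)
      ultimately show "x \<in> H" by simp
    qed
  qed
  from this[of "nat (f i - b)"] have "tail_row i b \<subseteq> H" using bf by simp
  moreover have "H \<subseteq> tail_row i b" using H(1) below by (auto simp: tail_row_def)
  ultimately show ?thesis using b(2) bf that by blast
qed

lemma tail_row_factor:
  assumes x: "x \<in> tail_row i b" and b: "i \<le> b"
  obtains u where "u \<in> row b" "x = E i b \<otimes> u"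
proof (cases "b < f i")
  case False
  have "x = \<zero>" using x False by (intro row_eqI[of x i \<zero>]) (auto simp: tail_row_def row_zero co_zero)
  then show ?thesis using that[OF row_zero[of b]] by simp
next
  case True
  define u where "u = rowv b (co x i)"
  have u: "u \<in> row b" unfolding u_def by (rule rowv_row)
  have xr: "x \<in> row i" using x by (simp add: tail_row_def)
  have "x = E i b \<otimes> u"
  proof (rule row_eqI[OF xr row_mult[OF row_E[OF b] row_closed[OF u]]])
    fix j assume j: "i \<le> j" "j < f i"
    have "f i \<le> f b" by (rule a(2)[OF b])
    then have "co (E i b \<otimes> u) i j = co u b j" using j by (simp add: co_E_mult row_closed[OF u] b True)
    also have "\<dots> = (if b \<le> j then co x i j else 0)" using j \<open>f i \<le> f b\<close> by (simp add: u_def co_rowv)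
    also have "\<dots> = co x i j" using x by (simp add: tail_row_def)
    finally show "co x i j = co (E i b \<otimes> u) i j" by simp
  qed
  with u show ?thesis by (rule that)
qed
text \<open>
  Partial sums of the decomposition of the unit into vertex idempotents.
\<close>

definition esum :: "nat \<Rightarrow> 'a" where
  "esum n = Phi (\<lambda>a b. if a = b \<and> a mod N < int n then 1 else 0)"

lemma esum_PM: "(\<lambda>a b. if a = b \<and> a mod N < int n then 1 else 0 :: 'k) \<in> carrier (PM N f)"
  unfolding PM_simps(1) using a(4) by (auto split: if_splits)

lemma esum_closed: "esum n \<in> carrier A" unfolding esum_def by (rule P(4)[OF esum_PM])

lemma co_esum: "co (esum n) x y = (if x = y \<and> x mod N < int n then 1 else 0)"
  unfolding esum_def co_Phi[OF esum_PM] ..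

lemma esum_0: "esum 0 = \<zero>"
  by (rule co_eqI) (use a(1) in \<open>simp_all add: esum_closed co_esum co_zero not_less\<close>)

lemma esum_Suc: "int n < N \<Longrightarrow> esum (Suc n) = esum n \<oplus> e (int n)"
proof (rule co_eqI)
  fix x y :: int assume n: "int n < N"
  have "N dvd x - int n \<longleftrightarrow> x mod N = int n"
    using n by (simp add: mod_eq_dvd_iff[symmetric])
  then show "co (esum (Suc n)) x y = co (esum n \<oplus> e (int n)) x y"
    by (auto simp: co_add esum_closed co_esum co_e)
qed (simp_all add: esum_closed)

lemma esum_N: "esum (nat N) = \<one>"
  by (rule co_eqI) (use a(1) in \<open>simp_all add: esum_closed co_esum co_one\<close>)

end

section \<open>Right modules and projective resolutions\<close>

context right_module
begin

lemma smult_l_null: "x \<in> carrier M \<Longrightarrow> \<zero> \<odot>\<^bsub>M\<^esub> x = \<zero>\<^bsub>M\<^esub>"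
proof -
  assume x: "x \<in> carrier M"
  have c: "\<zero> \<odot>\<^bsub>M\<^esub> x \<in> carrier M" by (rule smult_closed[OF A.zero_closed x])
  have "\<zero> \<odot>\<^bsub>M\<^esub> x = \<zero> \<odot>\<^bsub>M\<^esub> x \<oplus>\<^bsub>M\<^esub> \<zero> \<odot>\<^bsub>M\<^esub> x"
    using smult_l_distr[OF A.zero_closed A.zero_closed x] by simp
  then show ?thesis using M.add.r_cancel_one'[OF c c] by simp
qed

lemma smult_r_null: "c \<in> carrier A \<Longrightarrow> c \<odot>\<^bsub>M\<^esub> \<zero>\<^bsub>M\<^esub> = \<zero>\<^bsub>M\<^esub>"
proof -
  assume x: "c \<in> carrier A"
  have c: "c \<odot>\<^bsub>M\<^esub> \<zero>\<^bsub>M\<^esub> \<in> carrier M" by (rule smult_closed[OF x M.zero_closed])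
  have "c \<odot>\<^bsub>M\<^esub> \<zero>\<^bsub>M\<^esub> = c \<odot>\<^bsub>M\<^esub> \<zero>\<^bsub>M\<^esub> \<oplus>\<^bsub>M\<^esub> c \<odot>\<^bsub>M\<^esub> \<zero>\<^bsub>M\<^esub>"
    using smult_r_distr[OF x M.zero_closed M.zero_closed] by simp
  then show ?thesis using M.add.r_cancel_one'[OF c c] by simp
qed

lemma smult_l_minus: "c \<in> carrier A \<Longrightarrow> x \<in> carrier M \<Longrightarrow> (\<ominus> c) \<odot>\<^bsub>M\<^esub> x = \<ominus>\<^bsub>M\<^esub> (c \<odot>\<^bsub>M\<^esub> x)"
proof -
  assume c: "c \<in> carrier A" and x: "x \<in> carrier M"
  have "(\<ominus> c) \<odot>\<^bsub>M\<^esub> x \<oplus>\<^bsub>M\<^esub> c \<odot>\<^bsub>M\<^esub> x = \<zero>\<^bsub>M\<^esub>"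
    using smult_l_distr[OF A.a_inv_closed[OF c] c x] by (simp add: A.l_neg[OF c] smult_l_null[OF x])
  then show ?thesis
    using M.minus_equality[OF _ smult_closed[OF c x] smult_closed[OF A.a_inv_closed[OF c] x]] by simp
qed

lemma minus_as_smult: "x \<in> carrier M \<Longrightarrow> \<ominus>\<^bsub>M\<^esub> x = (\<ominus> \<one>) \<odot>\<^bsub>M\<^esub> x"
  using smult_l_minus[OF A.one_closed] smult_one by simp

lemma smult_r_minus: "c \<in> carrier A \<Longrightarrow> x \<in> carrier M \<Longrightarrow> c \<odot>\<^bsub>M\<^esub> (\<ominus>\<^bsub>M\<^esub> x) = \<ominus>\<^bsub>M\<^esub> (c \<odot>\<^bsub>M\<^esub> x)"
proof -
  assume c: "c \<in> carrier A" and x: "x \<in> carrier M"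
  have "c \<odot>\<^bsub>M\<^esub> (\<ominus>\<^bsub>M\<^esub> x) \<oplus>\<^bsub>M\<^esub> c \<odot>\<^bsub>M\<^esub> x = \<zero>\<^bsub>M\<^esub>"
    using smult_r_distr[OF c M.a_inv_closed[OF x] x] by (simp add: M.l_neg[OF x] smult_r_null[OF c])
  then show ?thesis
    using M.minus_equality[OF _ smult_closed[OF c x] smult_closed[OF c M.a_inv_closed[OF x]]] by simp
qed

lemma submoduleI:
  assumes "H \<subseteq> carrier M" "\<zero>\<^bsub>M\<^esub> \<in> H" "\<And>x y. x \<in> H \<Longrightarrow> y \<in> H \<Longrightarrow> x \<oplus>\<^bsub>M\<^esub> y \<in> H"
    "\<And>c x. c \<in> carrier A \<Longrightarrow> x \<in> H \<Longrightarrow> c \<odot>\<^bsub>M\<^esub> x \<in> H"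
  shows "submodule H A M"
proof (intro submodule.intro submodule_axioms.intro)
  show "subgroup H (add_monoid M)"
  proof (rule M.add.subgroupI)
    show "H \<subseteq> carrier M" by (rule assms(1))
    show "H \<noteq> {}" using assms(2) by blast
    show "\<ominus>\<^bsub>M\<^esub> x \<in> H" if "x \<in> H" for x
      using assms(4)[OF A.a_inv_closed[OF A.one_closed] that] minus_as_smult[OF subsetD[OF assms(1) that]] by simp
    show "x \<oplus>\<^bsub>M\<^esub> y \<in> H" if "x \<in> H" "y \<in> H" for x y by (rule assms(3)[OF that])
  qed
  show "c \<odot>\<^bsub>M\<^esub> x \<in> H" if "c \<in> carrier A" "x \<in> H" for c x by (rule assms(4)[OF that])
qed

lemma submoduleD:
  assumes "submodule H A M"
  shows "H \<subseteq> carrier M" "x \<in> H \<Longrightarrow> x \<in> carrier M" "\<zero>\<^bsub>M\<^esub> \<in> H" "x \<in> H \<Longrightarrow> y \<in> H \<Longrightarrow> x \<oplus>\<^bsub>M\<^esub> y \<in> H"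
    "c \<in> carrier A \<Longrightarrow> x \<in> H \<Longrightarrow> c \<odot>\<^bsub>M\<^esub> x \<in> H" "x \<in> H \<Longrightarrow> \<ominus>\<^bsub>M\<^esub> x \<in> H"
    "x \<in> H \<Longrightarrow> y \<in> H \<Longrightarrow> x \<ominus>\<^bsub>M\<^esub> y \<in> H"
proof -
  note s = submodule.axioms(1)[OF assms]
  show sub: "H \<subseteq> carrier M" using subgroup.subset[OF s] by simp
  show "x \<in> H \<Longrightarrow> x \<in> carrier M" using sub by blast
  show "\<zero>\<^bsub>M\<^esub> \<in> H" using subgroup.one_closed[OF s] by simp
  show add: "x \<oplus>\<^bsub>M\<^esub> y \<in> H" if "x \<in> H" "y \<in> H" for x y using subgroup.m_closed[OF s that] by simp
  show sm: "c \<odot>\<^bsub>M\<^esub> x \<in> H" if "c \<in> carrier A" "x \<in> H" for c x by (rule submodule.smult_closed[OF assms that])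
  show neg: "\<ominus>\<^bsub>M\<^esub> x \<in> H" if "x \<in> H" for x
    using sm[OF A.a_inv_closed[OF A.one_closed] that] minus_as_smult[OF subsetD[OF sub that]] by simp
  show "x \<in> H \<Longrightarrow> y \<in> H \<Longrightarrow> x \<ominus>\<^bsub>M\<^esub> y \<in> H" unfolding M.minus_eq by (rule add[OF _ neg])
qed

lemma submodule_right_module:
  assumes "submodule H A M" shows "right_module A (M\<lparr>carrier := H\<rparr>)"
proof (intro right_module.intro right_module_axioms.intro)
  note s = submoduleD[OF assms]
  show "ring A" by (rule A.ring_axioms)
  show "abelian_group (M\<lparr>carrier := H\<rparr>)"
  proof (rule abelian_groupI)
    fix x assume x: "x \<in> carrier (M\<lparr>carrier := H\<rparr>)"
    then show "\<exists>y\<in>carrier (M\<lparr>carrier := H\<rparr>). y \<oplus>\<^bsub>M\<lparr>carrier := H\<rparr>\<^esub> x = \<zero>\<^bsub>M\<lparr>carrier := H\<rparr>\<^esub>"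
      using s(6)[of x] M.l_neg[OF s(2)[of x]] by (intro bexI[of _ "\<ominus>\<^bsub>M\<^esub> x"]) simp_all
  qed (use s(2-4) in \<open>simp_all add: M.a_ac\<close>)
qed (use submoduleD(2,5)[OF assms] in \<open>simp_all add: smult_l_distr smult_r_distr smult_mult smult_one\<close>)

lemma submodule_restrict:
  assumes "submodule L A M"
  shows "submodule H A (M\<lparr>carrier := L\<rparr>) \<longleftrightarrow> submodule H A M \<and> H \<subseteq> L"
proof
  interpret L: right_module A "M\<lparr>carrier := L\<rparr>" by (rule submodule_right_module[OF assms])
  show "submodule H A M \<and> H \<subseteq> L" if h: "submodule H A (M\<lparr>carrier := L\<rparr>)"
  proof
    note d = L.submoduleD[OF h]
    show "H \<subseteq> L" using d(1) by simp
    show "submodule H A M"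
      by (rule submoduleI) (use d(1,3,4,5) submoduleD(1)[OF assms] in auto)
  qed
  show "submodule H A (M\<lparr>carrier := L\<rparr>)" if h: "submodule H A M \<and> H \<subseteq> L"
    by (rule L.submoduleI) (use submoduleD[of H] h in auto)
qed

lemma zero_submodule: "submodule {\<zero>\<^bsub>M\<^esub>} A M"
  by (rule submoduleI) (simp_all add: smult_r_null)

lemma carrier_submodule: "submodule (carrier M) A M"
  by (rule submoduleI) (simp_all add: smult_closed)

end

lemma mod_homD:
  assumes "h \<in> mod_hom A M N"
  shows "x \<in> carrier M \<Longrightarrow> h x \<in> carrier N"
    "x \<in> carrier M \<Longrightarrow> y \<in> carrier M \<Longrightarrow> h (x \<oplus>\<^bsub>M\<^esub> y) = h x \<oplus>\<^bsub>N\<^esub> h y"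
    "c \<in> carrier A \<Longrightarrow> x \<in> carrier M \<Longrightarrow> h (c \<odot>\<^bsub>M\<^esub> x) = c \<odot>\<^bsub>N\<^esub> h x"
  using assms by (auto simp: mod_hom_def)

lemma mod_homI:
  assumes "\<And>x. x \<in> carrier M \<Longrightarrow> h x \<in> carrier N"
    "\<And>x y. x \<in> carrier M \<Longrightarrow> y \<in> carrier M \<Longrightarrow> x \<oplus>\<^bsub>M\<^esub> y \<in> carrier M"
    "\<And>c x. c \<in> carrier A \<Longrightarrow> x \<in> carrier M \<Longrightarrow> c \<odot>\<^bsub>M\<^esub> x \<in> carrier M"
    "\<And>x y. x \<in> carrier M \<Longrightarrow> y \<in> carrier M \<Longrightarrow> h (x \<oplus>\<^bsub>M\<^esub> y) = h x \<oplus>\<^bsub>N\<^esub> h y"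
    "\<And>c x. c \<in> carrier A \<Longrightarrow> x \<in> carrier M \<Longrightarrow> h (c \<odot>\<^bsub>M\<^esub> x) = c \<odot>\<^bsub>N\<^esub> h x"
  shows "(\<lambda>x\<in>carrier M. h x) \<in> mod_hom A M N"
  unfolding mod_hom_def using assms by simp

lemma mod_hom_zero:
  assumes "right_module A M" "right_module A N" "h \<in> mod_hom A M N" shows "h \<zero>\<^bsub>M\<^esub> = \<zero>\<^bsub>N\<^esub>"
proof -
  interpret M: right_module A M by (rule assms(1))
  interpret N: right_module A N by (rule assms(2))
  note h = mod_homD[OF assms(3)]
  have c: "h \<zero>\<^bsub>M\<^esub> \<in> carrier N" by (rule h(1)[OF M.M.zero_closed])
  have "h \<zero>\<^bsub>M\<^esub> = h \<zero>\<^bsub>M\<^esub> \<oplus>\<^bsub>N\<^esub> h \<zero>\<^bsub>M\<^esub>" using h(2)[OF M.M.zero_closed M.M.zero_closed] by simp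
  then show ?thesis using N.M.add.r_cancel_one'[OF c c] by simp
qed

lemma hom_kernel_submodule:
  assumes "right_module A M" "right_module A N" "h \<in> mod_hom A M N" shows "submodule (hom_kernel M N h) A M"
proof -
  interpret M: right_module A M by (rule assms(1))
  interpret N: right_module A N by (rule assms(2))
  note h = mod_homD[OF assms(3)]
  show ?thesis
    by (rule M.submoduleI)
      (use mod_hom_zero[OF assms] in \<open>auto simp: hom_kernel_def h M.smult_closed N.smult_r_null\<close>)
qed
text \<open>
  Scalars act from the right, so \<open>lincomb M y s n\<close> is the sum of the \<open>y i
  \<cdot> s i\<close> for \<open>i < n\<close>.
\<close>

primrec lincomb :: "('a, 'm) module \<Rightarrow> (nat \<Rightarrow> 'm) \<Rightarrow> (nat \<Rightarrow> 'a) \<Rightarrow> nat \<Rightarrow> 'm" where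
  "lincomb M y s 0 = \<zero>\<^bsub>M\<^esub>"
| "lincomb M y s (Suc n) = lincomb M y s n \<oplus>\<^bsub>M\<^esub> (s n \<odot>\<^bsub>M\<^esub> y n)"

lemma lincomb_cong:
  "(\<And>i. i < n \<Longrightarrow> y i = y' i) \<Longrightarrow> (\<And>i. i < n \<Longrightarrow> s i = s' i) \<Longrightarrow> lincomb M y s n = lincomb M y' s' n"
  by (induction n) simp_all

lemma lincomb_hom:
  assumes "right_module A M" "right_module A N" "h \<in> mod_hom A M N"
    and "\<And>i. i < n \<Longrightarrow> y i \<in> carrier M" "\<And>i. i < n \<Longrightarrow> s i \<in> carrier A"
  shows "lincomb M y s n \<in> carrier M \<and> h (lincomb M y s n) = lincomb N (\<lambda>i. h (y i)) s n"
  using assms(4,5)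
proof (induction n)
  case 0
  interpret M: right_module A M by (rule assms(1))
  show ?case using mod_hom_zero[OF assms(1-3)] by simp
next
  case (Suc n)
  interpret M: right_module A M by (rule assms(1))
  have c: "s n \<odot>\<^bsub>M\<^esub> y n \<in> carrier M" using Suc.prems by (simp add: M.smult_closed)
  show ?case using Suc c by (simp add: mod_homD[OF assms(3)])
qed

context right_module
begin

lemma lincomb_closed:
  "(\<And>i. i < n \<Longrightarrow> y i \<in> carrier M) \<Longrightarrow> (\<And>i. i < n \<Longrightarrow> s i \<in> carrier A) \<Longrightarrow> lincomb M y s n \<in> carrier M"
  by (induction n) (simp_all add: smult_closed)

lemma lincomb_in_submodule:
  "submodule H A M \<Longrightarrow> (\<And>i. i < n \<Longrightarrow> y i \<in> H) \<Longrightarrow> (\<And>i. i < n \<Longrightarrow> s i \<in> carrier A) \<Longrightarrow> lincomb M y s n \<in> H"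
  by (induction n) (simp_all add: submoduleD)

lemma lincomb_add:
  assumes "\<And>i. i < n \<Longrightarrow> y i \<in> carrier M" "\<And>i. i < n \<Longrightarrow> s i \<in> carrier A" "\<And>i. i < n \<Longrightarrow> t i \<in> carrier A"
  shows "lincomb M y (\<lambda>i. s i \<oplus> t i) n = lincomb M y s n \<oplus>\<^bsub>M\<^esub> lincomb M y t n"
  using assms
proof (induction n)
  case (Suc n)
  have "lincomb M y s n \<in> carrier M" "lincomb M y t n \<in> carrier M"
    "s n \<odot>\<^bsub>M\<^esub> y n \<in> carrier M" "t n \<odot>\<^bsub>M\<^esub> y n \<in> carrier M"
    using Suc.prems by (simp_all add: lincomb_closed smult_closed)
  then show ?case using Suc by (simp add: smult_l_distr M.a_ac)
qed simp

lemma lincomb_smult: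
  assumes "\<And>i. i < n \<Longrightarrow> y i \<in> carrier M" "\<And>i. i < n \<Longrightarrow> s i \<in> carrier A" "c \<in> carrier A"
  shows "lincomb M y (\<lambda>i. s i \<otimes> c) n = c \<odot>\<^bsub>M\<^esub> lincomb M y s n"
  using assms
proof (induction n)
  case (Suc n)
  have "lincomb M y s n \<in> carrier M" "s n \<odot>\<^bsub>M\<^esub> y n \<in> carrier M"
    using Suc.prems by (simp_all add: lincomb_closed smult_closed)
  then show ?case using Suc by (simp add: smult_r_distr smult_mult)
qed (simp add: smult_r_null)

lemma lincomb_zero_tail:
  assumes "m \<le> n" "\<And>i. i < n \<Longrightarrow> y i \<in> carrier M" "\<And>i. i < m \<Longrightarrow> s i \<in> carrier A"
    "\<And>i. m \<le> i \<Longrightarrow> i < n \<Longrightarrow> s i = \<zero>"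
  shows "lincomb M y s n = lincomb M y s m"
  using assms
proof (induction n rule: dec_induct)
  case (step n)
  have "lincomb M y s m \<in> carrier M" using step by (intro lincomb_closed) simp_all
  then show ?case using step by (simp add: smult_l_null)
qed simp

lemma lincomb_single:
  assumes "k < n" "\<And>i. i < n \<Longrightarrow> y i \<in> carrier M" "c \<in> carrier A"
  shows "lincomb M y (\<lambda>i. if i = k then c else \<zero>) n = c \<odot>\<^bsub>M\<^esub> y k"
proof -
  let ?s = "\<lambda>i. if i = k then c else \<zero>"
  have "lincomb M y ?s n = lincomb M y ?s (Suc k)"
    by (rule lincomb_zero_tail) (use assms in simp_all)
  moreover have "lincomb M y ?s k = lincomb M y ?s 0"
    by (rule lincomb_zero_tail) (use assms in simp_all)
  ultimately show ?thesis using assms by (simp add: smult_closed)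
qed

end
text \<open>
  Submodules of free modules of finite rank inside the fixed universe of modules: a sequence
  \<open>s\<close> in \<open>K\<close> is represented by the singleton \<open>{s}\<close>, and
  operations are componentwise.
\<close>

definition seq_module :: "('a, 'r) ring_scheme \<Rightarrow> (nat \<Rightarrow> 'a) set \<Rightarrow> 'a rmod" where
  "seq_module A K = \<lparr>carrier = (\<lambda>s. {s}) ` K, monoid.mult = undefined, one = undefined,
     zero = {\<lambda>i. \<zero>\<^bsub>A\<^esub>}, add = (\<lambda>X Y. {\<lambda>i. the_elem X i \<oplus>\<^bsub>A\<^esub> the_elem Y i}),
     module.smult = (\<lambda>c X. {\<lambda>i. the_elem X i \<otimes>\<^bsub>A\<^esub> c})\<rparr>"

lemma seq_module_simps [simp]:
  "carrier (seq_module A K) = (\<lambda>s. {s}) ` K" "zero (seq_module A K) = {\<lambda>i. \<zero>\<^bsub>A\<^esub>}"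
  "X \<oplus>\<^bsub>seq_module A K\<^esub> Y = {\<lambda>i. the_elem X i \<oplus>\<^bsub>A\<^esub> the_elem Y i}"
  "c \<odot>\<^bsub>seq_module A K\<^esub> X = {\<lambda>i. the_elem X i \<otimes>\<^bsub>A\<^esub> c}"
  by (simp_all add: seq_module_def)

lemma seq_module_carrier_update: "(seq_module A K)\<lparr>carrier := (\<lambda>s. {s}) ` K'\<rparr> = seq_module A K'"
  by (simp add: seq_module_def)

definition seq_closed :: "('a, 'r) ring_scheme \<Rightarrow> (nat \<Rightarrow> 'a) set \<Rightarrow> bool" where
  "seq_closed A K \<longleftrightarrow> (\<forall>s\<in>K. \<forall>i. s i \<in> carrier A) \<and> (\<lambda>i. \<zero>\<^bsub>A\<^esub>) \<in> K \<and>
     (\<forall>s\<in>K. \<forall>t\<in>K. (\<lambda>i. s i \<oplus>\<^bsub>A\<^esub> t i) \<in> K) \<and> (\<forall>s\<in>K. \<forall>c\<in>carrier A. (\<lambda>i. s i \<otimes>\<^bsub>A\<^esub> c) \<in> K)"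

lemma seq_closedD:
  assumes "seq_closed A K"
  shows "s \<in> K \<Longrightarrow> s i \<in> carrier A" "(\<lambda>i. \<zero>\<^bsub>A\<^esub>) \<in> K"
    "s \<in> K \<Longrightarrow> t \<in> K \<Longrightarrow> (\<lambda>i. s i \<oplus>\<^bsub>A\<^esub> t i) \<in> K" "s \<in> K \<Longrightarrow> c \<in> carrier A \<Longrightarrow> (\<lambda>i. s i \<otimes>\<^bsub>A\<^esub> c) \<in> K"
  using assms by (auto simp: seq_closed_def)

lemma (in ring) seq_closed_minus:
  assumes K: "seq_closed R K" and "s \<in> K" "t \<in> K" shows "(\<lambda>i. s i \<ominus> t i) \<in> K"
proof -
  have "(\<lambda>i. t i \<otimes> (\<ominus> \<one>)) \<in> K" by (rule seq_closedD(4)[OF K assms(3)]) simp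
  from seq_closedD(3)[OF K assms(2) this] show ?thesis
    using seq_closedD(1)[OF K assms(3)] by (simp add: minus_eq r_minus)
qed

lemma seq_module_right_module:
  assumes "ring A" and K: "seq_closed A K" shows "right_module A (seq_module A K)"
proof -
  interpret ring A by (rule assms(1))
  note k = seq_closedD[OF K]
  show ?thesis
  proof (intro right_module.intro right_module_axioms.intro)
    show "ring A" by (rule assms(1))
    show "abelian_group (seq_module A K)"
    proof (rule abelian_groupI)
      fix X assume "X \<in> carrier (seq_module A K)"
      then obtain s where s: "s \<in> K" "X = {s}" by auto
      have "(\<lambda>i. s i \<otimes>\<^bsub>A\<^esub> (\<ominus>\<^bsub>A\<^esub> \<one>\<^bsub>A\<^esub>)) \<in> K" by (rule k(4)[OF s(1)]) simp
      then show "\<exists>Y\<in>carrier (seq_module A K). Y \<oplus>\<^bsub>seq_module A K\<^esub> X = \<zero>\<^bsub>seq_module A K\<^esub>"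
        using k(1)[OF s(1)] by (intro bexI[of _ "{\<lambda>i. s i \<otimes>\<^bsub>A\<^esub> (\<ominus>\<^bsub>A\<^esub> \<one>\<^bsub>A\<^esub>)}"]) (simp_all add: s r_minus l_neg)
    qed (use k in \<open>auto simp: a_ac\<close>)
  qed (use k in \<open>auto simp: l_distr r_distr m_assoc\<close>)
qed

lemma seq_submodule:
  assumes "ring A" "seq_closed A K" "submodule H A (seq_module A K)"
  obtains K' where "K' \<subseteq> K" "seq_closed A K'" "H = (\<lambda>s. {s}) ` K'"
proof -
  interpret right_module A "seq_module A K" by (rule seq_module_right_module[OF assms(1,2)])
  note d = submoduleD[OF assms(3)]
  define K' where "K' = {s. {s} \<in> H}"
  have sub: "K' \<subseteq> K" using d(1) by (auto simp: K'_def)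
  have HK: "H = (\<lambda>s. {s}) ` K'" using d(1) by (auto simp: K'_def)
  have "seq_closed A K'"
    unfolding seq_closed_def
  proof (intro conjI ballI allI)
    show "s i \<in> carrier A" if "s \<in> K'" for s i using that sub seq_closedD(1)[OF assms(2)] by blast
    show "(\<lambda>i. \<zero>\<^bsub>A\<^esub>) \<in> K'" using d(3) by (simp add: K'_def)
    show "(\<lambda>i. s i \<oplus>\<^bsub>A\<^esub> t i) \<in> K'" if "s \<in> K'" "t \<in> K'" for s t
      using d(4)[of "{s}" "{t}"] that by (simp add: K'_def)
    show "(\<lambda>i. s i \<otimes>\<^bsub>A\<^esub> c) \<in> K'" if "s \<in> K'" "c \<in> carrier A" for s c
      using d(5)[of c "{s}"] that by (simp add: K'_def)
  qed
  with sub HK show ?thesis using that by blast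
qed

lemma seq_lincomb_Suc:
  "the_elem (lincomb (seq_module A K) Y s (Suc n)) j =
     the_elem (lincomb (seq_module A K) Y s n) j \<oplus>\<^bsub>A\<^esub> (the_elem (Y n) j \<otimes>\<^bsub>A\<^esub> s n)"
  by simp

lemma seq_lincomb_singleton: "lincomb (seq_module A K) Y s n = {the_elem (lincomb (seq_module A K) Y s n)}"
  by (cases n) simp_all

lemma (in ring) seq_lincomb_zero:
  "(\<And>i. i < n \<Longrightarrow> the_elem (Y i) j \<otimes> s i = \<zero>) \<Longrightarrow> the_elem (lincomb (seq_module R K) Y s n) j = \<zero>"
  by (induction n) simp_all
lemma lincomb_mod_hom:
  assumes "right_module A M" "seq_closed A F" "\<And>i. i < n \<Longrightarrow> y i \<in> carrier M"
  shows "(\<lambda>X\<in>carrier (seq_module A F). lincomb M y (the_elem X) n) \<in> mod_hom A (seq_module A F) M"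
proof -
  interpret right_module A M by (rule assms(1))
  interpret F: right_module A "seq_module A F" by (rule seq_module_right_module[OF A.ring_axioms assms(2)])
  note f = seq_closedD[OF assms(2)]
  show ?thesis
  proof (rule mod_homI)
    fix X assume X: "X \<in> carrier (seq_module A F)"
    then obtain s where s: "s \<in> F" "X = {s}" by auto
    show "lincomb M y (the_elem X) n \<in> carrier M" using s f(1) assms(3) by (intro lincomb_closed) simp_all
    show "c \<odot>\<^bsub>seq_module A F\<^esub> X \<in> carrier (seq_module A F)" if "c \<in> carrier A" for c
      by (rule F.smult_closed[OF that X])
    show "lincomb M y (the_elem (c \<odot>\<^bsub>seq_module A F\<^esub> X)) n = c \<odot>\<^bsub>M\<^esub> lincomb M y (the_elem X) n"
      if "c \<in> carrier A" for c
      using lincomb_smult[OF assms(3) f(1)[OF s(1)] that] by (simp add: s)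
    fix Y assume Y: "Y \<in> carrier (seq_module A F)"
    then obtain t where t: "t \<in> F" "Y = {t}" by auto
    show "X \<oplus>\<^bsub>seq_module A F\<^esub> Y \<in> carrier (seq_module A F)" by (rule F.M.add.m_closed[OF X Y])
    show "lincomb M y (the_elem (X \<oplus>\<^bsub>seq_module A F\<^esub> Y)) n = lincomb M y (the_elem X) n \<oplus>\<^bsub>M\<^esub> lincomb M y (the_elem Y) n"
      using lincomb_add[OF assms(3) f(1)[OF s(1)] f(1)[OF t(1)]] by (simp add: s t)
  qed
qed
text \<open>
  The coordinates in a basis with entries in \<open>F\<close> are unique, hence linear; a
  homomorphism out of \<open>M\<close> is lifted by lifting the images of the basis elements.
\<close>

lemma projective_of_basis:
  fixes M :: "'a rmod"
  assumes M: "right_module A M" and F: "seq_closed A F" and y: "\<And>i. i < n \<Longrightarrow> y i \<in> carrier M"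
    and basis: "\<And>x. x \<in> carrier M \<Longrightarrow> \<exists>!s. s \<in> F \<and> x = lincomb M y s n"
  shows "projective_module A M"
  unfolding projective_module_def
proof (intro conjI allI impI)
  interpret right_module A M by (rule M)
  note f = seq_closedD[OF F]
  show "fg_module A M"
    unfolding fg_module_def
  proof (intro conjI M exI[of _ "y ` {..<n}"] allI impI)
    show "finite (y ` {..<n})" by simp
    show "y ` {..<n} \<subseteq> carrier M" using y by auto
    fix H assume H: "submodule H A M \<and> y ` {..<n} \<subseteq> H"
    show "H = carrier M"
    proof
      show "H \<subseteq> carrier M" using H submoduleD(1) by blast
      show "carrier M \<subseteq> H"
      proof
        fix x assume "x \<in> carrier M"
        from basis[OF this] obtain s where s: "s \<in> F" "x = lincomb M y s n" by blast
        show "x \<in> H" unfolding s(2) by (rule lincomb_in_submodule) (use H f(1)[OF s(1)] in auto)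
      qed
    qed
  qed
  fix M1 N1 :: "'a rmod" and g h0
  assume H: "fg_module A M1 \<and> fg_module A N1 \<and> g \<in> mod_hom A M1 N1 \<and> g ` carrier M1 = carrier N1 \<and> h0 \<in> mod_hom A M N1"
  then have M1: "right_module A M1" and N1: "right_module A N1" and g: "g \<in> mod_hom A M1 N1"
    and onto: "g ` carrier M1 = carrier N1" and h0: "h0 \<in> mod_hom A M N1" by (auto simp: fg_module_def)
  interpret M1: right_module A M1 by (rule M1)
  have "\<exists>m\<in>carrier M1. g m = h0 (y i)" if "i < n" for i
    using mod_homD(1)[OF h0 y[OF that]] unfolding onto[symmetric] by (metis imageE)
  then obtain m where m: "\<And>i. i < n \<Longrightarrow> m i \<in> carrier M1" "\<And>i. i < n \<Longrightarrow> g (m i) = h0 (y i)" by metis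
  define sol where "sol x = (THE s. s \<in> F \<and> x = lincomb M y s n)" for x
  have sol: "sol x \<in> F" "x = lincomb M y (sol x) n" if "x \<in> carrier M" for x
    using theI'[OF basis[OF that]] unfolding sol_def by blast+
  have sol_eq: "sol (lincomb M y s n) = s" if "s \<in> F" for s
  proof -
    have c: "lincomb M y s n \<in> carrier M" by (rule lincomb_closed) (use y f(1)[OF that] in auto)
    show ?thesis using basis[OF c] sol[OF c] that by blast
  qed
  have sol_add: "sol (x \<oplus>\<^bsub>M\<^esub> z) = (\<lambda>i. sol x i \<oplus>\<^bsub>A\<^esub> sol z i)" if x: "x \<in> carrier M" and z: "z \<in> carrier M" for x z
  proof -
    have "x \<oplus>\<^bsub>M\<^esub> z = lincomb M y (\<lambda>i. sol x i \<oplus>\<^bsub>A\<^esub> sol z i) n"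
      using lincomb_add[OF y f(1)[OF sol(1)[OF x]] f(1)[OF sol(1)[OF z]]] sol(2)[OF x] sol(2)[OF z] by simp
    then show ?thesis using sol_eq[OF f(3)[OF sol(1)[OF x] sol(1)[OF z]]] by simp
  qed
  have sol_smult: "sol (c \<odot>\<^bsub>M\<^esub> x) = (\<lambda>i. sol x i \<otimes>\<^bsub>A\<^esub> c)" if x: "x \<in> carrier M" and c: "c \<in> carrier A" for x c
  proof -
    have "c \<odot>\<^bsub>M\<^esub> x = lincomb M y (\<lambda>i. sol x i \<otimes>\<^bsub>A\<^esub> c) n"
      using lincomb_smult[OF y f(1)[OF sol(1)[OF x]] c] sol(2)[OF x] by simp
    then show ?thesis using sol_eq[OF f(4)[OF sol(1)[OF x] c]] by simp
  qed
  let ?h = "\<lambda>x\<in>carrier M. lincomb M1 m (sol x) n"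
  show "\<exists>h\<in>mod_hom A M M1. \<forall>x\<in>carrier M. g (h x) = h0 x"
  proof (intro bexI[of _ ?h] ballI)
    show "?h \<in> mod_hom A M M1"
    proof (rule mod_homI)
      fix x assume x: "x \<in> carrier M"
      show "lincomb M1 m (sol x) n \<in> carrier M1"
        by (rule M1.lincomb_closed) (use m(1) f(1)[OF sol(1)[OF x]] in auto)
      show "c \<odot>\<^bsub>M\<^esub> x \<in> carrier M" if "c \<in> carrier A" for c by (rule smult_closed[OF that x])
      show "lincomb M1 m (sol (c \<odot>\<^bsub>M\<^esub> x)) n = c \<odot>\<^bsub>M1\<^esub> lincomb M1 m (sol x) n" if c: "c \<in> carrier A" for c
        unfolding sol_smult[OF x c] by (rule M1.lincomb_smult[OF m(1) f(1)[OF sol(1)[OF x]] c])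
      fix z assume z: "z \<in> carrier M"
      show "x \<oplus>\<^bsub>M\<^esub> z \<in> carrier M" by (rule M.add.m_closed[OF x z])
      show "lincomb M1 m (sol (x \<oplus>\<^bsub>M\<^esub> z)) n = lincomb M1 m (sol x) n \<oplus>\<^bsub>M1\<^esub> lincomb M1 m (sol z) n"
        unfolding sol_add[OF x z]
        by (rule M1.lincomb_add[OF m(1) f(1)[OF sol(1)[OF x]] f(1)[OF sol(1)[OF z]]])
    qed
    fix x assume x: "x \<in> carrier M"
    have "g (lincomb M1 m (sol x) n) = lincomb N1 (\<lambda>i. g (m i)) (sol x) n"
      using lincomb_hom[OF M1 N1 g m(1) f(1)[OF sol(1)[OF x]]] by simp
    also have "\<dots> = lincomb N1 (\<lambda>i. h0 (y i)) (sol x) n" by (rule lincomb_cong) (simp_all add: m(2))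
    also have "\<dots> = h0 (lincomb M y (sol x) n)"
      using lincomb_hom[OF M N1 h0 y f(1)[OF sol(1)[OF x]]] by simp
    also have "\<dots> = h0 x" using sol(2)[OF x] by simp
    finally show "g (?h x) = h0 x" using x by simp
  qed
qed
definition has_res :: "('a, 'r) ring_scheme \<Rightarrow> 'a rmod \<Rightarrow> nat \<Rightarrow> bool" where
  "has_res A M n \<longleftrightarrow> (\<exists>P d p. projective_resolution A M n P d p)"

text \<open>
  Splicing: the resolution of the kernel is continued by its inclusion into \<open>P0\<close>.
\<close>

lemma has_res_Suc:
  fixes P0 M :: "'a rmod"
  assumes "projective_module A P0" "p \<in> mod_hom A P0 M" "p ` carrier P0 = carrier M"
    "has_res A (P0\<lparr>carrier := hom_kernel P0 M p\<rparr>) n"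
  shows "has_res A M (Suc n)"
proof -
  let ?K = "P0\<lparr>carrier := hom_kernel P0 M p\<rparr>"
  from assms(4) obtain P d q where pr: "projective_resolution A ?K n P d q" unfolding has_res_def by blast
  have r: "\<And>i. projective_module A (P i)" "\<And>i. i > n \<Longrightarrow> carrier (P i) = {\<zero>\<^bsub>P i\<^esub>}"
      "q \<in> mod_hom A (P 0) ?K" "q ` carrier (P 0) = carrier ?K" "\<And>i. d i \<in> mod_hom A (P (Suc i)) (P i)"
      "d 0 ` carrier (P 1) = hom_kernel (P 0) ?K q"
      "\<And>i. d (Suc i) ` carrier (P (Suc (Suc i))) = hom_kernel (P (Suc i)) (P i) (d i)"
    using pr unfolding projective_resolution_def by simp_all
  define P' where "P' i = (case i of 0 \<Rightarrow> P0 | Suc j \<Rightarrow> P j)" for i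
  define d' where "d' i = (case i of 0 \<Rightarrow> q | Suc j \<Rightarrow> d j)" for i
  have q0: "q \<in> mod_hom A (P 0) P0"
    using r(3) unfolding mod_hom_def by (auto simp: hom_kernel_def PiE_def Pi_def)
  have "projective_resolution A M (Suc n) P' d' p"
    unfolding projective_resolution_def
  proof (intro conjI allI impI)
    show "projective_module A (P' i)" for i using assms(1) r(1) by (cases i) (simp_all add: P'_def)
    show "carrier (P' i) = {\<zero>\<^bsub>P' i\<^esub>}" if "Suc n < i" for i
      using that r(2) by (cases i) (simp_all add: P'_def)
    show "p \<in> mod_hom A (P' 0) M" "p ` carrier (P' 0) = carrier M" using assms by (simp_all add: P'_def)
    show "d' i \<in> mod_hom A (P' (Suc i)) (P' i)" for i using q0 r(5) by (cases i) (simp_all add: P'_def d'_def)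
    show "d' 0 ` carrier (P' 1) = hom_kernel (P' 0) M p" using r(4) by (simp add: P'_def d'_def)
    show "d' (Suc i) ` carrier (P' (Suc (Suc i))) = hom_kernel (P' (Suc i)) (P' i) (d' i)" for i
      using r(6,7) by (cases i) (simp_all add: P'_def d'_def hom_kernel_def)
  qed
  then show ?thesis unfolding has_res_def by blast
qed

lemma zero_projective:
  fixes M :: "'a rmod"
  assumes "right_module A M" shows "projective_module A (M\<lparr>carrier := {\<zero>\<^bsub>M\<^esub>}\<rparr>)"
proof -
  interpret right_module A M by (rule assms)
  have Z: "right_module A (M\<lparr>carrier := {\<zero>\<^bsub>M\<^esub>}\<rparr>)" by (rule submodule_right_module[OF zero_submodule])
  have "seq_closed A {\<lambda>i. \<zero>\<^bsub>A\<^esub>}" by (simp add: seq_closed_def)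
  then show ?thesis
    by (rule projective_of_basis[OF Z _, where n = 0]) auto
qed

lemma has_res_0:
  fixes M :: "'a rmod"
  assumes "projective_module A M" shows "has_res A M 0"
proof -
  have M: "right_module A M" using assms by (simp add: projective_module_def fg_module_def)
  interpret right_module A M by (rule M)
  let ?Z = "M\<lparr>carrier := {\<zero>\<^bsub>M\<^esub>}\<rparr>"
  define P where "P i = (case i of 0 \<Rightarrow> M | Suc j \<Rightarrow> ?Z)" for i :: nat
  let ?z = "\<lambda>x\<in>{\<zero>\<^bsub>M\<^esub>}. \<zero>\<^bsub>M\<^esub>"
  have "projective_resolution A M 0 P (\<lambda>i. ?z) (\<lambda>x\<in>carrier M. x)"
    unfolding projective_resolution_def
  proof (intro conjI allI impI)
    show "projective_module A (P i)" for i using assms zero_projective[OF M] by (cases i) (simp_all add: P_def)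
    show "carrier (P i) = {\<zero>\<^bsub>P i\<^esub>}" if "0 < i" for i using that by (cases i) (simp_all add: P_def)
    show "(\<lambda>x\<in>carrier M. x) \<in> mod_hom A (P 0) M" by (simp add: P_def mod_hom_def smult_closed)
    show "(\<lambda>x\<in>carrier M. x) ` carrier (P 0) = carrier M" by (simp add: P_def)
    show "?z \<in> mod_hom A (P (Suc i)) (P i)" for i by (cases i) (simp_all add: P_def mod_hom_def smult_r_null)
    show "?z ` carrier (P 1) = hom_kernel (P 0) M (\<lambda>x\<in>carrier M. x)" by (auto simp: P_def hom_kernel_def)
    show "?z ` carrier (P (Suc (Suc i))) = hom_kernel (P (Suc i)) (P i) ?z" for i
      by (cases i) (auto simp: P_def hom_kernel_def)
  qed
  then show ?thesis unfolding has_res_def by blast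
qed

lemma gl_dim_le:
  assumes "\<And>M :: 'a rmod. fg_module A M \<Longrightarrow> has_res A M n" shows "gl_dim A \<le> enat n"
  unfolding gl_dim_def
proof (rule SUP_least)
  fix M :: "'a rmod" assume "M \<in> {M. fg_module A M}"
  then have "has_res A M n" using assms by simp
  then show "proj_dim A M \<le> enat n" unfolding proj_dim_def has_res_def by (intro Inf_lower) blast
qed

lemma gl_dim_finite_res:
  assumes "gl_dim A < \<infinity>" "fg_module A (M :: 'a rmod)" shows "\<exists>n. has_res A M n"
proof -
  have "proj_dim A M \<le> gl_dim A" unfolding gl_dim_def by (rule SUP_upper) (use assms in simp)
  then have "proj_dim A M < \<infinity>" using assms(1) by (rule le_less_trans)
  then have "{enat n | n. \<exists>P d p. projective_resolution A M n P d p} \<noteq> {}"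
    unfolding proj_dim_def by (metis Inf_empty order_less_irrefl top_enat_def)
  then show ?thesis unfolding has_res_def by blast
qed

section \<open>An upper bound for the global dimension\<close>

context nak
begin

text \<open>
  A property that is closed under addition needs to be checked on the components \<open>x \<cdot> e
  j\<close> only.
\<close>

lemma mem_by_idempotents:
  assumes "right_module A M" and x: "x \<in> carrier M" and H: "\<zero>\<^bsub>M\<^esub> \<in> H" "\<And>x y. x \<in> H \<Longrightarrow> y \<in> H \<Longrightarrow> x \<oplus>\<^bsub>M\<^esub> y \<in> H"
    and ex: "\<And>j. 0 \<le> j \<Longrightarrow> j < N \<Longrightarrow> e j \<odot>\<^bsub>M\<^esub> x \<in> H"
  shows "x \<in> H"
proof -
  interpret M: right_module A M by (rule assms(1))
  have "n \<le> nat N \<Longrightarrow> esum n \<odot>\<^bsub>M\<^esub> x \<in> H" for n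
  proof (induction n)
    case 0 then show ?case using H(1) by (simp add: esum_0 M.smult_l_null[OF x])
  next
    case (Suc n)
    then have n: "int n < N" by linarith
    have "esum (Suc n) \<odot>\<^bsub>M\<^esub> x = esum n \<odot>\<^bsub>M\<^esub> x \<oplus>\<^bsub>M\<^esub> e (int n) \<odot>\<^bsub>M\<^esub> x"
      unfolding esum_Suc[OF n] by (rule M.smult_l_distr[OF esum_closed E_closed x])
    then show ?case using H(2)[OF Suc.IH ex[of "int n"]] Suc.prems n by simp
  qed
  from this[of "nat N"] show ?thesis by (simp add: esum_N M.smult_one[OF x])
qed

text \<open>
  The projective module that is the direct sum of \<open>row (b 0), \<dots>, row (b (n -
  1))\<close>, as sequences.
\<close>

definition FS :: "nat \<Rightarrow> (nat \<Rightarrow> int) \<Rightarrow> (nat \<Rightarrow> 'a) set" where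
  "FS n b = {s. (\<forall>i<n. s i \<in> row (b i)) \<and> (\<forall>i\<ge>n. s i = \<zero>)}"

lemma FS_closed: "s \<in> FS n b \<Longrightarrow> s i \<in> carrier A"
  using row_closed by (cases "i < n") (auto simp: FS_def)

lemma FS_seq_closed: "seq_closed A (FS n b)"
  unfolding seq_closed_def
proof (intro conjI ballI allI)
  show "s i \<in> carrier A" if "s \<in> FS n b" for s i by (rule FS_closed[OF that])
qed (auto simp: FS_def row_zero row_add row_mult)

lemma FS_module: "right_module A (seq_module A (FS n b))"
  by (rule seq_module_right_module[OF ring_axioms FS_seq_closed])

definition unit_seq :: "(nat \<Rightarrow> int) \<Rightarrow> nat \<Rightarrow> nat \<Rightarrow> 'a" where
  "unit_seq b k = (\<lambda>i. if i = k then e (b k) else \<zero>)"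

lemma unit_seq_FS: "k < n \<Longrightarrow> unit_seq b k \<in> FS n b"
  by (auto simp: FS_def unit_seq_def row_zero row_E)

lemma FS_lincomb:
  assumes s: "\<And>i. i < n \<Longrightarrow> s i \<in> row (b i)"
  shows "the_elem (lincomb (seq_module A F) (\<lambda>i. {unit_seq b i}) s n) j = (if j < n then s j else \<zero>)"
  using s
proof (induction n)
  case (Suc n)
  have "s n \<in> row (b n)" using Suc.prems by simp
  then have sn: "e (b n) \<otimes> s n = s n" "s n \<in> carrier A" by (simp_all add: row_def)
  have sj: "s j \<in> carrier A" if "j < n" using row_closed[OF Suc.prems[of j]] that by simp
  have IH: "the_elem (lincomb (seq_module A F) (\<lambda>i. {unit_seq b i}) s n) j = (if j < n then s j else \<zero>)"
    by (rule Suc.IH) (use Suc.prems in simp)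
  show ?case unfolding seq_lincomb_Suc IH using sn sj by (cases "j = n") (simp_all add: unit_seq_def less_Suc_eq)
qed simp

lemma FS_projective: "projective_module A (seq_module A (FS n b))"
proof (rule projective_of_basis[OF FS_module FS_seq_closed, where y = "\<lambda>i. {unit_seq b i}" and n = n])
  show "{unit_seq b i} \<in> carrier (seq_module A (FS n b))" if "i < n" for i using unit_seq_FS[OF that] by simp
  fix X assume "X \<in> carrier (seq_module A (FS n b))"
  then obtain s where s: "s \<in> FS n b" "X = {s}" by auto
  have l: "lincomb (seq_module A (FS n b)) (\<lambda>i. {unit_seq b i}) t n = {t}" if t: "t \<in> FS n b" for t
  proof -
    have "the_elem (lincomb (seq_module A (FS n b)) (\<lambda>i. {unit_seq b i}) t n) = t"
    proof
      fix j show "the_elem (lincomb (seq_module A (FS n b)) (\<lambda>i. {unit_seq b i}) t n) j = t j"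
        using t FS_lincomb[of n t b "FS n b" j] by (auto simp: FS_def)
    qed
    then show ?thesis using seq_lincomb_singleton by metis
  qed
  show "\<exists>!t. t \<in> FS n b \<and> X = lincomb (seq_module A (FS n b)) (\<lambda>i. {unit_seq b i}) t n"
    using l s by (intro ex1I[of _ s]) auto
qed
text \<open>
  Each generator is replaced by its components under the vertex idempotents, so that it generates
  an image of some \<open>row (b i)\<close>.
\<close>

lemma fg_cover:
  assumes fg: "fg_module A M"
  obtains n b y where "\<And>i. i < n \<Longrightarrow> y i \<in> carrier M" "\<And>i. i < n \<Longrightarrow> e (b i) \<odot>\<^bsub>M\<^esub> y i = y i"
    "\<And>x. x \<in> carrier M \<Longrightarrow> \<exists>s\<in>FS n b. x = lincomb M y s n"
proof -
  have M: "right_module A M" using fg by (simp add: fg_module_def)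
  interpret M: right_module A M by (rule M)
  from fg obtain X where X: "finite X" "X \<subseteq> carrier M"
    "\<And>H. submodule H A M \<Longrightarrow> X \<subseteq> H \<Longrightarrow> H = carrier M" unfolding fg_module_def by blast
  define Y where "Y = (\<lambda>(j, x). e j \<odot>\<^bsub>M\<^esub> x) ` ({0..<N} \<times> X)"
  have "finite Y" unfolding Y_def using X(1) by simp
  then obtain ys where ys: "set ys = Y" using finite_list by blast
  define n where "n = length ys"
  have "\<exists>b. ys ! i \<in> carrier M \<and> e b \<odot>\<^bsub>M\<^esub> (ys ! i) = ys ! i" if "i < n" for i
  proof -
    have "ys ! i \<in> Y" using that ys by (auto simp: n_def)
    then obtain j x where jx: "ys ! i = e j \<odot>\<^bsub>M\<^esub> x" "x \<in> X" unfolding Y_def by auto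
    have xc: "x \<in> carrier M" using jx(2) X(2) by blast
    have "e j \<odot>\<^bsub>M\<^esub> (e j \<odot>\<^bsub>M\<^esub> x) = e j \<odot>\<^bsub>M\<^esub> x"
      using M.smult_mult[OF E_closed E_closed xc, of j j j j] by (simp add: e_idem)
    then show ?thesis unfolding jx(1) using M.smult_closed[OF E_closed xc] by blast
  qed
  then obtain b where b: "\<And>i. i < n \<Longrightarrow> ys ! i \<in> carrier M" "\<And>i. i < n \<Longrightarrow> e (b i) \<odot>\<^bsub>M\<^esub> (ys ! i) = ys ! i" by metis
  let ?y = "\<lambda>i. ys ! i"
  define H where "H = (\<lambda>s. lincomb M ?y s n) ` FS n b"
  note f = seq_closedD[OF FS_seq_closed]
  have sub: "submodule H A M"
  proof (rule M.submoduleI)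
    show "H \<subseteq> carrier M" unfolding H_def
      by (rule image_subsetI, rule M.lincomb_closed) (use b(1) FS_closed in blast)+
    have "lincomb M ?y (\<lambda>i. \<zero>) n = lincomb M ?y (\<lambda>i. \<zero>) 0"
      by (rule M.lincomb_zero_tail) (use b(1) in simp_all)
    then have "lincomb M ?y (\<lambda>i. \<zero>) n = \<zero>\<^bsub>M\<^esub>" by simp
    then show "\<zero>\<^bsub>M\<^esub> \<in> H" unfolding H_def by (intro image_eqI[OF sym f(2)])
    fix x assume "x \<in> H"
    then obtain s where s: "s \<in> FS n b" "x = lincomb M ?y s n" by (auto simp: H_def)
    show "c \<odot>\<^bsub>M\<^esub> x \<in> H" if "c \<in> carrier A" for c
    proof -
      have "lincomb M ?y (\<lambda>i. s i \<otimes> c) n = c \<odot>\<^bsub>M\<^esub> x"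
        unfolding s(2) by (rule M.lincomb_smult) (use b(1) FS_closed[OF s(1)] that in auto)
      then show ?thesis unfolding H_def by (intro image_eqI[OF sym f(4)[OF s(1) that]])
    qed
    fix z assume "z \<in> H"
    then obtain t where t: "t \<in> FS n b" "z = lincomb M ?y t n" by (auto simp: H_def)
    show "x \<oplus>\<^bsub>M\<^esub> z \<in> H"
    proof -
      have "lincomb M ?y (\<lambda>i. s i \<oplus> t i) n = x \<oplus>\<^bsub>M\<^esub> z"
        unfolding s(2) t(2) by (rule M.lincomb_add) (use b(1) FS_closed[OF s(1)] FS_closed[OF t(1)] in auto)
      then show ?thesis unfolding H_def by (intro image_eqI[OF sym f(3)[OF s(1) t(1)]])
    qed
  qed
  have "X \<subseteq> H"
  proof
    fix x assume x: "x \<in> X"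
    show "x \<in> H"
    proof (rule mem_by_idempotents[OF M])
      show "x \<in> carrier M" using x X(2) by blast
      show "\<zero>\<^bsub>M\<^esub> \<in> H" by (rule M.submoduleD(3)[OF sub])
      show "u \<oplus>\<^bsub>M\<^esub> v \<in> H" if "u \<in> H" "v \<in> H" for u v by (rule M.submoduleD(4)[OF sub that])
      fix j assume j: "0 \<le> j" "j < N"
      have "e j \<odot>\<^bsub>M\<^esub> x \<in> set ys" unfolding ys Y_def using x j by (intro image_eqI[of _ _ "(j, x)"]) auto
      then obtain k where k: "k < n" "ys ! k = e j \<odot>\<^bsub>M\<^esub> x" by (auto simp: in_set_conv_nth n_def)
      have "lincomb M ?y (unit_seq b k) n = e (b k) \<odot>\<^bsub>M\<^esub> (ys ! k)"
        unfolding unit_seq_def by (rule M.lincomb_single[OF k(1) b(1) E_closed])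
      also have "\<dots> = e j \<odot>\<^bsub>M\<^esub> x" using b(2)[OF k(1)] k(2) by simp
      finally show "e j \<odot>\<^bsub>M\<^esub> x \<in> H" unfolding H_def
        by (intro image_eqI[OF sym unit_seq_FS[OF k(1)]])
    qed
  qed
  then have "H = carrier M" using X(3) sub by blast
  then have "\<exists>s\<in>FS n b. x = lincomb M ?y s n" if "x \<in> carrier M" for x using that by (auto simp: H_def)
  then show ?thesis using that b by blast
qed

definition cover_map :: "('a, 'm) module \<Rightarrow> (nat \<Rightarrow> 'm) \<Rightarrow> nat \<Rightarrow> (nat \<Rightarrow> int) \<Rightarrow> (nat \<Rightarrow> 'a) set \<Rightarrow> 'm" where
  "cover_map M y n b = (\<lambda>X\<in>carrier (seq_module A (FS n b)). lincomb M y (the_elem X) n)"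

definition relations :: "('a, 'm) module \<Rightarrow> (nat \<Rightarrow> 'm) \<Rightarrow> nat \<Rightarrow> (nat \<Rightarrow> int) \<Rightarrow> (nat \<Rightarrow> 'a) set" where
  "relations M y n b = {s \<in> FS n b. lincomb M y s n = \<zero>\<^bsub>M\<^esub>}"

lemma cover_map_hom:
  "right_module A M \<Longrightarrow> (\<And>i. i < n \<Longrightarrow> y i \<in> carrier M) \<Longrightarrow> cover_map M y n b \<in> mod_hom A (seq_module A (FS n b)) M"
  unfolding cover_map_def by (rule lincomb_mod_hom[OF _ FS_seq_closed])

lemma cover_map_apply: "s \<in> FS n b \<Longrightarrow> cover_map M y n b {s} = lincomb M y s n"
  by (simp add: cover_map_def)

lemma cover_map_onto:
  assumes "right_module A M" "\<And>i. i < n \<Longrightarrow> y i \<in> carrier M" "\<And>x. x \<in> carrier M \<Longrightarrow> \<exists>s\<in>FS n b. x = lincomb M y s n"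
  shows "cover_map M y n b ` carrier (seq_module A (FS n b)) = carrier M"
proof
  show "cover_map M y n b ` carrier (seq_module A (FS n b)) \<subseteq> carrier M"
    by (rule image_subsetI, rule mod_homD(1)[OF cover_map_hom[OF assms(1)]]) (use assms(2) in auto)
  show "carrier M \<subseteq> cover_map M y n b ` carrier (seq_module A (FS n b))"
  proof
    fix x assume "x \<in> carrier M"
    from assms(3)[OF this] obtain s where s: "s \<in> FS n b" "x = lincomb M y s n" by blast
    then have "x = cover_map M y n b {s}" by (simp add: cover_map_apply)
    then show "x \<in> cover_map M y n b ` carrier (seq_module A (FS n b))" using s(1) by (auto intro: image_eqI)
  qed
qed

lemma cover_map_kernel:
  "hom_kernel (seq_module A (FS n b)) M (cover_map M y n b) = (\<lambda>s. {s}) ` relations M y n b"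
  by (auto simp: hom_kernel_def relations_def cover_map_apply)

lemma relations_closed:
  assumes "right_module A M" "\<And>i. i < n \<Longrightarrow> y i \<in> carrier M"
  shows "seq_closed A (relations M y n b)"
proof -
  have "submodule ((\<lambda>s. {s}) ` relations M y n b) A (seq_module A (FS n b))"
    using hom_kernel_submodule[OF FS_module assms(1) cover_map_hom[OF assms]] unfolding cover_map_kernel .
  from seq_submodule[OF ring_axioms FS_seq_closed this] obtain K' where
    K': "seq_closed A K'" "(\<lambda>s. {s}) ` relations M y n b = (\<lambda>s. {s}) ` K'" by metis
  have "relations M y n b = K'" using K'(2) inj_image_eq_iff[of "\<lambda>s :: nat \<Rightarrow> 'a. {s}"] by (simp add: inj_on_def)
  then show ?thesis using K'(1) by simp
qed
text \<open>
  Possible last nonzero entries at position \<open>i\<close>, as in elimination: a right ideal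
  inside a row.
\<close>

definition lead :: "(nat \<Rightarrow> 'a) set \<Rightarrow> nat \<Rightarrow> 'a set" where
  "lead K i = {s i | s. s \<in> K \<and> (\<forall>j>i. s j = \<zero>)}"

text \<open>
  The submodule \<open>K\<close> of \<open>FS n c\<close> has leading right ideal \<open>tail_row
  (c i) (b i)\<close> at position \<open>i\<close>. Thus \<open>K\<close> has a filtration whose
  factors are the uniserial modules \<open>tail_row (c i) (b i)\<close>, and as far as syzygies are
  concerned it behaves like their direct sum.
\<close>

definition leads :: "nat \<Rightarrow> (nat \<Rightarrow> int) \<Rightarrow> (nat \<Rightarrow> int) \<Rightarrow> (nat \<Rightarrow> 'a) set \<Rightarrow> bool" where
  "leads n c b K \<longleftrightarrow> seq_closed A K \<and> K \<subseteq> FS n c \<and>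
     (\<forall>i<n. c i \<le> b i \<and> b i \<le> f (c i) \<and> lead K i = tail_row (c i) (b i))"

lemma leads_exist:
  assumes K: "seq_closed A K" "K \<subseteq> FS n c" obtains b where "leads n c b K"
proof -
  note k = seq_closedD[OF K(1)]
  have "\<exists>b. c i \<le> b \<and> b \<le> f (c i) \<and> lead K i = tail_row (c i) b" if i: "i < n" for i
  proof -
    have 1: "lead K i \<subseteq> row (c i)" using K(2) i by (auto simp: lead_def FS_def)
    have 2: "\<zero> \<in> lead K i" using k(2) by (force simp: lead_def)
    have 3: "x \<oplus> y \<in> lead K i" if xy: "x \<in> lead K i" "y \<in> lead K i" for x y
    proof -
      from xy obtain s t where s: "s \<in> K" "x = s i" "\<forall>j>i. s j = \<zero>" and t: "t \<in> K" "y = t i" "\<forall>j>i. t j = \<zero>"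
        unfolding lead_def by blast
      show ?thesis unfolding lead_def
        by (intro CollectI exI[of _ "\<lambda>j. s j \<oplus> t j"]) (use k(3)[OF s(1) t(1)] s t in simp)
    qed
    have 4: "x \<otimes> d \<in> lead K i" if xy: "x \<in> lead K i" "d \<in> carrier A" for x d
    proof -
      from xy obtain s where s: "s \<in> K" "x = s i" "\<forall>j>i. s j = \<zero>" unfolding lead_def by blast
      show ?thesis unfolding lead_def
        by (intro CollectI exI[of _ "\<lambda>j. s j \<otimes> d"]) (use k(4)[OF s(1) xy(2)] s xy(2) in simp)
    qed
    from right_ideal_char[OF 1 2 3 4] show ?thesis by metis
  qed
  then obtain b where "\<And>i. i < n \<Longrightarrow> c i \<le> b i \<and> b i \<le> f (c i) \<and> lead K i = tail_row (c i) (b i)" by metis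
  then show ?thesis using K that unfolding leads_def by blast
qed

lemma tail_row_E: "i \<le> b \<Longrightarrow> E i b \<in> tail_row i b"
  unfolding tail_row_def using row_E[of i b] by (auto simp: co_E)

text \<open>
  Elements of \<open>K\<close> whose leading entries generate the leading right ideals.
\<close>

definition standard_basis :: "nat \<Rightarrow> (nat \<Rightarrow> int) \<Rightarrow> (nat \<Rightarrow> int) \<Rightarrow> (nat \<Rightarrow> 'a) set \<Rightarrow> (nat \<Rightarrow> nat \<Rightarrow> 'a) \<Rightarrow> bool" where
  "standard_basis n c b K y \<longleftrightarrow> (\<forall>i<n. y i \<in> K \<and> (\<forall>j>i. y i j = \<zero>) \<and> y i i = E (c i) (b i))"

lemma standard_basis_exists:
  assumes L: "leads n c b K" obtains y where "standard_basis n c b K y"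
proof -
  have "\<exists>s. s \<in> K \<and> (\<forall>j>i. s j = \<zero>) \<and> s i = E (c i) (b i)" if i: "i < n" for i
  proof -
    have "E (c i) (b i) \<in> lead K i" using L i tail_row_E by (auto simp: leads_def)
    then show ?thesis unfolding lead_def by fastforce
  qed
  then obtain y where "\<And>i. i < n \<Longrightarrow> y i \<in> K \<and> (\<forall>j>i. y i j = \<zero>) \<and> y i i = E (c i) (b i)" by metis
  then show ?thesis by (intro that[of y]) (simp add: standard_basis_def)
qed

context
  fixes n c b K y
  assumes L: "leads n c b K" and y: "standard_basis n c b K y"
begin

lemma Kc: "seq_closed A K" and KF: "K \<subseteq> FS n c"
  and cb: "i < n \<Longrightarrow> c i \<le> b i" "i < n \<Longrightarrow> b i \<le> f (c i)" and lead_K: "i < n \<Longrightarrow> lead K i = tail_row (c i) (b i)"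
  using L by (auto simp: leads_def)

lemma y_K: "i < n \<Longrightarrow> y i \<in> K" and y_above: "i < n \<Longrightarrow> i < j \<Longrightarrow> y i j = \<zero>" and y_diag: "i < n \<Longrightarrow> y i i = E (c i) (b i)"
  using y by (auto simp: standard_basis_def)

lemma K_module: "right_module A (seq_module A K)"
  by (rule seq_module_right_module[OF ring_axioms Kc])

lemma y_carrier: "i < n \<Longrightarrow> {y i} \<in> carrier (seq_module A K)"
  using y_K by simp

text \<open>
  Elimination from the last position downwards. If \<open>b i = f (c i)\<close> then \<open>y
  i\<close> has leading entry zero and its coefficient can be chosen to be zero; this normalisation
  makes coefficients unique in the projective case.
\<close>

lemma standard_basis_span:
  "m \<le> n \<Longrightarrow> s \<in> K \<Longrightarrow> (\<And>j. m \<le> j \<Longrightarrow> s j = \<zero>) \<Longrightarrow>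
     \<exists>t\<in>FS m b. (\<forall>i<m. b i = f (c i) \<longrightarrow> t i = \<zero>) \<and> {s} = lincomb (seq_module A K) (\<lambda>i. {y i}) t m"
proof (induction m arbitrary: s)
  case 0
  then have "s = (\<lambda>i. \<zero>)" by auto
  moreover have "(\<lambda>i. \<zero>) \<in> FS 0 b" by (simp add: FS_def)
  ultimately show ?case by auto
next
  case (Suc m)
  have m: "m < n" using Suc.prems by simp
  note k = seq_closedD[OF Kc]
  have "s m \<in> lead K m" unfolding lead_def using Suc.prems by auto
  then have "s m \<in> tail_row (c m) (b m)" using lead_K[OF m] by simp
  then obtain u0 where u0: "u0 \<in> row (b m)" "s m = E (c m) (b m) \<otimes> u0" by (rule tail_row_factor[OF _ cb(1)[OF m]])
  define u where "u = (if b m = f (c m) then \<zero> else u0)"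
  have "E (c m) (b m) = \<zero>" if "b m = f (c m)" using that by (simp add: E_zero_iff)
  then have u: "u \<in> row (b m)" "s m = E (c m) (b m) \<otimes> u" "b m = f (c m) \<Longrightarrow> u = \<zero>"
    using u0 row_closed[OF u0(1)] by (auto simp: u_def row_zero)
  have uc: "u \<in> carrier A" by (rule row_closed[OF u(1)])
  \<comment> \<open>subtract the multiple of the basis element that cancels the leading entry\<close>
  define s' where "s' = (\<lambda>i. s i \<ominus> y m i \<otimes> u)"
  have yuK: "(\<lambda>i. y m i \<otimes> u) \<in> K" by (rule k(4)[OF y_K[OF m] uc])
  have s'K: "s' \<in> K" unfolding s'_def by (rule seq_closed_minus[OF Kc Suc.prems(2) yuK])
  have "s' j = \<zero>" if "m \<le> j" for j
  proof (cases "j = m")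
    case True then show ?thesis using u uc by (simp add: s'_def y_diag[OF m] minus_eq r_neg)
  next
    case False
    then show ?thesis using that Suc.prems(3)[of j] uc by (simp add: s'_def y_above[OF m] minus_eq)
  qed
  from Suc.IH[OF _ s'K this] m obtain t where t: "t \<in> FS m b" "{s'} = lincomb (seq_module A K) (\<lambda>i. {y i}) t m"
      "\<And>i. i < m \<Longrightarrow> b i = f (c i) \<Longrightarrow> t i = \<zero>" by auto
  define t' where "t' = (\<lambda>i. if i = m then u else t i)"
  have "\<forall>i<Suc m. b i = f (c i) \<longrightarrow> t' i = \<zero>" using t(3) u(3) by (auto simp: t'_def less_Suc_eq)
  moreover have "t' \<in> FS (Suc m) b" using t(1) u(1) by (auto simp: FS_def t'_def less_Suc_eq)
  moreover have "{s} = lincomb (seq_module A K) (\<lambda>i. {y i}) t' (Suc m)"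
  proof -
    have "lincomb (seq_module A K) (\<lambda>i. {y i}) t' m = {s'}"
      unfolding t(2) by (rule lincomb_cong) (simp_all add: t'_def)
    moreover have "s' i \<oplus> y m i \<otimes> u = s i" for i
      using k(1)[OF Suc.prems(2), of i] k(1)[OF yuK, of i] unfolding s'_def
      by (simp add: minus_eq a_assoc l_neg)
    ultimately show ?thesis by (simp add: t'_def)
  qed
  ultimately show ?case by blast
qed

lemma lincomb_above:
  assumes "m \<le> n" "s \<in> FS n b" "m \<le> j" shows "the_elem (lincomb (seq_module A K) (\<lambda>i. {y i}) s m) j = \<zero>"
  by (rule seq_lincomb_zero) (use assms FS_closed in \<open>simp add: y_above\<close>)

text \<open>
  The syzygy step. The map from \<open>FS n b\<close> onto \<open>K\<close> given by the standard
  basis has a kernel that is again of the same kind, with \<open>(c i, b i)\<close> replaced by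
  \<open>(b i, f (c i))\<close>, exactly as for a single uniserial module: \<open>x\<close> leads a
  relation at position \<open>i\<close> iff it annihilates the leading entry \<open>E (c i) (b
  i)\<close>, the lower positions being corrected by elimination.
\<close>

lemma relations_leads: "leads n b (\<lambda>i. f (c i)) (relations (seq_module A K) (\<lambda>i. {y i}) n b)"
  unfolding leads_def
proof (intro conjI allI impI)
  let ?M = "seq_module A K" and ?Y = "\<lambda>i. {y i}"
  let ?R = "relations ?M ?Y n b"
  show "seq_closed A ?R" by (rule relations_closed[OF K_module y_carrier])
  show "?R \<subseteq> FS n b" by (auto simp: relations_def)
  fix i assume i: "i < n"
  show "b i \<le> f (c i)" by (rule cb(2)[OF i])
  show "f (c i) \<le> f (b i)" by (rule a(2)[OF cb(1)[OF i]])
  have tail: "x \<in> tail_row (b i) (f (c i)) \<longleftrightarrow> x \<in> row (b i) \<and> E (c i) (b i) \<otimes> x = \<zero>" for x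
  proof (cases "x \<in> row (b i)")
    case False then show ?thesis by (simp add: tail_row_def)
  next
    case True
    have xc: "x \<in> carrier A" by (rule row_closed[OF True])
    show ?thesis
    proof (cases "b i < f (c i)")
      case True
      have "E (c i) (b i) \<otimes> x = \<zero> \<longleftrightarrow> (\<forall>j. co (E (c i) (b i) \<otimes> x) (c i) j = 0)"
        using row_eqI[of "E (c i) (b i) \<otimes> x" "c i" \<zero>] row_mult[OF row_E[OF cb(1)[OF i]] xc] row_zero by (auto simp: co_zero)
      also have "\<dots> \<longleftrightarrow> (\<forall>j<f (c i). co x (b i) j = 0)"
        using cb(1)[OF i] True by (auto simp: co_E_mult xc)
      finally show ?thesis using \<open>x \<in> row (b i)\<close> by (auto simp: tail_row_def)
    next
      case False
      then have "E (c i) (b i) = \<zero>" by (simp add: E_zero_iff)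
      moreover have "co x (b i) j = 0" if "j < f (c i)" for j
        using that False by (intro co_out[OF xc]) auto
      ultimately show ?thesis using \<open>x \<in> row (b i)\<close> xc by (simp add: tail_row_def)
    qed
  qed
  show "lead ?R i = tail_row (b i) (f (c i))"
  proof
    show "lead ?R i \<subseteq> tail_row (b i) (f (c i))"
    proof
      fix x assume "x \<in> lead ?R i"
      then obtain s where s: "s \<in> FS n b" "lincomb ?M ?Y s n = \<zero>\<^bsub>?M\<^esub>" "\<And>j. i < j \<Longrightarrow> s j = \<zero>" "x = s i"
        unfolding lead_def relations_def by blast
      have "lincomb ?M ?Y s n = lincomb ?M ?Y s (Suc i)"
        by (rule right_module.lincomb_zero_tail[OF K_module])
          (use i s(3) y_carrier FS_closed[OF s(1)] in auto)
      then have "lincomb ?M ?Y s (Suc i) = {\<lambda>i. \<zero>}" using s(2) by (simp del: lincomb.simps)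
      then have "the_elem (lincomb ?M ?Y s (Suc i)) i = \<zero>" by (simp only: the_elem_eq)
      then have "the_elem (lincomb ?M ?Y s i) i \<oplus> (y i i \<otimes> s i) = \<zero>" unfolding seq_lincomb_Suc by simp
      moreover have "the_elem (lincomb ?M ?Y s i) i = \<zero>" by (rule lincomb_above[OF _ s(1)]) (use i in simp_all)
      ultimately have "E (c i) (b i) \<otimes> x = \<zero>" using FS_closed[OF s(1)] by (simp add: y_diag[OF i] s(4))
      moreover have "x \<in> row (b i)" using s(1,4) i by (simp add: FS_def)
      ultimately show "x \<in> tail_row (b i) (f (c i))" using tail by simp
    qed
    show "tail_row (b i) (f (c i)) \<subseteq> lead ?R i"
    proof
      fix x assume "x \<in> tail_row (b i) (f (c i))"
      then have x: "x \<in> row (b i)" "E (c i) (b i) \<otimes> x = \<zero>" using tail by auto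
      have xc: "x \<in> carrier A" by (rule row_closed[OF x(1)])
      note k = seq_closedD[OF Kc]
      \<comment> \<open>this multiple of the basis element has lost its leading entry, so the lower
        basis elements express it\<close>
      have sK: "(\<lambda>j. y i j \<otimes> (\<ominus> x)) \<in> K" by (rule k(4)[OF y_K[OF i]]) (simp add: xc)
      have "y i j \<otimes> (\<ominus> x) = \<zero>" if "i \<le> j" for j
      proof (cases "j = i")
        case True then show ?thesis using x(2) by (simp add: y_diag[OF i] r_minus xc)
      next
        case False then show ?thesis using that xc by (simp add: y_above[OF i])
      qed
      from standard_basis_span[OF _ sK this, of i] i obtain t where
        t: "t \<in> FS i b" "{\<lambda>j. y i j \<otimes> (\<ominus> x)} = lincomb ?M ?Y t i" by auto
      define t' where "t' = (\<lambda>j. if j = i then x else t j)"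
      have "t j \<in> row (b j)" for j using t(1) by (cases "j < i") (auto simp: FS_def row_zero)
      then have t'F: "t' \<in> FS n b" using t(1) x(1) i by (auto simp: FS_def t'_def)
      have "lincomb ?M ?Y t' n = lincomb ?M ?Y t' (Suc i)"
        by (rule right_module.lincomb_zero_tail[OF K_module])
          (use i y_carrier FS_closed[OF t'F] t(1) in \<open>auto simp: t'_def FS_def\<close>)
      also have "\<dots> = \<zero>\<^bsub>?M\<^esub>"
      proof -
        have "lincomb ?M ?Y t' i = {\<lambda>j. y i j \<otimes> (\<ominus> x)}"
          unfolding t(2) by (rule lincomb_cong) (simp_all add: t'_def)
        moreover have "y i j \<otimes> (\<ominus> x) \<oplus> y i j \<otimes> x = \<zero>" for j
          using k(1)[OF y_K[OF i], of j] xc by (simp add: r_minus l_neg)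
        ultimately show ?thesis by (simp add: t'_def)
      qed
      finally have "t' \<in> ?R" using t'F by (simp add: relations_def)
      moreover have "\<forall>j>i. t' j = \<zero>" using t(1) by (simp add: t'_def FS_def)
      ultimately show "x \<in> lead ?R i" unfolding lead_def by (intro CollectI exI[of _ t']) (simp add: t'_def)
    qed
  qed
qed

end

lemma leads_zero:
  assumes "leads n c b K" "s \<in> K" "\<And>i. i < n \<Longrightarrow> b i = f (c i) \<or> s i = \<zero>"
  shows "s = (\<lambda>i. \<zero>)"
proof (rule ccontr)
  assume "s \<noteq> (\<lambda>i. \<zero>)"
  then obtain j where j: "s j \<noteq> \<zero>" by auto
  have F: "s \<in> FS n c" using assms by (auto simp: leads_def)
  define S where "S = {j. s j \<noteq> \<zero>}"
  have "S \<subseteq> {..<n}" using F unfolding S_def FS_def by (auto simp: not_le[symmetric])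
  then have fin: "finite S" by (rule finite_subset) simp
  define i where "i = Max S"
  have iS: "i \<in> S" unfolding i_def using fin j by (intro Max_in) (auto simp: S_def)
  have i: "i < n" "s i \<noteq> \<zero>" using iS \<open>S \<subseteq> {..<n}\<close> by (auto simp: S_def)
  have "\<forall>j>i. s j = \<zero>" using Max_ge[OF fin] unfolding i_def S_def by (meson mem_Collect_eq not_le)
  then have "s i \<in> lead K i" using assms(2) unfolding lead_def by blast
  moreover have "lead K i = tail_row (c i) (b i)" using assms(1) i(1) by (simp add: leads_def)
  moreover have "b i = f (c i)" using assms(3)[OF i(1)] i(2) by simp
  ultimately have t: "s i \<in> tail_row (c i) (f (c i))" by simp
  have "s i = \<zero>"
    by (rule row_eqI[of _ "c i"]) (use t in \<open>auto simp: tail_row_def row_zero co_zero\<close>)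
  then show False using i by simp
qed

text \<open>
  If each leading right ideal is zero or projective, then the coefficients with respect to the
  standard basis are unique, because a nonzero relation would have a nonzero leading term.
\<close>

lemma leads_projective:
  assumes L: "leads n c b K" and st: "\<And>i. i < n \<Longrightarrow> b i = f (c i) \<or> f (b i) = f (c i)"
  shows "projective_module A (seq_module A K)"
proof -
  obtain y where y: "standard_basis n c b K y" by (rule standard_basis_exists[OF L])
  let ?M = "seq_module A K" and ?Y = "\<lambda>i. {y i}"
  have M: "right_module A ?M" by (rule K_module[OF L y])
  interpret M: right_module A ?M by (rule M)
  have Yc: "?Y i \<in> carrier ?M" if "i < n" for i by (rule y_carrier[OF L y that])
  \<comment> \<open>coefficients at zero leading entries are normalised to zero\<close>
  define F where "F = {s \<in> FS n b. \<forall>i<n. b i = f (c i) \<longrightarrow> s i = \<zero>}"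
  have Fc: "seq_closed A F"
    using FS_seq_closed[of n b] unfolding seq_closed_def F_def by auto
  have R: "leads n b (\<lambda>i. f (c i)) (relations ?M ?Y n b)" by (rule relations_leads[OF L y])
  have KF: "K \<subseteq> FS n c" using L by (simp add: leads_def)
  show ?thesis
  proof (rule projective_of_basis[OF M Fc Yc])
    fix X assume "X \<in> carrier ?M"
    then obtain s where s: "s \<in> K" "X = {s}" by auto
    have "s j = \<zero>" if "n \<le> j" for j using that s(1) KF by (auto simp: FS_def)
    from standard_basis_span[OF L y order_refl s(1) this] obtain q0 where
      q0: "q0 \<in> F" "X = lincomb ?M ?Y q0 n" using s(2) unfolding F_def by auto
    have FF: "q \<in> F \<Longrightarrow> q \<in> FS n b" for q by (simp add: F_def)
    show "\<exists>!q. q \<in> F \<and> X = lincomb ?M ?Y q n"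
    proof (rule ex_ex1I)
      show "\<exists>q. q \<in> F \<and> X = lincomb ?M ?Y q n" using q0 by blast
      fix q r assume "q \<in> F \<and> X = lincomb ?M ?Y q n" and "r \<in> F \<and> X = lincomb ?M ?Y r n"
      then have q: "q \<in> F" "X = lincomb ?M ?Y q n" and r: "r \<in> F" "X = lincomb ?M ?Y r n" by auto
      have qc: "q i \<in> carrier A" and rc: "r i \<in> carrier A" for i
        using FS_closed[OF FF[OF q(1)]] FS_closed[OF FF[OF r(1)]] by auto
      have Xc: "X \<in> carrier ?M" using s by simp
      define d where "d = (\<lambda>i. q i \<oplus> r i \<otimes> (\<ominus> \<one>))"
      have d: "d i = q i \<ominus> r i" for i using rc by (simp add: d_def r_minus minus_eq)
      have dF: "d \<in> F" unfolding d using seq_closed_minus[OF Fc q(1) r(1)] unfolding d[symmetric] by simp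
      have "lincomb ?M ?Y d n = lincomb ?M ?Y q n \<oplus>\<^bsub>?M\<^esub> lincomb ?M ?Y (\<lambda>i. r i \<otimes> (\<ominus> \<one>)) n"
        unfolding d_def by (rule M.lincomb_add) (use Yc qc rc in auto)
      also have "lincomb ?M ?Y (\<lambda>i. r i \<otimes> (\<ominus> \<one>)) n = (\<ominus> \<one>) \<odot>\<^bsub>?M\<^esub> lincomb ?M ?Y r n"
        by (rule M.lincomb_smult) (use Yc rc in auto)
      also have "\<dots> = \<ominus>\<^bsub>?M\<^esub> X" using M.minus_as_smult[OF Xc] r(2) by simp
      also have "lincomb ?M ?Y q n \<oplus>\<^bsub>?M\<^esub> (\<ominus>\<^bsub>?M\<^esub> X) = \<zero>\<^bsub>?M\<^esub>"
        unfolding q(2)[symmetric] by (rule M.M.r_neg[OF Xc])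
      finally have dR: "d \<in> relations ?M ?Y n b" using FF[OF dF] by (simp add: relations_def)
      have "d = (\<lambda>i. \<zero>)"
      proof (rule leads_zero[OF R dR])
        show "f (c i) = f (b i) \<or> d i = \<zero>" if "i < n" for i using st[OF that] dF that by (auto simp: F_def)
      qed
      then have "q i \<ominus> r i = \<zero>" for i using d by metis
      moreover have "(q i \<ominus> r i) \<oplus> r i = q i" for i using qc[of i] rc[of i] by (simp add: minus_eq a_assoc l_neg)
      ultimately show "q = r" using rc by (intro ext) (metis l_zero)
    qed
  qed
qed
text \<open>
  A submodule of \<open>FS n c\<close> with leading data \<open>b\<close> is filtered by first
  syzygies of the pairs \<open>(c i, b i)\<close>, which accounts for the shift from \<open>Suc
  d\<close> to \<open>d\<close>.
\<close>

lemma leads_has_res: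
  "leads n c b K \<Longrightarrow> (\<And>i. i < n \<Longrightarrow> stop f (Suc d) (c i) (b i)) \<Longrightarrow> has_res A (seq_module A K) d"
proof (induction d arbitrary: n c b K)
  case 0
  have "b i = f (c i) \<or> f (b i) = f (c i)" if "i < n" for i using 0(2)[OF that] by auto
  then show ?case by (rule has_res_0[OF leads_projective[OF 0(1)]])
next
  case (Suc d)
  obtain y where y: "standard_basis n c b K y" by (rule standard_basis_exists[OF Suc.prems(1)])
  let ?M = "seq_module A K" and ?Y = "\<lambda>i. {y i}"
  have M: "right_module A ?M" by (rule K_module[OF Suc.prems(1) y])
  have Yc: "?Y i \<in> carrier ?M" if "i < n" for i by (rule y_carrier[OF Suc.prems(1) y that])
  have KF: "K \<subseteq> FS n c" using Suc.prems(1) by (simp add: leads_def)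
  have span: "\<exists>t\<in>FS n b. X = lincomb ?M ?Y t n" if X: "X \<in> carrier ?M" for X
  proof -
    obtain s where s: "s \<in> K" "X = {s}" using X by auto
    have "s j = \<zero>" if "n \<le> j" for j using that s(1) KF by (auto simp: FS_def)
    from standard_basis_span[OF Suc.prems(1) y order_refl s(1) this] show ?thesis using s(2) by auto
  qed
  have IH: "has_res A (seq_module A (relations ?M ?Y n b)) d"
    by (rule Suc.IH[OF relations_leads[OF Suc.prems(1) y]]) (use Suc.prems(2) in auto)
  show ?case
  proof (rule has_res_Suc[OF FS_projective])
    show "cover_map ?M ?Y n b \<in> mod_hom A (seq_module A (FS n b)) ?M" by (rule cover_map_hom[OF M Yc])
    show "cover_map ?M ?Y n b ` carrier (seq_module A (FS n b)) = carrier ?M" by (rule cover_map_onto[OF M Yc span])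
    show "has_res A ((seq_module A (FS n b))\<lparr>carrier := hom_kernel (seq_module A (FS n b)) ?M (cover_map ?M ?Y n b)\<rparr>) d"
      unfolding cover_map_kernel seq_module_carrier_update by (rule IH)
  qed
qed

text \<open>
  A module is covered by some \<open>FS n c\<close>, and the kernel has leading data to which the
  preceding resolution applies.
\<close>

theorem gl_dim_bound:
  assumes "\<And>i j. i \<le> j \<Longrightarrow> j \<le> f i \<Longrightarrow> stop f (Suc d) i j"
  shows "gl_dim A \<le> enat (Suc d)"
proof (rule gl_dim_le)
  fix M :: "'a rmod" assume fg: "fg_module A M"
  then have M: "right_module A M" by (simp add: fg_module_def)
  obtain n c y where y: "\<And>i. i < n \<Longrightarrow> y i \<in> carrier M"
    "\<And>x. x \<in> carrier M \<Longrightarrow> \<exists>s\<in>FS n c. x = lincomb M y s n" using fg_cover[OF fg] by metis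
  obtain b where b: "leads n c b (relations M y n c)"
    by (rule leads_exist[OF relations_closed[OF M y(1)]]) (auto simp: relations_def)
  show "has_res A M (Suc d)"
  proof (rule has_res_Suc[OF FS_projective])
    show "cover_map M y n c \<in> mod_hom A (seq_module A (FS n c)) M" by (rule cover_map_hom[OF M y(1)])
    show "cover_map M y n c ` carrier (seq_module A (FS n c)) = carrier M" by (rule cover_map_onto[OF M y])
    show "has_res A ((seq_module A (FS n c))\<lparr>carrier := hom_kernel (seq_module A (FS n c)) M (cover_map M y n c)\<rparr>) d"
      unfolding cover_map_kernel seq_module_carrier_update
      by (rule leads_has_res[OF b]) (use b assms in \<open>auto simp: leads_def\<close>)
  qed
qed

end

section \<open>Exact pairs and simple modules\<close>

context nak
begin
text \<open>
  One half of the exactness of the pair \<open>t, t'\<close> on the summand \<open>H \<cdot>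
  ee\<close>; in the application \<open>t\<close> and \<open>t'\<close> have product zero, which is
  the other inclusion.
\<close>

definition exact_at :: "'a \<Rightarrow> 'a \<Rightarrow> 'a \<Rightarrow> ('a, 'm) module \<Rightarrow> 'm set \<Rightarrow> bool" where
  "exact_at ee t t' M H \<longleftrightarrow> (\<forall>x\<in>H. ee \<odot>\<^bsub>M\<^esub> x = x \<and> t \<odot>\<^bsub>M\<^esub> x = \<zero>\<^bsub>M\<^esub> \<longrightarrow> (\<exists>y\<in>H. ee \<odot>\<^bsub>M\<^esub> y = y \<and> x = t' \<odot>\<^bsub>M\<^esub> y))"

definition biexact :: "'a \<Rightarrow> 'a \<Rightarrow> 'a \<Rightarrow> ('a, 'm) module \<Rightarrow> 'm set \<Rightarrow> bool" where
  "biexact ee t t' M H \<longleftrightarrow> exact_at ee t t' M H \<and> exact_at ee t' t M H"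

text \<open>
  A connecting homomorphism argument: lift \<open>x\<close> to \<open>p\<close>; then \<open>p
  \<cdot> t\<close> is in the kernel of \<open>h\<close> and is annihilated by \<open>t'\<close>,
  so it is \<open>k \<cdot> t\<close> with \<open>k\<close> in the kernel, and \<open>p - k\<close>
  is a lift of \<open>x\<close> annihilated by \<open>t\<close>. Exactness for the kernel is needed
  with the roles of \<open>t\<close> and \<open>t'\<close> exchanged.
\<close>

lemma exact_at_image:
  assumes PM: "right_module A P" "right_module A M" and h: "h \<in> mod_hom A P M"
    and ee: "ee \<in> carrier A" "ee \<otimes> ee = ee"
    and t: "t \<in> carrier A" "t' \<in> carrier A" "t \<otimes> t' = \<zero>" "ee \<otimes> t = t" "t \<otimes> ee = t" "ee \<otimes> t' = t'" "t' \<otimes> ee = t'"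
    and P: "exact_at ee t t' P (carrier P)" and K: "exact_at ee t' t P (hom_kernel P M h)"
  shows "exact_at ee t t' M (h ` carrier P)"
  unfolding exact_at_def
proof (intro ballI impI, elim conjE)
  interpret P: right_module A P by (rule PM(1))
  interpret M: right_module A M by (rule PM(2))
  note hh = mod_homD[OF h]
  fix x assume x: "x \<in> h ` carrier P" "ee \<odot>\<^bsub>M\<^esub> x = x" "t \<odot>\<^bsub>M\<^esub> x = \<zero>\<^bsub>M\<^esub>"
  then obtain p0 where p0: "p0 \<in> carrier P" "x = h p0" by auto
  define p where "p = ee \<odot>\<^bsub>P\<^esub> p0"
  have p: "p \<in> carrier P" "ee \<odot>\<^bsub>P\<^esub> p = p" "h p = x"
  proof -
    show "p \<in> carrier P" unfolding p_def by (rule P.smult_closed[OF ee(1) p0(1)])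
    show "ee \<odot>\<^bsub>P\<^esub> p = p" using P.smult_mult[OF ee(1) ee(1) p0(1)] unfolding p_def ee(2) by simp
    show "h p = x" unfolding p_def hh(3)[OF ee(1) p0(1)] using x(2) p0(2) by simp
  qed
  define q where "q = t \<odot>\<^bsub>P\<^esub> p"
  have q: "q \<in> carrier P" unfolding q_def by (rule P.smult_closed[OF t(1) p(1)])
  have qK: "q \<in> hom_kernel P M h"
    using q hh(3)[OF t(1) p(1)] x(3) p(3) by (simp add: hom_kernel_def q_def)
  have "ee \<odot>\<^bsub>P\<^esub> q = q" using P.smult_mult[OF t(1) ee(1) p(1)] unfolding q_def t(5) by simp
  moreover have "t' \<odot>\<^bsub>P\<^esub> q = \<zero>\<^bsub>P\<^esub>"
    using P.smult_mult[OF t(1) t(2) p(1)] P.smult_l_null[OF p(1)] unfolding q_def t(3) by simp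
  ultimately obtain k where k: "k \<in> hom_kernel P M h" "ee \<odot>\<^bsub>P\<^esub> k = k" "q = t \<odot>\<^bsub>P\<^esub> k"
    using K qK unfolding exact_at_def by blast
  have kc: "k \<in> carrier P" "h k = \<zero>\<^bsub>M\<^esub>" using k(1) by (simp_all add: hom_kernel_def)
  define d where "d = p \<oplus>\<^bsub>P\<^esub> (\<ominus>\<^bsub>P\<^esub> k)"
  have nk: "\<ominus>\<^bsub>P\<^esub> k \<in> carrier P" using kc(1) by simp
  have d: "d \<in> carrier P" using p(1) nk by (simp add: d_def)
  have "ee \<odot>\<^bsub>P\<^esub> d = d"
    unfolding d_def P.smult_r_distr[OF ee(1) p(1) nk] P.smult_r_minus[OF ee(1) kc(1)] p(2) k(2) ..
  moreover have "t \<odot>\<^bsub>P\<^esub> d = \<zero>\<^bsub>P\<^esub>"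
    unfolding d_def P.smult_r_distr[OF t(1) p(1) nk] P.smult_r_minus[OF t(1) kc(1)] k(3)[symmetric] q_def[symmetric]
    by (rule P.M.r_neg[OF q])
  ultimately obtain y where y: "y \<in> carrier P" "ee \<odot>\<^bsub>P\<^esub> y = y" "d = t' \<odot>\<^bsub>P\<^esub> y"
    using P d unfolding exact_at_def by blast
  have "h (d \<oplus>\<^bsub>P\<^esub> k) = h d \<oplus>\<^bsub>M\<^esub> h k" by (rule hh(2)[OF d kc(1)])
  moreover have "d \<oplus>\<^bsub>P\<^esub> k = p" unfolding d_def using p(1) kc(1) by (simp add: P.M.a_assoc P.M.l_neg)
  ultimately have "h d = x" using p(3) kc(2) hh(1)[OF d] by simp
  then have "x = t' \<odot>\<^bsub>M\<^esub> h y" using y(3) hh(3)[OF t(2) y(1)] by simp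
  moreover have "ee \<odot>\<^bsub>M\<^esub> h y = h y" using hh(3)[OF ee(1) y(1)] y(2) by simp
  ultimately show "\<exists>y\<in>h ` carrier P. ee \<odot>\<^bsub>M\<^esub> y = y \<and> x = t' \<odot>\<^bsub>M\<^esub> y" using y(1) by blast
qed

text \<open>
  Lift the identity of \<open>P\<close> along a cover by some \<open>FS n b\<close>. Properties of
  rows pass to all projective modules in this way.
\<close>

lemma projective_split:
  fixes P :: "'a rmod"
  assumes P: "projective_module A P"
  obtains n b g h where "g \<in> mod_hom A (seq_module A (FS n b)) P" "h \<in> mod_hom A P (seq_module A (FS n b))"
    "\<And>x. x \<in> carrier P \<Longrightarrow> g (h x) = x"
proof -
  have fg: "fg_module A P" using P by (simp add: projective_module_def)
  then have M: "right_module A P" by (simp add: fg_module_def)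
  interpret right_module A P by (rule M)
  obtain n b y where y: "\<And>i. i < n \<Longrightarrow> y i \<in> carrier P"
    "\<And>x. x \<in> carrier P \<Longrightarrow> \<exists>s\<in>FS n b. x = lincomb P y s n" using fg_cover[OF fg] by metis
  let ?F = "seq_module A (FS n b)"
  have 1: "fg_module A ?F" using FS_projective[of n b] by (simp add: projective_module_def)
  have 2: "cover_map P y n b \<in> mod_hom A ?F P" by (rule cover_map_hom[OF M y(1)])
  have 3: "cover_map P y n b ` carrier ?F = carrier P" by (rule cover_map_onto[OF M y])
  have 4: "(\<lambda>x\<in>carrier P. x) \<in> mod_hom A P P" by (simp add: mod_hom_def smult_closed)
  have "\<exists>h\<in>mod_hom A P ?F. \<forall>x\<in>carrier P. cover_map P y n b (h x) = (\<lambda>x\<in>carrier P. x) x"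
    using P 1 2 3 4 fg unfolding projective_module_def by blast
  then obtain h where h: "h \<in> mod_hom A P ?F" "\<And>x. x \<in> carrier P \<Longrightarrow> cover_map P y n b (h x) = x" by auto
  show ?thesis by (rule that[OF 2 h])
qed

lemma exact_at_projective:
  fixes P :: "'a rmod"
  assumes P: "projective_module A P" and ee: "ee \<in> carrier A"
    and t: "t \<in> carrier A" "t' \<in> carrier A"
    and ex: "\<And>i x. x \<in> row i \<Longrightarrow> x \<otimes> ee = x \<Longrightarrow> x \<otimes> t = \<zero> \<Longrightarrow> \<exists>y\<in>row i. y \<otimes> ee = y \<and> x = y \<otimes> t'"
  shows "exact_at ee t t' P (carrier P)"
  unfolding exact_at_def
proof (intro ballI impI, elim conjE)
  have M: "right_module A P" using P by (simp add: projective_module_def fg_module_def)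
  interpret P: right_module A P by (rule M)
  obtain n b g h where g: "g \<in> mod_hom A (seq_module A (FS n b)) P" and h: "h \<in> mod_hom A P (seq_module A (FS n b))"
    and gh: "\<And>x. x \<in> carrier P \<Longrightarrow> g (h x) = x" by (rule projective_split[OF P]) blast
  let ?F = "seq_module A (FS n b)"
  fix x assume x: "x \<in> carrier P" "ee \<odot>\<^bsub>P\<^esub> x = x" "t \<odot>\<^bsub>P\<^esub> x = \<zero>\<^bsub>P\<^esub>"
  obtain s where s: "s \<in> FS n b" "h x = {s}" using mod_homD(1)[OF h x(1)] by auto
  have "{\<lambda>i. s i \<otimes> ee} = {s}" using mod_homD(3)[OF h ee x(1)] x(2) s(2) by simp
  then have see: "s i \<otimes> ee = s i" for i by (metis singleton_inject)
  have "{\<lambda>i. s i \<otimes> t} = {\<lambda>i. \<zero>}" using mod_homD(3)[OF h t(1) x(1)] x(3) s(2) mod_hom_zero[OF M FS_module h] by simp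
  then have st: "s i \<otimes> t = \<zero>" for i by (metis singleton_inject)
  have "\<exists>y. y \<in> (if i < n then row (b i) else {\<zero>}) \<and> y \<otimes> ee = y \<and> s i = y \<otimes> t'" for i
  proof (cases "i < n")
    case True
    then have "s i \<in> row (b i)" using s(1) by (simp add: FS_def)
    from ex[OF this see st] show ?thesis using True by auto
  next
    case False
    then have "s i = \<zero>" using s(1) by (simp add: FS_def)
    then show ?thesis using False ee t by simp
  qed
  then obtain u where u: "\<And>i. u i \<in> (if i < n then row (b i) else {\<zero>})" "\<And>i. u i \<otimes> ee = u i" "\<And>i. s i = u i \<otimes> t'" by metis
  have "u i \<in> row (b i)" if "i < n" for i using u(1)[of i] that by simp
  moreover have "u i = \<zero>" if "n \<le> i" for i using u(1)[of i] that by simp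
  ultimately have uF: "u \<in> FS n b" unfolding FS_def by blast
  have uc: "{u} \<in> carrier ?F" using uF by simp
  have "t' \<odot>\<^bsub>?F\<^esub> {u} = h x" unfolding s(2) using ext[of s "\<lambda>i. u i \<otimes> t'", OF u(3)] by simp
  then have "g (t' \<odot>\<^bsub>?F\<^esub> {u}) = x" using gh[OF x(1)] by simp
  then have "x = t' \<odot>\<^bsub>P\<^esub> g {u}" using mod_homD(3)[OF g t(2) uc] by simp
  moreover have "ee \<odot>\<^bsub>?F\<^esub> {u} = {u}" using u(2) by simp
  then have "ee \<odot>\<^bsub>P\<^esub> g {u} = g {u}" using mod_homD(3)[OF g ee uc] by simp
  ultimately show "\<exists>y\<in>carrier P. ee \<odot>\<^bsub>P\<^esub> y = y \<and> x = t' \<odot>\<^bsub>P\<^esub> y" using mod_homD(1)[OF g uc] by blast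
qed

text \<open>
  Exactness of the pair \<open>t, t'\<close> holds for projective modules since it holds for rows,
  and it passes to cokernels by \<open>exact_at_image\<close>. Going down a finite resolution,
  which ends in zero, it reaches \<open>M\<close>.
\<close>

lemma biexact_resolution:
  fixes M :: "'a rmod"
  assumes M: "right_module A M" and res: "has_res A M n"
    and ee: "ee \<in> carrier A" "ee \<otimes> ee = ee"
    and t: "t \<in> carrier A" "t' \<in> carrier A" "t \<otimes> t' = \<zero>" "t' \<otimes> t = \<zero>"
      "ee \<otimes> t = t" "t \<otimes> ee = t" "ee \<otimes> t' = t'" "t' \<otimes> ee = t'"
    and ex: "\<And>i x. x \<in> row i \<Longrightarrow> x \<otimes> ee = x \<Longrightarrow> x \<otimes> t = \<zero> \<Longrightarrow> \<exists>y\<in>row i. y \<otimes> ee = y \<and> x = y \<otimes> t'"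
      "\<And>i x. x \<in> row i \<Longrightarrow> x \<otimes> ee = x \<Longrightarrow> x \<otimes> t' = \<zero> \<Longrightarrow> \<exists>y\<in>row i. y \<otimes> ee = y \<and> x = y \<otimes> t"
  shows "biexact ee t t' M (carrier M)"
proof -
  from res obtain P d p where pr: "projective_resolution A M n P d p" unfolding has_res_def by blast
  have r: "\<And>i. projective_module A (P i)" "\<And>i. i > n \<Longrightarrow> carrier (P i) = {\<zero>\<^bsub>P i\<^esub>}"
      "p \<in> mod_hom A (P 0) M" "p ` carrier (P 0) = carrier M" "\<And>i. d i \<in> mod_hom A (P (Suc i)) (P i)"
      "d 0 ` carrier (P 1) = hom_kernel (P 0) M p"
      "\<And>i. d (Suc i) ` carrier (P (Suc (Suc i))) = hom_kernel (P (Suc i)) (P i) (d i)"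
    using pr unfolding projective_resolution_def by simp_all
  have Pm: "right_module A (P i)" for i using r(1)[of i] by (simp add: projective_module_def fg_module_def)
  have Pe: "exact_at ee t t' (P i) (carrier (P i))" "exact_at ee t' t (P i) (carrier (P i))" for i
    using exact_at_projective[OF r(1) ee(1) t(1,2) ex(1)] exact_at_projective[OF r(1) ee(1) t(2,1) ex(2)] by blast+
  have step: "biexact ee t t' N (h ` carrier (P i))"
    if "right_module A N" "h \<in> mod_hom A (P i) N" "biexact ee t t' (P i) (hom_kernel (P i) N h)" for N :: "'a rmod" and h i
  proof -
    have k: "exact_at ee t t' (P i) (hom_kernel (P i) N h)" "exact_at ee t' t (P i) (hom_kernel (P i) N h)"
      using that(3) by (auto simp: biexact_def)
    show ?thesis unfolding biexact_def
      using exact_at_image[OF Pm that(1,2) ee t(1,2,3,5-8) Pe(1) k(2)]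
        exact_at_image[OF Pm that(1,2) ee t(2,1,4,7,8,5,6) Pe(2) k(1)] by blast
  qed
  \<comment> \<open>downward induction along the resolution, starting beyond its last term\<close>
  have "biexact ee t t' (P (Suc n - k)) (d (Suc n - k) ` carrier (P (Suc (Suc n - k))))" if "k \<le> Suc n" for k
    using that
  proof (induction k)
    case 0
    have z: "carrier (P (Suc (Suc n))) = {\<zero>\<^bsub>P (Suc (Suc n))\<^esub>}" by (rule r(2)) simp
    have "d (Suc n) ` carrier (P (Suc (Suc n))) = {\<zero>\<^bsub>P (Suc n)\<^esub>}"
      unfolding z using mod_hom_zero[OF Pm Pm r(5)] by simp
    then show ?case using right_module.smult_r_null[OF Pm] ee(1) t(1,2) by (simp add: biexact_def exact_at_def)
  next
    case (Suc k)
    then have e: "Suc n - k = Suc (Suc n - Suc k)" by simp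
    have "biexact ee t t' (P (Suc n - k)) (d (Suc n - k) ` carrier (P (Suc (Suc n - k))))"
      using Suc by simp
    then have "biexact ee t t' (P (Suc (Suc n - Suc k))) (hom_kernel (P (Suc (Suc n - Suc k))) (P (Suc n - Suc k)) (d (Suc n - Suc k)))"
      unfolding e r(7) .
    then show ?case by (rule step[OF Pm r(5)])
  qed
  from this[of "Suc n"] have "biexact ee t t' (P 0) (hom_kernel (P 0) M p)" using r(6) by simp
  from step[OF M r(3) this] show ?thesis unfolding r(4) .
qed
text \<open>
  The simple modules are one-dimensional; a scalar \<open>c\<close> is coded by a singleton in the
  universe of modules.
\<close>

definition enc :: "'k \<Rightarrow> (nat \<Rightarrow> 'a) set" where "enc c = {\<lambda>i. c \<odot> \<one>}"

definition dec :: "(nat \<Rightarrow> 'a) set \<Rightarrow> 'k" where "dec X = co (the_elem X 0) 0 0"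

lemma dec_enc [simp]: "dec (enc c) = c" by (simp add: dec_def enc_def co_smult co_one)

definition simple_mod :: "int \<Rightarrow> 'a rmod" where
  "simple_mod i = \<lparr>carrier = range enc, monoid.mult = undefined, one = undefined, zero = enc 0,
     add = (\<lambda>X Y. enc (dec X + dec Y)), module.smult = (\<lambda>x X. enc (dec X * co x i i))\<rparr>"

lemma simple_mod_simps [simp]:
  "carrier (simple_mod i) = range enc" "zero (simple_mod i) = enc 0"
  "X \<oplus>\<^bsub>simple_mod i\<^esub> Y = enc (dec X + dec Y)" "x \<odot>\<^bsub>simple_mod i\<^esub> X = enc (dec X * co x i i)"
  by (simp_all add: simple_mod_def)

lemma co_mult_diag: "x \<in> carrier A \<Longrightarrow> y \<in> carrier A \<Longrightarrow> co (x \<otimes> y) i i = co x i i * co y i i"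
  using a(4)[of i] by (simp add: co_mult)

lemma simple_mod_module: "right_module A (simple_mod i)"
proof (intro right_module.intro right_module_axioms.intro)
  show "ring A" by (rule ring_axioms)
  show "abelian_group (simple_mod i)"
  proof (rule abelian_groupI)
    fix X assume "X \<in> carrier (simple_mod i)"
    then show "\<exists>Y\<in>carrier (simple_mod i). Y \<oplus>\<^bsub>simple_mod i\<^esub> X = \<zero>\<^bsub>simple_mod i\<^esub>"
      by (intro bexI[of _ "enc (- dec X)"]) auto
  qed (auto simp: algebra_simps)
qed (auto simp: algebra_simps co_add co_mult_diag co_one)

lemma enc_inj: "enc c = enc d \<longleftrightarrow> c = d" by (metis dec_enc)

lemma simple_mod_simple: "simple_module A (simple_mod i)"
  unfolding simple_module_def
proof (intro conjI allI impI)
  interpret right_module A "simple_mod i" by (rule simple_mod_module)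
  show "right_module A (simple_mod i)" by (rule simple_mod_module)
  have "enc 1 \<noteq> enc 0" by (simp add: enc_inj)
  then show "carrier (simple_mod i) \<noteq> {\<zero>\<^bsub>simple_mod i\<^esub>}" by auto
  fix H assume H: "submodule H A (simple_mod i)"
  note d = submoduleD[OF H]
  show "H = {\<zero>\<^bsub>simple_mod i\<^esub>} \<or> H = carrier (simple_mod i)"
  proof (cases "H = {enc 0}")
    case False
    then obtain X where "X \<in> H" "X \<noteq> enc 0" using d(3) by auto
    then obtain c where c: "enc c \<in> H" "c \<noteq> 0" using d(1) by auto
    have "enc x \<in> H" for x
      using d(5)[OF k_algebra.smult_closed[OF k_algebra_axioms one_closed, of "x / c"] c(1)] c(2) by (simp add: co_smult co_one)
    then show ?thesis using d(1) by auto
  qed simp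
qed

lemma simple_mod_fg: "fg_module A (simple_mod i)"
  unfolding fg_module_def
proof (intro conjI simple_mod_module exI[of _ "{enc 1}"] allI impI)
  show "{enc 1} \<subseteq> carrier (simple_mod i)" by simp
  fix H assume H: "submodule H A (simple_mod i) \<and> {enc 1} \<subseteq> H"
  then have "H \<noteq> {\<zero>\<^bsub>simple_mod i\<^esub>}" by (auto simp: enc_inj)
  then show "H = carrier (simple_mod i)" using H simple_mod_simple[of i] unfolding simple_module_def by blast
qed simp

lemma simple_mod_at: "simple_at A (e i) (simple_mod i)"
  unfolding simple_at_def using simple_mod_simple by (auto simp: co_e enc_inj intro!: exI[of _ 1])

end

section \<open>Infinite global dimension\<close>

text \<open>
  The function \<open>f\<close> becomes a shift by \<open>c \<ge> 2\<close> after a monotone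
  periodic projection \<open>p\<close>. This is the situation at the top of a tower of reductions
  that ends with a self-injective algebra.
\<close>

locale jump = nak A N f Phi for A :: "('k::field, 'a) module" (structure) and N f Phi +
  fixes p :: "int \<Rightarrow> int" and n c :: int
  assumes p_mono: "mono p" and p_surj: "surj p" and p_per: "\<And>i. p (i + N) = p i + n"
    and p_f: "\<And>i. p (f i) = p i + c" and c: "2 \<le> c"
begin

text \<open>
  The last point of the fibre of \<open>p\<close> over \<open>j\<close>. These points behave like
  the vertices of a cycle on which all nonzero paths have length less than \<open>c\<close>.
\<close>

definition u :: "int \<Rightarrow> int" where "u j = (GREATEST i. p i = j)"

lemma u_ex: "\<exists>m. p m = j \<and> (\<forall>i. p i = j \<longrightarrow> i \<le> m)"
proof -
  obtain i0 where i0: "p i0 = j" using p_surj by (metis surjD)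
  obtain i1 where i1: "p i1 = j + 1" using p_surj by (metis surjD)
  have le: "i \<le> i1" if "p i = j" for i
  proof (rule ccontr)
    assume "\<not> i \<le> i1"
    then have "p i1 \<le> p i" using p_mono by (simp add: mono_def)
    then show False using i1 that by simp
  qed
  obtain m where m: "p m = j" "m \<le> i1" "\<And>i. i \<le> i1 \<Longrightarrow> p i = j \<Longrightarrow> i \<le> m"
    by (rule greatest_int_le[of "\<lambda>i. p i = j" i0 i1, OF i0 le[OF i0]]) blast
  then show ?thesis using le by blast
qed

lemma u: "p (u j) = j" "p i = j \<Longrightarrow> i \<le> u j"
proof -
  obtain m where m: "p m = j" "\<And>i. p i = j \<Longrightarrow> i \<le> m" using u_ex by blast
  have "u j = m" unfolding u_def by (rule Greatest_equality) (use m in auto)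
  then show "p (u j) = j" "p i = j \<Longrightarrow> i \<le> u j" using m by auto
qed

lemma le_u_iff: "i \<le> u j \<longleftrightarrow> p i \<le> j"
proof
  assume "i \<le> u j" then show "p i \<le> j" using p_mono u(1)[of j] by (metis monoD)
next
  assume *: "p i \<le> j"
  show "i \<le> u j"
  proof (rule ccontr)
    assume "\<not> i \<le> u j"
    then have "p (u j) \<le> p i" using p_mono by (simp add: mono_def)
    then have "p i = j" using * u(1)[of j] by simp
    from u(2)[OF this] show False using \<open>\<not> i \<le> u j\<close> by simp
  qed
qed

lemma u_le: "u i \<le> u j \<longleftrightarrow> i \<le> j" by (simp add: le_u_iff u(1))

lemma u_eq: "u i = u j \<longleftrightarrow> i = j" by (metis u(1))

lemma u_per: "u (j + n) = u j + N"
proof (rule antisym)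
  have "p (u (j + n) - N) = j" using p_per[of "u (j + n) - N"] u(1)[of "j + n"] by simp
  then show "u (j + n) \<le> u j + N" using u(2) by fastforce
  have "p (u j + N) = j + n" using p_per[of "u j"] u(1) by simp
  then show "u j + N \<le> u (j + n)" by (rule u(2))
qed

lemma u_f: "0 \<le> d \<Longrightarrow> u (j + d) < f (u j) \<longleftrightarrow> d < c"
proof -
  have "f (u j) \<le> u (j + d) \<longleftrightarrow> j + c \<le> j + d" by (simp add: le_u_iff p_f u(1))
  then show ?thesis by linarith
qed

text \<open>
  The sum of the paths from \<open>u j\<close> to \<open>u (j + d)\<close>. In particular \<open>T
  0\<close> is the idempotent of the points \<open>u j\<close>, and \<open>T d\<close> is the
  \<open>d\<close>-th power of \<open>T 1\<close>, which vanishes for \<open>d = c\<close>.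
\<close>

definition T :: "int \<Rightarrow> 'a" where
  "T d = Phi (\<lambda>a b. if b < f a \<and> (\<exists>j. a = u j \<and> b = u (j + d)) then 1 else 0)"

lemma T_PM: "0 \<le> d \<Longrightarrow> (\<lambda>a b. if b < f a \<and> (\<exists>j. a = u j \<and> b = u (j + d)) then 1 else 0 :: 'k) \<in> carrier (PM N f)"
  unfolding PM_simps(1)
proof (intro CollectI conjI allI impI)
  fix x y assume d: "0 \<le> d"
  have "(\<exists>j. x + N = u j \<and> y + N = u (j + d)) \<longleftrightarrow> (\<exists>j. x = u j \<and> y = u (j + d))"
  proof
    assume "\<exists>j. x = u j \<and> y = u (j + d)"
    then obtain j where "x = u j" "y = u (j + d)" by blast
    then have "x + N = u (j + n)" "y + N = u (j + n + d)" using u_per[of j] u_per[of "j + d"] by (simp_all add: ac_simps)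
    then show "\<exists>j. x + N = u j \<and> y + N = u (j + d)" by blast
  next
    assume "\<exists>j. x + N = u j \<and> y + N = u (j + d)"
    then obtain j where "x + N = u j" "y + N = u (j + d)" by blast
    then have "x = u (j - n)" "y = u (j - n + d)" using u_per[of "j - n"] u_per[of "j - n + d"] by (simp_all add: algebra_simps)
    then show "\<exists>j. x = u j \<and> y = u (j + d)" by blast
  qed
  then show "(if y + N < f (x + N) \<and> (\<exists>j. x + N = u j \<and> y + N = u (j + d)) then 1 else 0 :: 'k) =
    (if y < f x \<and> (\<exists>j. x = u j \<and> y = u (j + d)) then 1 else 0)" by (simp add: a(3))
  assume nz: "(if y < f x \<and> (\<exists>j. x = u j \<and> y = u (j + d)) then 1 else 0 :: 'k) \<noteq> 0"
  show "y < f x" using nz by (simp split: if_splits)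
  show "x \<le> y" using nz d by (auto simp: u_le split: if_splits)
qed

lemma T_closed: "0 \<le> d \<Longrightarrow> T d \<in> carrier A"
  unfolding T_def by (rule P(4)[OF T_PM])

lemma co_T: "0 \<le> d \<Longrightarrow> co (T d) x y = (if y < f x \<and> (\<exists>j. x = u j \<and> y = u (j + d)) then 1 else 0)"
  unfolding T_def by (subst co_Phi[OF T_PM]) simp_all

lemma co_T_u: "0 \<le> d \<Longrightarrow> co (T d) x (u j) = (if u j < f x \<and> x = u (j - d) then 1 else 0)"
proof -
  have "(\<exists>i. x = u i \<and> u j = u (i + d)) \<longleftrightarrow> x = u (j - d)" by (auto simp: u_eq)
  then show "0 \<le> d \<Longrightarrow> ?thesis" by (simp add: co_T)
qed

lemma co_mult_T:
  assumes x: "x \<in> carrier A" and d: "0 \<le> d" "d < c"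
  shows "co (x \<otimes> T d) i (u j) = (if u j < f i then co x i (u (j - d)) else 0)"
    "l \<notin> range u \<Longrightarrow> co (x \<otimes> T d) i l = 0"
proof -
  have lt: "u j < f (u (j - d))" using u_f[OF d(1), of "j - d"] d(2) by simp
  have e: "co (T d) k (u j) = (if k = u (j - d) then 1 else 0)" for k
    using lt by (simp add: co_T_u d)
  have "(\<Sum>k\<in>{i..u j}. co x i k * co (T d) k (u j)) = (\<Sum>k\<in>{i..u j}. if k = u (j - d) then co x i (u (j - d)) else 0)"
    by (rule sum.cong) (auto simp: e)
  also have "\<dots> = co x i (u (j - d))"
    using co_out[OF x, of i "u (j - d)"] d(1) u_le[of "j - d" j] by auto
  finally show "co (x \<otimes> T d) i (u j) = (if u j < f i then co x i (u (j - d)) else 0)"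
    using x T_closed[OF d(1)] by (simp add: co_mult)
  assume "l \<notin> range u"
  then have "co (T d) k l = 0" for k using d(1) by (auto simp: co_T)
  then show "co (x \<otimes> T d) i l = 0" using x T_closed[OF d(1)] by (simp add: co_mult)
qed

lemma co_T_out: "0 \<le> d \<Longrightarrow> l \<notin> range u \<Longrightarrow> co (T d) i l = 0"
  by (auto simp: co_T)

lemma T_mult: assumes d: "0 \<le> d" "0 \<le> d'" "d' < c" shows "T d \<otimes> T d' = T (d + d')"
proof (rule co_eqI)
  fix i l assume l: "i \<le> l" "l < f i"
  show "co (T d \<otimes> T d') i l = co (T (d + d')) i l"
  proof (cases "l \<in> range u")
    case True
    then obtain j where j: "l = u j" by auto
    have "u (j - d') \<le> u j" using d by (simp add: u_le)
    then have "u (j - d') < f i" using l j by simp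
    moreover have e: "j - d' - d = j - (d + d')" by simp
    ultimately show ?thesis using l d unfolding j by (simp add: co_mult_T T_closed co_T_u e)
  next
    case False then show ?thesis using d by (simp add: co_mult_T T_closed co_T_out)
  qed
qed (use d in \<open>simp_all add: T_closed\<close>)

lemma T_c: "T c = \<zero>"
proof (rule co_eqI)
  fix i l
  have "\<not> (l < f i \<and> (\<exists>j. i = u j \<and> l = u (j + c)))" using u_f[of c] c by auto
  then show "co (T c) i l = co \<zero> i l" using c by (simp add: co_T co_zero)
qed (use c in \<open>simp_all add: T_closed\<close>)

text \<open>
  As in a self-injective Nakayama algebra with all projectives of length \<open>c\<close>, the
  kernel of the \<open>d\<close>-th power of the radical generator is the image of the
  complementary power. The element \<open>y\<close> is \<open>x\<close> moved back by
  \<open>d'\<close> points.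
\<close>

lemma T_exact:
  assumes x: "x \<in> row i" "x \<otimes> T 0 = x" "x \<otimes> T d = \<zero>" and d: "0 < d" "0 < d'" "d + d' = c"
  shows "\<exists>y\<in>row i. y \<otimes> T 0 = y \<and> x = y \<otimes> T d'"
proof -
  have xc: "x \<in> carrier A" by (rule row_closed[OF x(1)])
  have dd: "0 \<le> d" "d < c" "0 \<le> d'" "d' < c" using d by auto
  define y where "y = rowv i (\<lambda>l. if l \<in> range u then co x i (u (p l + d')) else 0)"
  have y: "y \<in> row i" unfolding y_def by (rule rowv_row)
  have yc: "y \<in> carrier A" by (rule row_closed[OF y])
  have coy: "co y i (u m) = (if i \<le> u m \<and> u m < f i then co x i (u (m + d')) else 0)" for m
    unfolding y_def co_rowv by (simp add: u(1))
  have coy0: "l \<notin> range u \<Longrightarrow> co y i l = 0" for l unfolding y_def co_rowv by simp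
  have x0: "l \<notin> range u \<Longrightarrow> co x i l = 0" for l
    using co_mult_T(2)[OF xc, of 0 l i] c x(2) by simp
  have xz: "co x i (u (m - d)) = 0" if "u m < f i" for m
    using co_mult_T(1)[OF xc dd(1,2), of i m] x(3) that by (simp add: co_zero)
  have "y \<otimes> T 0 = y"
  proof (rule row_eqI[OF row_mult[OF y T_closed] y])
    fix l assume l: "i \<le> l" "l < f i"
    show "co (y \<otimes> T 0) i l = co y i l"
    proof (cases "l \<in> range u")
      case True
      then obtain j where "l = u j" by auto
      then show ?thesis using co_mult_T(1)[OF yc, of 0 i j] c l by simp
    next
      case False
      then show ?thesis using co_mult_T(2)[OF yc, of 0 l i] c coy0 by simp
    qed
  qed simp
  moreover have "x = y \<otimes> T d'"
  proof (rule row_eqI[OF x(1) row_mult[OF y T_closed[OF dd(3)]]])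
    fix l assume l: "i \<le> l" "l < f i"
    show "co x i l = co (y \<otimes> T d') i l"
    proof (cases "l \<in> range u")
      case True
      then obtain j where j: "l = u j" by auto
      have up: "u (j - d') < f i"
      proof -
        have "u (j - d') \<le> u j" using dd(3) by (simp add: u_le)
        then show ?thesis using l j by simp
      qed
      have "co x i (u j) = (if i \<le> u (j - d') then co x i (u j) else 0)"
      proof (cases "i \<le> u (j - d')")
        case False
        then have "j - d' < p i" by (simp add: le_u_iff)
        \<comment> \<open>an entry too close to i to be moved back stays inside the row when moved
          on by d, so it vanishes\<close>
        then have "j + d < p i + c" using d by simp
        then have "\<not> f i \<le> u (j + d)" by (simp add: le_u_iff p_f)
        then have "u (j + d) < f i" by simp
        from xz[OF this] show ?thesis by simp
      qed simp
      then show ?thesis using co_mult_T(1)[OF yc dd(3,4), of i j] l up unfolding j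
        by (cases "i \<le> u (j - d')") (simp_all add: coy)
    next
      case False
      then show ?thesis using co_mult_T(2)[OF yc dd(3,4) False] x0 by simp
    qed
  qed
  ultimately show ?thesis using y by blast
qed

text \<open>
  On the simple module at \<open>u 0\<close> both \<open>T 1\<close> and \<open>T (c - 1)\<close>
  act as zero, since \<open>c \<ge> 2\<close>, whereas \<open>T 0\<close> acts as the identity. So
  the pair is not exact there, and the module has no finite resolution.
\<close>

theorem gl_dim_infinite: "\<not> gl_dim A < \<infinity>"
proof
  assume "gl_dim A < \<infinity>"
  from gl_dim_finite_res[OF this simple_mod_fg[of "u 0"]] obtain m where m: "has_res A (simple_mod (u 0)) m" by blast
  let ?t = "T 1" and ?t' = "T (c - 1)"
  have T0: "T 0 \<otimes> T d = T d" "T d \<otimes> T 0 = T d" if "0 \<le> d" "d < c" for d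
    using T_mult[of 0 d] T_mult[of d 0] that c by simp_all
  have "biexact (T 0) ?t ?t' (simple_mod (u 0)) (carrier (simple_mod (u 0)))"
  proof (rule biexact_resolution[OF simple_mod_module m])
    show "?t \<otimes> ?t' = \<zero>" "?t' \<otimes> ?t = \<zero>" using T_mult[of 1 "c - 1"] T_mult[of "c - 1" 1] c T_c by simp_all
    show "\<exists>y\<in>row i. y \<otimes> T 0 = y \<and> x = y \<otimes> ?t'" if "x \<in> row i" "x \<otimes> T 0 = x" "x \<otimes> ?t = \<zero>" for i x
      by (rule T_exact[OF that]) (use c in simp_all)
    show "\<exists>y\<in>row i. y \<otimes> T 0 = y \<and> x = y \<otimes> ?t" if "x \<in> row i" "x \<otimes> T 0 = x" "x \<otimes> ?t' = \<zero>" for i x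
      by (rule T_exact[OF that]) (use c in simp_all)
  qed (use c in \<open>simp_all add: T_closed T0\<close>)
  then have ex: "exact_at (T 0) ?t ?t' (simple_mod (u 0)) (carrier (simple_mod (u 0)))" by (simp add: biexact_def)
  have c0: "co (T 0) (u 0) (u 0) = 1" using a(4)[of "u 0"] by (simp add: co_T_u)
  have c1: "co (T d) (u 0) (u 0) = 0" if "0 < d" for d using that by (simp add: co_T_u u_eq)
  have "enc 1 = enc 0"
  proof -
    have "\<exists>y\<in>carrier (simple_mod (u 0)). T 0 \<odot>\<^bsub>simple_mod (u 0)\<^esub> y = y \<and> enc 1 = ?t' \<odot>\<^bsub>simple_mod (u 0)\<^esub> y"
    proof (rule mp[OF bspec[OF ex[unfolded exact_at_def]]])
      show "enc 1 \<in> carrier (simple_mod (u 0))" by simp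
      show "T 0 \<odot>\<^bsub>simple_mod (u 0)\<^esub> enc 1 = enc 1 \<and> ?t \<odot>\<^bsub>simple_mod (u 0)\<^esub> enc 1 = \<zero>\<^bsub>simple_mod (u 0)\<^esub>"
        by (simp add: c0 c1)
    qed
    then show ?thesis using c1[of "c - 1"] c by auto
  qed
  then show False by (simp add: enc_inj)
qed

end

section \<open>Invariants of a presentation\<close>

lemma sum_fun_apply: "finite S \<Longrightarrow> (\<Sum>i\<in>S. F i) j = (\<Sum>i\<in>S. F i j)"
  by (induction S rule: finite_induct) simp_all
text \<open>
  The Jacobson radical, which here is nil. Its definition does not refer to a presentation; so it
  can be used to compare presentations.
\<close>

definition jac :: "('k::field, 'a) module \<Rightarrow> 'a set" where
  "jac A = {x \<in> carrier A. \<forall>y\<in>carrier A. \<exists>n::nat. (x \<otimes>\<^bsub>A\<^esub> y) [^]\<^bsub>A\<^esub> n = \<zero>\<^bsub>A\<^esub>}"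

context nak
begin

lemma co_pow_diag: "x \<in> carrier A \<Longrightarrow> co (x [^] (n::nat)) i i = co x i i ^ n"
  by (induction n) (simp_all add: co_one co_mult_diag)

lemma nilpotent:
  assumes x: "x \<in> carrier A" "\<And>i. co x i i = 0" shows "x [^] nat (f 0 + N) = \<zero>"
proof -
  have step: "co (x [^] n) i j = 0" if "j < i + int n" for n :: nat and i j
    using that
  proof (induction n arbitrary: i j)
    case 0 then show ?case by (simp add: co_one)
  next
    case (Suc n)
    have "co (x [^] n) i k * co x k j = 0" if k: "k \<in> {i..j}" for k
    proof (cases "k < i + int n")
      case True then show ?thesis using Suc.IH by simp
    next
      case False
      then have "k = j" using k Suc.prems by auto
      then show ?thesis using x(2) by simp
    qed
    then show ?case using x(1) by (simp add: co_mult sum.neutral)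
  qed
  show ?thesis
  proof (rule co_eqI)
    fix i j assume ij: "i \<le> j" "j < f i"
    have "f i - i \<le> f 0 + N" by (rule adm_length_bound[OF adm])
    then have "j < i + int (nat (f 0 + N))" using ij by linarith
    from step[OF this] show "co (x [^] nat (f 0 + N)) i j = co \<zero> i j" by (simp add: co_zero)
  qed (use x in simp_all)
qed

lemma jac_eq: "jac A = {x \<in> carrier A. \<forall>i. co x i i = 0}"
proof
  show "jac A \<subseteq> {x \<in> carrier A. \<forall>i. co x i i = 0}"
  proof
    fix x assume "x \<in> jac A"
    then have x: "x \<in> carrier A" "\<And>y. y \<in> carrier A \<Longrightarrow> \<exists>n::nat. (x \<otimes> y) [^] n = \<zero>" by (auto simp: jac_def)
    have "co x i i = 0" for i
    proof -
      from x(2)[OF one_closed] obtain n :: nat where "x [^] n = \<zero>" using x(1) by auto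
      then have "co x i i ^ n = 0" using co_pow_diag[OF x(1), of n i] by (simp add: co_zero)
      then show ?thesis by simp
    qed
    then show "x \<in> {x \<in> carrier A. \<forall>i. co x i i = 0}" using x(1) by simp
  qed
  show "{x \<in> carrier A. \<forall>i. co x i i = 0} \<subseteq> jac A"
  proof
    fix x assume "x \<in> {x \<in> carrier A. \<forall>i. co x i i = 0}"
    then have x: "x \<in> carrier A" "\<And>i. co x i i = 0" by auto
    have "(x \<otimes> y) [^] nat (f 0 + N) = \<zero>" if "y \<in> carrier A" for y
      by (rule nilpotent) (use x that in \<open>simp_all add: co_mult_diag\<close>)
    then show "x \<in> jac A" using x(1) unfolding jac_def by blast
  qed
qed

lemma E_jac: "i < j \<Longrightarrow> E i j \<in> jac A" by (simp add: jac_eq co_E)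

text \<open>
  At a break the projective module is simple, so its radical is zero.
\<close>

lemma simple_idempotent:
  assumes "f z = z + 1" shows "e z \<noteq> \<zero>" "x \<in> jac A \<Longrightarrow> e z \<otimes> x = \<zero>"
proof -
  show "e z \<noteq> \<zero>" using a(4)[of z] by (simp add: E_zero_iff)
  assume x: "x \<in> jac A"
  then have xc: "x \<in> carrier A" "\<And>i. co x i i = 0" by (auto simp: jac_eq)
  show "e z \<otimes> x = \<zero>"
  proof (rule row_eqI[OF row_e_mult[OF xc(1)] row_zero])
    fix j assume "z \<le> j" "j < f z"
    then have "j = z" using assms by simp
    then show "co (e z \<otimes> x) z j = co \<zero> z j" using xc by (simp add: co_e_mult co_zero)
  qed
qed

text \<open>
  In contrast to the preceding lemma, without breaks no indecomposable projective module is simple.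
  These two facts separate cyclic Nakayama algebras from the others.
\<close>

lemma idempotent_moves_jac:
  assumes two: "\<And>i. i + 2 \<le> f i" and g: "g \<in> carrier A" "g \<otimes> g = g" "g \<noteq> \<zero>"
  shows "\<exists>x\<in>jac A. g \<otimes> x \<noteq> \<zero>"
proof -
  have "\<exists>i. co g i i \<noteq> 0"
  proof (rule ccontr)
    assume "\<nexists>i. co g i i \<noteq> 0"
    \<comment> \<open>an idempotent with zero diagonal would be nilpotent\<close>
    then have "g [^] nat (f 0 + N) = \<zero>" by (intro nilpotent g(1)) simp
    moreover have "g [^] Suc n = g" for n by (induction n) (simp_all add: g)
    moreover have "nat (f 0 + N) = Suc (nat (f 0 + N) - 1)" using a(4)[of 0] a(1) by simp
    ultimately show False using g(3) by metis
  qed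
  then obtain i where i: "co g i i \<noteq> 0" by blast
  have lt: "i + 1 < f i" using two[of i] by simp
  have "co (g \<otimes> E i (i + 1)) i (i + 1) = co g i i" using lt by (simp add: co_mult_E g(1))
  then have "g \<otimes> E i (i + 1) \<noteq> \<zero>" using i by (auto simp: co_zero)
  then show ?thesis using E_jac[of i "i + 1"] by auto
qed

text \<open>
  Elements annihilated by the radical on both sides. They are spanned by the maximal nonzero paths.
\<close>

definition dsoc :: "'a set" where
  "dsoc = {x \<in> carrier A. \<forall>y\<in>jac A. x \<otimes> y = \<zero> \<and> y \<otimes> x = \<zero>}"

lemma dsoc_co:
  assumes x: "x \<in> dsoc" and nz: "co x i j \<noteq> 0" shows "j + 1 = f i" "f (i - 1) < f i"
proof -
  have xc: "x \<in> carrier A" and x0: "\<And>y. y \<in> jac A \<Longrightarrow> x \<otimes> y = \<zero>" "\<And>y. y \<in> jac A \<Longrightarrow> y \<otimes> x = \<zero>"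
    using x by (auto simp: dsoc_def)
  have ij: "i \<le> j" "j < f i" using nz co_out[OF xc] by blast+
  show "j + 1 = f i"
  proof (rule ccontr)
    assume "j + 1 \<noteq> f i"
    then have "j + 1 < f i" using ij by simp
    moreover have "f i \<le> f j" by (rule a(2)[OF ij(1)])
    ultimately have "co (x \<otimes> E j (j + 1)) i (j + 1) = co x i j" by (simp add: co_mult_E xc)
    then show False using x0(1)[OF E_jac[of j "j + 1"]] nz by (simp add: co_zero)
  qed
  show "f (i - 1) < f i"
  proof (rule ccontr)
    assume "\<not> f (i - 1) < f i"
    then have "j < f (i - 1)" using ij by simp
    moreover from this have "i < f (i - 1)" using ij by simp
    ultimately have "co (E (i - 1) i \<otimes> x) (i - 1) j = co x i j" by (simp add: co_E_mult xc)
    then show False using x0(2)[OF E_jac[of "i - 1" i]] nz by (simp add: co_zero)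
  qed
qed

lemma E_dsoc:
  assumes "f (i - 1) < f i" shows "E i (f i - 1) \<in> dsoc"
  unfolding dsoc_def
proof (intro CollectI conjI ballI E_closed)
  have lt: "i \<le> f i - 1" "f i - 1 < f i" using a(5)[of i] by auto
  fix y assume "y \<in> jac A"
  then have y: "y \<in> carrier A" "\<And>i. co y i i = 0" by (auto simp: jac_eq)
  show "E i (f i - 1) \<otimes> y = \<zero>"
  proof (rule row_eqI[OF row_mult[OF row_E[OF lt(1)] y(1)] row_zero])
    fix j assume j: "i \<le> j" "j < f i"
    have "co y (f i - 1) j = 0" using j y co_out[OF y(1), of "f i - 1" j] by (cases "j = f i - 1") auto
    then show "co (E i (f i - 1) \<otimes> y) i j = co \<zero> i j" using j lt by (simp add: co_E_mult y co_zero)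
  qed
  show "y \<otimes> E i (f i - 1) = \<zero>"
  proof (rule co_eqI)
    fix k l assume kl: "k \<le> l" "l < f k"
    have "co y k (l - (f i - 1 - i)) = 0" if "N dvd l - (f i - 1)"
    proof (rule ccontr)
      assume nz: "co y k (l - (f i - 1 - i)) \<noteq> 0"
      define i' where "i' = l - (f i - 1 - i)"
      have k': "k \<le> i'" using nz co_out[OF y(1)] unfolding i'_def by blast
      moreover have "k \<noteq> i'" using nz y(2) unfolding i'_def by auto
      ultimately have "k \<le> i' - 1" by simp
      then have "f k \<le> f (i' - 1)" by (rule a(2))
      moreover have "N dvd i' - i" using that by (simp add: i'_def algebra_simps)
      then have "f i' = f i + (i' - i)" "f (i' - 1) = f (i - 1) + (i' - i)"
        using f_dvd[of i' i] f_dvd[of "i' - 1" "i - 1"] by simp_all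
      ultimately show False using kl(2) assms unfolding i'_def by simp
    qed
    then show "co (y \<otimes> E i (f i - 1)) k l = co \<zero> k l" using lt by (simp add: co_mult_E y co_zero)
  qed (use y in simp_all)
qed

text \<open>
  The points where maximal nonzero paths start, one for each residue of a value of
  \<open>f\<close>.
\<close>

definition tops :: "int set" where "tops = {i \<in> {0..<N}. f (i - 1) < f i}"

lemma tops_card: "card tops = card (range f \<inter> {0..<N})"
proof -
  have N: "1 \<le> N" by (rule a(1))
  have "bij_betw (\<lambda>i. f i mod N) tops (range f \<inter> {0..<N})"
    unfolding bij_betw_def
  proof
    show "inj_on (\<lambda>i. f i mod N) tops"
    proof (rule inj_onI)
      fix i j assume i: "i \<in> tops" and j: "j \<in> tops" and e: "f i mod N = f j mod N"
      then have "N dvd f i - f j" by (simp add: mod_eq_dvd_iff)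
      then obtain t where "f i - f j = N * t" by auto
      then have fe: "f i = f (j + t * N)" using a(6)[of j t] by (simp add: mult.commute)
      have top: "k \<le> l" if "f k = f l" "f (k - 1) < f k" for k l
      proof (rule ccontr)
        assume "\<not> k \<le> l"
        then have "f l \<le> f (k - 1)" by (intro a(2)) simp
        then show False using that by simp
      qed
      have "f (j + t * N - 1) < f (j + t * N)"
        using a(6)[of "j - 1" t] a(6)[of j t] j by (simp add: tops_def algebra_simps)
      then have "i = j + t * N" using top[of i "j + t * N"] top[of "j + t * N" i] fe i by (simp add: tops_def)
      then have "i mod N = j mod N" by simp
      then show "i = j" using i j by (simp add: tops_def)
    qed
    show "(\<lambda>i. f i mod N) ` tops = range f \<inter> {0..<N}"
    proof
      show "(\<lambda>i. f i mod N) ` tops \<subseteq> range f \<inter> {0..<N}"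
      proof
        fix x assume "x \<in> (\<lambda>i. f i mod N) ` tops"
        then obtain i where x: "x = f i mod N" by auto
        have "x = f (i + - (f i div N) * N)" unfolding x a(6) by (simp add: minus_mult_div_eq_mod[symmetric] mult.commute)
        moreover have "x \<in> {0..<N}" using N unfolding x by simp
        ultimately show "x \<in> range f \<inter> {0..<N}" by blast
      qed
      show "range f \<inter> {0..<N} \<subseteq> (\<lambda>i. f i mod N) ` tops"
      proof
        fix x assume x: "x \<in> range f \<inter> {0..<N}"
        then obtain i0 where i0: "f i0 = x" by auto
        have low: "i0 + - (\<bar>i0 - x\<bar> + f 0 + N) \<le> i" if "f i = x" for i
          using adm_length_bound[OF adm, of i] that by linarith
        obtain i where i: "f i = x" "i0 + - (\<bar>i0 - x\<bar> + f 0 + N) \<le> i"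
          "\<And>j. i0 + - (\<bar>i0 - x\<bar> + f 0 + N) \<le> j \<Longrightarrow> f j = x \<Longrightarrow> i \<le> j"
          by (rule least_int_ge[of "\<lambda>i. f i = x", OF i0 low[OF i0]]) blast
        have "f (i - 1) \<noteq> x" using i(3)[OF low, of "i - 1"] by auto
        moreover have "f (i - 1) \<le> f i" by (rule a(2)) simp
        ultimately have lt: "f (i - 1) < f i" using i(1) by simp
        define j where "j = i mod N"
        have j: "j = i + - (i div N) * N" unfolding j_def by (simp add: minus_mult_div_eq_mod[symmetric] mult.commute)
        have "f j = f i + - (i div N) * N" "f (j - 1) = f (i - 1) + - (i div N) * N"
          using a(6)[of i "- (i div N)"] a(6)[of "i - 1" "- (i div N)"] unfolding j by (simp_all add: algebra_simps)
        then have "f (j - 1) < f j" "f j mod N = (x + - (i div N) * N) mod N" using lt i(1) by simp_all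
        moreover have "(x + - (i div N) * N) mod N = x" using x by (subst mod_mult_self1) simp
        moreover have "j \<in> {0..<N}" using N by (simp add: j_def)
        ultimately have "j \<in> tops" "f j mod N = x" by (simp_all add: tops_def)
        then show "x \<in> (\<lambda>i. f i mod N) ` tops" by (metis imageI)
      qed
    qed
  qed
  then show ?thesis by (rule bij_betw_same_card)
qed

lemma dsoc_eqI:
  assumes "x \<in> dsoc" "y \<in> dsoc" "\<And>i. i \<in> tops \<Longrightarrow> co x i (f i - 1) = co y i (f i - 1)" shows "x = y"
proof (rule co_eqI)
  show xc: "x \<in> carrier A" and yc: "y \<in> carrier A" using assms(1,2) by (auto simp: dsoc_def)
  fix k l assume kl: "k \<le> l" "l < f k"
  have *: "co x i j = co y i j" if "i \<in> {0..<N}" for i j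
  proof (cases "j + 1 = f i \<and> f (i - 1) < f i")
    case True
    then have "j = f i - 1" "i \<in> tops" using that by (auto simp: tops_def)
    then show ?thesis using assms(3) by simp
  next
    case False
    then have "co x i j = 0" "co y i j = 0" using dsoc_co[OF assms(1)] dsoc_co[OF assms(2)] by blast+
    then show ?thesis by simp
  qed
  have "k mod N \<in> {0..<N}" using a(1) by simp
  moreover have k: "k = k mod N + (k div N) * N" by simp
  ultimately show "co x k l = co y k l"
    using *[of "k mod N" "l - (k div N) * N"] co_shift[OF xc, of "k mod N" "k div N" "l - (k div N) * N"]
      co_shift[OF yc, of "k mod N" "k div N" "l - (k div N) * N"] by simp
qed

end

text \<open>
  Both numbers are the dimension of the space \<open>dsoc\<close>, which depends on the algebra
  only. The maximal paths of the first presentation are linearly independent, and the second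
  presentation embeds the space into the functions on its set \<open>tops\<close>.
\<close>

lemma range_card_le:
  fixes A :: "('k::field, 'a) module"
  assumes "nak A N f Phi" "nak A N' f' Phi'"
  shows "card (range f \<inter> {0..<N}) \<le> card (range f' \<inter> {0..<N'})"
proof -
  interpret X: nak A N f Phi by (rule assms(1))
  interpret Y: nak A N' f' Phi' by (rule assms(2))
  have same: "X.dsoc = Y.dsoc" by (simp add: X.dsoc_def Y.dsoc_def)
  \<comment> \<open>the maximal path starting at i, in the coordinates of the second presentation\<close>
  define v where "v i = (\<lambda>j. if j \<in> Y.tops then Y.co (X.E i (f i - 1)) j (f' j - 1) else 0)" for i
  interpret V: vector_space "\<lambda>(c::'k) (g :: int \<Rightarrow> 'k) x. c * g x"
    by unfold_locales (auto simp: fun_eq_iff algebra_simps)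
  define L where "L x = (\<lambda>j. if j \<in> Y.tops then Y.co x j (f' j - 1) else 0)" for x
  have dA: "x \<in> carrier A" if "x \<in> X.dsoc" for x using that by (simp add: X.dsoc_def)
  have fin: "finite X.tops" "finite Y.tops" 
    by (rule finite_subset[of _ "{0..<N}"], auto simp: X.tops_def)
      (rule finite_subset[of _ "{0..<N'}"], auto simp: Y.tops_def)
  have dadd: "x \<oplus>\<^bsub>A\<^esub> y \<in> X.dsoc" if "x \<in> X.dsoc" "y \<in> X.dsoc" for x y
    using that unfolding X.dsoc_def X.jac_eq by (auto simp: X.l_distr X.r_distr)
  have dsm: "c \<odot>\<^bsub>A\<^esub> x \<in> X.dsoc" if "x \<in> X.dsoc" for c x
  proof -
    have "c \<odot>\<^bsub>A\<^esub> \<zero>\<^bsub>A\<^esub> = \<zero>\<^bsub>A\<^esub>"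
      by (rule X.co_eqI) (simp_all add: X.smult_closed X.co_smult X.co_zero)
    then show ?thesis using that unfolding X.dsoc_def X.jac_eq
      by (auto simp: X.smult_closed X.smult_mult_l X.smult_mult_r)
  qed
  have comb: "\<exists>x\<in>X.dsoc. (\<forall>j\<in>X.tops. X.co x j (f j - 1) = (if j \<in> S then r j else 0)) \<and>
      L x = (\<lambda>j. \<Sum>i\<in>S. r i * v i j)" if "finite S" "S \<subseteq> X.tops" for S r
    using that
  proof (induction S)
    case empty
    have "\<zero>\<^bsub>A\<^esub> \<in> X.dsoc" unfolding X.dsoc_def X.jac_eq by auto
    then show ?case by (intro bexI[of _ "\<zero>\<^bsub>A\<^esub>"]) (simp_all add: X.co_zero Y.co_zero L_def fun_eq_iff)
  next
    case (insert i S)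
    then obtain x where x: "x \<in> X.dsoc" "\<forall>j\<in>X.tops. X.co x j (f j - 1) = (if j \<in> S then r j else 0)"
      "L x = (\<lambda>j. \<Sum>i\<in>S. r i * v i j)" by auto
    have iT: "i \<in> X.tops" using insert.prems by simp
    then have Ei: "X.E i (f i - 1) \<in> X.dsoc" by (intro X.E_dsoc) (simp add: X.tops_def)
    define y where "y = r i \<odot>\<^bsub>A\<^esub> X.E i (f i - 1)"
    have yd: "y \<in> X.dsoc" unfolding y_def by (rule dsm[OF Ei])
    have cy: "X.co y j (f j - 1) = (if j = i then r i else 0)" if j: "j \<in> X.tops" for j
    proof (cases "j = i")
      case True
      have "i \<le> f i - 1" using X.a(5)[of i] by simp
      then show ?thesis using True by (simp add: y_def X.co_smult X.co_E)
    next
      case False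
      have "\<not> N dvd j - i"
      proof
        assume "N dvd j - i"
        then have "j mod N = i mod N" by (simp add: mod_eq_dvd_iff)
        then show False using False j iT by (simp add: X.tops_def)
      qed
      then show ?thesis using False by (simp add: y_def X.co_smult X.co_E)
    qed
    have "L (x \<oplus>\<^bsub>A\<^esub> y) = (\<lambda>j. L x j + r i * v i j)"
      by (rule ext) (simp add: L_def v_def y_def Y.co_add Y.co_smult dA[OF x(1)] X.smult_closed)
    then have "L (x \<oplus>\<^bsub>A\<^esub> y) = (\<lambda>j. \<Sum>i\<in>insert i S. r i * v i j)"
      using insert.hyps x(3) by (simp add: add.commute)
    moreover have "\<forall>j\<in>X.tops. X.co (x \<oplus>\<^bsub>A\<^esub> y) j (f j - 1) = (if j \<in> insert i S then r j else 0)"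
      using x(2) cy insert.hyps(2) by (auto simp: X.co_add dA[OF x(1)] dA[OF yd])
    ultimately show ?case using dadd[OF x(1) yd] by blast
  qed
  have inj: "inj_on v X.tops"
  proof (rule inj_onI)
    fix i j assume ij: "i \<in> X.tops" "j \<in> X.tops" "v i = v j"
    have E: "X.E i (f i - 1) \<in> X.dsoc" "X.E j (f j - 1) \<in> X.dsoc"
      using ij by (auto intro!: X.E_dsoc simp: X.tops_def)
    have "X.E i (f i - 1) = X.E j (f j - 1)"
    proof (rule Y.dsoc_eqI)
      show "X.E i (f i - 1) \<in> Y.dsoc" "X.E j (f j - 1) \<in> Y.dsoc" using E same by simp_all
      fix k assume "k \<in> Y.tops"
      then show "Y.co (X.E i (f i - 1)) k (f' k - 1) = Y.co (X.E j (f j - 1)) k (f' k - 1)"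
        using fun_cong[OF ij(3), of k] by (simp add: v_def)
    qed
    then have "X.co (X.E i (f i - 1)) i (f i - 1) = X.co (X.E j (f j - 1)) i (f i - 1)" by simp
    moreover have "i \<le> f i - 1" using X.a(5)[of i] by simp
    ultimately have "N dvd i - j" by (simp add: X.co_E split: if_splits)
    then have "i mod N = j mod N" by (simp add: mod_eq_dvd_iff)
    then show "i = j" using ij by (simp add: X.tops_def)
  qed
  have indep: "V.independent (v ` X.tops)"
  proof (rule V.independent_if_scalars_zero)
    show "finite (v ` X.tops)" using fin by simp
    fix r w assume s0: "(\<Sum>g\<in>v ` X.tops. (\<lambda>x. r g * g x)) = 0" and w: "w \<in> v ` X.tops"
    obtain x where x: "x \<in> X.dsoc" "\<And>j. j \<in> X.tops \<Longrightarrow> X.co x j (f j - 1) = r (v j)"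
      "L x = (\<lambda>j. \<Sum>i\<in>X.tops. r (v i) * v i j)" using comb[OF fin(1) order_refl, of "\<lambda>i. r (v i)"] by auto
    have "(\<Sum>g\<in>v ` X.tops. (\<lambda>x. r g * g x)) = (\<Sum>i\<in>X.tops. (\<lambda>x. r (v i) * v i x))"
      by (rule sum.reindex[OF inj, unfolded comp_def])
    then have "(\<Sum>i\<in>X.tops. (\<lambda>x. r (v i) * v i x)) j = 0" for j using s0 by simp
    then have "(\<Sum>i\<in>X.tops. r (v i) * v i j) = 0" for j
      using sum_fun_apply[OF fin(1), of "\<lambda>i x. r (v i) * v i x" j] by simp
    then have L0: "L x = (\<lambda>j. 0)" using x(3) by simp
    have "x = \<zero>\<^bsub>A\<^esub>"
    proof (rule Y.dsoc_eqI)
      show "x \<in> Y.dsoc" using x(1) same by simp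
      show "\<zero>\<^bsub>A\<^esub> \<in> Y.dsoc" unfolding Y.dsoc_def Y.jac_eq by auto
      fix k assume "k \<in> Y.tops"
      then show "Y.co x k (f' k - 1) = Y.co \<zero>\<^bsub>A\<^esub> k (f' k - 1)" using fun_cong[OF L0, of k] by (simp add: L_def Y.co_zero)
    qed
    then show "r w = 0" using w x(2) by (auto simp: X.co_zero)
  qed
  have "v ` X.tops \<subseteq> V.span ((\<lambda>k j. if j = k then 1 else 0) ` Y.tops)"
  proof
    fix g assume "g \<in> v ` X.tops"
    then have g0: "j \<notin> Y.tops \<Longrightarrow> g j = 0" for j by (auto simp: v_def)
    have "g = (\<Sum>k\<in>Y.tops. (\<lambda>j. g k * (if j = k then 1 else 0)))"
    proof
      fix j
      have "(\<Sum>k\<in>Y.tops. (\<lambda>j. g k * (if j = k then 1 else 0))) j = (\<Sum>k\<in>Y.tops. g k * (if j = k then 1 else 0))"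
        by (rule sum_fun_apply[OF fin(2)])
      also have "\<dots> = g j" using fin(2) g0 by (simp add: if_distrib[of "\<lambda>x. _ * x"] sum.delta cong: if_cong)
      finally show "g j = (\<Sum>k\<in>Y.tops. (\<lambda>j. g k * (if j = k then 1 else 0))) j" by simp
    qed
    also have "\<dots> \<in> V.span ((\<lambda>k j. if j = k then 1 else 0) ` Y.tops)"
      by (intro V.span_sum V.span_scale V.span_base) auto
    finally show "g \<in> V.span ((\<lambda>k j. if j = k then 1 else 0) ` Y.tops)" .
  qed
  from V.independent_span_bound[OF _ indep this] fin
  have "card (v ` X.tops) \<le> card ((\<lambda>k j. if j = k then 1 else 0 :: 'k) ` Y.tops)" by simp
  also have "\<dots> \<le> card Y.tops" using fin by (intro card_image_le)
  finally show ?thesis using card_image[OF inj] X.tops_card Y.tops_card by simp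
qed

section \<open>Corner algebras\<close>

text \<open>
  The points of \<open>range w\<close> are a set of vertices; \<open>g\<close> is \<open>f\<close>
  restricted to them, in the sense that \<open>w (g i)\<close> is the first of these points at or
  after \<open>f (w i)\<close>. The subalgebra at these vertices is \<open>PM n g\<close>.
\<close>

locale corner = nak A N f Phi for A :: "('k::field, 'a) module" (structure) and N f Phi +
  fixes w :: "int \<Rightarrow> int" and n :: int and g :: "int \<Rightarrow> int"
  assumes w_mono: "strict_mono w" and n_pos: "1 \<le> n" and w_per: "\<And>j. w (j + n) = w j + N"
    and w_f: "\<And>i j. w j < f (w i) \<longleftrightarrow> j < g i"
begin

lemma w_le: "w i \<le> w j \<longleftrightarrow> i \<le> j" and w_eq: "w i = w j \<longleftrightarrow> i = j"
  using strict_mono_less_eq[OF w_mono] strict_mono_eq[OF w_mono] by auto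

lemma w_inj: "inj w" using strict_mono_imp_inj_on[OF w_mono] .

lemma g_adm: "adm n g"
  unfolding adm_def
proof (intro conjI allI n_pos)
  show "mono g"
  proof (rule monoI)
    fix i j :: int assume "i \<le> j"
    then have "f (w i) \<le> f (w j)" by (intro a(2)) (simp add: w_le)
    moreover have "\<not> w (g j) < f (w j)" by (simp add: w_f)
    ultimately have "\<not> w (g j) < f (w i)" by simp
    then show "g i \<le> g j" by (simp add: w_f)
  qed
  show "g (i + n) = g i + n" for i
  proof -
    have "j < g (i + n) \<longleftrightarrow> j - n < g i" for j
    proof -
      have "j < g (i + n) \<longleftrightarrow> w ((j - n) + n) < f (w i + N)" unfolding w_per[symmetric] w_f by simp
      also have "\<dots> \<longleftrightarrow> w (j - n) < f (w i)" unfolding w_per a(3) by simp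
      finally show ?thesis by (simp only: w_f)
    qed
    from this[of "g i + n"] this[of "g i + n - 1"] show ?thesis by simp
  qed
  show "i < g i" for i using a(4)[of "w i"] by (simp add: w_f)
qed

text \<open>
  Extension by zero from the chosen vertices to all of them.
\<close>

definition ext :: "(int \<Rightarrow> int \<Rightarrow> 'k) \<Rightarrow> int \<Rightarrow> int \<Rightarrow> 'k" where
  "ext m x y = (if x \<in> range w \<and> y \<in> range w then m (inv_into UNIV w x) (inv_into UNIV w y) else 0)"

lemma ext_w: "ext m (w i) (w j) = m i j"
  by (simp add: ext_def inv_f_f[OF w_inj])

lemma ext_out: "x \<notin> range w \<or> y \<notin> range w \<Longrightarrow> ext m x y = 0"
  by (auto simp: ext_def)

lemma range_w_shift: "x + N \<in> range w \<longleftrightarrow> x \<in> range w"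
proof
  assume "x \<in> range w"
  then obtain j where "x = w j" by auto
  then have "x + N = w (j + n)" by (simp add: w_per)
  then show "x + N \<in> range w" by simp
next
  assume "x + N \<in> range w"
  then obtain j where "x + N = w j" by auto
  then have "x = w (j - n)" using w_per[of "j - n"] by simp
  then show "x \<in> range w" by simp
qed

lemma ext_PM: assumes m: "m \<in> carrier (PM n g)" shows "ext m \<in> carrier (PM N f)"
  unfolding PM_simps(1)
proof (intro CollectI conjI allI impI)
  fix x y
  show "ext m (x + N) (y + N) = ext m x y"
  proof (cases "x \<in> range w \<and> y \<in> range w")
    case True
    then obtain i j where "x = w i" "y = w j" by auto
    then show ?thesis using PM_D(1)[OF m, of i j] by (simp add: w_per[symmetric] ext_w)
  next
    case False
    then show ?thesis using ext_out[of x y m] ext_out[of "x + N" "y + N" m] range_w_shift by auto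
  qed
  assume nz: "ext m x y \<noteq> 0"
  then obtain i j where ij: "x = w i" "y = w j" using ext_out[of x y m] by blast
  then have "m i j \<noteq> 0" using nz by (simp add: ext_w)
  then show "x \<le> y" "y < f x" using PM_D(2,3)[OF m, of i j] by (simp_all add: ij w_le w_f)
qed

definition iota :: "(int \<Rightarrow> int \<Rightarrow> 'k) \<Rightarrow> 'a" where "iota m = Phi (ext m)"

lemma iota_closed: "m \<in> carrier (PM n g) \<Longrightarrow> iota m \<in> carrier A"
  unfolding iota_def by (rule P(4)[OF ext_PM])

lemma co_iota: "m \<in> carrier (PM n g) \<Longrightarrow> co (iota m) = ext m"
  unfolding iota_def by (rule co_Phi[OF ext_PM])

definition corner_set :: "'a set" where
  "corner_set = {x \<in> carrier A. \<forall>i j. i \<notin> range w \<or> j \<notin> range w \<longrightarrow> co x i j = 0}"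

lemma iota_corner: "m \<in> carrier (PM n g) \<Longrightarrow> iota m \<in> corner_set"
  by (simp add: corner_set_def iota_closed co_iota ext_out)

lemma iota_image: "iota ` carrier (PM n g) = corner_set"
proof
  show "iota ` carrier (PM n g) \<subseteq> corner_set" using iota_corner by blast
  show "corner_set \<subseteq> iota ` carrier (PM n g)"
  proof
    fix x assume "x \<in> corner_set"
    then have x: "x \<in> carrier A" and x0: "\<And>i j. i \<notin> range w \<or> j \<notin> range w \<Longrightarrow> co x i j = 0" by (auto simp: corner_set_def)
    define m where "m i j = co x (w i) (w j)" for i j
    have m: "m \<in> carrier (PM n g)"
      unfolding PM_simps(1)
    proof (intro CollectI conjI allI impI)
      fix i j
      show "m (i + n) (j + n) = m i j" using co_shift[OF x, of "w i" 1 "w j"] by (simp add: m_def w_per)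
      assume "m i j \<noteq> 0"
      then have "w i \<le> w j \<and> w j < f (w i)" using co_out[OF x] unfolding m_def by blast
      then show "i \<le> j" "j < g i" by (simp_all add: w_le w_f)
    qed
    have "ext m = co x"
    proof (intro HOL.ext)
      fix i j show "ext m i j = co x i j"
      proof (cases "i \<in> range w \<and> j \<in> range w")
        case True then show ?thesis by (auto simp: ext_w m_def)
      next
        case False then show ?thesis using x0 ext_out by auto
      qed
    qed
    then have "iota m = x" by (simp add: iota_def Phi_co[OF x])
    then show "x \<in> iota ` carrier (PM n g)" using m by blast
  qed
qed

lemma iota_inj: "inj_on iota (carrier (PM n g))"
proof (rule inj_onI)
  fix m m' assume m: "m \<in> carrier (PM n g)" "m' \<in> carrier (PM n g)" "iota m = iota m'"
  then have "ext m = ext m'" using co_iota by metis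
  then show "m = m'" by (intro HOL.ext) (metis ext_w)
qed

lemma iota_add: "m \<in> carrier (PM n g) \<Longrightarrow> m' \<in> carrier (PM n g) \<Longrightarrow> iota (m \<oplus>\<^bsub>PM n g\<^esub> m') = iota m \<oplus> iota m'"
proof (rule co_eqI)
  assume m: "m \<in> carrier (PM n g)" "m' \<in> carrier (PM n g)"
  interpret K: k_algebra "PM n g :: ('k, _) module" by (rule PM_k_algebra[OF g_adm])
  have mm: "m \<oplus>\<^bsub>PM n g\<^esub> m' \<in> carrier (PM n g)" using m by simp
  show "iota (m \<oplus>\<^bsub>PM n g\<^esub> m') \<in> carrier A" "iota m \<oplus> iota m' \<in> carrier A"
    using iota_closed m mm by simp_all
  show "co (iota (m \<oplus>\<^bsub>PM n g\<^esub> m')) i j = co (iota m \<oplus> iota m') i j" for i j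
    using m by (simp add: co_add iota_closed co_iota[OF mm] co_iota) (simp add: ext_def PM_simps(5))
qed

lemma iota_smult: "m \<in> carrier (PM n g) \<Longrightarrow> iota (c \<odot>\<^bsub>PM n g\<^esub> m) = c \<odot> iota m"
proof (rule co_eqI)
  assume m: "m \<in> carrier (PM n g)"
  interpret K: k_algebra "PM n g :: ('k, _) module" by (rule PM_k_algebra[OF g_adm])
  have mm: "c \<odot>\<^bsub>PM n g\<^esub> m \<in> carrier (PM n g)" using m by (rule K.smult_closed)
  show "iota (c \<odot>\<^bsub>PM n g\<^esub> m) \<in> carrier A" "c \<odot> iota m \<in> carrier A"
    using iota_closed[OF m] iota_closed[OF mm] by (simp_all add: smult_closed)
  show "co (iota (c \<odot>\<^bsub>PM n g\<^esub> m)) i j = co (c \<odot> iota m) i j" for i j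
    using m by (simp add: co_smult iota_closed co_iota[OF mm] co_iota) (simp add: ext_def PM_simps(6))
qed

lemma iota_mult: "m \<in> carrier (PM n g) \<Longrightarrow> m' \<in> carrier (PM n g) \<Longrightarrow> iota (m \<otimes>\<^bsub>PM n g\<^esub> m') = iota m \<otimes> iota m'"
proof (rule co_eqI)
  assume m: "m \<in> carrier (PM n g)" "m' \<in> carrier (PM n g)"
  interpret K: k_algebra "PM n g :: ('k, _) module" by (rule PM_k_algebra[OF g_adm])
  have mm: "m \<otimes>\<^bsub>PM n g\<^esub> m' \<in> carrier (PM n g)" using m by simp
  show "iota (m \<otimes>\<^bsub>PM n g\<^esub> m') \<in> carrier A" "iota m \<otimes> iota m' \<in> carrier A"
    using iota_closed m mm by simp_all
  fix x y assume xy: "x \<le> y" "y < f x"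
  have cm: "co (iota m \<otimes> iota m') x y = (\<Sum>k\<in>{x..y}. ext m x k * ext m' k y)"
    using xy m by (simp add: co_mult iota_closed co_iota)
  show "co (iota (m \<otimes>\<^bsub>PM n g\<^esub> m')) x y = co (iota m \<otimes> iota m') x y"
  proof (cases "x \<in> range w \<and> y \<in> range w")
    case True
    then obtain i j where ij: "x = w i" "y = w j" by auto
    have "(\<Sum>k\<in>{x..y}. ext m x k * ext m' k y) = (\<Sum>k\<in>w ` {i..j}. ext m x k * ext m' k y)"
    proof (rule sum.mono_neutral_right)
      show "w ` {i..j} \<subseteq> {x..y}" by (auto simp: ij w_le)
      show "\<forall>k\<in>{x..y} - w ` {i..j}. ext m x k * ext m' k y = 0"
      proof
        fix k assume k: "k \<in> {x..y} - w ` {i..j}"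
        have "k \<notin> range w"
        proof
          assume "k \<in> range w"
          then obtain l where "k = w l" by auto
          then show False using k by (auto simp: ij w_le)
        qed
        then show "ext m x k * ext m' k y = 0" by (simp add: ext_out)
      qed
    qed simp
    also have "\<dots> = (\<Sum>k\<in>{i..j}. ext m x (w k) * ext m' (w k) y)"
      by (rule sum.reindex[unfolded comp_def]) (rule inj_on_subset[OF w_inj], simp)
    also have "\<dots> = (\<Sum>k\<in>{i..j}. m i k * m' k j)" by (simp add: ij ext_w)
    also have "\<dots> = (m \<otimes>\<^bsub>PM n g\<^esub> m') i j" using xy unfolding ij w_f PM_simps(2) by simp
    finally have eq: "(\<Sum>k\<in>{x..y}. ext m x k * ext m' k y) = (m \<otimes>\<^bsub>PM n g\<^esub> m') i j" .
    have "co (iota (m \<otimes>\<^bsub>PM n g\<^esub> m')) x y = (m \<otimes>\<^bsub>PM n g\<^esub> m') i j"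
      unfolding co_iota[OF mm] ij ext_w ..
    then show ?thesis unfolding cm eq .
  next
    case False
    then have "ext m x k * ext m' k y = 0" for k using ext_out by auto
    then have "co (iota m \<otimes> iota m') x y = 0" unfolding cm by (simp add: sum.neutral)
    then show ?thesis unfolding co_iota[OF mm] using ext_out False by metis
  qed
qed

lemma PM_one_closed: "\<one>\<^bsub>PM n g\<^esub> \<in> carrier (PM n g :: ('k, _) module)"
proof -
  interpret K: k_algebra "PM n g :: ('k, _) module" by (rule PM_k_algebra[OF g_adm])
  show ?thesis by simp
qed

lemma PM_zero_closed: "\<zero>\<^bsub>PM n g\<^esub> \<in> carrier (PM n g :: ('k, _) module)"
proof -
  interpret K: k_algebra "PM n g :: ('k, _) module" by (rule PM_k_algebra[OF g_adm])
  show ?thesis by simp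
qed

definition eW :: 'a where "eW = iota \<one>\<^bsub>PM n g\<^esub>"

lemma co_eW: "co eW i j = (if i = j \<and> i \<in> range w then 1 else 0)"
  unfolding eW_def co_iota[OF PM_one_closed] by (auto simp: ext_def PM_simps(3) inv_f_f[OF w_inj] w_eq)

lemma eW_closed: "eW \<in> carrier A" unfolding eW_def by (rule iota_closed[OF PM_one_closed])

lemma co_eW_mult: "x \<in> carrier A \<Longrightarrow> co (eW \<otimes> x) i j = (if i \<in> range w then co x i j else 0)"
proof -
  assume x: "x \<in> carrier A"
  have "(\<Sum>k\<in>{i..j}. co eW i k * co x k j) = (\<Sum>k\<in>{i..j}. if k = i then (if i \<in> range w then co x i j else 0) else 0)"
    by (rule sum.cong) (auto simp: co_eW)
  then show ?thesis using x co_out[OF x, of i j] by (auto simp: co_mult eW_closed)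
qed

lemma co_mult_eW: "x \<in> carrier A \<Longrightarrow> co (x \<otimes> eW) i j = (if j \<in> range w then co x i j else 0)"
proof -
  assume x: "x \<in> carrier A"
  have "(\<Sum>k\<in>{i..j}. co x i k * co eW k j) = (\<Sum>k\<in>{i..j}. if k = j then (if j \<in> range w then co x i j else 0) else 0)"
    by (rule sum.cong) (auto simp: co_eW)
  then show ?thesis using x co_out[OF x, of i j] by (auto simp: co_mult eW_closed)
qed

lemma corner_set_eq: "corner_set = {x \<in> carrier A. eW \<otimes> x = x \<and> x \<otimes> eW = x}"
proof
  show "corner_set \<subseteq> {x \<in> carrier A. eW \<otimes> x = x \<and> x \<otimes> eW = x}"
  proof
    fix x assume "x \<in> corner_set"
    then have x: "x \<in> carrier A" "\<And>i j. i \<notin> range w \<or> j \<notin> range w \<Longrightarrow> co x i j = 0" by (auto simp: corner_set_def)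
    have "eW \<otimes> x = x" by (rule co_eqI) (use x in \<open>auto simp: co_eW_mult eW_closed\<close>)
    moreover have "x \<otimes> eW = x" by (rule co_eqI) (use x in \<open>auto simp: co_mult_eW eW_closed\<close>)
    ultimately show "x \<in> {x \<in> carrier A. eW \<otimes> x = x \<and> x \<otimes> eW = x}" using x by simp
  qed
  show "{x \<in> carrier A. eW \<otimes> x = x \<and> x \<otimes> eW = x} \<subseteq> corner_set"
  proof
    fix x assume "x \<in> {x \<in> carrier A. eW \<otimes> x = x \<and> x \<otimes> eW = x}"
    then have x: "x \<in> carrier A" "eW \<otimes> x = x" "x \<otimes> eW = x" by auto
    have "co x i j = 0" if "i \<notin> range w \<or> j \<notin> range w" for i j
      using that co_eW_mult[OF x(1), of i j] co_mult_eW[OF x(1), of i j] x(2,3) by auto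
    then show "x \<in> corner_set" using x(1) by (simp add: corner_set_def)
  qed
qed
text \<open>
  If the idempotent of the chosen vertices is central then the corner is a factor of the algebra.
\<close>

lemma corner_block:
  assumes central: "\<And>x. x \<in> carrier A \<Longrightarrow> eW \<otimes> x = x \<otimes> eW"
  shows "iota \<in> alg_isos (PM n g) (A\<lparr>carrier := {eW \<otimes> x | x. x \<in> carrier A}, one := eW\<rparr>)"
proof (rule alg_transport[OF PM_k_algebra[OF g_adm]])
  have idem: "eW \<otimes> eW = eW" by (rule co_eqI) (auto simp: co_eW_mult eW_closed co_eW)
  have "corner_set = {eW \<otimes> x | x. x \<in> carrier A}"
  proof
    show "corner_set \<subseteq> {eW \<otimes> x | x. x \<in> carrier A}" unfolding corner_set_eq by force
    show "{eW \<otimes> x | x. x \<in> carrier A} \<subseteq> corner_set"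
    proof
      fix y assume "y \<in> {eW \<otimes> x | x. x \<in> carrier A}"
      then obtain x where x: "x \<in> carrier A" "y = eW \<otimes> x" by blast
      have "eW \<otimes> y = y" unfolding x(2) by (simp add: m_assoc[symmetric] eW_closed x(1) idem)
      moreover from this have "y \<otimes> eW = y" using central[of y] x by (simp add: eW_closed)
      ultimately show "y \<in> corner_set" unfolding corner_set_eq using x by (simp add: eW_closed)
    qed
  qed
  then show "iota ` carrier (PM n g) = carrier (A\<lparr>carrier := {eW \<otimes> x | x. x \<in> carrier A}, one := eW\<rparr>)"
    using iota_image by simp
  have "iota \<zero>\<^bsub>PM n g\<^esub> = \<zero>"
    by (rule co_eqI) (simp_all add: iota_closed[OF PM_zero_closed] co_iota[OF PM_zero_closed] co_zero,
      simp add: ext_def PM_simps(4))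
  then show "iota \<zero>\<^bsub>PM n g\<^esub> = \<zero>\<^bsub>A\<lparr>carrier := {eW \<otimes> x | x. x \<in> carrier A}, one := eW\<rparr>\<^esub>" by simp
qed (simp_all add: iota_inj iota_add iota_mult iota_smult eW_def)

end

section \<open>Indecomposable projective modules and their socles\<close>

context nak
begin

text \<open>
  The indecomposable projective module at \<open>i\<close>; it is \<open>row i\<close> as a module
  of sequences of length one.
\<close>

definition PP :: "int \<Rightarrow> 'a rmod" where "PP i = seq_module A (FS 1 (\<lambda>_. i))"

definition seq1 :: "'a \<Rightarrow> nat \<Rightarrow> 'a" where "seq1 x = (\<lambda>k. if k = 0 then x else \<zero>)"

lemma seq1_0 [simp]: "seq1 x 0 = x" by (simp add: seq1_def)

lemma seq1_inj: "seq1 x = seq1 y \<longleftrightarrow> x = y" by (metis seq1_0)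

lemma FS1_eq: "FS 1 (\<lambda>_. i) = seq1 ` row i"
proof
  show "FS 1 (\<lambda>_. i) \<subseteq> seq1 ` row i"
  proof
    fix s assume s: "s \<in> FS 1 (\<lambda>_. i)"
    then have "s = seq1 (s 0)" by (auto simp: FS_def seq1_def)
    moreover have "s 0 \<in> row i" using s by (simp add: FS_def)
    ultimately show "s \<in> seq1 ` row i" by blast
  qed
qed (auto simp: FS_def seq1_def)

lemma PP_carrier: "carrier (PP i) = (\<lambda>x. {seq1 x}) ` row i"
  unfolding PP_def FS1_eq by (simp add: image_image)

lemma PP_ops: "x \<in> carrier A \<Longrightarrow> y \<in> carrier A \<Longrightarrow> {seq1 x} \<oplus>\<^bsub>PP i\<^esub> {seq1 y} = {seq1 (x \<oplus> y)}"
  "x \<in> carrier A \<Longrightarrow> c \<in> carrier A \<Longrightarrow> c \<odot>\<^bsub>PP i\<^esub> {seq1 x} = {seq1 (x \<otimes> c)}"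
  "\<zero>\<^bsub>PP i\<^esub> = {seq1 \<zero>}"
  unfolding PP_def by (auto simp: seq1_def fun_eq_iff)

text \<open>
  The submodules of \<open>PP i\<close>, where \<open>b\<close> ranges from \<open>i\<close> (all
  of it) to \<open>f i\<close> (zero).
\<close>

definition sub :: "int \<Rightarrow> int \<Rightarrow> (nat \<Rightarrow> 'a) set set" where "sub i b = (\<lambda>x. {seq1 x}) ` tail_row i b"

lemma PP_module: "right_module A (PP i)" unfolding PP_def by (rule FS_module)

lemma PP_projective: "projective_module A (PP i)" unfolding PP_def by (rule FS_projective)

lemma tail_row_closed:
  "x \<in> tail_row i b \<Longrightarrow> y \<in> tail_row i b \<Longrightarrow> x \<oplus> y \<in> tail_row i b"
  "x \<in> tail_row i b \<Longrightarrow> c \<in> carrier A \<Longrightarrow> x \<otimes> c \<in> tail_row i b"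
  "\<zero> \<in> tail_row i b"
proof -
  show "x \<oplus> y \<in> tail_row i b" if "x \<in> tail_row i b" "y \<in> tail_row i b"
    using that row_closed[of x i] row_closed[of y i] by (auto simp: tail_row_def row_add co_add)
  show "\<zero> \<in> tail_row i b" by (simp add: tail_row_def row_zero co_zero)
  show "x \<otimes> c \<in> tail_row i b" if x: "x \<in> tail_row i b" and c: "c \<in> carrier A"
  proof -
    have xr: "x \<in> row i" and x0: "\<And>j. j < b \<Longrightarrow> co x i j = 0" using x by (auto simp: tail_row_def)
    have "co (x \<otimes> c) i j = 0" if "j < b" for j
      using that x0 by (simp add: co_mult row_closed[OF xr] c sum.neutral)
    then show ?thesis using row_mult[OF xr c] by (simp add: tail_row_def)
  qed
qed

lemma sub_submodule: "submodule (sub i b) A (PP i)"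
  unfolding sub_def
proof (rule right_module.submoduleI[OF PP_module])
  have rc: "x \<in> row i" "x \<in> carrier A" if "x \<in> tail_row i b" for x using that row_closed by (auto simp: tail_row_def)
  show "(\<lambda>x. {seq1 x}) ` tail_row i b \<subseteq> carrier (PP i)" unfolding PP_carrier by (rule image_mono) (use rc in auto)
  show "\<zero>\<^bsub>PP i\<^esub> \<in> (\<lambda>x. {seq1 x}) ` tail_row i b" unfolding PP_ops(3) by (rule imageI[OF tail_row_closed(3)])
  show "X \<oplus>\<^bsub>PP i\<^esub> Y \<in> (\<lambda>x. {seq1 x}) ` tail_row i b" if XY: "X \<in> (\<lambda>x. {seq1 x}) ` tail_row i b" "Y \<in> (\<lambda>x. {seq1 x}) ` tail_row i b" for X Y
  proof -
    obtain x where x: "x \<in> tail_row i b" "X = {seq1 x}" using XY(1) by (rule imageE)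
    obtain y where y: "y \<in> tail_row i b" "Y = {seq1 y}" using XY(2) by (rule imageE)
    show ?thesis unfolding x(2) y(2) PP_ops(1)[OF rc(2)[OF x(1)] rc(2)[OF y(1)]]
      by (rule imageI[OF tail_row_closed(1)[OF x(1) y(1)]])
  qed
  show "c \<odot>\<^bsub>PP i\<^esub> X \<in> (\<lambda>x. {seq1 x}) ` tail_row i b" if X: "c \<in> carrier A" "X \<in> (\<lambda>x. {seq1 x}) ` tail_row i b" for c X
  proof -
    obtain x where x: "x \<in> tail_row i b" "X = {seq1 x}" using X(2) by (rule imageE)
    show ?thesis unfolding x(2) PP_ops(2)[OF rc(2)[OF x(1)] X(1)]
      by (rule imageI[OF tail_row_closed(2)[OF x(1) X(1)]])
  qed
qed

lemma PP_submodules: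
  assumes H: "submodule H A (PP i)" obtains b where "i \<le> b" "b \<le> f i" "H = sub i b"
proof -
  note d = right_module.submoduleD[OF PP_module H]
  define H' where "H' = {x. {seq1 x} \<in> H}"
  have H: "H = (\<lambda>x. {seq1 x}) ` H'" unfolding H'_def using d(1) unfolding PP_carrier by blast
  have 1: "H' \<subseteq> row i"
  proof
    fix x assume "x \<in> H'"
    then have "{seq1 x} \<in> carrier (PP i)" using d(1) by (auto simp: H'_def)
    then show "x \<in> row i" unfolding PP_carrier by (auto simp: seq1_inj)
  qed
  have 2: "\<zero> \<in> H'" using d(3) unfolding PP_ops(3) by (simp add: H'_def)
  have 3: "x \<oplus> y \<in> H'" if "x \<in> H'" "y \<in> H'" for x y
  proof -
    have "{seq1 x} \<oplus>\<^bsub>PP i\<^esub> {seq1 y} \<in> H" by (rule d(4)) (use that in \<open>simp_all add: H'_def\<close>)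
    moreover have "x \<in> carrier A" "y \<in> carrier A" using that 1 row_closed by blast+
    ultimately show ?thesis unfolding H'_def by (simp only: PP_ops(1)) simp
  qed
  have 4: "x \<otimes> c \<in> H'" if "x \<in> H'" "c \<in> carrier A" for x c
  proof -
    have "c \<odot>\<^bsub>PP i\<^esub> {seq1 x} \<in> H" by (rule d(5)) (use that in \<open>simp_all add: H'_def\<close>)
    moreover have "x \<in> carrier A" using that 1 row_closed by blast
    ultimately show ?thesis unfolding H'_def using that(2) by (simp only: PP_ops(2)) simp
  qed
  from right_ideal_char[OF 1 2 3 4] obtain b where "i \<le> b" "b \<le> f i" "H' = tail_row i b" by metis
  then show ?thesis using H that unfolding sub_def by simp
qed

lemma sub_mono: "b \<le> b' \<Longrightarrow> sub i b' \<subseteq> sub i b" unfolding sub_def by (rule image_mono) (auto simp: tail_row_def)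

lemma sub_top: "sub i i = carrier (PP i)"
proof -
  have "tail_row i i = row i" using co_out[OF row_closed] by (auto simp: tail_row_def)
  then show ?thesis by (simp only: PP_carrier sub_def)
qed

lemma tail_row_f: "tail_row i (f i) = {\<zero>}"
proof
  show "tail_row i (f i) \<subseteq> {\<zero>}"
  proof
    fix x assume x: "x \<in> tail_row i (f i)"
    have "x = \<zero>" by (rule row_eqI[of _ i]) (use x in \<open>auto simp: tail_row_def row_zero co_zero\<close>)
    then show "x \<in> {\<zero>}" by simp
  qed
qed (simp add: tail_row_closed)

lemma sub_bot: "sub i (f i) = {\<zero>\<^bsub>PP i\<^esub>}" unfolding sub_def tail_row_f PP_ops(3) by simp

lemma sub_E: "i \<le> b \<Longrightarrow> {seq1 (E i b)} \<in> sub i b" unfolding sub_def by (rule imageI[OF tail_row_E])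

lemma sub_nonzero: "i \<le> b \<Longrightarrow> b < f i \<Longrightarrow> sub i b \<noteq> {\<zero>\<^bsub>PP i\<^esub>}"
proof
  assume b: "i \<le> b" "b < f i" and "sub i b = {\<zero>\<^bsub>PP i\<^esub>}"
  then have "{seq1 (E i b)} = {seq1 \<zero>}" using sub_E[OF b(1)] unfolding PP_ops(3) by blast
  then have "E i b = \<zero>" by (simp add: seq1_inj)
  then show False using b by (simp add: E_zero_iff)
qed

lemma sub_eqD: "i \<le> b \<Longrightarrow> i \<le> b' \<Longrightarrow> b' \<le> f i \<Longrightarrow> sub i b \<subseteq> sub i b' \<Longrightarrow> b \<le> f i \<Longrightarrow> b' \<le> b"
proof (rule ccontr)
  assume b: "i \<le> b" "i \<le> b'" "b' \<le> f i" "sub i b \<subseteq> sub i b'" "b \<le> f i" "\<not> b' \<le> b"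
  then have "{seq1 (E i b)} \<in> sub i b'" using sub_E[OF b(1)] by blast
  then have "E i b \<in> tail_row i b'" unfolding sub_def by (auto simp: seq1_inj)
  then have "co (E i b) i b = 0" using b by (simp add: tail_row_def)
  then show False using b by (simp add: co_E)
qed

lemma PP_indecomposable: "indecomposable_module A (PP i)"
  unfolding indecomposable_module_def
proof (intro conjI allI impI PP_module)
  show "carrier (PP i) \<noteq> {\<zero>\<^bsub>PP i\<^esub>}" using sub_nonzero[of i i] a(4)[of i] unfolding sub_top by simp
  fix H L assume HL: "submodule H A (PP i) \<and> submodule L A (PP i) \<and> H \<inter> L = {\<zero>\<^bsub>PP i\<^esub>} \<and> H <+>\<^bsub>PP i\<^esub> L = carrier (PP i)"
  obtain b where b: "i \<le> b" "b \<le> f i" "H = sub i b" using HL PP_submodules by metis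
  obtain c where c: "i \<le> c" "c \<le> f i" "L = sub i c" using HL PP_submodules by metis
  have "H \<subseteq> L \<or> L \<subseteq> H" unfolding b c using sub_mono[of b c i] sub_mono[of c b i] by linarith
  then show "H = {\<zero>\<^bsub>PP i\<^esub>} \<or> L = {\<zero>\<^bsub>PP i\<^esub>}" using HL by (auto simp only: Int_absorb1 Int_absorb2)
qed

lemma sub_simple_iff:
  assumes b: "i \<le> b" "b \<le> f i"
  shows "simple_module A ((PP i)\<lparr>carrier := sub i b\<rparr>) \<longleftrightarrow> b = f i - 1"
proof
  note rest = right_module.submodule_restrict[OF PP_module sub_submodule[of i b]]
  assume s: "simple_module A ((PP i)\<lparr>carrier := sub i b\<rparr>)"
  then have nz: "sub i b \<noteq> {\<zero>\<^bsub>PP i\<^esub>}" by (simp add: simple_module_def)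
  then have "b \<noteq> f i" using sub_bot[of i] by metis
  then have lt: "b < f i" using b by simp
  have "submodule (sub i (b + 1)) A ((PP i)\<lparr>carrier := sub i b\<rparr>)"
    unfolding rest using sub_submodule sub_mono[of b "b + 1" i] by simp
  then have "sub i (b + 1) = {\<zero>\<^bsub>PP i\<^esub>} \<or> sub i (b + 1) = sub i b" using s unfolding simple_module_def by simp
  moreover have "sub i (b + 1) \<noteq> sub i b" using sub_eqD[of i b "b + 1"] b lt by auto
  ultimately show "b = f i - 1" using sub_nonzero[of i "b + 1"] b lt by force
next
  note rest = right_module.submodule_restrict[OF PP_module sub_submodule[of i b]]
  assume bf: "b = f i - 1"
  show "simple_module A ((PP i)\<lparr>carrier := sub i b\<rparr>)"
    unfolding simple_module_def
  proof (intro conjI allI impI)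
    show "right_module A ((PP i)\<lparr>carrier := sub i b\<rparr>)" by (rule right_module.submodule_right_module[OF PP_module sub_submodule])
    show "carrier ((PP i)\<lparr>carrier := sub i b\<rparr>) \<noteq> {\<zero>\<^bsub>(PP i)\<lparr>carrier := sub i b\<rparr>\<^esub>}"
      using sub_nonzero[of i b] b bf by simp
    fix H assume "submodule H A ((PP i)\<lparr>carrier := sub i b\<rparr>)"
    then have H: "submodule H A (PP i)" "H \<subseteq> sub i b" unfolding rest by auto
    obtain c where c: "i \<le> c" "c \<le> f i" "H = sub i c" using H(1) PP_submodules by metis
    have "b \<le> c" using sub_eqD[OF c(1) b] H(2) c by simp
    then have "c = b \<or> c = f i" using c bf by linarith
    then show "H = {\<zero>\<^bsub>(PP i)\<lparr>carrier := sub i b\<rparr>\<^esub>} \<or> H = carrier ((PP i)\<lparr>carrier := sub i b\<rparr>)"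
      using c(3) sub_bot[of i] by (elim disjE) simp_all
  qed
qed

lemma PP_socle: "socle A (PP i) = (PP i)\<lparr>carrier := sub i (f i - 1)\<rparr>"
proof -
  have b: "i \<le> f i - 1" "f i - 1 \<le> f i" using a(5)[of i] by auto
  have "\<Inter>{H. submodule H A (PP i) \<and> (\<forall>L. submodule L A (PP i) \<and> simple_module A ((PP i)\<lparr>carrier := L\<rparr>) \<longrightarrow> L \<subseteq> H)} = sub i (f i - 1)"
    (is "\<Inter>?F = _")
  proof
    have "sub i (f i - 1) \<in> ?F"
    proof (intro CollectI conjI sub_submodule allI impI)
      fix L assume L: "submodule L A (PP i) \<and> simple_module A ((PP i)\<lparr>carrier := L\<rparr>)"
      then obtain c where c: "i \<le> c" "c \<le> f i" "L = sub i c" using PP_submodules by metis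
      then show "L \<subseteq> sub i (f i - 1)" using L sub_simple_iff[OF c(1,2)] by simp
    qed
    then show "\<Inter>?F \<subseteq> sub i (f i - 1)" by blast
    show "sub i (f i - 1) \<subseteq> \<Inter>?F"
      using sub_simple_iff[OF b] sub_submodule[of i "f i - 1"] by blast
  qed
  then show ?thesis unfolding socle_def by simp
qed

lemma PP_socle_at:
  assumes "N dvd f i - 1 - j" shows "simple_at A (e j) (socle A (PP i))"
  unfolding simple_at_def PP_socle
proof
  have b: "i \<le> f i - 1" "f i - 1 \<le> f i" "f i - 1 < f i" using a(5)[of i] by auto
  show "simple_module A ((PP i)\<lparr>carrier := sub i (f i - 1)\<rparr>)" using sub_simple_iff[OF b(1,2)] by simp
  have "e j = e (f i - 1)" using e_cong[OF assms] by simp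
  then have "e j \<odot>\<^bsub>PP i\<^esub> {seq1 (E i (f i - 1))} = {seq1 (E i (f i - 1))}"
    using PP_ops(2)[of "E i (f i - 1)" "e j"] e_E(2)[OF b(1)] by simp
  moreover have "{seq1 (E i (f i - 1))} \<noteq> \<zero>\<^bsub>PP i\<^esub>"
    unfolding PP_ops(3) using b E_zero_iff[of i "f i - 1"] by (simp add: seq1_inj)
  ultimately have "e j \<odot>\<^bsub>PP i\<^esub> {seq1 (E i (f i - 1))} \<noteq> \<zero>\<^bsub>PP i\<^esub>" by simp
  then show "\<exists>x\<in>carrier ((PP i)\<lparr>carrier := sub i (f i - 1)\<rparr>). e j \<odot>\<^bsub>(PP i)\<lparr>carrier := sub i (f i - 1)\<rparr>\<^esub> x \<noteq> \<zero>\<^bsub>(PP i)\<lparr>carrier := sub i (f i - 1)\<rparr>\<^esub>"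
    by (intro bexI[of _ "{seq1 (E i (f i - 1))}"]) (simp, simp add: sub_E[OF b(1)])
qed

text \<open>
  The radical of \<open>PP i\<close> is its only maximal submodule, hence superfluous.
\<close>

lemma PP_cover: "projective_cover A (PP i) (simple_mod i)"
  unfolding projective_cover_def
proof (intro conjI PP_projective simple_mod_fg)
  let ?p = "\<lambda>X\<in>carrier (PP i). enc (co (the_elem X 0) i i)"
  have p: "?p \<in> mod_hom A (PP i) (simple_mod i)"
  proof (rule mod_homI)
    interpret right_module A "PP i" by (rule PP_module)
    fix X assume X: "X \<in> carrier (PP i)"
    then obtain x where x: "x \<in> row i" "X = {seq1 x}" unfolding PP_carrier by (rule imageE)
    have xc: "x \<in> carrier A" by (rule row_closed[OF x(1)])
    show "enc (co (the_elem X 0) i i) \<in> carrier (simple_mod i)" by simp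
    show "c \<odot>\<^bsub>PP i\<^esub> X \<in> carrier (PP i)" if "c \<in> carrier A" for c by (rule smult_closed[OF that X])
    show "enc (co (the_elem (c \<odot>\<^bsub>PP i\<^esub> X) 0) i i) = c \<odot>\<^bsub>simple_mod i\<^esub> enc (co (the_elem X 0) i i)"
      if c: "c \<in> carrier A" for c
      unfolding x(2) PP_ops(2)[OF xc c] by (simp add: co_mult_diag xc c)
    fix Y assume Y: "Y \<in> carrier (PP i)"
    then obtain y where y: "y \<in> row i" "Y = {seq1 y}" unfolding PP_carrier by (rule imageE)
    have yc: "y \<in> carrier A" by (rule row_closed[OF y(1)])
    show "X \<oplus>\<^bsub>PP i\<^esub> Y \<in> carrier (PP i)" by (rule M.add.m_closed[OF X Y])
    show "enc (co (the_elem (X \<oplus>\<^bsub>PP i\<^esub> Y) 0) i i) = enc (co (the_elem X 0) i i) \<oplus>\<^bsub>simple_mod i\<^esub> enc (co (the_elem Y 0) i i)"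
      unfolding x(2) y(2) PP_ops(1)[OF xc yc] by (simp add: co_add xc yc)
  qed
  have app: "?p {seq1 x} = enc (co x i i)" if "x \<in> row i" for x
  proof -
    have "{seq1 x} \<in> carrier (PP i)" unfolding PP_carrier by (rule imageI[OF that])
    then show ?thesis by (simp only: restrict_apply' the_elem_eq seq1_0)
  qed
  show "\<exists>p\<in>mod_hom A (PP i) (simple_mod i). p ` carrier (PP i) = carrier (simple_mod i) \<and>
     (\<forall>H. submodule H A (PP i) \<and> H <+>\<^bsub>PP i\<^esub> hom_kernel (PP i) (simple_mod i) p = carrier (PP i) \<longrightarrow> H = carrier (PP i))"
  proof (intro bexI[OF _ p] conjI allI impI)
    show "?p ` carrier (PP i) = carrier (simple_mod i)"
    proof
      show "?p ` carrier (PP i) \<subseteq> carrier (simple_mod i)" using mod_homD(1)[OF p] by blast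
      show "carrier (simple_mod i) \<subseteq> ?p ` carrier (PP i)"
      proof
        fix X assume "X \<in> carrier (simple_mod i)"
        then obtain c where c: "X = enc c" by auto
        have r: "c \<odot> e i \<in> row i" by (rule row_smult[OF row_E]) simp
        have pX: "?p {seq1 (c \<odot> e i)} = X" unfolding app[OF r] c by (simp add: co_smult co_e)
        have "{seq1 (c \<odot> e i)} \<in> carrier (PP i)" unfolding PP_carrier by (rule imageI[OF r])
        then show "X \<in> ?p ` carrier (PP i)"
          by (intro image_eqI[of X ?p "{seq1 (c \<odot> e i)}"]) (rule pX[symmetric])
      qed
    qed
    fix H assume H: "submodule H A (PP i) \<and> H <+>\<^bsub>PP i\<^esub> hom_kernel (PP i) (simple_mod i) ?p = carrier (PP i)"
    note Hs = conjunct1[OF H] and Hc = conjunct2[OF H]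
    obtain b where b: "i \<le> b" "b \<le> f i" "H = sub i b" using Hs by (rule PP_submodules)
    have "{seq1 (e i)} \<in> carrier (PP i)" unfolding PP_carrier by (rule imageI[OF row_E]) simp
    then have "{seq1 (e i)} \<in> H <+>\<^bsub>PP i\<^esub> hom_kernel (PP i) (simple_mod i) ?p" unfolding Hc .
    then obtain X Y where XY: "X \<in> H" "Y \<in> hom_kernel (PP i) (simple_mod i) ?p" "{seq1 (e i)} = X \<oplus>\<^bsub>PP i\<^esub> Y"
      unfolding set_add_def' by blast
    obtain x where x: "x \<in> tail_row i b" "X = {seq1 x}" using XY(1) unfolding b(3) sub_def by (rule imageE)
    have Yc: "Y \<in> carrier (PP i) \<and> ?p Y = \<zero>\<^bsub>simple_mod i\<^esub>" using XY(2) unfolding hom_kernel_def by (rule CollectD)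
    obtain y where y: "y \<in> row i" "Y = {seq1 y}" using conjunct1[OF Yc] unfolding PP_carrier by (rule imageE)
    have "enc (co y i i) = enc 0" using conjunct2[OF Yc] unfolding y(2) app[OF y(1)] simple_mod_simps .
    then have y0: "co y i i = 0" by (simp only: enc_inj)
    have xc: "x \<in> carrier A" "y \<in> carrier A" using x(1) y(1) row_closed by (auto simp: tail_row_def)
    have "e i = x \<oplus> y" using XY(3) unfolding x(2) y(2) PP_ops(1)[OF xc] by (simp add: seq1_inj)
    then have "co (e i) i i = co x i i" using co_add[OF xc, of i i] y0 by simp
    then have "co x i i = 1" by (simp add: co_e)
    then have "\<not> i < b" using x(1) by (auto simp: tail_row_def)
    then have "b = i" using b(1) by simp
    then show "H = carrier (PP i)" using b(3) sub_top by simp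
  qed
qed
lemma smult_pow_fix:
  assumes M: "right_module A M" and x: "x \<in> carrier M" and u: "u \<in> carrier A" "u \<odot>\<^bsub>M\<^esub> x = x"
  shows "(u [^] (m::nat)) \<odot>\<^bsub>M\<^esub> x = x"
proof (induction m)
  case 0 then show ?case using right_module.smult_one[OF M x] by simp
next
  case (Suc m)
  then show ?case using right_module.smult_mult[OF M nat_pow_closed[OF u(1)] u(1) x, of m] u(2) by simp
qed

text \<open>
  Let \<open>x\<close> generate the simple socle and belong to the vertex \<open>j\<close>. The
  arrow from \<open>j\<close> annihilates \<open>x\<close>; otherwise \<open>x\<close> would be
  reproduced by a nilpotent element. Inside a sum of rows, an element annihilated by the arrow at
  its end is supported in the last columns \<open>f k - 1\<close>.
\<close>

lemma socle_of_projective: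
  fixes P :: "'a rmod"
  assumes two: "\<And>i. i + 2 \<le> f i" and P: "projective_module A P" and s: "simple_at A (e j) (socle A P)"
  shows "\<exists>k. N dvd f k - 1 - j"
proof -
  define C where "C = carrier (socle A P)"
  have soc: "socle A P = P\<lparr>carrier := C\<rparr>" by (simp add: socle_def C_def)
  have simple: "simple_module A (P\<lparr>carrier := C\<rparr>)" using s by (simp add: simple_at_def soc)
  have S: "right_module A (P\<lparr>carrier := C\<rparr>)" using simple by (simp add: simple_module_def)
  interpret S: right_module A "P\<lparr>carrier := C\<rparr>" by (rule S)
  have PM: "right_module A P" using P by (simp add: projective_module_def fg_module_def)
  interpret PM: right_module A P by (rule PM)
  have "submodule (carrier P) A P" by (rule PM.carrier_submodule)
  then have "carrier P \<in> {H. submodule H A P \<and> (\<forall>L. submodule L A P \<and> simple_module A (P\<lparr>carrier := L\<rparr>) \<longrightarrow> L \<subseteq> H)}"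
    using PM.submoduleD(1) by blast
  then have CP: "C \<subseteq> carrier P" unfolding C_def socle_def by auto
  obtain x0 where x0: "x0 \<in> C" "e j \<odot>\<^bsub>P\<^esub> x0 \<noteq> \<zero>\<^bsub>P\<^esub>" using s by (auto simp: simple_at_def soc)
  define x where "x = e j \<odot>\<^bsub>P\<^esub> x0"
  have xC: "x \<in> C" unfolding x_def using S.smult_closed[OF E_closed, of x0 j j] x0(1) by simp
  have x: "x \<in> carrier P" "x \<noteq> \<zero>\<^bsub>P\<^esub>" using xC CP x0(2) by (auto simp: x_def)
  have ex: "e j \<odot>\<^bsub>P\<^esub> x = x"
    using PM.smult_mult[OF E_closed E_closed, of x0 j j j j] x0(1) CP by (auto simp: x_def e_idem)
  let ?al = "E j (j + 1)"
  have al0: "?al \<odot>\<^bsub>P\<^esub> x = \<zero>\<^bsub>P\<^esub>"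
  proof (rule ccontr)
    assume nz: "?al \<odot>\<^bsub>P\<^esub> x \<noteq> \<zero>\<^bsub>P\<^esub>"
    define z where "z = ?al \<odot>\<^bsub>P\<^esub> x"
    have zC: "z \<in> C" using S.smult_closed[OF E_closed, of x j "j + 1"] xC by (simp add: z_def)
    have zP: "z \<in> carrier P" using zC CP by blast
    define H where "H = (\<lambda>c. c \<odot>\<^bsub>P\<^esub> z) ` carrier A"
    have "submodule H A (P\<lparr>carrier := C\<rparr>)"
    proof (rule S.submoduleI)
      show "H \<subseteq> carrier (P\<lparr>carrier := C\<rparr>)" unfolding H_def using S.smult_closed[of _ z] zC by auto
      have "\<zero>\<^bsub>P\<^esub> = \<zero> \<odot>\<^bsub>P\<^esub> z" using PM.smult_l_null[OF zP] by simp
      then show "\<zero>\<^bsub>P\<lparr>carrier := C\<rparr>\<^esub> \<in> H" unfolding H_def by simp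
      show "u \<oplus>\<^bsub>P\<lparr>carrier := C\<rparr>\<^esub> v \<in> H" if uv: "u \<in> H" "v \<in> H" for u v
      proof -
        obtain c d where cd: "c \<in> carrier A" "d \<in> carrier A" "u = c \<odot>\<^bsub>P\<^esub> z" "v = d \<odot>\<^bsub>P\<^esub> z" using uv unfolding H_def by blast
        have "u \<oplus>\<^bsub>P\<^esub> v = (c \<oplus> d) \<odot>\<^bsub>P\<^esub> z" unfolding cd PM.smult_l_distr[OF cd(1,2) zP] ..
        then show ?thesis unfolding H_def using cd(1,2) by simp
      qed
      show "c \<odot>\<^bsub>P\<lparr>carrier := C\<rparr>\<^esub> u \<in> H" if cu: "c \<in> carrier A" "u \<in> H" for c u
      proof -
        obtain d where d: "d \<in> carrier A" "u = d \<odot>\<^bsub>P\<^esub> z" using cu(2) unfolding H_def by blast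
        have "c \<odot>\<^bsub>P\<^esub> u = (d \<otimes> c) \<odot>\<^bsub>P\<^esub> z" unfolding d PM.smult_mult[OF d(1) cu(1) zP] ..
        then show ?thesis unfolding H_def using d(1) cu(1) by simp
      qed
    qed
    then have "H = {\<zero>\<^bsub>P\<^esub>} \<or> H = C" using simple by (auto simp: simple_module_def)
    moreover have "z \<in> H" unfolding H_def using PM.smult_one[OF zP] by (metis imageI one_closed)
    ultimately have "x \<in> H" using nz xC by (auto simp: z_def)
    then obtain c where c: "c \<in> carrier A" "x = c \<odot>\<^bsub>P\<^esub> z" unfolding H_def by blast
    then have fix_x: "(?al \<otimes> c) \<odot>\<^bsub>P\<^esub> x = x" using PM.smult_mult[OF E_closed c(1) x(1)] by (simp add: z_def)
    have "co (?al \<otimes> c) i i = 0" for i by (simp add: co_mult_diag c(1) co_E)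
    then have "(?al \<otimes> c) [^] nat (f 0 + N) = \<zero>" using nilpotent c(1) by simp
    then show False using smult_pow_fix[OF PM x(1) _ fix_x, of "nat (f 0 + N)"] c(1) PM.smult_l_null[OF x(1)] x(2) by simp
  qed
  obtain n b g h where g: "g \<in> mod_hom A (seq_module A (FS n b)) P" and h: "h \<in> mod_hom A P (seq_module A (FS n b))"
    and gh: "\<And>x. x \<in> carrier P \<Longrightarrow> g (h x) = x" by (rule projective_split[OF P]) blast
  let ?F = "seq_module A (FS n b)"
  obtain t where t: "t \<in> FS n b" "h x = {t}" using mod_homD(1)[OF h x(1)] by auto
  have "{\<lambda>i. t i \<otimes> e j} = {t}" using mod_homD(3)[OF h E_closed x(1), of j j] ex t(2) by simp
  then have te: "t i \<otimes> e j = t i" for i by (metis singleton_inject)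
  have "{\<lambda>i. t i \<otimes> ?al} = {\<lambda>i. \<zero>}"
    using mod_homD(3)[OF h E_closed x(1), of j "j + 1"] al0 t(2) mod_hom_zero[OF PM FS_module h] by simp
  then have ta: "t i \<otimes> ?al = \<zero>" for i by (metis singleton_inject)
  have "t \<noteq> (\<lambda>i. \<zero>)"
  proof
    assume "t = (\<lambda>i. \<zero>)"
    then have "h x = \<zero>\<^bsub>?F\<^esub>" using t(2) by simp
    then have "x = \<zero>\<^bsub>P\<^esub>" using gh[OF x(1)] mod_hom_zero[OF FS_module PM g] by simp
    then show False using x(2) by simp
  qed
  then obtain i where i: "t i \<noteq> \<zero>" by auto
  then have "i < n" using t(1) by (auto simp: FS_def not_le[symmetric])
  then have tr: "t i \<in> row (b i)" using t(1) by (simp add: FS_def)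
  have tc: "t i \<in> carrier A" by (rule row_closed[OF tr])
  obtain l where l: "b i \<le> l" "l < f (b i)" "co (t i) (b i) l \<noteq> 0"
    using row_eqI[OF tr row_zero] i by (auto simp: co_zero)
  have d: "N dvd l - j" using te[of i] co_mult_e[OF tc, of j "b i" l] l(3) by (simp split: if_splits)
  have "j + 1 < f j" using two[of j] by simp
  then have "co (t i \<otimes> ?al) (b i) (l + 1) = (if l + 1 < f (b i) then co (t i) (b i) l else 0)"
    using d by (simp add: co_mult_E tc)
  then have "\<not> l + 1 < f (b i)" using ta[of i] l(3) by (auto simp: co_zero)
  then have "f (b i) - 1 = l" using l(2) by simp
  then show ?thesis using d by (intro exI[of _ "b i"]) simp
qed

lemma socle_vertices_eq:
  assumes two: "\<And>i. i + 2 \<le> f i"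
  shows "socle_vertices A (nat N) (\<lambda>i. e (int i)) = {i. i < nat N \<and> (\<exists>k. N dvd f k - 1 - int i)}"
proof
  show "socle_vertices A (nat N) (\<lambda>i. e (int i)) \<subseteq> {i. i < nat N \<and> (\<exists>k. N dvd f k - 1 - int i)}"
    unfolding socle_vertices_def using socle_of_projective[OF two] by blast
  show "{i. i < nat N \<and> (\<exists>k. N dvd f k - 1 - int i)} \<subseteq> socle_vertices A (nat N) (\<lambda>i. e (int i))"
    unfolding socle_vertices_def using PP_projective PP_indecomposable PP_socle_at by blast
qed

text \<open>
  The socle of \<open>PP k\<close> is at \<open>f k - 1\<close>, so the shift by one gives the
  values of \<open>f\<close>.
\<close>

lemma shifted_socle_vertices_eq:
  assumes two: "\<And>i. i + 2 \<le> f i"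
  shows "shifted_socle_vertices A (nat N) (\<lambda>i. e (int i)) = nat ` (range f \<inter> {0..<N})"
proof
  have N: "1 \<le> N" by (rule a(1))
  have step: "int (Suc i mod nat N) = (int i + 1) mod N" for i using N by (simp add: zmod_int add.commute)
  show "shifted_socle_vertices A (nat N) (\<lambda>i. e (int i)) \<subseteq> nat ` (range f \<inter> {0..<N})"
  proof
    fix v assume "v \<in> shifted_socle_vertices A (nat N) (\<lambda>i. e (int i))"
    then obtain i k where i: "v = Suc i mod nat N" "N dvd f k - 1 - int i"
      unfolding shifted_socle_vertices_def socle_vertices_eq[OF two] by blast
    have "N dvd f k - (int i + 1)" using i(2) by (simp add: algebra_simps)
    then have "int v = f k mod N" unfolding i(1) step by (simp add: mod_eq_dvd_iff[symmetric])
    also have "\<dots> = f (k + - (f k div N) * N)" unfolding a(6) by (simp add: minus_mult_div_eq_mod[symmetric] mult.commute)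
    finally have "int v \<in> range f" by simp
    moreover have "int v \<in> {0..<N}" using \<open>int v = f k mod N\<close> N by simp
    ultimately show "v \<in> nat ` (range f \<inter> {0..<N})" by (intro image_eqI[of _ _ "int v"]) simp_all
  qed
  show "nat ` (range f \<inter> {0..<N}) \<subseteq> shifted_socle_vertices A (nat N) (\<lambda>i. e (int i))"
  proof
    fix v assume "v \<in> nat ` (range f \<inter> {0..<N})"
    then obtain k where k: "v = nat (f k)" "0 \<le> f k" "f k < N" by auto
    define i where "i = nat ((f k - 1) mod N)"
    have ii: "int i = (f k - 1) mod N" using N by (simp add: i_def)
    have "i < nat N" using N ii by (simp add: i_def nat_less_iff)
    moreover have "N dvd f k - 1 - int i" unfolding ii by (simp add: mod_eq_dvd_iff[symmetric])
    ultimately have "i \<in> socle_vertices A (nat N) (\<lambda>i. e (int i))" unfolding socle_vertices_eq[OF two] by blast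
    moreover have "v = Suc i mod nat N"
    proof -
      have "int (Suc i mod nat N) = ((f k - 1) mod N + 1) mod N" unfolding step ii ..
      also have "\<dots> = f k mod N" by (subst mod_add_left_eq) simp
      also have "\<dots> = int v" using k by simp
      finally show ?thesis by simp
    qed
    ultimately show "v \<in> shifted_socle_vertices A (nat N) (\<lambda>i. e (int i))" unfolding shifted_socle_vertices_def by blast
  qed
qed

end

section \<open>The syzygy filtered algebra as a corner\<close>

context corner
begin

text \<open>
  The vertices of the corner, as elements of \<open>{0..<N}\<close>.
\<close>

definition VV :: "nat set" where "VV = nat ` (range w \<inter> {0..<N})"

lemma VV_iff: "v \<in> VV \<longleftrightarrow> int v < N \<and> int v \<in> range w"
proof
  assume "v \<in> VV"
  then obtain z where "v = nat z" "z \<in> range w" "0 \<le> z" "z < N" unfolding VV_def by auto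
  then show "int v < N \<and> int v \<in> range w" by simp
next
  assume "int v < N \<and> int v \<in> range w"
  then show "v \<in> VV" unfolding VV_def by (intro image_eqI[of _ _ "int v"]) simp_all
qed

lemma range_w_mod: "x mod N \<in> range w \<longleftrightarrow> x \<in> range w"
proof -
  have "x + t * N \<in> range w \<longleftrightarrow> x \<in> range w" for t
  proof (induction t rule: int_induct[of _ 0])
    case base then show ?case by simp
  next
    case (step1 t) then show ?case using range_w_shift[of "x + t * N"] by (simp add: algebra_simps)
  next
    case (step2 t) then show ?case using range_w_shift[of "x + (t - 1) * N"] by (simp add: algebra_simps)
  qed
  from this[of "- (x div N)"] show ?thesis by (simp add: minus_mult_div_eq_mod[symmetric] mult.commute)
qed

lemma VV_mod: "nat (a mod N) \<in> VV \<longleftrightarrow> a \<in> range w"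
  using a(1) by (simp add: VV_iff range_w_mod)

text \<open>
  As right modules, \<open>DS\<close> is the right ideal \<open>eW A\<close>: an element of it is
  the same as a family of rows. The maps \<open>spread\<close> and \<open>glue\<close> are the two
  directions.
\<close>

definition DS :: "('a, nat \<Rightarrow> (nat \<Rightarrow> 'a) set) module" where "DS = direct_sum VV (\<lambda>v. PP (int v))"

lemma DS_simps:
  "carrier DS = (\<Pi>\<^sub>E v\<in>VV. carrier (PP (int v)))" "\<zero>\<^bsub>DS\<^esub> = (\<lambda>v\<in>VV. \<zero>\<^bsub>PP (int v)\<^esub>)"
  "X \<oplus>\<^bsub>DS\<^esub> Y = (\<lambda>v\<in>VV. X v \<oplus>\<^bsub>PP (int v)\<^esub> Y v)" "c \<odot>\<^bsub>DS\<^esub> X = (\<lambda>v\<in>VV. c \<odot>\<^bsub>PP (int v)\<^esub> X v)"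
  by (simp_all add: DS_def direct_sum_def)
definition spread :: "'a \<Rightarrow> nat \<Rightarrow> (nat \<Rightarrow> 'a) set" where "spread y = (\<lambda>v\<in>VV. {seq1 (e (int v) \<otimes> y)})"

definition glue :: "(nat \<Rightarrow> (nat \<Rightarrow> 'a) set) \<Rightarrow> 'a" where
  "glue X = Phi (\<lambda>a b. if a \<in> range w then co (the_elem (X (nat (a mod N))) 0) a b else 0)"

lemma DS_elem:
  assumes "X \<in> carrier DS" "v \<in> VV"
  shows "X v = {seq1 (the_elem (X v) 0)}" "the_elem (X v) 0 \<in> row (int v)" "the_elem (X v) 0 \<in> carrier A"
proof -
  have "X v \<in> carrier (PP (int v))" using PiE_mem[OF assms(1)[unfolded DS_simps(1)] assms(2)] .
  then obtain x where x: "x \<in> row (int v)" "X v = {seq1 x}" unfolding PP_carrier by (rule imageE)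
  then show "X v = {seq1 (the_elem (X v) 0)}" "the_elem (X v) 0 \<in> row (int v)" "the_elem (X v) 0 \<in> carrier A"
    by (simp_all add: row_closed)
qed

lemma glue_PM:
  assumes X: "X \<in> carrier DS"
  shows "(\<lambda>a b. if a \<in> range w then co (the_elem (X (nat (a mod N))) 0) a b else 0) \<in> carrier (PM N f)"
  unfolding PM_simps(1)
proof (intro CollectI conjI allI impI)
  fix a b
  show "(if a + N \<in> range w then co (the_elem (X (nat ((a + N) mod N))) 0) (a + N) (b + N) else 0) =
    (if a \<in> range w then co (the_elem (X (nat (a mod N))) 0) a b else 0)"
  proof (cases "a \<in> range w")
    case True
    then have "the_elem (X (nat (a mod N))) 0 \<in> carrier A" using DS_elem(3)[OF X] VV_mod by blast
    from co_shift[OF this, of a 1 b] show ?thesis by (simp add: range_w_shift)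
  qed (simp add: range_w_shift)
  assume nz: "(if a \<in> range w then co (the_elem (X (nat (a mod N))) 0) a b else 0) \<noteq> 0"
  then have W: "a \<in> range w" by (auto split: if_splits)
  then have "the_elem (X (nat (a mod N))) 0 \<in> carrier A" using DS_elem(3)[OF X] VV_mod by blast
  from co_out[OF this, of a b] nz W show "a \<le> b" "b < f a" by auto
qed

lemma glue_closed: "X \<in> carrier DS \<Longrightarrow> glue X \<in> carrier A"
  unfolding glue_def by (rule P(4)[OF glue_PM])

lemma co_glue: "X \<in> carrier DS \<Longrightarrow> co (glue X) a b = (if a \<in> range w then co (the_elem (X (nat (a mod N))) 0) a b else 0)"
  unfolding glue_def by (simp only: co_Phi[OF glue_PM])

lemma spread_closed: "y \<in> carrier A \<Longrightarrow> spread y \<in> carrier DS"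
  unfolding DS_simps spread_def PP_carrier
proof (rule restrict_PiE_iff[THEN iffD2], rule ballI)
  fix v assume "y \<in> carrier A"
  then show "{seq1 (e (int v) \<otimes> y)} \<in> (\<lambda>x. {seq1 x}) ` row (int v)" by (intro imageI row_e_mult)
qed

lemma spread_glue: assumes X: "X \<in> carrier DS" shows "spread (glue X) = X"
proof (rule PiE_ext[of _ VV "\<lambda>v. carrier (PP (int v))"])
  show "spread (glue X) \<in> (\<Pi>\<^sub>E v\<in>VV. carrier (PP (int v)))" "X \<in> (\<Pi>\<^sub>E v\<in>VV. carrier (PP (int v)))"
    using spread_closed[OF glue_closed[OF X]] X unfolding DS_simps by simp_all
  fix v assume v: "v \<in> VV"
  note x = DS_elem[OF X v]
  have "e (int v) \<otimes> glue X = the_elem (X v) 0"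
  proof (rule row_eqI[OF row_e_mult[OF glue_closed[OF X]] x(2)])
    fix j
    have "int v mod N = int v" using v by (simp add: VV_iff)
    then show "co (e (int v) \<otimes> glue X) (int v) j = co (the_elem (X v) 0) (int v) j"
      using v by (simp add: co_e_mult glue_closed[OF X] co_glue[OF X] VV_iff)
  qed
  then show "spread (glue X) v = X v" using v x(1) by (simp add: spread_def)
qed

lemma glue_spread: assumes y: "y \<in> carrier A" shows "glue (spread y) = eW \<otimes> y"
proof (rule co_eqI)
  fix a b
  have "N dvd a - a mod N" by (simp add: mod_eq_dvd_iff[symmetric])
  moreover have "int (nat (a mod N)) = a mod N" using a(1) by simp
  ultimately show "co (glue (spread y)) a b = co (eW \<otimes> y) a b"
    unfolding co_glue[OF spread_closed[OF y]] co_eW_mult[OF y]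
    using VV_mod[of a] by (simp add: spread_def co_e_mult y)
qed (simp_all add: glue_closed spread_closed y eW_closed)

lemma spread_add: "y \<in> carrier A \<Longrightarrow> z \<in> carrier A \<Longrightarrow> spread (y \<oplus> z) = spread y \<oplus>\<^bsub>DS\<^esub> spread z"
  unfolding DS_simps spread_def by (rule restrict_ext) (simp add: PP_ops(1) r_distr)

lemma spread_smult: "y \<in> carrier A \<Longrightarrow> c \<in> carrier A \<Longrightarrow> spread (y \<otimes> c) = c \<odot>\<^bsub>DS\<^esub> spread y"
  unfolding DS_simps spread_def by (rule restrict_ext) (simp add: PP_ops(2) m_assoc)

lemma spread_zero: "spread \<zero> = \<zero>\<^bsub>DS\<^esub>"
  unfolding DS_simps spread_def by (rule restrict_ext) (simp add: PP_ops(3))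

lemma eW_idem: "eW \<otimes> eW = eW" by (rule co_eqI) (auto simp: co_eW_mult eW_closed co_eW)

lemma eW_glue: assumes X: "X \<in> carrier DS" shows "eW \<otimes> glue X = glue X"
  using glue_spread[OF glue_closed[OF X]] by (simp add: spread_glue[OF X])

lemma DS_cases:
  assumes "X \<in> carrier DS" obtains y where "y \<in> carrier A" "eW \<otimes> y = y" "X = spread y" "glue X = y"
  using that[of "glue X"] glue_closed[OF assms] eW_glue[OF assms] spread_glue[OF assms] by simp

lemma DS_closed:
  "X \<in> carrier DS \<Longrightarrow> Y \<in> carrier DS \<Longrightarrow> X \<oplus>\<^bsub>DS\<^esub> Y \<in> carrier DS"
  "X \<in> carrier DS \<Longrightarrow> c \<in> carrier A \<Longrightarrow> c \<odot>\<^bsub>DS\<^esub> X \<in> carrier DS"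
proof -
  show "X \<oplus>\<^bsub>DS\<^esub> Y \<in> carrier DS" if XY: "X \<in> carrier DS" "Y \<in> carrier DS"
  proof -
    obtain y where y: "y \<in> carrier A" "X = spread y" using XY(1) by (rule DS_cases)
    obtain z where z: "z \<in> carrier A" "Y = spread z" using XY(2) by (rule DS_cases)
    show ?thesis unfolding y(2) z(2) spread_add[OF y(1) z(1), symmetric] by (rule spread_closed) (simp add: y z)
  qed
  show "c \<odot>\<^bsub>DS\<^esub> X \<in> carrier DS" if X: "X \<in> carrier DS" "c \<in> carrier A"
  proof -
    obtain y where y: "y \<in> carrier A" "X = spread y" using X(1) by (rule DS_cases)
    show ?thesis unfolding y(2) spread_smult[OF y(1) X(2), symmetric] by (rule spread_closed) (simp add: y X)
  qed
qed

lemma glue_add: assumes "X \<in> carrier DS" "Y \<in> carrier DS" shows "glue (X \<oplus>\<^bsub>DS\<^esub> Y) = glue X \<oplus> glue Y"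
proof -
  obtain y where y: "y \<in> carrier A" "eW \<otimes> y = y" "X = spread y" "glue X = y" using assms(1) by (rule DS_cases)
  obtain z where z: "z \<in> carrier A" "eW \<otimes> z = z" "Y = spread z" "glue Y = z" using assms(2) by (rule DS_cases)
  have "glue (X \<oplus>\<^bsub>DS\<^esub> Y) = eW \<otimes> (y \<oplus> z)" using glue_spread[of "y \<oplus> z"] by (simp add: y(1,3) z(1,3) spread_add)
  then show ?thesis by (simp add: y z r_distr eW_closed y(4)[unfolded y(3)] z(4)[unfolded z(3)])
qed

lemma glue_smult: assumes "X \<in> carrier DS" "c \<in> carrier A" shows "glue (c \<odot>\<^bsub>DS\<^esub> X) = glue X \<otimes> c"
proof -
  obtain y where y: "y \<in> carrier A" "eW \<otimes> y = y" "X = spread y" "glue X = y" using assms(1) by (rule DS_cases)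
  have "glue (c \<odot>\<^bsub>DS\<^esub> X) = eW \<otimes> (y \<otimes> c)" using glue_spread[of "y \<otimes> c"] by (simp add: y(1,3) spread_smult assms(2))
  then show ?thesis by (simp add: y m_assoc[symmetric] eW_closed assms(2) y(4)[unfolded y(3)])
qed

definition left_mult :: "(int \<Rightarrow> int \<Rightarrow> 'k) \<Rightarrow> (nat \<Rightarrow> (nat \<Rightarrow> 'a) set) \<Rightarrow> nat \<Rightarrow> (nat \<Rightarrow> 'a) set" where
  "left_mult m = (\<lambda>X\<in>carrier DS. spread (iota m \<otimes> glue X))"

lemma iota_cornerD: "m \<in> carrier (PM n g) \<Longrightarrow> eW \<otimes> iota m = iota m" "m \<in> carrier (PM n g) \<Longrightarrow> iota m \<otimes> eW = iota m"
  using iota_corner[of m] unfolding corner_set_eq by auto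

lemma left_mult_closed: "m \<in> carrier (PM n g) \<Longrightarrow> X \<in> carrier DS \<Longrightarrow> spread (iota m \<otimes> glue X) \<in> carrier DS"
  by (intro spread_closed m_closed iota_closed glue_closed)

lemma glue_left_mult: "m \<in> carrier (PM n g) \<Longrightarrow> X \<in> carrier DS \<Longrightarrow> glue (spread (iota m \<otimes> glue X)) = iota m \<otimes> glue X"
  by (simp add: glue_spread iota_closed glue_closed m_assoc[symmetric] eW_closed iota_cornerD)

lemma left_mult_hom: assumes m: "m \<in> carrier (PM n g)" shows "left_mult m \<in> mod_hom A DS DS"
  unfolding left_mult_def mod_hom_def
proof (intro CollectI conjI ballI)
  note ic = iota_closed[OF m]
  show "(\<lambda>X\<in>carrier DS. spread (iota m \<otimes> glue X)) \<in> carrier DS \<rightarrow>\<^sub>E carrier DS"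
    using left_mult_closed[OF m] by auto
  fix X assume X: "X \<in> carrier DS"
  show "(\<lambda>X\<in>carrier DS. spread (iota m \<otimes> glue X)) (X \<oplus>\<^bsub>DS\<^esub> Y) =
    (\<lambda>X\<in>carrier DS. spread (iota m \<otimes> glue X)) X \<oplus>\<^bsub>DS\<^esub> (\<lambda>X\<in>carrier DS. spread (iota m \<otimes> glue X)) Y" if Y: "Y \<in> carrier DS" for Y
    using X Y DS_closed(1)[OF X Y] ic by (simp add: glue_add r_distr glue_closed spread_add)
  show "(\<lambda>X\<in>carrier DS. spread (iota m \<otimes> glue X)) (c \<odot>\<^bsub>DS\<^esub> X) =
    c \<odot>\<^bsub>DS\<^esub> (\<lambda>X\<in>carrier DS. spread (iota m \<otimes> glue X)) X" if c: "c \<in> carrier A" for c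
    using X c DS_closed(2)[OF X c] ic by (simp add: glue_smult glue_closed spread_smult[symmetric] m_assoc)
qed

text \<open>
  An endomorphism of \<open>eW A\<close> is left multiplication by the image of \<open>eW\<close>,
  which lies in \<open>eW A eW\<close>.
\<close>

lemma left_mult_surj:
  assumes h: "h \<in> mod_hom A DS DS" shows "h \<in> left_mult ` carrier (PM n g)"
proof -
  have hc: "h X \<in> carrier DS" if "X \<in> carrier DS" for X using h that by (auto simp: mod_hom_def)
  have hs: "h (c \<odot>\<^bsub>DS\<^esub> X) = c \<odot>\<^bsub>DS\<^esub> h X" if "X \<in> carrier DS" "c \<in> carrier A" for X c using h that by (auto simp: mod_hom_def)
  define G where "G = spread eW"
  have G: "G \<in> carrier DS" unfolding G_def by (rule spread_closed[OF eW_closed])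
  define y where "y = glue (h G)"
  have yc: "y \<in> carrier A" unfolding y_def by (rule glue_closed[OF hc[OF G]])
  have "eW \<odot>\<^bsub>DS\<^esub> G = G" unfolding G_def using spread_smult[OF eW_closed eW_closed] by (simp add: eW_idem)
  then have "y \<otimes> eW = y" using glue_smult[OF hc[OF G] eW_closed] hs[OF G eW_closed] by (simp add: y_def)
  moreover have "eW \<otimes> y = y" unfolding y_def by (rule eW_glue[OF hc[OF G]])
  ultimately have "y \<in> corner_set" unfolding corner_set_eq using yc by simp
  then obtain m where m: "m \<in> carrier (PM n g)" "y = iota m" unfolding iota_image[symmetric] by (rule imageE)
  have "h = left_mult m"
  proof (rule extensionalityI[of _ "carrier DS"])
    show "h \<in> extensional (carrier DS)" using h by (auto simp: mod_hom_def PiE_def)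
    show "left_mult m \<in> extensional (carrier DS)" by (simp add: left_mult_def)
    fix X assume X: "X \<in> carrier DS"
    have gX: "glue X \<in> carrier A" by (rule glue_closed[OF X])
    have "X = spread (eW \<otimes> glue X)" using spread_glue[OF X] eW_glue[OF X] by simp
    also have "\<dots> = glue X \<odot>\<^bsub>DS\<^esub> G" unfolding G_def by (rule spread_smult[OF eW_closed gX])
    finally have "h X = glue X \<odot>\<^bsub>DS\<^esub> h G" using hs[OF G gX] by simp
    also have "\<dots> = spread (y \<otimes> glue X)" using spread_smult[OF yc gX] spread_glue[OF hc[OF G]] by (simp add: y_def)
    finally show "h X = left_mult m X" using X m(2) by (simp add: left_mult_def)
  qed
  then show ?thesis using m(1) by (rule image_eqI)
qed

text \<open>
  The endomorphism algebra of \<open>eW A\<close> is \<open>eW A eW\<close>.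
\<close>

lemma left_mult_iso: "left_mult \<in> alg_isos (PM n g) (endomorphism_algebra A DS)"
proof (rule alg_transport[OF PM_k_algebra[OF g_adm]])
  let ?End = "endomorphism_algebra A DS"
  interpret K: k_algebra "PM n g :: ('k, _) module" by (rule PM_k_algebra[OF g_adm])
  note ops = endomorphism_algebra_def
  show "left_mult ` carrier (PM n g) = carrier ?End"
    using left_mult_hom left_mult_surj by (auto simp: ops)
  show "inj_on left_mult (carrier (PM n g))"
  proof (rule inj_onI)
    fix m m' assume m: "m \<in> carrier (PM n g)" "m' \<in> carrier (PM n g)" and eq: "left_mult m = left_mult m'"
    have G: "spread eW \<in> carrier DS" by (rule spread_closed[OF eW_closed])
    have gG: "glue (spread eW) = eW" by (simp add: glue_spread eW_closed eW_idem)
    have "glue (left_mult u (spread eW)) = iota u" if "u \<in> carrier (PM n g)" for u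
      using glue_left_mult[OF that G] G gG by (simp add: left_mult_def iota_cornerD that)
    then have "iota m = iota m'" using m eq by metis
    then show "m = m'" using inj_onD[OF iota_inj] m by blast
  qed
  fix m m' :: "int \<Rightarrow> int \<Rightarrow> 'k" assume m: "m \<in> carrier (PM n g)" and m': "m' \<in> carrier (PM n g)"
  note c = iota_closed[OF m] iota_closed[OF m']
  show "left_mult (m \<oplus>\<^bsub>PM n g\<^esub> m') = left_mult m \<oplus>\<^bsub>?End\<^esub> left_mult m'"
    unfolding left_mult_def ops module.simps ring.simps
    by (rule restrict_ext) (simp add: iota_add m m' l_distr c glue_closed spread_add)
  show "left_mult (m \<otimes>\<^bsub>PM n g\<^esub> m') = left_mult m \<otimes>\<^bsub>?End\<^esub> left_mult m'"
    unfolding left_mult_def ops monoid.simps compose_def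
    by (rule restrict_ext) (simp add: iota_mult m m' left_mult_closed glue_left_mult m_assoc c glue_closed)
next
  fix c :: 'k and m :: "int \<Rightarrow> int \<Rightarrow> 'k" assume m: "m \<in> carrier (PM n g)"
  have "c \<odot> \<one> \<in> carrier A" by (simp add: smult_closed)
  then show "left_mult (c \<odot>\<^bsub>PM n g\<^esub> m) = c \<odot>\<^bsub>endomorphism_algebra A DS\<^esub> left_mult m"
    unfolding left_mult_def endomorphism_algebra_def module.simps
    by (intro restrict_ext) (simp add: iota_smult m iota_closed glue_closed spread_smult[symmetric] smult_mult_l smult_mult_r)
next
  show "left_mult \<one>\<^bsub>PM n g\<^esub> = \<one>\<^bsub>endomorphism_algebra A DS\<^esub>"
    unfolding left_mult_def endomorphism_algebra_def monoid.simps eW_def[symmetric]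
    by (rule restrict_ext) (simp add: eW_glue spread_glue)
  have "iota \<zero>\<^bsub>PM n g\<^esub> = \<zero>"
    by (rule co_eqI) (simp_all add: iota_closed[OF PM_zero_closed] co_iota[OF PM_zero_closed] co_zero,
      simp add: ext_def PM_simps(4))
  then show "left_mult \<zero>\<^bsub>PM n g\<^esub> = \<zero>\<^bsub>endomorphism_algebra A DS\<^esub>"
    unfolding left_mult_def endomorphism_algebra_def ring.simps
    by (intro restrict_ext) (simp add: glue_closed spread_zero)
qed

end

lemma reduces_corner:
  assumes "nak A N f Phi" "reduces N f w n f'" shows "corner A N f Phi w n f'"
proof -
  note r = reducesD[OF assms(2)]
  have "w j < f (w i) \<longleftrightarrow> j < f' i" for i j unfolding r(7) r(8) ..
  then show ?thesis using assms(1) r(2,5,6) by (simp add: corner_def corner_axioms_def)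
qed

text \<open>
  The projectives in the definition of the syzygy filtered algebra are those at the vertices of
  \<open>range f\<close>, by \<open>shifted_socle_vertices_eq\<close>; hence the endomorphism
  algebra is the corner at these vertices.
\<close>

lemma nak_syzygy_filtered:
  fixes A :: "('k::field, 'a) module" and B :: "('k, 'b) module"
  assumes A: "nak A (int N) f Phi" and two: "\<And>i. i + 2 \<le> f i" and red: "reduces (int N) f w n f'"
    and B: "Psi \<in> alg_isos (PM n f') B" and pres: "cyclic_presentation A N R \<phi>"
    and idem: "\<And>i. i < N \<Longrightarrow> vertex_idempotent N R \<phi> i = nak.E (int N) f Phi (int i) (int i)"
  shows "syzygy_filtered A B"
  unfolding syzygy_filtered_def
proof (intro exI conjI)
  show "cyclic_presentation A N R \<phi>" by (rule pres)
  interpret corner A "int N" f Phi w n f' by (rule reduces_corner[OF A red])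
  let ?e = "vertex_idempotent N R \<phi>"
  let ?V = "shifted_socle_vertices A N ?e"
  have "socle_vertices A N ?e = socle_vertices A N (\<lambda>i. e (int i))"
    unfolding socle_vertices_def using idem by (intro Collect_cong conj_cong refl ex_cong1) simp_all
  then have V: "?V = VV"
    using shifted_socle_vertices_eq[OF two] unfolding shifted_socle_vertices_def VV_def reducesD(4)[OF red] by simp
  have cover: "\<exists>S :: 'a rmod. simple_at A (?e i) S \<and> projective_cover A (PP (int i)) S" if "i \<in> VV" for i
  proof (intro exI conjI)
    have "i < N" using that by (simp add: VV_iff)
    then show "simple_at A (?e i) (simple_mod (int i))" using simple_mod_at[of "int i"] idem by simp
    show "projective_cover A (PP (int i)) (simple_mod (int i))" by (rule PP_cover)
  qed
  have "alg_isomorphic (endomorphism_algebra A DS) B"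
    unfolding alg_isomorphic_def using alg_isos_trans[OF alg_isos_sym[OF left_mult_iso] B] by blast
  then show "let e = ?e; V = shifted_socle_vertices A N e in
      (\<forall>i\<in>V. \<exists>S :: 'a rmod. simple_at A (e i) S \<and> projective_cover A ((\<lambda>v. PP (int v)) i) S) \<and>
      alg_isomorphic (endomorphism_algebra A (direct_sum V (\<lambda>v. PP (int v)))) B"
    unfolding Let_def V DS_def[symmetric] using cover by blast
qed

section \<open>Linear Nakayama algebras\<close>

lemma upt_path:
  assumes "a + l < n" shows "(a, [a..<a + l]) \<in> paths (linear_quiver n)"
proof -
  have "pre_digraph.cas (linear_quiver n) b [b..<b + l] (b + l)" for b
  proof (induction l arbitrary: b)
    case 0 then show ?case by (simp add: pre_digraph.cas.simps)
  next
    case (Suc l)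
    have "[b..<b + Suc l] = b # [Suc b..<Suc b + l]" by (simp add: upt_conv_Cons)
    then show ?case using Suc[of "Suc b"] by (simp add: pre_digraph.cas.simps linear_quiver_def)
  qed
  then have "pre_digraph.awalk (linear_quiver n) a [a..<a + l] (a + l)"
    using assms by (auto simp: pre_digraph.awalk_def linear_quiver_def)
  then show ?thesis unfolding paths_def by blast
qed

text \<open>
  The condition \<open>g (n - 1) = n\<close> says that no nonzero path passes from \<open>n -
  1\<close> to \<open>n\<close>, so all nonzero paths live on the linearly oriented quiver.
\<close>

lemma linear_model:
  assumes n: "1 \<le> n" and g: "adm (int n) g" and last: "g (int n - 1) = int n"
  shows "quiver_model (linear_quiver n) n g"
proof (intro quiver_model.intro quiver_model_axioms.intro)
  show "finite_quiver (linear_quiver n)" by unfold_locales (auto simp: linear_quiver_def)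
  show "head (linear_quiver n) e = Suc e mod n" if "e \<in> arcs (linear_quiver n)" for e
    using that by (simp add: linear_quiver_def)
  show "cpath n i (nat (j - i)) \<in> paths (linear_quiver n)" if ij: "i \<le> j" "j < g i" for i j
  proof -
    define a where "a = nat (i mod int n)"
    have ai: "int a = i mod int n" "a < n" using n by (simp_all add: a_def nat_less_iff)
    have "g (int a) \<le> g (int n - 1)" by (rule admD(2)[OF g]) (use ai(2) in simp)
    moreover have "g i = g (int a) + (i - int a)"
      using adm_mod[OF g, of i] unfolding ai(1) by (simp add: minus_mod_eq_mult_div)
    ultimately have l: "a + nat (j - i) < n" using ij last by linarith
    have "snd (cpath n (int a) (nat (j - i))) = [a..<a + nat (j - i)]"
      by (rule nth_equalityI) (use l in \<open>simp_all add: cpath_def flip: of_nat_add\<close>)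
    then have "cpath n (int a) (nat (j - i)) = (a, [a..<a + nat (j - i)])"
      using ai(2) by (simp add: prod_eq_iff)
    moreover have "cpath n i (nat (j - i)) = cpath n (int a) (nat (j - i))"
      by (rule cpath_mod_eq) (simp add: ai)
    ultimately show ?thesis using upt_path[OF l] by simp
  qed
qed (use n g in \<open>simp_all add: linear_quiver_def\<close>)

lemma linear_admissible:
  assumes n: "1 \<le> n" and g: "adm (int n) g" and last: "g (int n - 1) = int n"
    and two: "\<And>j. 0 \<le> j \<Longrightarrow> j < int n - 1 \<Longrightarrow> j + 2 \<le> g j"
  shows "admissible_ideal (linear_quiver n) (quiver_model.vanishing (linear_quiver n) n g :: (_ \<Rightarrow> 'k::field) set)"
proof -
  let ?Q = "linear_quiver n"
  interpret quiver_model ?Q n g by (rule linear_model[OF n g last])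
  let ?I = "vanishing :: (_ \<Rightarrow> 'k) set"
  show ?thesis
    unfolding admissible_ideal_def
  proof (intro conjI ballI allI impI exI)
    show "ideal ?I (path_algebra ?Q)" by (rule vanishing_quotient)
  next
    fix h :: "_ \<Rightarrow> 'k" and w assume h: "h \<in> ?I" and nz: "h w \<noteq> 0"
    then have wP: "w \<in> paths ?Q" and h0: "\<And>i l. i + int l < g i \<Longrightarrow> h (cpath n i l) = 0"
      by (auto simp: vanishing_def path_algebra_simps)
    obtain u p where w: "w = (u, p)" by (cases w)
    have u: "u < n" using in_pathsD(1)[of u p] wP w by (simp add: linear_quiver_def)
    show "2 \<le> length (snd w)"
    proof (rule ccontr)
      assume "\<not> 2 \<le> length (snd w)"
      then consider "p = []" | c where "p = [c]" unfolding w by (cases p) (auto simp: not_le)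
      then show False
      proof cases
        case 1
        have "w = cpath n (int u) 0" using u by (simp add: w 1 cpath_def)
        then show False using h0[of "int u" 0] admD(4)[OF g, of "int u"] nz by simp
      next
        case (2 c)
        have "awalk u [c] (ptgt ?Q u [c])" by (rule in_pathsD(3)) (use wP in \<open>simp only: w 2\<close>)
        then have "tail ?Q c = u" "c \<in> arcs ?Q" unfolding awalk_def by (simp_all add: cas.simps)
        then have c: "c = u" "Suc u < n" by (simp_all add: linear_quiver_def)
        have "w = cpath n (int u) 1" using u by (simp add: w 2 c(1) cpath_def)
        moreover have "int u + int 1 < g (int u)" using two[of "int u"] c(2) by simp
        ultimately show False using h0[of "int u" 1] nz by simp
      qed
    qed
  next
    fix w assume w: "w \<in> paths ?Q" "nat (g 0 + int n) \<le> length (snd w)"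
    have "path_elem w \<in> carrier (path_algebra ?Q :: ('k, _) module)"
    proof -
      have "{w'. (path_elem w w' :: 'k) \<noteq> 0} \<subseteq> {w}" by (auto simp: path_elem_def split: if_splits)
      then have "finite {w'. (path_elem w w' :: 'k) \<noteq> 0} \<and> {w'. (path_elem w w' :: 'k) \<noteq> 0} \<subseteq> paths ?Q"
        using finite_subset[of _ "{w}"] w(1) by blast
      then show ?thesis unfolding path_algebra_simps(1) by simp
    qed
    moreover have "path_elem w (cpath n i l) = (0 :: 'k)" if "i + int l < g i" for i l
    proof -
      have "int l < g 0 + int n" using adm_length_bound[OF g, of i] that by linarith
      then have "cpath n i l \<noteq> w" using w(2) by auto
      then show ?thesis by (simp add: path_elem_def)
    qed
    ultimately show "path_elem w \<in> ?I" by (simp add: vanishing_def)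
  qed
qed

context right_module
begin

lemma cyclic_submodule: assumes x: "x \<in> carrier M" shows "submodule ((\<lambda>c. c \<odot>\<^bsub>M\<^esub> x) ` carrier A) A M"
proof (rule submoduleI)
  show "(\<lambda>c. c \<odot>\<^bsub>M\<^esub> x) ` carrier A \<subseteq> carrier M" using smult_closed x by auto
  show "\<zero>\<^bsub>M\<^esub> \<in> (\<lambda>c. c \<odot>\<^bsub>M\<^esub> x) ` carrier A"
    using imageI[OF A.zero_closed, of "\<lambda>c. c \<odot>\<^bsub>M\<^esub> x"] unfolding smult_l_null[OF x] .
  fix u assume "u \<in> (\<lambda>c. c \<odot>\<^bsub>M\<^esub> x) ` carrier A"
  then obtain c where c: "c \<in> carrier A" "u = c \<odot>\<^bsub>M\<^esub> x" by auto
  show "d \<odot>\<^bsub>M\<^esub> u \<in> (\<lambda>c. c \<odot>\<^bsub>M\<^esub> x) ` carrier A" if d: "d \<in> carrier A" for d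
    unfolding c(2) smult_mult[OF c(1) d x, symmetric] by (rule imageI) (simp add: c d)
  fix v assume "v \<in> (\<lambda>c. c \<odot>\<^bsub>M\<^esub> x) ` carrier A"
  then obtain d where d: "d \<in> carrier A" "v = d \<odot>\<^bsub>M\<^esub> x" by auto
  show "u \<oplus>\<^bsub>M\<^esub> v \<in> (\<lambda>c. c \<odot>\<^bsub>M\<^esub> x) ` carrier A"
    unfolding c(2) d(2) smult_l_distr[OF c(1) d(1) x, symmetric] by (rule imageI) (simp add: c d)
qed

lemma sum_submodule:
  assumes H: "submodule H A M" and L: "submodule L A M"
  shows "submodule (H <+>\<^bsub>M\<^esub> L) A M" "H \<subseteq> H <+>\<^bsub>M\<^esub> L" "L \<subseteq> H <+>\<^bsub>M\<^esub> L"
proof -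
  note h = submoduleD[OF H] and l = submoduleD[OF L]
  have mem: "u \<in> H <+>\<^bsub>M\<^esub> L \<longleftrightarrow> (\<exists>s\<in>H. \<exists>t\<in>L. u = s \<oplus>\<^bsub>M\<^esub> t)" for u by (auto simp: set_add_def')
  show "submodule (H <+>\<^bsub>M\<^esub> L) A M"
  proof (rule submoduleI)
    show "H <+>\<^bsub>M\<^esub> L \<subseteq> carrier M" using h(1) l(1) by (auto simp: mem subset_iff)
    show "\<zero>\<^bsub>M\<^esub> \<in> H <+>\<^bsub>M\<^esub> L" unfolding mem using h(3) l(3) by (intro bexI[of _ "\<zero>\<^bsub>M\<^esub>"]) simp_all
    fix u assume "u \<in> H <+>\<^bsub>M\<^esub> L"
    then obtain s t where st: "s \<in> H" "t \<in> L" "u = s \<oplus>\<^bsub>M\<^esub> t" unfolding mem by blast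
    have stc: "s \<in> carrier M" "t \<in> carrier M" using st h(1) l(1) by auto
    show "c \<odot>\<^bsub>M\<^esub> u \<in> H <+>\<^bsub>M\<^esub> L" if c: "c \<in> carrier A" for c
      unfolding mem st(3) smult_r_distr[OF c stc] using h(5)[OF c st(1)] l(5)[OF c st(2)] by blast
    fix v assume "v \<in> H <+>\<^bsub>M\<^esub> L"
    then obtain s' t' where st': "s' \<in> H" "t' \<in> L" "v = s' \<oplus>\<^bsub>M\<^esub> t'" unfolding mem by blast
    have stc': "s' \<in> carrier M" "t' \<in> carrier M" using st' h(1) l(1) by auto
    have "u \<oplus>\<^bsub>M\<^esub> v = (s \<oplus>\<^bsub>M\<^esub> s') \<oplus>\<^bsub>M\<^esub> (t \<oplus>\<^bsub>M\<^esub> t')" unfolding st(3) st'(3) using stc stc' by (simp add: M.a_ac)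
    then show "u \<oplus>\<^bsub>M\<^esub> v \<in> H <+>\<^bsub>M\<^esub> L" unfolding mem using h(4)[OF st(1) st'(1)] l(4)[OF st(2) st'(2)] by blast
  qed
  show "H \<subseteq> H <+>\<^bsub>M\<^esub> L"
  proof
    fix u assume u: "u \<in> H"
    then have "u = u \<oplus>\<^bsub>M\<^esub> \<zero>\<^bsub>M\<^esub>" using h(1) by auto
    then show "u \<in> H <+>\<^bsub>M\<^esub> L" unfolding mem using u l(3) by blast
  qed
  show "L \<subseteq> H <+>\<^bsub>M\<^esub> L"
  proof
    fix u assume u: "u \<in> L"
    then have "u = \<zero>\<^bsub>M\<^esub> \<oplus>\<^bsub>M\<^esub> u" using l(1) by auto
    then show "u \<in> H <+>\<^bsub>M\<^esub> L" unfolding mem using u h(3) by blast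
  qed
qed

end

context nak
begin
text \<open>
  The elements of \<open>row i\<close> that carry \<open>x\<close> into \<open>H\<close> form a
  right ideal.
\<close>

lemma cyclic_submodule_trace:
  assumes M: "right_module A M" and H: "submodule H A M" and x: "x \<in> carrier M"
  obtains b where "i \<le> b" "b \<le> f i" "{c \<in> row i. c \<odot>\<^bsub>M\<^esub> x \<in> H} = tail_row i b"
proof -
  interpret M: right_module A M by (rule M)
  note h = M.submoduleD[OF H]
  let ?H = "{c \<in> row i. c \<odot>\<^bsub>M\<^esub> x \<in> H}"
  have 1: "?H \<subseteq> row i" by blast
  have 2: "\<zero> \<in> ?H" using h(3) by (simp add: row_zero M.smult_l_null[OF x])
  have 3: "u \<oplus> v \<in> ?H" if "u \<in> ?H" "v \<in> ?H" for u v
  proof -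
    have "u \<in> carrier A" "v \<in> carrier A" using that row_closed by blast+
    then show ?thesis using that h(4) by (simp add: row_add M.smult_l_distr x)
  qed
  have 4: "u \<otimes> c \<in> ?H" if "u \<in> ?H" "c \<in> carrier A" for u c
  proof -
    have "u \<in> carrier A" using that row_closed by blast
    then show ?thesis using that h(5) by (simp add: row_mult M.smult_mult x)
  qed
  show ?thesis by (rule right_ideal_char[OF 1 2]) (rule 3 4 that; assumption)+
qed

lemma uniserial_of_generator:
  assumes M: "right_module A M" and x: "x \<in> carrier M" "e i \<odot>\<^bsub>M\<^esub> x = x"
    and gen: "(\<lambda>c. c \<odot>\<^bsub>M\<^esub> x) ` carrier A = carrier M"
  shows "uniserial_module A M"
  unfolding uniserial_module_def
proof (intro conjI M allI impI)
  interpret M: right_module A M by (rule M)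
  have trace: "u \<in> H \<longleftrightarrow> (\<exists>c\<in>{c \<in> row i. c \<odot>\<^bsub>M\<^esub> x \<in> H}. u = c \<odot>\<^bsub>M\<^esub> x)" if H: "submodule H A M" for H u
  proof
    assume u: "u \<in> H"
    then have "u \<in> carrier M" using M.submoduleD(1)[OF H] by blast
    then obtain c where c: "c \<in> carrier A" "u = c \<odot>\<^bsub>M\<^esub> x" unfolding gen[symmetric] by auto
    have "u = (e i \<otimes> c) \<odot>\<^bsub>M\<^esub> x" using c x by (simp add: M.smult_mult)
    then show "\<exists>c\<in>{c \<in> row i. c \<odot>\<^bsub>M\<^esub> x \<in> H}. u = c \<odot>\<^bsub>M\<^esub> x" using u row_e_mult[OF c(1), of i] by auto
  qed auto
  fix H L assume HL: "submodule H A M \<and> submodule L A M"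
  obtain b where b: "{c \<in> row i. c \<odot>\<^bsub>M\<^esub> x \<in> H} = tail_row i b" using cyclic_submodule_trace[OF M conjunct1[OF HL] x(1)] by metis
  obtain b' where b': "{c \<in> row i. c \<odot>\<^bsub>M\<^esub> x \<in> L} = tail_row i b'" using cyclic_submodule_trace[OF M conjunct2[OF HL] x(1)] by metis
  have "tail_row i b \<subseteq> tail_row i b' \<or> tail_row i b' \<subseteq> tail_row i b"
    using linear[of b b'] by (auto simp: tail_row_def)
  then show "H \<subseteq> L \<or> L \<subseteq> H"
    using trace[OF conjunct1[OF HL]] trace[OF conjunct2[OF HL]] unfolding b b' by blast
qed

context
  assumes last: "f (N - 1) = N"
begin

text \<open>
  In a linear quiver there is at most one path between two vertices.
\<close>

lemma e_mult_e:
  assumes j: "0 \<le> j" "j < N" and b: "0 \<le> b" "b < N" and c: "c \<in> carrier A"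
  shows "e j \<otimes> c \<otimes> e b = co c j b \<odot> E j b"
proof (rule row_eqI[of _ j])
  show "e j \<otimes> c \<otimes> e b \<in> row j" by (rule row_mult[OF row_e_mult[OF c] E_closed])
  show "co c j b \<odot> E j b \<in> row j"
  proof (cases "j \<le> b")
    case False
    then have "E j b = \<zero>" by (simp add: E_zero_iff)
    moreover have "co c j b = 0" using co_out[OF c] False by simp
    ultimately show ?thesis using row_smult[OF row_zero, of 0 j] by simp
  qed (simp add: row_smult row_E)
  fix k assume k: "j \<le> k" "k < f j"
  have "f j \<le> f (N - 1)" by (rule a(2)) (use j in simp)
  then have "k < N" "0 \<le> k" using k last j by simp_all
  then have "N dvd k - b \<longleftrightarrow> k = b" using b by (metis dvd_refl mod_eq_dvd_iff mod_pos_pos_trivial)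
  then show "co (e j \<otimes> c \<otimes> e b) j k = co (co c j b \<odot> E j b) j k"
    using k by (auto simp: co_mult_e co_e_mult c co_smult co_E)
qed

text \<open>
  Let \<open>i\<close> be the least vertex that occurs in \<open>M\<close>, take \<open>x \<noteq>
  0\<close> at \<open>i\<close>, and let \<open>y = x \<cdot> E i b\<close> be the last nonzero
  multiple of \<open>x\<close> by a path. Choose a submodule \<open>L\<close> maximal with \<open>y
  \<notin> L\<close>. Then \<open>x A \<inter> L = 0\<close> since \<open>y\<close> generates the
  socle of \<open>x A\<close>. Conversely \<open>M / L\<close> has socle generated by
  \<open>y\<close>; an element \<open>u\<close> of it at a vertex \<open>j\<close> is detected by
  \<open>u \<cdot> E j b\<close>, which is a multiple of \<open>y\<close>, and as \<open>j \<ge>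
  i\<close> the element \<open>x \<cdot> E i j\<close> has the same property. So \<open>x A + L =
  M\<close>, and \<open>M = x A\<close> if \<open>M\<close> is indecomposable.
\<close>

lemma indecomposable_uniserial:
  assumes ind: "indecomposable_module A M"
  shows "uniserial_module A M"
proof -
  have M: "right_module A M" and nz: "carrier M \<noteq> {\<zero>\<^bsub>M\<^esub>}"
    and dec: "\<And>H L. submodule H A M \<Longrightarrow> submodule L A M \<Longrightarrow> H \<inter> L = {\<zero>\<^bsub>M\<^esub>} \<Longrightarrow> H <+>\<^bsub>M\<^esub> L = carrier M
        \<Longrightarrow> H = {\<zero>\<^bsub>M\<^esub>} \<or> L = {\<zero>\<^bsub>M\<^esub>}"
    using ind unfolding indecomposable_module_def by simp_all
  interpret M: right_module A M by (rule M)
  let ?nz = "\<lambda>i. 0 \<le> i \<and> i < N \<and> (\<exists>x\<in>carrier M. e i \<odot>\<^bsub>M\<^esub> x \<noteq> \<zero>\<^bsub>M\<^esub>)"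
  have "\<exists>i. ?nz i"
  proof (rule ccontr)
    assume X: "\<nexists>i. ?nz i"
    have "x \<in> {\<zero>\<^bsub>M\<^esub>}" if x: "x \<in> carrier M" for x
      by (rule mem_by_idempotents[OF M x]) (use that X in auto)
    then have "carrier M \<subseteq> {\<zero>\<^bsub>M\<^esub>}" by (rule subsetI)
    then show False using nz M.zero_closed by blast
  qed
  then obtain i0 where i0: "?nz i0" ..
  obtain i where i: "?nz i" and i_min: "\<And>j. 0 \<le> j \<Longrightarrow> ?nz j \<Longrightarrow> i \<le> j"
    by (rule least_int_ge[of ?nz i0 0]) (use i0 in auto)
  from i obtain x0 where x0: "x0 \<in> carrier M" "e i \<odot>\<^bsub>M\<^esub> x0 \<noteq> \<zero>\<^bsub>M\<^esub>" and iN: "0 \<le> i" "i < N" by blast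
  define x where "x = e i \<odot>\<^bsub>M\<^esub> x0"
  have x: "x \<in> carrier M" "e i \<odot>\<^bsub>M\<^esub> x = x" "x \<noteq> \<zero>\<^bsub>M\<^esub>"
    using x0 by (simp_all add: x_def M.smult_closed M.smult_mult[symmetric] e_idem)
  obtain b where b: "E i b \<odot>\<^bsub>M\<^esub> x \<noteq> \<zero>\<^bsub>M\<^esub>" "b \<le> f i"
    and b_max: "\<And>k. k \<le> f i \<Longrightarrow> E i k \<odot>\<^bsub>M\<^esub> x \<noteq> \<zero>\<^bsub>M\<^esub> \<Longrightarrow> k \<le> b"
    by (rule greatest_int_le[of "\<lambda>k. E i k \<odot>\<^bsub>M\<^esub> x \<noteq> \<zero>\<^bsub>M\<^esub>" i "f i"]) (use x a(4)[of i] in auto)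
  have "E i b \<noteq> \<zero>" using b(1) M.smult_l_null[OF x(1)] by auto
  then have ib: "i \<le> b" "b < f i" by (simp_all add: E_zero_iff)
  have "f i \<le> f (N - 1)" by (rule a(2)) (use iN in simp)
  then have bN: "0 \<le> b" "b < N" using ib iN last by simp_all
  have after: "E i (b + 1) \<odot>\<^bsub>M\<^esub> x = \<zero>\<^bsub>M\<^esub>" using b_max[of "b + 1"] ib by force
  define y where "y = E i b \<odot>\<^bsub>M\<^esub> x"
  have y: "y \<in> carrier M" "y \<noteq> \<zero>\<^bsub>M\<^esub>" "e b \<odot>\<^bsub>M\<^esub> y = y"
    using b(1) ib by (simp_all add: y_def x M.smult_closed M.smult_mult[symmetric] e_E)
  obtain L where L: "submodule L A M" "y \<notin> L" and L_max: "\<And>K. submodule K A M \<Longrightarrow> y \<notin> K \<Longrightarrow> L \<subseteq> K \<Longrightarrow> K = L"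
  proof -
    let ?F = "{L. submodule L A M \<and> y \<notin> L}"
    have "\<exists>L\<in>?F. \<forall>K\<in>?F. L \<subseteq> K \<longrightarrow> K = L"
    proof (rule subset_Zorn_nonempty)
      show "?F \<noteq> {}" using M.zero_submodule y(2) by blast
      fix C assume C: "C \<noteq> {}" "subset.chain ?F C"
      then have CF: "\<And>K. K \<in> C \<Longrightarrow> submodule K A M" "\<And>K. K \<in> C \<Longrightarrow> y \<notin> K"
        and lin: "\<And>K K'. K \<in> C \<Longrightarrow> K' \<in> C \<Longrightarrow> K \<subseteq> K' \<or> K' \<subseteq> K"
        by (auto simp: subset.chain_def)
      have "submodule (\<Union>C) A M"
      proof (rule M.submoduleI)
        show "\<Union>C \<subseteq> carrier M" using M.submoduleD(1)[OF CF(1)] by blast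
        show "\<zero>\<^bsub>M\<^esub> \<in> \<Union>C" using M.submoduleD(3)[OF CF(1)] C(1) by blast
        show "c \<odot>\<^bsub>M\<^esub> u \<in> \<Union>C" if "c \<in> carrier A" "u \<in> \<Union>C" for c u
          using that M.submoduleD(5)[OF CF(1)] by blast
        fix u v assume "u \<in> \<Union>C" "v \<in> \<Union>C"
        then obtain K K' where K: "K \<in> C" "K' \<in> C" "u \<in> K" "v \<in> K'" by blast
        from lin[OF K(1,2)] obtain K'' where K'': "K'' \<in> C" "u \<in> K''" "v \<in> K''" using K by blast
        show "u \<oplus>\<^bsub>M\<^esub> v \<in> \<Union>C" using M.submoduleD(4)[OF CF(1)[OF K''(1)] K''(2,3)] K''(1) by blast
      qed
      then show "\<Union>C \<in> ?F" using CF(2) by blast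
    qed
    then show ?thesis using that by blast
  qed
  note l = M.submoduleD[OF L(1)]
  define X where "X = (\<lambda>c. c \<odot>\<^bsub>M\<^esub> x) ` carrier A"
  have X: "submodule X A M" unfolding X_def by (rule M.cyclic_submodule[OF x(1)])
  have xX: "x \<in> X" unfolding X_def using imageI[OF E_closed, of "\<lambda>c. c \<odot>\<^bsub>M\<^esub> x" i i] unfolding x(2) .
  \<comment> \<open>a consequence of the maximality of L: modulo L every nonzero element at a
    vertex reaches y\<close>
  have essential: "\<exists>c. c \<noteq> 0 \<and> j \<le> b \<and> (\<exists>t\<in>L. y = t \<oplus>\<^bsub>M\<^esub> (c \<odot> E j b) \<odot>\<^bsub>M\<^esub> u)"
    if j: "0 \<le> j" "j < N" and u: "u \<in> carrier M" "e j \<odot>\<^bsub>M\<^esub> u = u" "u \<notin> L" for j u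
  proof -
    let ?U = "(\<lambda>c. c \<odot>\<^bsub>M\<^esub> u) ` carrier A"
    have U: "submodule ?U A M" by (rule M.cyclic_submodule[OF u(1)])
    note s = M.sum_submodule[OF L(1) U]
    have "u \<in> ?U" using imageI[OF E_closed, of "\<lambda>c. c \<odot>\<^bsub>M\<^esub> u" j j] unfolding u(2) .
    then have "L <+>\<^bsub>M\<^esub> ?U \<noteq> L" using s(3) u(3) by blast
    then have "y \<in> L <+>\<^bsub>M\<^esub> ?U" using L_max[OF s(1) _ s(2)] by blast
    then obtain t c where tc: "t \<in> L" "c \<in> carrier A" "y = t \<oplus>\<^bsub>M\<^esub> c \<odot>\<^bsub>M\<^esub> u" unfolding set_add_def' by blast
    have tM: "t \<in> carrier M" using tc(1) l(1) by blast
    have "y = e b \<odot>\<^bsub>M\<^esub> t \<oplus>\<^bsub>M\<^esub> e b \<odot>\<^bsub>M\<^esub> (c \<odot>\<^bsub>M\<^esub> u)"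
      using y(3) unfolding tc(3) M.smult_r_distr[OF E_closed tM M.smult_closed[OF tc(2) u(1)]] ..
    also have "e b \<odot>\<^bsub>M\<^esub> (c \<odot>\<^bsub>M\<^esub> u) = (e j \<otimes> c \<otimes> e b) \<odot>\<^bsub>M\<^esub> u"
      using u by (simp add: M.smult_mult tc(2))
    also have "\<dots> = (co c j b \<odot> E j b) \<odot>\<^bsub>M\<^esub> u" unfolding e_mult_e[OF j bN tc(2)] ..
    finally have yt: "y = e b \<odot>\<^bsub>M\<^esub> t \<oplus>\<^bsub>M\<^esub> (co c j b \<odot> E j b) \<odot>\<^bsub>M\<^esub> u" .
    have et: "e b \<odot>\<^bsub>M\<^esub> t \<in> L" by (rule l(5)[OF E_closed tc(1)])
    have "co c j b \<noteq> 0"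
    proof
      assume "co c j b = 0"
      then have "co c j b \<odot> E j b = \<zero>" by (intro co_eqI) (simp_all add: smult_closed co_smult co_zero)
      then have "y = e b \<odot>\<^bsub>M\<^esub> t" using yt l(1) et by (simp add: M.smult_l_null[OF u(1)] subset_iff)
      then show False using et L(2) by simp
    qed
    moreover from this have "j \<le> b" using co_out[OF tc(2)] by blast
    ultimately show ?thesis using yt et by blast
  qed
  have span: "u \<in> X <+>\<^bsub>M\<^esub> L" if j: "0 \<le> j" "j < N" and u: "u \<in> carrier M" "e j \<odot>\<^bsub>M\<^esub> u = u" for j u
  proof (cases "u \<in> L")
    case True then show ?thesis using M.sum_submodule(3)[OF X L(1)] by blast
  next
    case False
    obtain c t where c: "c \<noteq> 0" "j \<le> b" "t \<in> L" "y = t \<oplus>\<^bsub>M\<^esub> (c \<odot> E j b) \<odot>\<^bsub>M\<^esub> u" using essential[OF j u False] by blast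
    have "u \<noteq> \<zero>\<^bsub>M\<^esub>" using False l(3) by auto
    then have "\<exists>x\<in>carrier M. e j \<odot>\<^bsub>M\<^esub> x \<noteq> \<zero>\<^bsub>M\<^esub>" using u by (intro bexI[of _ u]) simp_all
    then have ij: "i \<le> j" using i_min[OF j(1)] j by blast
    let ?d = "inverse c \<odot> E i j"
    have d: "?d \<in> carrier A" by (simp add: smult_closed)
    have tM: "t \<in> carrier M" using c(3) l(1) by blast
    \<comment> \<open>v is u corrected by a multiple of x so that its product with E j b lies in L\<close>
    define v where "v = u \<oplus>\<^bsub>M\<^esub> (\<ominus> ?d) \<odot>\<^bsub>M\<^esub> x"
    have v: "v \<in> carrier M" by (simp add: v_def u x d M.smult_closed)
    have ev: "e j \<odot>\<^bsub>M\<^esub> v = v"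
    proof -
      have "(\<ominus> ?d) \<otimes> e j = \<ominus> ?d" using ij by (simp add: l_minus d smult_mult_l e_E)
      then show ?thesis unfolding v_def
        by (simp add: M.smult_r_distr u x d M.smult_closed M.smult_mult[symmetric])
    qed
    have cv: "(c \<odot> E j b) \<odot>\<^bsub>M\<^esub> v = \<ominus>\<^bsub>M\<^esub> t"
    proof -
      have cE: "c \<odot> E j b \<in> carrier A" by (simp add: smult_closed)
      have "?d \<otimes> (c \<odot> E j b) = E i b"
        using c(1) by (simp add: smult_closed smult_mult_l smult_mult_r smult_smult[symmetric] E_mult_E[OF ij c(2)] smult_one)
      then have "(\<ominus> ?d) \<otimes> (c \<odot> E j b) = \<ominus> E i b" by (simp add: l_minus d cE)
      then have "(c \<odot> E j b) \<odot>\<^bsub>M\<^esub> ((\<ominus> ?d) \<odot>\<^bsub>M\<^esub> x) = \<ominus>\<^bsub>M\<^esub> y"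
        using M.smult_mult[of "\<ominus> ?d" "c \<odot> E j b" x] M.smult_l_minus[OF E_closed x(1), of i b] by (simp add: d cE x y_def)
      then have "(c \<odot> E j b) \<odot>\<^bsub>M\<^esub> v = (c \<odot> E j b) \<odot>\<^bsub>M\<^esub> u \<oplus>\<^bsub>M\<^esub> \<ominus>\<^bsub>M\<^esub> y"
        unfolding v_def by (simp add: M.smult_r_distr cE u x d M.smult_closed)
      also have "\<dots> = \<ominus>\<^bsub>M\<^esub> t"
        using M.smult_closed[OF cE u(1)] tM y(1) unfolding c(4)
        by (simp add: M.minus_add M.a_ac M.r_neg1 M.r_neg2 M.r_neg)
      finally show ?thesis .
    qed
    have vL: "v \<in> L"
    proof (rule ccontr)
      assume nv: "v \<notin> L"
      obtain c' t' where c': "t' \<in> L" "y = t' \<oplus>\<^bsub>M\<^esub> (c' \<odot> E j b) \<odot>\<^bsub>M\<^esub> v" using essential[OF j v ev nv] by blast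
      have "c' \<odot> E j b = (c \<odot> E j b) \<otimes> ((c' * inverse c) \<odot> \<one>)"
        using c(1) by (simp add: smult_closed smult_mult_l smult_mult_r smult_smult[symmetric] mult.assoc)
      then have "(c' \<odot> E j b) \<odot>\<^bsub>M\<^esub> v = ((c' * inverse c) \<odot> \<one>) \<odot>\<^bsub>M\<^esub> (\<ominus>\<^bsub>M\<^esub> t)"
        using cv by (simp add: M.smult_mult smult_closed v)
      also have "\<dots> \<in> L"
      proof (rule l(5))
        have "\<ominus>\<^bsub>M\<^esub> t = (\<ominus> \<one>) \<odot>\<^bsub>M\<^esub> t" by (rule M.minus_as_smult[OF tM])
        then show "\<ominus>\<^bsub>M\<^esub> t \<in> L" using l(5)[OF _ c(3), of "\<ominus> \<one>"] by simp
      qed (simp add: smult_closed)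
      finally have "y \<in> L" using c' l(4) by simp
      then show False using L(2) by simp
    qed
    have "?d \<odot>\<^bsub>M\<^esub> x \<in> X" unfolding X_def by (rule imageI[OF d])
    moreover have "u = ?d \<odot>\<^bsub>M\<^esub> x \<oplus>\<^bsub>M\<^esub> v"
      unfolding v_def using M.smult_closed[OF d x(1)] u(1)
      by (simp add: M.smult_l_minus[OF d x(1)] M.a_lcomm M.r_neg)
    ultimately show ?thesis unfolding set_add_def' using vL by blast
  qed
  note XL = M.sum_submodule(1)[OF X L(1)]
  have "X <+>\<^bsub>M\<^esub> L = carrier M"
  proof
    show "X <+>\<^bsub>M\<^esub> L \<subseteq> carrier M" by (rule M.submoduleD(1)[OF XL])
    show "carrier M \<subseteq> X <+>\<^bsub>M\<^esub> L"
    proof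
      fix u assume u: "u \<in> carrier M"
      have at: "e j \<odot>\<^bsub>M\<^esub> u \<in> X <+>\<^bsub>M\<^esub> L" if "0 \<le> j" "j < N" for j
        by (rule span[OF that]) (simp_all add: u M.smult_closed M.smult_mult[symmetric] e_idem)
      show "u \<in> X <+>\<^bsub>M\<^esub> L"
        by (rule mem_by_idempotents[OF M u]) (simp_all add: M.submoduleD(3,4)[OF XL] at)
    qed
  qed
  moreover have "X \<inter> L = {\<zero>\<^bsub>M\<^esub>}"
  proof
    show "{\<zero>\<^bsub>M\<^esub>} \<subseteq> X \<inter> L" using l(3) M.submoduleD(3)[OF X] by simp
    show "X \<inter> L \<subseteq> {\<zero>\<^bsub>M\<^esub>}"
    proof
      fix t assume t: "t \<in> X \<inter> L"
      then obtain c where c: "c \<in> carrier A" "t = c \<odot>\<^bsub>M\<^esub> x" unfolding X_def by auto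
      have tc: "t = (e i \<otimes> c) \<odot>\<^bsub>M\<^esub> x" using c x by (simp add: M.smult_mult)
      obtain k where k: "i \<le> k" "k \<le> f i" "{c \<in> row i. c \<odot>\<^bsub>M\<^esub> x \<in> L} = tail_row i k"
        using L(1) x(1) by (rule cyclic_submodule_trace[OF M])
      have n: "E i b \<notin> tail_row i k" unfolding k(3)[symmetric] using L(2) by (simp add: y_def)
      have "E i b \<in> tail_row i k" if "k \<le> b"
        using ib(1) that by (auto simp: tail_row_def row_E co_E)
      with n have "b < k" by (metis not_le)
      moreover have "e i \<otimes> c \<in> tail_row i k" unfolding k(3)[symmetric] using t tc c by (simp add: row_e_mult)
      ultimately have "e i \<otimes> c \<in> tail_row i (b + 1)" by (simp add: tail_row_def)
      then obtain r where r: "r \<in> row (b + 1)" "e i \<otimes> c = E i (b + 1) \<otimes> r"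
        by (rule tail_row_factor) (use ib in simp)
      then show "t \<in> {\<zero>\<^bsub>M\<^esub>}" unfolding tc
        by (simp add: M.smult_mult row_closed x after M.smult_r_null)
    qed
  qed
  ultimately have "X = {\<zero>\<^bsub>M\<^esub>} \<or> L = {\<zero>\<^bsub>M\<^esub>}" using dec[OF X L(1)] by blast
  then have "L = {\<zero>\<^bsub>M\<^esub>}" using xX x(3) by blast
  then have "X = carrier M"
    using \<open>X <+>\<^bsub>M\<^esub> L = carrier M\<close> M.submoduleD(1)[OF X] unfolding set_add_def' by (auto simp: subset_iff)
  then show ?thesis using uniserial_of_generator[OF M x(1,2)] unfolding X_def by blast
qed

end

end

text \<open>
  The last vertex is a break and there is no other in \<open>{0..<N}\<close>: the quiver is linear
  and connected, and the zero paths have length at least two.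
\<close>

lemma nak_linear_nakayama:
  fixes A :: "('k::field, 'a) module"
  assumes A: "nak A N f Phi" and last: "f (N - 1) = N" and two: "\<And>j. 0 \<le> j \<Longrightarrow> j < N - 1 \<Longrightarrow> j + 2 \<le> f j"
  shows "linear_nakayama A"
  unfolding linear_nakayama_def
proof (intro conjI exI allI impI)
  interpret nak A N f Phi by (rule A)
  have N: "int (nat N) = N" "1 \<le> nat N" using a(1) by simp_all
  show "1 \<le> nat N" by (rule N)
  have g: "adm (int (nat N)) f" unfolding N(1) by (rule adm)
  interpret Q: quiver_model "linear_quiver (nat N)" "nat N" f
    by (rule linear_model[OF N(2) g]) (unfold N(1), rule last)
  show "admissible_ideal (linear_quiver (nat N)) (Q.vanishing :: (_ \<Rightarrow> 'k) set)"
    by (rule linear_admissible[OF N(2) g]) (unfold N(1), rule last, rule two)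
  have "Phi \<in> alg_isos (PM (int (nat N)) f) A" using Phi by (simp only: N)
  then show "alg_isomorphic (quotient_algebra (path_algebra (linear_quiver (nat N))) (Q.vanishing :: (_ \<Rightarrow> 'k) set)) A"
    unfolding alg_isomorphic_def using alg_isos_trans[OF alg_isos_sym[OF Q.vanishing_quotient(2)]] by blast
  fix M :: "'a rmod" assume "fg_module A M \<and> indecomposable_module A M"
  then show "uniserial_module A M" using indecomposable_uniserial[OF last] by blast
qed

section \<open>Connected components\<close>

context nak
begin

text \<open>
  A maximal set \<open>{s..z}\<close> of consecutive vertices without a break before
  \<open>z\<close>. It supports a connected component.
\<close>

definition segment :: "int \<Rightarrow> int \<Rightarrow> bool" where
  "segment s z \<longleftrightarrow> 0 \<le> s \<and> s \<le> z \<and> z < N \<and> f (s - 1) = s \<and> f z = z + 1 \<and> (\<forall>j. s \<le> j \<longrightarrow> j < z \<longrightarrow> j + 2 \<le> f j)"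

lemma segmentD:
  assumes "segment s z"
  shows "0 \<le> s" "s \<le> z" "z < N" "f (s - 1) = s" "f z = z + 1" "s \<le> j \<Longrightarrow> j < z \<Longrightarrow> j + 2 \<le> f j"
  using assms by (auto simp: segment_def)

context
  fixes s z :: int
  assumes seg: "segment s z"
begin

definition seg_size :: int where "seg_size = z - s + 1"
text \<open>
  The enumeration of the vertices of the segment, continued periodically, and the corresponding
  restriction of \<open>f\<close>.
\<close>

definition seg_w :: "int \<Rightarrow> int" where "seg_w j = s + j mod seg_size + N * (j div seg_size)"
definition seg_g :: "int \<Rightarrow> int" where "seg_g j = f (s + j mod seg_size) - s + seg_size * (j div seg_size)"

lemma seg_size: "1 \<le> seg_size" "seg_size \<le> N" "0 \<le> j mod seg_size" "j mod seg_size < seg_size"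
proof -
  show 1: "1 \<le> seg_size" "seg_size \<le> N" using segmentD(1-3)[OF seg] by (simp_all add: seg_size_def)
  then have "0 < seg_size" by simp
  then show "0 \<le> j mod seg_size" "j mod seg_size < seg_size" by simp_all
qed

lemma seg_w_less:
  assumes "i < j" shows "seg_w i < seg_w j"
proof (cases "i div seg_size = j div seg_size")
  case True
  then have "i mod seg_size < j mod seg_size"
    using assms div_mult_mod_eq[of i seg_size] div_mult_mod_eq[of j seg_size] by (metis add_less_cancel_left)
  then show ?thesis by (simp add: seg_w_def True)
next
  case False
  then have "i div seg_size + 1 \<le> j div seg_size" using zdiv_mono1[of i j seg_size] assms seg_size(1) by simp
  then have "N * (i div seg_size + 1) \<le> N * (j div seg_size)" using a(1) by (intro mult_left_mono) simp_all
  then show ?thesis using seg_size(2) seg_size(4)[of i] seg_size(3)[of j] unfolding seg_w_def by (simp add: algebra_simps)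
qed

lemma seg_f_bounds:
  assumes "0 \<le> r" "r < seg_size" shows "s + r < f (s + r)" "f (s + r) \<le> z + 1"
proof -
  show "s + r < f (s + r)" by (rule a(4))
  have "f (s + r) \<le> f z" by (rule a(2)) (use assms in \<open>simp add: seg_size_def\<close>)
  then show "f (s + r) \<le> z + 1" using segmentD(5)[OF seg] by simp
qed

lemma segment_corner: "corner A N f Phi seg_w seg_size seg_g"
proof (intro corner.intro corner_axioms.intro)
  show "nak A N f Phi" by unfold_locales
  show "strict_mono seg_w" using seg_w_less by (simp add: strict_mono_def)
  show "1 \<le> seg_size" by (rule seg_size)
  have size0: "seg_size \<noteq> 0" using seg_size(1) by simp
  show "seg_w (j + seg_size) = seg_w j + N" for j
    using size0 by (simp add: seg_w_def algebra_simps)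
  fix i j
  let ?r = "i mod seg_size" and ?q = "i div seg_size" and ?r' = "j mod seg_size" and ?q' = "j div seg_size"
  have fw: "f (seg_w i) = f (s + ?r) + N * ?q"
    using a(6)[of "s + ?r" ?q] by (simp add: seg_w_def mult.commute)
  have L: "seg_w j < f (seg_w i) \<longleftrightarrow> s + ?r' + N * ?q' < f (s + ?r) + N * ?q"
    unfolding fw by (simp only: seg_w_def)
  note F = seg_f_bounds[OF seg_size(3,4), of i]
  note r' = seg_size(3,4)[of j]
  have j: "j = ?r' + seg_size * ?q'" by simp
  consider "?q' = ?q" | "?q' + 1 \<le> ?q" | "?q + 1 \<le> ?q'" by linarith
  then show "seg_w j < f (seg_w i) \<longleftrightarrow> j < seg_g i"
  proof cases
    case 1
    have "j < seg_g i \<longleftrightarrow> ?r' + seg_size * ?q < f (s + ?r) - s + seg_size * ?q"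
      by (subst j) (simp only: 1 seg_g_def)
    moreover have "seg_w j < f (seg_w i) \<longleftrightarrow> s + ?r' + N * ?q < f (s + ?r) + N * ?q" unfolding L by (simp only: 1)
    ultimately show ?thesis by linarith
  next
    case 2
    have "N * ?q' + N \<le> N * ?q" using mult_left_mono[OF 2, of N] a(1) by (simp add: distrib_left)
    then have "seg_w j < f (seg_w i)" using F(1) r' seg_size(2) seg_size(3)[of i] unfolding L by linarith
    moreover have "seg_size * ?q' + seg_size \<le> seg_size * ?q" using mult_left_mono[OF 2, of seg_size] seg_size(1) by (simp add: distrib_left)
    then have "?r' + seg_size * ?q' < seg_g i"
      using F(1) r' seg_size(3)[of i] unfolding seg_g_def by linarith
    ultimately show ?thesis using j by simp
  next
    case 3
    have "N * ?q + N \<le> N * ?q'" using mult_left_mono[OF 3, of N] a(1) by (simp add: distrib_left)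
    then have "\<not> seg_w j < f (seg_w i)"
      using F(2) r' segmentD(1,3)[OF seg] unfolding L by linarith
    moreover have "seg_size * ?q + seg_size \<le> seg_size * ?q'" using mult_left_mono[OF 3, of seg_size] seg_size(1) by (simp add: distrib_left)
    then have "\<not> ?r' + seg_size * ?q' < seg_g i"
      using F(2) r' unfolding seg_g_def seg_size_def by linarith
    ultimately show ?thesis using j by simp
  qed
qed

lemma seg_w_range: "x \<in> range seg_w \<longleftrightarrow> s \<le> x mod N \<and> x mod N \<le> z"
proof
  assume "x \<in> range seg_w"
  then obtain j where x: "x = seg_w j" by auto
  have "0 \<le> s + j mod seg_size" "s + j mod seg_size < N" "s + j mod seg_size \<le> z"
    using seg_size(3,4)[of j] segmentD(1,3)[OF seg] unfolding seg_size_def by linarith+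
  then show "s \<le> x mod N \<and> x mod N \<le> z" using seg_size(3)[of j] by (simp add: x seg_w_def)
next
  assume x: "s \<le> x mod N \<and> x mod N \<le> z"
  let ?j = "x mod N - s + seg_size * (x div N)"
  have "0 \<le> x mod N - s" "x mod N - s < seg_size" using x by (simp_all add: seg_size_def)
  then have "seg_w ?j = x" using seg_size(1) by (simp add: seg_w_def)
  then show "x \<in> range seg_w" by (metis rangeI)
qed

lemma seg_w_at: "0 \<le> r \<Longrightarrow> r < seg_size \<Longrightarrow> seg_w r = s + r" "0 \<le> r \<Longrightarrow> r < seg_size \<Longrightarrow> seg_g r = f (s + r) - s"
  by (simp_all add: seg_w_def seg_g_def)

interpretation B: corner A N f Phi seg_w seg_size seg_g by (rule segment_corner)

definition seg_e :: 'a where "seg_e = Phi (\<lambda>i j. if i = j \<and> s \<le> i mod N \<and> i mod N \<le> z then 1 else 0)"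

lemma seg_e_eq: "seg_e = B.eW"
proof -
  have "co B.eW = (\<lambda>i j. if i = j \<and> s \<le> i mod N \<and> i mod N \<le> z then 1 else 0)"
    by (intro ext) (simp add: B.co_eW seg_w_range)
  then show ?thesis using Phi_co[OF B.eW_closed] by (simp add: seg_e_def)
qed

lemma seg_e_closed: "seg_e \<in> carrier A"
  unfolding seg_e_eq by (rule B.eW_closed)

lemma co_seg_e: "co seg_e i j = (if i = j \<and> s \<le> i mod N \<and> i mod N \<le> z then 1 else 0)"
  unfolding seg_e_eq B.co_eW seg_w_range by simp

lemma co_seg_e_mult: "x \<in> carrier A \<Longrightarrow> co (seg_e \<otimes> x) i j = (if s \<le> i mod N \<and> i mod N \<le> z then co x i j else 0)"
  "x \<in> carrier A \<Longrightarrow> co (x \<otimes> seg_e) i j = (if s \<le> j mod N \<and> j mod N \<le> z then co x i j else 0)"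
  unfolding seg_e_eq by (simp_all only: B.co_eW_mult B.co_mult_eW seg_w_range)

lemma segment_nakayama: "linear_nakayama (A\<lparr>carrier := {seg_e \<otimes> x | x. x \<in> carrier A}, one := seg_e\<rparr>)"
  if central: "\<And>x. x \<in> carrier A \<Longrightarrow> seg_e \<otimes> x = x \<otimes> seg_e"
proof -
  have "B.iota \<in> alg_isos (PM seg_size seg_g) (A\<lparr>carrier := {seg_e \<otimes> x | x. x \<in> carrier A}, one := seg_e\<rparr>)"
    unfolding seg_e_eq by (rule B.corner_block) (rule central[unfolded seg_e_eq])
  then have "nak (A\<lparr>carrier := {seg_e \<otimes> x | x. x \<in> carrier A}, one := seg_e\<rparr>) seg_size seg_g B.iota"
    by (rule nakI[OF B.g_adm])
  then show ?thesis
  proof (rule nak_linear_nakayama)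
    show "seg_g (seg_size - 1) = seg_size"
      using seg_w_at(2)[of "seg_size - 1"] seg_size(1) segmentD(5)[OF seg] by (simp add: seg_size_def)
    show "j + 2 \<le> seg_g j" if "0 \<le> j" "j < seg_size - 1" for j
      using seg_w_at(2)[of j] segmentD(6)[OF seg, of "s + j"] that by (simp add: seg_size_def)
  qed
qed

text \<open>
  No nonzero path leaves or enters a segment. The assumption on \<open>-1\<close> ensures that the
  segments in \<open>{0..<N}\<close> do not wrap around the cycle.
\<close>

lemma seg_e_central:
  assumes start: "f (- 1) = 0" and x: "x \<in> carrier A"
  shows "seg_e \<otimes> x = x \<otimes> seg_e"
proof (rule co_eqI)
  fix i j assume ij: "i \<le> j" "j < f i"
  let ?i = "i mod N" and ?j = "j - N * (i div N)"
  have i: "0 \<le> ?i" "?i < N" using a(1) by simp_all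
  have fi: "f i = f ?i + N * (i div N)" by (rule adm_mod[OF adm])
  have ij': "?i \<le> ?j" "?j < f ?i" using ij fi by (simp_all add: minus_mult_div_eq_mod[symmetric])
  have "f (N - 1) = N" using a(3)[of "- 1"] start by simp
  moreover have "f ?i \<le> f (N - 1)" by (rule a(2)) (use i in simp)
  ultimately have "0 \<le> ?j" "?j < N" using ij' i by simp_all
  then have "?j mod N = ?j" by simp
  moreover have "?j mod N = j mod N" by (simp add: mod_diff_right_eq[symmetric])
  ultimately have jm: "j mod N = ?j" by simp
  have "f ?i \<le> z + 1" if "?i \<le> z" using a(2)[OF that] segmentD(5)[OF seg] by simp
  moreover have "f ?i \<le> s" if "?i < s" using a(2)[of ?i "s - 1"] segmentD(4)[OF seg] that by simp
  ultimately have "s \<le> ?i \<and> ?i \<le> z \<longleftrightarrow> s \<le> ?j \<and> ?j \<le> z" using ij' by linarith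
  then show "co (seg_e \<otimes> x) i j = co (x \<otimes> seg_e) i j"
    unfolding co_seg_e_mult[OF x] jm by simp
qed (simp_all add: seg_e_closed x)

end

lemma segment_exists:
  assumes start: "f (- 1) = 0" and z: "0 \<le> z" "z < N" "f z = z + 1"
  obtains s where "segment s z"
proof -
  obtain s where s: "f (s - 1) = s" "s \<le> z" and s_max: "\<And>i. i \<le> z \<Longrightarrow> f (i - 1) = i \<Longrightarrow> i \<le> s"
    by (rule greatest_int_le[of "\<lambda>s. f (s - 1) = s" 0 z]) (use start z(1) in auto)
  have "0 \<le> s" using s_max[of 0] start z(1) by simp
  moreover have "j + 2 \<le> f j" if "s \<le> j" "j < z" for j
  proof -
    have "f j \<noteq> j + 1" using s_max[of "j + 1"] that by auto
    then show ?thesis using a(4)[of j] by simp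
  qed
  ultimately have "segment s z" using s z by (simp add: segment_def)
  then show ?thesis by (rule that)
qed

text \<open>
  Elements that commute with the vertex idempotents are supported on closed paths; if there is a
  break, the only closed paths are trivial.
\<close>

lemma co_central:
  assumes start: "f (- 1) = 0" and x: "x \<in> carrier A" and c: "\<And>i. e i \<otimes> x = x \<otimes> e i" and ij: "co x i j \<noteq> 0"
  shows "i = j"
proof -
  have "N dvd j - i"
  proof (rule ccontr)
    assume "\<not> N dvd j - i"
    then have "co (x \<otimes> e i) i j = 0" by (simp add: co_mult_e x)
    moreover have "co (e i \<otimes> x) i j = co x i j" by (simp add: co_e_mult x)
    ultimately show False using c ij by simp
  qed
  moreover have "i \<le> j" "j < f i" using co_out[OF x] ij by blast+
  moreover have "f i \<le> i + N"
  proof -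
    have "f (N - 1) = N" using a(3)[of "- 1"] start by simp
    moreover have "f i = f (i mod N) + (i - i mod N)" using adm_mod[OF adm, of i] by (simp add: minus_mod_eq_mult_div)
    moreover have "i mod N < N" "0 \<le> i mod N" using a(1) by simp_all
    moreover from this have "f (i mod N) \<le> f (N - 1)" by (intro a(2)) simp
    ultimately show ?thesis by simp
  qed
  ultimately show "i = j" using zdvd_imp_le[of N "j - i"] by (cases "j = i") auto
qed

text \<open>
  A central idempotent is a diagonal matrix with entries \<open>0\<close> and \<open>1\<close>,
  constant along arrows, hence constant on segments. If it is primitive, it is the idempotent of
  one segment.
\<close>

lemma primitive_central_segment:
  assumes start: "f (- 1) = 0" and c: "primitive_central_idempotent A c"
  obtains z where "0 \<le> z" "z < N" "f z = z + 1" "\<And>s. segment s z \<Longrightarrow> c = seg_e s z"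
proof -
  have cA: "c \<in> carrier A" and cc: "c \<otimes> c = c" and c0: "c \<noteq> \<zero>"
    and cent: "\<And>x. x \<in> carrier A \<Longrightarrow> c \<otimes> x = x \<otimes> c"
    and prim: "\<And>x. central_idempotent A x \<Longrightarrow> c \<otimes> x = x \<Longrightarrow> x = \<zero> \<or> x = c"
    using c unfolding primitive_central_idempotent_def central_idempotent_def[of A c] by blast+
  have diag: "co c i j = 0" if "i \<noteq> j" for i j
  proof (rule ccontr)
    assume "co c i j \<noteq> 0"
    then have "i = j" using co_central[OF start cA cent[OF E_closed, symmetric]] by blast
    then show False using that by simp
  qed
  have idem: "co c i i = 0 \<or> co c i i = 1" for i
    using co_mult_diag[OF cA cA, of i] by (simp add: cc)
  have next_eq: "co c (j + 1) (j + 1) = co c j j" if "j + 2 \<le> f j" for j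
  proof -
    have "co (E j (j + 1) \<otimes> c) j (j + 1) = co c (j + 1) (j + 1)"
      using co_E_mult[OF cA, of j "j + 1" j "j + 1"] that by simp
    moreover have "co (c \<otimes> E j (j + 1)) j (j + 1) = co c j j"
      using co_mult_E[OF cA, of j "j + 1" j "j + 1"] that by simp
    ultimately show ?thesis using cent[OF E_closed] by simp
  qed
  obtain i0 where i0: "co c i0 i0 \<noteq> 0"
  proof (rule ccontr)
    assume n: "\<not> thesis"
    have "co c i j = 0" for i j using n that diag[of i j] by (cases "i = j") blast+
    then have "c = \<zero>" by (intro co_eqI) (simp_all add: cA co_zero)
    then show False using c0 by simp
  qed
  have per: "co c i i = co c (i mod N) (i mod N)" for i
    using co_shift[OF cA, of "i mod N" "i div N" "i mod N"] by simp
  define i where "i = i0 mod N"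
  have i: "0 \<le> i" "i < N" "co c i i = 1" using a(1) i0 idem[of i0] per[of i0] by (auto simp: i_def)
  have "f (N - 1) = N" using a(3)[of "- 1"] start by simp
  then obtain z where z: "f z = z + 1" "i \<le> z" and z_min: "\<And>j. i \<le> j \<Longrightarrow> f j = j + 1 \<Longrightarrow> z \<le> j"
    using least_int_ge[of "\<lambda>j. f j = j + 1" "N - 1" i] i by auto
  have zN: "0 \<le> z" "z < N" using z_min[of "N - 1"] \<open>f (N - 1) = N\<close> i z by simp_all
  have "c = seg_e s z" if seg: "segment s z" for s
  proof -
    note sD = segmentD[OF seg]
    have si: "s \<le> i" using z_min[of "s - 1"] sD(2,4) by force
    have up: "co c (s + int m) (s + int m) = co c s s" if "s + int m \<le> z" for m
      using that
    proof (induction m)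
      case 0 then show ?case by simp
    next
      case (Suc m)
      have "s + int (Suc m) = (s + int m) + 1" by simp
      moreover have "co c (s + int m + 1) (s + int m + 1) = co c s s"
        using next_eq[OF sD(6), of "s + int m"] Suc by simp
      ultimately show ?case by (simp only:)
    qed
    have cs: "co c s s = 1" using up[of "nat (i - s)"] si z(2) i(3) by simp
    have one: "co c j j = 1" if "s \<le> j mod N" "j mod N \<le> z" for j
      using up[of "nat (j mod N - s)"] that cs per[of j] by simp
    let ?E = "seg_e s z"
    note ec = seg_e_closed[OF seg]
    have cE: "c \<otimes> ?E = ?E"
    proof (rule co_eqI)
      fix j k
      show "co (c \<otimes> ?E) j k = co ?E j k"
        unfolding co_seg_e_mult(2)[OF seg cA] co_seg_e[OF seg] using one diag[of j k] by auto
    qed (simp_all add: cA ec)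
    have "?E \<otimes> ?E = ?E"
      by (rule co_eqI) (auto simp: ec co_seg_e_mult(2)[OF seg ec] co_seg_e[OF seg])
    then have "central_idempotent A ?E"
      unfolding central_idempotent_def using ec seg_e_central[OF seg start] by blast
    then have "?E = \<zero> \<or> ?E = c" using prim cE by blast
    moreover have "co ?E i i = 1" unfolding co_seg_e[OF seg] using si z(2) i(1,2) by simp
    then have "?E \<noteq> \<zero>" using co_zero[of i i] by auto
    ultimately show ?thesis by simp
  qed
  then show ?thesis using that zN z(1) by blast
qed

lemma components:
  assumes start: "f (- 1) = 0"
  shows "\<forall>X\<in>connected_components A. linear_nakayama X"
    "card (connected_components A) \<le> card {z \<in> {0..<N}. f z = z + 1}"
proof -
  let ?Z = "{z \<in> {0..<N}. f z = z + 1}"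
  define B where "B z = (let c = seg_e (SOME s. segment s z) z in A\<lparr>carrier := {c \<otimes> x | x. x \<in> carrier A}, one := c\<rparr>)" for z
  have S: "segment (SOME s. segment s z) z" if "z \<in> ?Z" for z
    by (rule someI_ex) (use segment_exists[OF start] that in auto)
  have comp: "X \<in> B ` ?Z" if X: "X \<in> connected_components A" for X
  proof -
    obtain c where c: "primitive_central_idempotent A c" "X = A\<lparr>carrier := {c \<otimes> x | x. x \<in> carrier A}, one := c\<rparr>"
      using X unfolding connected_components_def by blast
    obtain z where z: "0 \<le> z" "z < N" "f z = z + 1" "\<And>s. segment s z \<Longrightarrow> c = seg_e s z"
      using primitive_central_segment[OF start c(1)] by blast
    have zZ: "z \<in> ?Z" using z by simp
    have "X = B z" unfolding B_def Let_def c(2) using z(4)[OF S[OF zZ]] by simp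
    then show ?thesis using zZ by (rule image_eqI)
  qed
  show "\<forall>X\<in>connected_components A. linear_nakayama X"
  proof
    fix X assume "X \<in> connected_components A"
    from comp[OF this] obtain z where z: "z \<in> ?Z" "X = B z" by (elim imageE) simp
    show "linear_nakayama X" unfolding z(2) B_def Let_def
      by (rule segment_nakayama[OF S[OF z(1)]]) (rule seg_e_central[OF S[OF z(1)] start])
  qed
  have "finite ?Z" by (rule finite_subset[of _ "{0..<N}"]) auto
  moreover have "connected_components A \<subseteq> B ` ?Z" using comp by blast
  ultimately show "card (connected_components A) \<le> card ?Z"
    by (meson card_image_le card_mono finite_imageI le_trans)
qed

end

section \<open>The tower of syzygy filtered algebras\<close>

lemma relations_paths: "cyclic_relations N R \<Longrightarrow> R \<subseteq> path_elems N 2 \<and> R \<noteq> {} \<and> finite R"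
  unfolding cyclic_relations_def path_elems_def by (elim conjE) (intro conjI)

lemma path_elems_mono: "d \<le> d' \<Longrightarrow> path_elems N d' \<subseteq> (path_elems N d :: (_ \<Rightarrow> 'k::field) set)"
proof
  fix r :: "(nat, nat) path \<Rightarrow> 'k::field" assume d: "d \<le> d'" and "r \<in> path_elems N d'"
  then obtain w where "r = path_elem w" "w \<in> paths (cyclic_quiver N)" "d' \<le> length (snd w)" unfolding path_elems_def by blast
  then show "r \<in> path_elems N d" unfolding path_elems_def using d by (intro CollectI exI[of _ w]) simp
qed

lemma relations_cutoff:
  assumes "1 \<le> N" "cyclic_relations N R"
  obtains f where "cutoff N R f" "\<And>i. i + 2 \<le> f i"
proof -
  have "R \<subseteq> path_elems N (Suc 1)" "R \<noteq> {}" using relations_paths[OF assms(2)] by (simp_all add: numeral_2_eq_2)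
  then obtain f where "cutoff N R f" "\<And>i. i + int (Suc 1) \<le> f i" using cutoff_exists[OF assms(1), of R 1] by metis
  then show ?thesis using that by simp
qed

text \<open>
  The isomorphism \<open>cyclic_algebra_iso\<close> as an instance of the locale
  \<open>nak\<close>; it carries the vertex idempotents of the quiver to the diagonal matrix units.
\<close>

lemma cyclic_algebra_nak:
  fixes R :: "((nat, nat) path \<Rightarrow> 'k::field) set"
  assumes N: "1 \<le> N" and R: "R \<subseteq> path_elems N 0" and rf: "cutoff N R f"
  obtains T where "nak (cyclic_algebra N R) (int N) f T"
    "\<And>i. i < N \<Longrightarrow> vertex_idempotent N R (\<lambda>x. x) i = nak.E (int N) f T (int i) (int i)"
proof -
  obtain T where T: "T \<in> alg_isos (PM (int N) f) (cyclic_algebra N R)"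
    and vi: "\<And>i. i < N \<Longrightarrow> vertex_idempotent N R (\<lambda>x. x) i = T (vertex_unit N (int i))"
    using cyclic_algebra_iso[OF N R rf] by metis
  have adm: "adm (int N) f" using rf by (simp add: cutoff_def)
  have nk: "nak (cyclic_algebra N R) (int N) f T" by (rule nakI[OF adm T])
  have "vertex_unit N (int i) = (\<lambda>a b. if int i \<le> int i \<and> int i < f (int i) \<and> b - a = int i - int i \<and> int N dvd a - int i then 1 else 0 :: 'k)" for i
    unfolding vertex_unit_def using admD(4)[OF adm, of "int i"] by (intro ext) (auto simp: mod_eq_dvd_iff)
  then have "vertex_idempotent N R (\<lambda>x. x) i = nak.E (int N) f T (int i) (int i)" if "i < N" for i
    unfolding nak.E_def[OF nk] vi[OF that] by simp
  then show ?thesis using that nk by blast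
qed

lemma presentation_nak:
  fixes A :: "('k::field, 'a) module"
  assumes "cyclic_presentation A N R \<phi>"
  obtains f T where "cutoff N R f" "\<And>i. i + 2 \<le> f i" "nak A (int N) f T"
proof -
  have N: "1 \<le> N" and R: "cyclic_relations N R" and phi: "\<phi> \<in> alg_isos (cyclic_algebra N R) A"
    using assms by (auto simp: cyclic_presentation_def)
  obtain f where f: "cutoff N R f" "\<And>i. i + 2 \<le> f i" using relations_cutoff[OF N R] by metis
  have "R \<subseteq> path_elems N 0" using relations_paths[OF R] path_elems_mono[of 0 2 N] by blast
  then obtain T where "nak (cyclic_algebra N R) (int N) f T" using cyclic_algebra_nak[OF N _ f(1)] by metis
  then have "T \<in> alg_isos (PM (int N) f) (cyclic_algebra N R)" "adm (int N) f"
    by (simp_all add: nak_def nak_axioms_def)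
  then have "nak A (int N) f (\<lambda>x. \<phi> (T x))" using nakI alg_isos_trans phi by blast
  then show ?thesis using that f by blast
qed

text \<open>
  A presentation with few relations has a function \<open>f'\<close> with few residues of values,
  but by \<open>range_card_le\<close> their number does not depend on the presentation.
\<close>

lemma min_relations_ge:
  fixes A :: "('k::field, 'a) module"
  assumes A: "nak A N f Phi" and "cyclic_nakayama A"
  shows "card (range f \<inter> {0..<N}) \<le> min_relations A"
proof -
  have "\<exists>r. \<exists>N R \<phi>. cyclic_presentation A N R \<phi> \<and> card R = r" using assms(2) unfolding cyclic_nakayama_def by blast
  from LeastI_ex[OF this] obtain N' R' \<phi> where p: "cyclic_presentation A N' R' \<phi>" "card R' = min_relations A"
    unfolding min_relations_def by blast
  obtain f' T where f': "cutoff N' R' f'" "nak A (int N') f' T" using presentation_nak[OF p(1)] by metis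
  have "1 \<le> N'" "finite R'" using p(1) relations_paths unfolding cyclic_presentation_def by blast+
  then have "card (range f' \<inter> {0..<int N'}) \<le> card R'" using cutoff_card f'(1) by blast
  then show ?thesis using range_card_le[OF A f'(2)] p(2) by simp
qed

lemma not_cyclic_nakayama:
  assumes A: "nak A N f Phi" and z: "f z = z + 1"
  shows "\<not> cyclic_nakayama A"
proof
  assume "cyclic_nakayama A"
  then obtain N' R' \<phi> where p: "cyclic_presentation A N' R' \<phi>" unfolding cyclic_nakayama_def by blast
  obtain f' T where f': "\<And>i. i + 2 \<le> f' i" "nak A (int N') f' T" using presentation_nak[OF p] by metis
  interpret nak A N f Phi by (rule A)
  note e = simple_idempotent[OF z]
  have "\<exists>x\<in>jac A. e z \<otimes>\<^bsub>A\<^esub> x \<noteq> \<zero>\<^bsub>A\<^esub>"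
    by (rule nak.idempotent_moves_jac[OF f'(2) f'(1) E_closed e_idem e(1)])
  then show False using e(2) by blast
qed

lemma cyclic_algebra_presentation:
  assumes "1 \<le> N" "cyclic_relations N R" "k_algebra (cyclic_algebra N R)"
  shows "cyclic_presentation (cyclic_algebra N R) N R (\<lambda>x. x)"
  using assms alg_isos_id by (simp add: cyclic_presentation_def)

text \<open>
  The syzygy filtered algebra is presented on a cycle with \<open>n\<close> vertices by its minimal
  zero paths. If \<open>f'\<close> has breaks, some of these have length one and the presentation
  is not one of a cyclic Nakayama algebra.
\<close>

lemma syzygy_step:
  fixes R :: "((nat, nat) path \<Rightarrow> 'k::field) set"
  assumes N: "1 \<le> N" and R: "cyclic_relations N R" and f: "cutoff N R f" and two: "\<And>i. i + 2 \<le> f i"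
    and red: "reduces (int N) f w n f'"
  defines "S \<equiv> min_zero_paths (nat n) f' :: ((nat, nat) path \<Rightarrow> 'k) set"
  obtains T where "syzygy_filtered (cyclic_algebra N R) (cyclic_algebra (nat n) S)"
    "nak (cyclic_algebra (nat n) S) n f' T"
proof -
  have n: "1 \<le> n" "int (nat n) = n" "1 \<le> nat n" using reducesD(5)[OF red] by simp_all
  have f': "adm (int (nat n)) f'" unfolding n(2) by (rule reduces_adm[OF red])
  have "S \<subseteq> path_elems (nat n) 0"
    unfolding S_def by (rule min_zero_paths_sub[OF n(3)]) (use admD(4)[OF f'] in \<open>simp add: less_imp_le\<close>)
  moreover have "cutoff (nat n) S f'" unfolding S_def by (rule min_zero_paths_cutoff[OF n(3) f'])
  ultimately obtain T where T: "nak (cyclic_algebra (nat n) S) (int (nat n)) f' T"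
    using cyclic_algebra_nak[OF n(3)] by metis
  have T': "nak (cyclic_algebra (nat n) S) n f' T" using T unfolding n(2) .
  have "R \<subseteq> path_elems N 0" using relations_paths[OF R] path_elems_mono[of 0 2 N] by blast
  then obtain U where U: "nak (cyclic_algebra N R) (int N) f U"
    "\<And>i. i < N \<Longrightarrow> vertex_idempotent N R (\<lambda>x. x) i = nak.E (int N) f U (int i) (int i)"
    using cyclic_algebra_nak[OF N _ f] by metis
  have pres: "cyclic_presentation (cyclic_algebra N R) N R (\<lambda>x. x)"
    by (rule cyclic_algebra_presentation[OF N R]) (use U(1) in \<open>simp add: nak_def\<close>)
  have "T \<in> alg_isos (PM n f') (cyclic_algebra (nat n) S)" using T' by (simp add: nak_def nak_axioms_def)
  from nak_syzygy_filtered[OF U(1) two red this pres U(2)]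
  have "syzygy_filtered (cyclic_algebra N R) (cyclic_algebra (nat n) S)" .
  then show ?thesis using T' that by blast
qed

text \<open>
  Induction on the number of vertices. The induction is about the current algebra, with function
  \<open>f\<close>, and remembers the first algebra only through a projection \<open>p\<close> onto
  it from \<open>f0\<close>; the assumption \<open>no_jump\<close> about the first algebra excludes
  that the number of vertices stays constant.
\<close>

lemma syzygy_tower:
  fixes R :: "((nat, nat) path \<Rightarrow> 'k::field) set"
  assumes "1 \<le> N" and "cyclic_relations N R" and "cutoff N R f" and "\<And>i. i + 2 \<le> f i"
    and "mono p" "surj p" "\<And>i. p (i + N0) = p i + int N" "\<And>i. p (f0 i) = f (p i)"
    and no_jump: "\<forall>(q :: int \<Rightarrow> int) n c. mono q \<longrightarrow> surj q \<longrightarrow> (\<forall>i. q (i + N0) = q i + n) \<longrightarrow> (\<forall>i. q (f0 i) = q i + c) \<longrightarrow> c < 2"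
  shows "\<exists>m\<ge>1. \<exists>(A :: ('k, ((nat, nat) path \<Rightarrow> 'k) set) module) (B :: ('k, ((nat, nat) path \<Rightarrow> 'k) set) module) D.
    (syzygy_filtered ^^ (m - 1)) (cyclic_algebra N R) A \<and> cyclic_nakayama A \<and>
    syzygy_filtered A B \<and> \<not> cyclic_nakayama B \<and> (\<forall>X\<in>connected_components B. linear_nakayama X) \<and>
    (\<forall>a b. a \<le> b \<longrightarrow> b \<le> f a \<longrightarrow> stop f (Suc D) a b) \<and>
    int (Suc D) \<le> 2 * int m + int (min_relations A) - int (card (connected_components B))"
  using assms(1-8)
proof (induction N arbitrary: R f p rule: less_induct)
  case (less N)
  note N = less.prems(1) and R = less.prems(2) and f = less.prems(3) and two = less.prems(4)
  note p = less.prems(5-8)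
  have adm: "adm (int N) f" using f by (simp add: cutoff_def)
  obtain w n f' where red: "reduces (int N) f w n f'" using reduces_exists[OF adm] by metis
  have n1: "1 \<le> n" by (rule reducesD(5)[OF red])
  show ?case
  proof (cases "\<exists>z. f' z = z + 1")
    case True
    then obtain z where z: "f' z = z + 1" by blast
    \<comment> \<open>renumber the vertices so that the break is at -1\<close>
    define g where "g = (\<lambda>j. f' (j + (z + 1)) - (z + 1))"
    have red': "reduces (int N) f (\<lambda>j. w (j + (z + 1))) n g" unfolding g_def by (rule reduces_shift[OF red])
    have start: "g (- 1) = 0" using z by (simp add: g_def)
    let ?A = "cyclic_algebra N R" and ?B = "cyclic_algebra (nat n) (min_zero_paths (nat n) g :: ((nat, nat) path \<Rightarrow> 'k) set)"
    obtain T where sf: "syzygy_filtered ?A ?B" and B: "nak ?B n g T"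
      using syzygy_step[OF N R f two red'] by metis
    have "R \<subseteq> path_elems N 0" using relations_paths[OF R] path_elems_mono[of 0 2 N] by blast
    then obtain U where U: "nak ?A (int N) f U" using cyclic_algebra_nak[OF N _ f] by metis
    have "cyclic_presentation ?A N R (\<lambda>x. x)"
      by (rule cyclic_algebra_presentation[OF N R]) (use U(1) in \<open>simp add: nak_def\<close>)
    then have cA: "cyclic_nakayama ?A" unfolding cyclic_nakayama_def by blast
    have nB: "\<not> cyclic_nakayama ?B" by (rule not_cyclic_nakayama[OF B, of "- 1"]) (simp add: start)
    note comp = nak.components[OF B start]
    let ?Z = "{j \<in> {0..<n}. g j = j + 1}"
    have "card ?Z \<le> card {0..<n}" by (rule card_mono) auto
    then have Z: "card ?Z \<le> nat n" by simp
    have g: "adm n g" by (rule reduces_adm[OF red'])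
    \<comment> \<open>two steps for the reduction and n - C steps for the linear algebra; the bound
      is Suc ?D\<close>
    let ?D = "nat n - card ?Z + 1"
    have "stop f (Suc ?D) a b" if "a \<le> b" "b \<le> f a" for a b
    proof -
      have "stop g (nat n - card ?Z) a b" if "a \<le> b" "b \<le> g a" for a b
        by (rule linear_stop[OF g _ that, of "- 1"]) (simp add: start)
      from stop_reduces[OF red' this \<open>a \<le> b\<close> \<open>b \<le> f a\<close>] show ?thesis by simp
    qed
    moreover have "nat n \<le> min_relations ?A"
      using min_relations_ge[OF U cA] reduces_card[OF red] by simp
    then have "int (Suc ?D) \<le> 2 * int 1 + int (min_relations ?A) - int (card (connected_components ?B))"
      using Z comp(2) by linarith
    moreover have "(syzygy_filtered ^^ (1 - 1)) ?A ?A" by simp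
    ultimately show ?thesis using sf cA nB comp(1) by (intro exI[of _ "1::nat"] conjI exI[of _ ?A] exI[of _ ?B] exI[of _ ?D]) auto
  next
    case False
    have adm': "adm n f'" by (rule reduces_adm[OF red])
    have two': "i + 2 \<le> f' i" for i
    proof -
      have "i < f' i" by (rule admD(4)[OF adm'])
      moreover have "f' i \<noteq> i + 1" using False by blast
      ultimately show ?thesis by simp
    qed
    \<comment> \<open>without loss of vertices f would be a shift by at least two, and p would be a
      jump\<close>
    have "n \<noteq> int N"
    proof
      assume "n = int N"
      then obtain c where c: "\<And>i. f i = i + c" using reduces_bijective red by metis
      have "\<forall>i. p (i + N0) = p i + int N" "\<forall>i. p (f0 i) = p i + c" using p(3,4) c by simp_all
      then have "c < 2" using no_jump p(1,2) by blast
      then show False using two[of 0] by (simp add: c)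
    qed
    then have nN: "nat n < N" using reduces_le[OF red] n1 by simp
    obtain q where q: "mono q" "surj q" "\<And>i. q (i + int N) = q i + n" "\<And>i. q (f i) = f' (q i)"
      using reduces_projection[OF red] by metis
    let ?S = "min_zero_paths (nat n) f' :: ((nat, nat) path \<Rightarrow> 'k) set"
    obtain T where sf: "syzygy_filtered (cyclic_algebra N R) (cyclic_algebra (nat n) ?S)"
      using syzygy_step[OF N R f two red] by metis
    have n: "1 \<le> nat n" "int (nat n) = n" using n1 by simp_all
    have a: "adm (int (nat n)) f'" unfolding n(2) by (rule adm')
    have "\<exists>m\<ge>1. \<exists>(A :: ('k, ((nat, nat) path \<Rightarrow> 'k) set) module) (B :: ('k, ((nat, nat) path \<Rightarrow> 'k) set) module) D.
      (syzygy_filtered ^^ (m - 1)) (cyclic_algebra (nat n) ?S) A \<and> cyclic_nakayama A \<and>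
      syzygy_filtered A B \<and> \<not> cyclic_nakayama B \<and> (\<forall>X\<in>connected_components B. linear_nakayama X) \<and>
      (\<forall>a b. a \<le> b \<longrightarrow> b \<le> f' a \<longrightarrow> stop f' (Suc D) a b) \<and>
      int (Suc D) \<le> 2 * int m + int (min_relations A) - int (card (connected_components B))"
    proof (rule less.IH[OF nN n(1)])
      show "cyclic_relations (nat n) ?S" by (rule min_zero_paths_relations[OF n(1) a two'])
      show "cutoff (nat n) ?S f'" by (rule min_zero_paths_cutoff[OF n(1) a])
      show "i + 2 \<le> f' i" for i by (rule two')
      show "mono (q \<circ> p)" using q(1) p(1) by (simp add: mono_def)
      show "surj (q \<circ> p)" by (rule comp_surj[OF p(2) q(2)])
      show "(q \<circ> p) (i + N0) = (q \<circ> p) i + int (nat n)" for i by (simp only: o_apply p(3) q(3) n(2))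
      show "(q \<circ> p) (f0 i) = f' ((q \<circ> p) i)" for i by (simp add: p(4) q(4))
    qed
    then obtain m and A B :: "('k, ((nat, nat) path \<Rightarrow> 'k) set) module" and D where m: "m \<ge> 1" and
      IH: "(syzygy_filtered ^^ (m - 1)) (cyclic_algebra (nat n) ?S) A" "cyclic_nakayama A" "syzygy_filtered A B"
      "\<not> cyclic_nakayama B" "\<forall>X\<in>connected_components B. linear_nakayama X"
      "\<forall>a b. a \<le> b \<longrightarrow> b \<le> f' a \<longrightarrow> stop f' (Suc D) a b"
      "int (Suc D) \<le> 2 * int m + int (min_relations A) - int (card (connected_components B))"
      by (elim exE conjE) (rule that; assumption)
    have "(syzygy_filtered ^^ Suc (m - 1)) (cyclic_algebra N R) A" by (rule relpowp_Suc_I2[OF sf IH(1)])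
    then have tower: "(syzygy_filtered ^^ (Suc m - 1)) (cyclic_algebra N R) A" using m by simp
    have "stop f' (Suc D) a b" if "a \<le> b" "b \<le> f' a" for a b using IH(6) that by blast
    then have "stop f (Suc D + 2) a b" if "a \<le> b" "b \<le> f a" for a b using stop_reduces[OF red _ that] by blast
    then have stops: "\<forall>a b. a \<le> b \<longrightarrow> b \<le> f a \<longrightarrow> stop f (Suc (D + 2)) a b" by simp
    have bound: "int (Suc (D + 2)) \<le> 2 * int (Suc m) + int (min_relations A) - int (card (connected_components B))"
      using IH(7) by simp
    show ?thesis
      by (rule exI[of _ "Suc m"], rule conjI, simp, rule exI[of _ A], rule exI[of _ B], rule exI[of _ "D + 2"],
        intro conjI; rule tower IH(2-5) stops bound)
  qed
qed

theorem theoremD: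
  fixes \<Lambda> :: "('k::alg_closed_field, ((nat, nat) path \<Rightarrow> 'k) set) module"
    and N :: nat and R :: "((nat, nat) path \<Rightarrow> 'k) set"
  assumes "2 \<le> N" and "cyclic_relations N R" and "\<Lambda> = cyclic_algebra N R"
    and "gl_dim \<Lambda> < \<infinity>"
  shows "\<exists>m\<ge>1. \<exists>(A :: ('k, ((nat, nat) path \<Rightarrow> 'k) set) module)
      (B :: ('k, ((nat, nat) path \<Rightarrow> 'k) set) module).
    (syzygy_filtered ^^ (m - 1)) \<Lambda> A \<and> cyclic_nakayama A \<and>
    syzygy_filtered A B \<and> \<not> cyclic_nakayama B \<and>
    (\<forall>X\<in>connected_components B. linear_nakayama X) \<and>
    int (the_enat (gl_dim \<Lambda>)) \<le>
      2 * int m + int (min_relations A) - int (card (connected_components B))"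
proof -
  have N: "1 \<le> N" using assms(1) by simp
  obtain f where f: "cutoff N R f" "\<And>i. i + 2 \<le> f i" using relations_cutoff[OF N assms(2)] by metis
  have "R \<subseteq> path_elems N 0" using relations_paths[OF assms(2)] path_elems_mono[of 0 2 N] by blast
  then obtain T where T: "nak \<Lambda> (int N) f T" using cyclic_algebra_nak[OF N _ f(1)] unfolding assms(3) by metis
  have no_jump: "c < 2" if q: "mono q" "surj q" "\<And>i. q (i + int N) = q i + n" "\<And>i. q (f i) = q i + c" for q :: "int \<Rightarrow> int" and n c
  proof (rule ccontr)
    assume "\<not> c < 2"
    then have "jump \<Lambda> (int N) f T q n c" using T q by (simp add: jump_def jump_axioms_def)
    from jump.gl_dim_infinite[OF this] show False using assms(4) by simp
  qed
  obtain m and A B :: "('k, ((nat, nat) path \<Rightarrow> 'k) set) module" and D where m: "m \<ge> 1" and r: "(syzygy_filtered ^^ (m - 1)) \<Lambda> A" "cyclic_nakayama A" "syzygy_filtered A B"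
    "\<not> cyclic_nakayama B" "\<forall>X\<in>connected_components B. linear_nakayama X"
    and stop: "\<forall>a b. a \<le> b \<longrightarrow> b \<le> f a \<longrightarrow> stop f (Suc D) a b"
    and bound: "int (Suc D) \<le> 2 * int m + int (min_relations A) - int (card (connected_components B))"
  proof -
    have "mono (\<lambda>i::int. i)" "surj (\<lambda>i::int. i)" by (simp_all add: mono_def)
    moreover have "\<forall>(q :: int \<Rightarrow> int) n c. mono q \<longrightarrow> surj q \<longrightarrow> (\<forall>i. q (i + int N) = q i + n) \<longrightarrow> (\<forall>i. q (f i) = q i + c) \<longrightarrow> c < 2"
      using no_jump by blast
    ultimately have "\<exists>m\<ge>1. \<exists>A B D. (syzygy_filtered ^^ (m - 1)) \<Lambda> (A :: ('k, ((nat, nat) path \<Rightarrow> 'k) set) module) \<and> cyclic_nakayama A \<and>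
      syzygy_filtered A (B :: ('k, ((nat, nat) path \<Rightarrow> 'k) set) module) \<and> \<not> cyclic_nakayama B \<and> (\<forall>X\<in>connected_components B. linear_nakayama X) \<and>
      (\<forall>a b. a \<le> b \<longrightarrow> b \<le> f a \<longrightarrow> stop f (Suc D) a b) \<and>
      int (Suc D) \<le> 2 * int m + int (min_relations A) - int (card (connected_components B))"
      unfolding assms(3) by (intro syzygy_tower[OF N assms(2) f, of "\<lambda>i. i" "int N" f]) simp_all
    then show ?thesis by (elim exE conjE) (rule that; assumption)
  qed
  have "gl_dim \<Lambda> \<le> enat (Suc D)" by (rule nak.gl_dim_bound[OF T]) (use stop in blast)
  then have "the_enat (gl_dim \<Lambda>) \<le> Suc D" by (cases "gl_dim \<Lambda>") simp_all
  then have final: "int (the_enat (gl_dim \<Lambda>)) \<le> 2 * int m + int (min_relations A) - int (card (connected_components B))"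
    using bound by linarith
  show ?thesis
    by (rule exI[of _ m], rule conjI[OF m], rule exI[of _ A], rule exI[of _ B], intro conjI; rule r final)
qed

end
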